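(* Let $\mathcal R=(\Omega,\mathcal F,\mathbb P,\sigma,X,\mathcal L)$ be an ergodic random dynamical system acting on a Banach space $X$ whose dual $X^*$ is separable. Suppose that $\kappa(\mathcal R)<\lambda(\mathcal R)$. Then there exist $1\le r\le\infty$ and: (i) a sequence of exceptional Lyapunov exponents of $\mathcal R$: $\lambda(\mathcal R)=\lambda_1>\lambda_2>\dots>\lambda_r>\kappa(\mathcal R)$ if $r<\infty$, and $\lambda(\mathcal R)=\lambda_1>\lambda_2>\dots$ with $\lambda_i\to\kappa(\mathcal R)$ as $i\to\infty$ if $r=\infty$; (ii) a sequence of positive integers $m_1,\dots,m_r$ if $r<\infty$, and $m_1,m_2,\dots$ if $r=\infty$; (iii) a measurable filtration of closed subspaces of $X$: $X=V_1(\omega)\supset V_2(\omega)\supset\dots\supset V_r(\omega)\supset V_\infty(\omega)$ if $r<\infty$, and $X=V_1(\omega)\supset V_2(\omega)\supset\dots$ with $V_\infty(\omega)=\bigcap_{i\ge1}V_i(\omega)$ if $r=\infty$, with the equivariance property $\mathcal L_\omega(V_i(\omega))\subset V_i(\sigma(\omega))$ for each $i$ (including $i=\infty$); such that, writing $V_{r+1}(\omega):=V_\infty(\omega)$ when $r<\infty$, for $\mathbb P$-a.e. $\omega$ the following hold: $\operatorname{codim}V_\ell(\omega)=m_1+\dots+m_{\ell-1}$ for every finite index $\ell$ (that is, $1\le\ell\le r+1$ if $r<\infty$, and all $\ell\ge1$ if $r=\infty$); for every finite $\ell$ with $1\le \ell\le r$ and all $v\in V_\ell(\omega)\setminus V_{\ell+1}(\omega)$,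 $$\lim_{n\to\infty}\tfrac1n\log\|\mathcal L^{(n)}_\omega v\|=\lambda_\ell;$$ and for all $v\in V_\infty(\omega)$, $$\limsup_{n\to\infty}\tfrac1n\log\|\mathcal L^{(n)}_\omega v\|\le\kappa(\mathcal R).$$
   Context: A random dynamical system is a tuple $\mathcal R=(\Omega,\mathcal F,\mathbb P,\sigma,X,\mathcal L)$ where $(\Omega,\mathcal F,\mathbb P)$ is a complete probability space, $\sigma$ is a measure-preserving transformation of $\Omega$, $X$ is a separable Banach space, $\mathcal L:\Omega\to B(X,X)$ (bounded linear operators on $X$) is strongly measurable (for each fixed $x\in X$, $\omega\mapsto\mathcal L_\omega x$ is measurable from $(\Omega,\mathcal F)$ to $X$ with its Borel $\sigma$-algebra), and $\log\|\mathcal L_\omega\|$ is integrable. It is ergodic if $\sigma$ is ergodic. (A Banach space with separable dual is separable.) Put $\mathcal L^{(n)}_\omega=\mathcal L_{\sigma^{n-1}\omega}\circ\dots\circ\mathcal L_\omega$. Convention: $\log 0=-\infty$. For a bounded operator $A$ on $X$ with closed unit ball $B_X$, $\alpha(A)=\inf\{r>0: A(B_X)\text{ can be covered by finitely many balls of radius }r\}$. For ergodic $\mathcal R$ the following limits exist and are constant for $\mathbb P$-a.e. $\omega$, and define $\lambda(\mathcal R)=\lim_n\frac1n\log\|\mathcal L^{(n)}_\omega\|$ and $\kappa(\mathcal R)=\lim_n\frac1n\log\alpha(\mathcal L^{(n)}_\omega)$ (values in $[-\infty,\infty)$). For vectors, $\operatorname{vol}_k(v_1,\dots,v_k)=\prod_{i=1}^k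 d(v_i,\operatorname{lin}\{v_j:j<i\})$, where $d(x,A)=\inf_{y\in A}\|x-y\|$ and $\operatorname{lin}(\emptyset)=\{0\}$. For bounded linear $T$, $D_k(T)=\sup_{\|v_1\|=\dots=\|v_k\|=1}\operatorname{vol}_k(Tv_1,\dots,Tv_k)$. For ergodic $\mathcal R$ there are constants $\Delta_k$ with $\lim_n\frac1n\log D_k(\mathcal L^{(n)}_\omega)=\Delta_k$ for a.e. $\omega$; put $\Delta_0=0$. The Lyapunov exponents of $\mathcal R$ are $\mu_k=\Delta_k-\Delta_{k-1}$, $k\ge1$ (with $\mu_k=-\infty$ if $\Delta_{k-1}=-\infty$). An exponent $\mu_k$ is exceptional if $\mu_k>\kappa(\mathcal R)$. $\mathcal G^k(X)$ is the set of closed $k$-codimensional subspaces of $X$ with the metric $d(Y,Y')=d_H(Y\cap S_X,Y'\cap S_X)$, where $S_X$ is the unit sphere and $d_H$ is Hausdorff distance. Measurability of a family of closed subspaces $\omega\mapsto V(\omega)$ of codimension $k$ means measurability as a map into $\mathcal G^k(X)$ with its Borel $\sigma$-algebra; the filtration is measurable if each of its members of finite codimension is measurable in this sense. *)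

theory Defs
  imports "HOL-Probability.Probability"
begin

section \<open>Random dynamical systems\<close>

text \<open>Separability of the Banach space is the sort constraint
  \<^class>\<open>second_countable_topology\<close>. Since \<^term>\<open>ln 0 = (0::real)\<close> in HOL, integrability of the
  extended-real function \<open>log \<parallel>L\<^sub>\<omega>\<parallel>\<close> with \<open>log 0 = -\<infinity>\<close> is split into finiteness almost everywhere
  and integrability of the real-valued function.\<close>

locale random_dynamical_system = prob_space M + complete_measure M
  for M :: "'o measure" +
  fixes \<sigma> :: "'o \<Rightarrow> 'o"
    and L :: "'o \<Rightarrow> 'x::{banach,second_countable_topology} \<Rightarrow>\<^sub>L 'x"
  assumes base_measurable: "\<sigma> \<in> measurable M M"
    and base_preserving: "\<And>A. A \<in> sets M \<Longrightarrow> emeasure M (\<sigma> -` A \<inter> space M) = emeasure M A"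
    and strongly_measurable: "\<And>x. (\<lambda>\<omega>. blinfun_apply (L \<omega>) x) \<in> borel_measurable M"
    and log_norm_finite: "AE \<omega> in M. L \<omega> \<noteq> 0"
    and log_norm_integrable: "integrable M (\<lambda>\<omega>. ln (norm (L \<omega>)))"

locale ergodic_rds = random_dynamical_system M \<sigma> L
  for M :: "'o measure" and \<sigma> :: "'o \<Rightarrow> 'o"
    and L :: "'o \<Rightarrow> 'x::{banach,second_countable_topology} \<Rightarrow>\<^sub>L 'x" +
  assumes ergodic:
    "\<And>A. A \<in> sets M \<Longrightarrow> \<sigma> -` A \<inter> space M = A \<Longrightarrow> prob A = 0 \<or> prob A = 1"

primrec cocycle ::
  "('o \<Rightarrow> 'o) \<Rightarrow> ('o \<Rightarrow> 'x::real_normed_vector \<Rightarrow>\<^sub>L 'x) \<Rightarrow> nat \<Rightarrow> 'o \<Rightarrow> 'x \<Rightarrow>\<^sub>L 'x" where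
  "cocycle \<sigma> L 0 \<omega> = id_blinfun"
| "cocycle \<sigma> L (Suc n) \<omega> = L ((\<sigma> ^^ n) \<omega>) o\<^sub>L cocycle \<sigma> L n \<omega>"


section \<open>Growth rates\<close>

definition ext_ln :: "real \<Rightarrow> ereal" where
  "ext_ln x = (if x \<le> 0 then -\<infinity> else ereal (ln x))"

definition log_rate :: "(nat \<Rightarrow> real) \<Rightarrow> nat \<Rightarrow> ereal" where
  "log_rate a n = ereal (1 / real n) * ext_ln (a n)"

text \<open>The almost sure constant limit of \<open>(1/n) log a\<^sub>n(\<omega>)\<close>. It is unique on a probability space
  (see below); its existence for the sequences used here is a theorem about ergodic systems.\<close>

definition as_growth_rate :: "'o measure \<Rightarrow> (nat \<Rightarrow> 'o \<Rightarrow> real) \<Rightarrow> ereal" where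
  "as_growth_rate M a = (THE l. AE \<omega> in M. log_rate (\<lambda>n. a n \<omega>) \<longlonglongrightarrow> l)"

lemma (in prob_space) as_growth_rate_eqI:
  assumes "AE \<omega> in M. log_rate (\<lambda>n. a n \<omega>) \<longlonglongrightarrow> l"
  shows "as_growth_rate M a = l"
  unfolding as_growth_rate_def
proof (rule the_equality)
  fix l' assume "AE \<omega> in M. log_rate (\<lambda>n. a n \<omega>) \<longlonglongrightarrow> l'"
  with assms have "AE \<omega> in M. l' = l"
    by eventually_elim (rule LIMSEQ_unique)
  then show "l' = l" by simp
qed (rule assms)

definition ball_noncompactness :: "('x::real_normed_vector \<Rightarrow>\<^sub>L 'x) \<Rightarrow> real" where
  "ball_noncompactness A =
     Inf {r. r > 0 \<and> (\<exists>C. finite C \<and> blinfun_apply A ` cball 0 1 \<subseteq> (\<Union>c\<in>C. ball c r))}"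

definition top_exponent ::
  "'o measure \<Rightarrow> ('o \<Rightarrow> 'o) \<Rightarrow> ('o \<Rightarrow> 'x::real_normed_vector \<Rightarrow>\<^sub>L 'x) \<Rightarrow> ereal" where
  "top_exponent M \<sigma> L = as_growth_rate M (\<lambda>n \<omega>. norm (cocycle \<sigma> L n \<omega>))"

definition compactness_exponent ::
  "'o measure \<Rightarrow> ('o \<Rightarrow> 'o) \<Rightarrow> ('o \<Rightarrow> 'x::real_normed_vector \<Rightarrow>\<^sub>L 'x) \<Rightarrow> ereal" where
  "compactness_exponent M \<sigma> L = as_growth_rate M (\<lambda>n \<omega>. ball_noncompactness (cocycle \<sigma> L n \<omega>))"

text \<open>The vectors \<open>v\<^sub>1, \<dots>, v\<^sub>k\<close> are \<open>v 0, \<dots>, v (k - 1)\<close>.\<close>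

definition vol :: "nat \<Rightarrow> (nat \<Rightarrow> 'x::real_normed_vector) \<Rightarrow> real" where
  "vol k v = (\<Prod>i<k. infdist (v i) (span (v ` {..<i})))"

definition vol_growth :: "nat \<Rightarrow> ('x::real_normed_vector \<Rightarrow>\<^sub>L 'x) \<Rightarrow> real" where
  "vol_growth k T = (SUP v\<in>{v. \<forall>i<k. norm (v i) = 1}. vol k (\<lambda>i. blinfun_apply T (v i)))"

definition vol_exponent ::
  "'o measure \<Rightarrow> ('o \<Rightarrow> 'o) \<Rightarrow> ('o \<Rightarrow> 'x::real_normed_vector \<Rightarrow>\<^sub>L 'x) \<Rightarrow> nat \<Rightarrow> ereal" where
  "vol_exponent M \<sigma> L k =
     (if k = 0 then 0 else as_growth_rate M (\<lambda>n \<omega>. vol_growth k (cocycle \<sigma> L n \<omega>)))"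

definition lyapunov_exponent ::
  "'o measure \<Rightarrow> ('o \<Rightarrow> 'o) \<Rightarrow> ('o \<Rightarrow> 'x::real_normed_vector \<Rightarrow>\<^sub>L 'x) \<Rightarrow> nat \<Rightarrow> ereal" where
  "lyapunov_exponent M \<sigma> L k =
     (if vol_exponent M \<sigma> L (k - 1) = -\<infinity> then -\<infinity>
      else vol_exponent M \<sigma> L k - vol_exponent M \<sigma> L (k - 1))"

definition exceptional_exponent ::
  "'o measure \<Rightarrow> ('o \<Rightarrow> 'o) \<Rightarrow> ('o \<Rightarrow> 'x::real_normed_vector \<Rightarrow>\<^sub>L 'x) \<Rightarrow> ereal \<Rightarrow> bool" where
  "exceptional_exponent M \<sigma> L \<mu> \<longleftrightarrow>
     (\<exists>k\<ge>1. \<mu> = lyapunov_exponent M \<sigma> L k) \<and> \<mu> > compactness_exponent M \<sigma> L"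


section \<open>Closed subspaces of finite codimension\<close>

text \<open>\<open>B\<close> maps bijectively onto a basis of the quotient by \<open>Y\<close>, that is, \<open>span B\<close> is a
  \<open>k\<close>-dimensional algebraic complement of \<open>Y\<close>.\<close>

definition has_codim :: "'x::real_vector set \<Rightarrow> nat \<Rightarrow> bool" where
  "has_codim Y k \<longleftrightarrow> subspace Y \<and>
     (\<exists>B. finite B \<and> independent B \<and> card B = k \<and>
          span B \<inter> Y = {0} \<and> (\<forall>x. \<exists>b\<in>span B. x - b \<in> Y))"

definition cograss :: "nat \<Rightarrow> 'x::real_normed_vector set set" where
  "cograss k = {Y. closed Y \<and> has_codim Y k}"

text \<open>Taking the suprema and infima in \<^typ>\<open>ennreal\<close> gives distance \<open>0\<close> between empty sets, as
  needed for the trivial subspace.\<close>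

definition hausdorff_dist :: "'a::metric_space set \<Rightarrow> 'a set \<Rightarrow> real" where
  "hausdorff_dist A B = enn2real
     (max (SUP x\<in>A. INF y\<in>B. ennreal (dist x y)) (SUP y\<in>B. INF x\<in>A. ennreal (dist x y)))"

definition cograss_dist :: "'x::real_normed_vector set \<Rightarrow> 'x set \<Rightarrow> real" where
  "cograss_dist Y Y' = hausdorff_dist (Y \<inter> sphere 0 1) (Y' \<inter> sphere 0 1)"

definition cograss_borel :: "nat \<Rightarrow> 'x::real_normed_vector set measure" where
  "cograss_borel k =
     sigma (cograss k) {U. openin (Metric_space.mtopology (cograss k) cograss_dist) U}"

text \<open>Families of subspaces are only required to have codimension \<open>k\<close> almost everywhere, so
  measurability is that of a map defined off a null set.\<close>

definition measurable_subspaces ::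
  "'o measure \<Rightarrow> nat \<Rightarrow> ('o \<Rightarrow> 'x::real_normed_vector set) \<Rightarrow> bool" where
  "measurable_subspaces M k V \<longleftrightarrow>
     (\<exists>N\<in>null_sets M. V \<in> measurable (restrict_space M (space M - N)) (cograss_borel k))"

text \<open>The spaces \<^term>\<open>cograss k\<close> are metric spaces, so the topology above is the intended one.\<close>

lemma hausdorff_dist_commute: "hausdorff_dist A B = hausdorff_dist B A"
  by (simp add: hausdorff_dist_def dist_commute max.commute)

lemma infdist_almost_attained:
  assumes "B \<noteq> {}" "infdist x B < c"
  shows "\<exists>y\<in>B. dist x y < c"
  using assms by (auto simp: infdist_notempty cInf_less_iff)

lemma INF_dist_eq_infdist:
  assumes "B \<noteq> {}"
  shows "(INF y\<in>B. ennreal (dist x y)) = ennreal (infdist x B)"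
proof (rule antisym)
  show "ennreal (infdist x B) \<le> (INF y\<in>B. ennreal (dist x y))"
    by (intro INF_greatest ennreal_leI infdist_le)
  show "(INF y\<in>B. ennreal (dist x y)) \<le> ennreal (infdist x B)"
  proof (rule ennreal_le_epsilon)
    fix e :: real assume "e > 0"
    then have "\<exists>y\<in>B. dist x y < infdist x B + e"
      using infdist_almost_attained[OF assms] by simp
    then obtain y where y: "y \<in> B" "dist x y < infdist x B + e" by blast
    have "(INF y\<in>B. ennreal (dist x y)) \<le> ennreal (dist x y)"
      using y(1) by (rule INF_lower)
    also have "\<dots> \<le> ennreal (infdist x B) + ennreal e"
      using y(2) \<open>e > 0\<close> by (simp flip: ennreal_plus add: infdist_nonneg ennreal_leI)
    finally show "(INF y\<in>B. ennreal (dist x y)) \<le> ennreal (infdist x B) + ennreal e" .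
  qed
qed

lemma hausdorff_dist_le_iff:
  assumes "A \<noteq> {}" "B \<noteq> {}" "bounded A" "bounded B" "r \<ge> 0"
  shows "hausdorff_dist A B \<le> r \<longleftrightarrow> (\<forall>x\<in>A. infdist x B \<le> r) \<and> (\<forall>y\<in>B. infdist y A \<le> r)"
proof -
  let ?m = "max (SUP x\<in>A. INF y\<in>B. ennreal (dist x y)) (SUP y\<in>B. INF x\<in>A. ennreal (dist x y))"
  have iff: "?m \<le> ennreal s \<longleftrightarrow> (\<forall>x\<in>A. infdist x B \<le> s) \<and> (\<forall>y\<in>B. infdist y A \<le> s)" if "s \<ge> 0" for s
    using INF_dist_eq_infdist[OF assms(2)] INF_dist_eq_infdist[OF assms(1)] that
    by (simp add: SUP_le_iff dist_commute)
  have "bounded (A \<union> B)" using assms by simp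
  then obtain c where c: "\<And>x y. x \<in> A \<union> B \<Longrightarrow> y \<in> A \<union> B \<Longrightarrow> dist x y \<le> c"
    by (meson bounded_two_points)
  obtain a b where ab: "a \<in> A" "b \<in> B" using assms by blast
  have "c \<ge> 0" using c[of a a] ab by simp
  have "?m \<le> ennreal c"
    unfolding iff[OF \<open>c \<ge> 0\<close>] using c ab by (meson UnI1 UnI2 infdist_le2)
  then have "?m < \<top>" by (rule le_less_trans) simp
  then have "enn2real ?m \<le> r \<longleftrightarrow> ?m \<le> ennreal r"
    using assms(5) by (metis enn2real_leI ennreal_enn2real ennreal_leI)
  then show ?thesis unfolding hausdorff_dist_def iff[OF assms(5)] .
qed

lemma hausdorff_dist_triangle:
  assumes "A \<noteq> {}" "B \<noteq> {}" "C \<noteq> {}" "bounded A" "bounded B" "bounded C"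
  shows "hausdorff_dist A C \<le> hausdorff_dist A B + hausdorff_dist B C"
proof -
  have nn: "hausdorff_dist A' B' \<ge> 0" for A' B' :: "'a set"
    by (simp add: hausdorff_dist_def)
  have half: "infdist x C' \<le> hausdorff_dist A' B + hausdorff_dist B C'"
    if x: "x \<in> A'" and ne: "A' \<noteq> {}" "C' \<noteq> {}" and bd: "bounded A'" "bounded C'" for x A' C'
  proof (rule field_le_epsilon)
    fix e :: real assume "e > 0"
    have "infdist x B \<le> hausdorff_dist A' B"
      using hausdorff_dist_le_iff[OF ne(1) assms(2) bd(1) assms(5) nn[of A' B]] x by blast
    then have "infdist x B < hausdorff_dist A' B + e" using \<open>e > 0\<close> by linarith
    then obtain y where y: "y \<in> B" "dist x y < hausdorff_dist A' B + e"
      using infdist_almost_attained[OF assms(2)] by blast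
    have "infdist y C' \<le> hausdorff_dist B C'"
      using hausdorff_dist_le_iff[OF assms(2) ne(2) assms(5) bd(2) nn[of B C']] y(1) by blast
    then show "infdist x C' \<le> hausdorff_dist A' B + hausdorff_dist B C' + e"
      using infdist_triangle[of x C' y] y(2) by linarith
  qed
  have "(\<forall>x\<in>A. infdist x C \<le> hausdorff_dist A B + hausdorff_dist B C) \<and>
        (\<forall>y\<in>C. infdist y A \<le> hausdorff_dist A B + hausdorff_dist B C)"
    using half[of _ A C] half[of _ C A] assms
    by (simp add: hausdorff_dist_commute[of B A] hausdorff_dist_commute[of C B] add.commute)
  then show ?thesis
    by (subst hausdorff_dist_le_iff) (use assms nn in auto)
qed

lemma has_codim_zero_eq:
  assumes "has_codim ({0} :: 'x::real_vector set) k" "has_codim (Y :: 'x set) k"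
  shows "Y = {0}"
proof -
  obtain B :: "'x set" where B: "finite B" "card B = k" "\<forall>x. \<exists>b\<in>span B. x - b \<in> {0}"
    using assms(1) by (auto simp: has_codim_def)
  then have span: "span B = UNIV" by auto
  obtain B' where B': "finite B'" "independent B'" "card B' = k" "span B' \<inter> Y = {0}"
    using assms(2) by (auto simp: has_codim_def)
  have "y = 0" if "y \<in> Y" for y
  proof (rule ccontr)
    assume "y \<noteq> 0"
    then have y: "y \<notin> span B'" using that B'(4) by blast
    then have "independent (insert y B')" using B'(2) by (simp add: independent_insert)
    then have "card (insert y B') \<le> card B"
      using independent_span_bound[OF B(1), of "insert y B'"] span by simp
    moreover have "y \<notin> B'" using y span_base by blast
    ultimately show False using B' B by simp
  qed
  moreover have "0 \<in> Y" using assms(2) by (simp add: has_codim_def subspace_0)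
  ultimately show ?thesis by blast
qed

lemma subspace_sphere_empty_iff:
  fixes Y :: "'x::real_normed_vector set"
  assumes "subspace Y"
  shows "Y \<inter> sphere 0 1 = {} \<longleftrightarrow> Y = {0}"
proof
  assume e: "Y \<inter> sphere 0 1 = {}"
  have "y = 0" if "y \<in> Y" for y
  proof (rule ccontr)
    assume "y \<noteq> 0"
    then have "(1 / norm y) *\<^sub>R y \<in> Y \<inter> sphere 0 1"
      using assms that by (simp add: subspace_scale)
    with e show False by blast
  qed
  then show "Y = {0}" using assms subspace_0 by blast
qed auto

lemma subspace_sphere_inject:
  fixes Y Y' :: "'x::real_normed_vector set"
  assumes "subspace Y" "subspace Y'" "Y \<inter> sphere 0 1 \<subseteq> Y' \<inter> sphere 0 1"
  shows "Y \<subseteq> Y'"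
proof
  fix y assume y: "y \<in> Y"
  show "y \<in> Y'"
  proof (cases "y = 0")
    case False
    then have "(1 / norm y) *\<^sub>R y \<in> Y'"
      using assms y by (auto simp: subspace_scale subset_iff)
    then have "norm y *\<^sub>R ((1 / norm y) *\<^sub>R y) \<in> Y'"
      using assms(2) by (rule subspace_scale[rotated])
    then show ?thesis using False by simp
  qed (use assms(2) subspace_0 in auto)
qed

lemma Metric_space_cograss:
  "Metric_space (cograss k :: 'x::real_normed_vector set set) cograss_dist"
proof
  let ?S = "sphere (0::'x) 1"
  fix X Y Z :: "'x set"
  show "0 \<le> cograss_dist X Y" by (simp add: cograss_dist_def hausdorff_dist_def)
  show "cograss_dist X Y = cograss_dist Y X"
    unfolding cograss_dist_def by (rule hausdorff_dist_commute)
  have bd: "bounded (W \<inter> ?S)" for W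
    by (rule bounded_subset[OF bounded_cball[of 0 1]]) auto
  have sub: "subspace W" if "W \<in> cograss k" for W :: "'x set"
    using that by (simp add: cograss_def has_codim_def)
  have triv: "cograss k = {{0} :: 'x set}" if "W \<in> cograss k" "W \<inter> ?S = {}" for W :: "'x set"
    using that subspace_sphere_empty_iff[OF sub[OF that(1)]] has_codim_zero_eq
    by (auto simp: cograss_def)
  have self0: "cograss_dist {0} ({0} :: 'x set) = 0"
    by (simp add: cograss_dist_def hausdorff_dist_def bot_ennreal)
  show "cograss_dist X Y = 0 \<longleftrightarrow> X = Y" if XY: "X \<in> cograss k" "Y \<in> cograss k"
  proof (cases "X \<inter> ?S = {} \<or> Y \<inter> ?S = {}")
    case True
    then have "cograss k = {{0} :: 'x set}" using triv XY by blast
    then show ?thesis using XY self0 by simp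
  next
    case False
    then have ne: "X \<inter> ?S \<noteq> {}" "Y \<inter> ?S \<noteq> {}" by auto
    have "closed ?S"
      unfolding sphere_def by (intro closed_Collect_eq continuous_intros)
    then have cl: "closed (X \<inter> ?S)" "closed (Y \<inter> ?S)" using XY by (auto simp: cograss_def intro!: closed_Int)
    have "cograss_dist X Y = 0 \<longleftrightarrow> cograss_dist X Y \<le> 0"
      using \<open>0 \<le> cograss_dist X Y\<close> by linarith
    also have "\<dots> \<longleftrightarrow> (\<forall>x\<in>X \<inter> ?S. infdist x (Y \<inter> ?S) \<le> 0) \<and> (\<forall>y\<in>Y \<inter> ?S. infdist y (X \<inter> ?S) \<le> 0)"
      unfolding cograss_dist_def by (rule hausdorff_dist_le_iff[OF ne bd bd]) simp
    also have "\<dots> \<longleftrightarrow> X \<inter> ?S \<subseteq> Y \<inter> ?S \<and> Y \<inter> ?S \<subseteq> X \<inter> ?S"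
      unfolding subset_iff Ball_def in_closed_iff_infdist_zero[OF cl(1) ne(1)]
        in_closed_iff_infdist_zero[OF cl(2) ne(2)]
      by (simp add: order_antisym_conv infdist_nonneg)
    also have "\<dots> \<longleftrightarrow> X = Y"
      using subspace_sphere_inject[of X Y] subspace_sphere_inject[of Y X] sub XY by blast
    finally show ?thesis .
  qed
  show "cograss_dist X Z \<le> cograss_dist X Y + cograss_dist Y Z"
    if XYZ: "X \<in> cograss k" "Y \<in> cograss k" "Z \<in> cograss k"
  proof (cases "X \<inter> ?S = {} \<or> Y \<inter> ?S = {} \<or> Z \<inter> ?S = {}")
    case True
    then have "cograss k = {{0} :: 'x set}" using triv XYZ by blast
    then show ?thesis using XYZ self0 by simp
  next
    case False
    then show ?thesis unfolding cograss_dist_def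
      by (intro hausdorff_dist_triangle bd) auto
  qed
qed

end

theory Submission
  imports Defs
begin

text \<open>
The exponents are defined by the growth of volumes, and the filtration is obtained from volumes as
well. Write \<open>D\<^sub>k\<close> for \<^const>\<open>vol_growth\<close> of \<open>k\<close> vectors and \<open>T\<^sub>n\<close> for the cocycle at time \<open>n\<close>. Since
\<open>D\<^sub>k\<close> is submultiplicative (\<open>vol_growth_compose\<close>), the subadditive ergodic theorem gives the
rates \<open>\<Delta>\<^sub>k\<close> and with them \<open>\<mu>\<^sub>k = \<Delta>\<^sub>k - \<Delta>\<^sub>k\<^sub>-\<^sub>1\<close>. Call \<open>k\<close> a gap if \<open>\<mu>\<^sub>k\<^sub>+\<^sub>1 < \<mu>\<^sub>k\<close>.

At a gap, choose for every \<open>n\<close> a tuple of \<open>k\<close> unit vectors for which the volume of the images under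
\<open>T\<^sub>n\<close> is at least half of the supremum, and let \<open>F\<^sub>n\<close> be its span. Two quotients of volume growths
control these spaces. Every vector lies in \<open>F\<^sub>n\<close> up to an error whose image under \<open>T\<^sub>n\<close> has size about
\<open>D\<^sub>k\<^sub>+\<^sub>1(T\<^sub>n) / D\<^sub>k(T\<^sub>n)\<close>, which grows at rate \<open>\<mu>\<^sub>k\<^sub>+\<^sub>1\<close> (\<open>near_opt_span_approx\<close>). And a vector of \<open>F\<^sub>m\<close>
has expanded at rate at least \<open>\<mu>\<^sub>k\<close> between any earlier time \<open>n\<close> and time \<open>m\<close>
(\<open>near_opt_span_no_contraction\<close>); here \<open>D\<^sub>k\<^sub>-\<^sub>1\<close> of the operators leading from \<open>n\<close> to \<open>m\<close> has to be
bounded with an error of size \<open>\<epsilon> m\<close> that is uniform in \<open>n\<close>, which is the purpose of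
\<open>uniform_upper\<close>. Removing from a vector its component in \<open>F\<^sub>m\<close> successively for all large \<open>m\<close> then
amounts to subtracting a convergent series, and leaves a vector that grows at most at rate \<open>\<mu>\<^sub>k\<^sub>+\<^sub>1\<close>.
So these slow vectors form a closed complement of \<open>F\<^sub>n\<close>, of codimension \<open>k\<close>, and every other vector
grows at least at rate \<open>\<mu>\<^sub>k\<close> (locale \<open>dominated_sequence\<close>, \<open>slow_dichotomy\<close>). The slow space is
characterised by a growth rate alone, whence its equivariance.

Gaps above \<open>\<kappa>\<close> exist because a cover of the image of the unit ball by finitely many balls of radius
\<open>r\<close> bounds \<open>D\<^sub>j\<close> by a constant times \<open>(2 r)\<^sup>j\<close>: hence \<open>\<mu>\<^sub>j\<close> drops below any number above \<open>\<kappa>\<close> for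
arbitrarily large \<open>j\<close> (\<open>exponent_below\<close>). Between consecutive gaps \<open>\<mu>\<close> is constant: it cannot decrease
without a gap, and if it increased, then the slow space of the first gap would be contained in that of
the second one, which has larger codimension (\<open>consecutive_gaps\<close>). The \<open>V\<^sub>l\<close> are the slow spaces at the
successive gaps above \<open>\<kappa>\<close>, and the multiplicities are the distances between these gaps.

For measurability, fix \<open>t\<close> with \<open>\<mu>\<^sub>k\<^sub>+\<^sub>1 < t < \<mu>\<^sub>k\<close>. The open sets of all \<open>x\<close> with
\<open>\<parallel>T\<^sub>n x\<parallel> < exp (n t) \<parallel>x\<parallel>\<close>, intersected with the unit sphere, converge to the unit sphere of the slow space in
the Hausdorff distance. So the distance of the slow space from any fixed subspace is measurable, and
this suffices because the Grassmannian is separable if the dual of the space is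
(\<open>cograss_separable\<close>).
\<close>

section \<open>Volumes relative to a subspace\<close>

text \<open>The set \<open>S\<close> collects the vectors that come before the list, which makes induction from the front
  of the list possible.\<close>

fun rel_vol :: "'x::real_normed_vector set \<Rightarrow> 'x list \<Rightarrow> real" where
  "rel_vol S [] = 1"
| "rel_vol S (x # xs) = infdist x (span S) * rel_vol (insert x S) xs"

lemma span_ne [simp]: "span S \<noteq> {}"
  using span_zero by blast

lemma infdist_span_approx:
  assumes "infdist x (span S) < c"
  shows "\<exists>s\<in>span S. norm (x - s) < c"
  using infdist_almost_attained[OF span_ne assms] by (simp add: dist_norm)

lemma infdist_span_le:
  assumes "s \<in> span S" shows "infdist x (span S) \<le> norm (x - s)"
  using infdist_le[OF assms, of x] by (simp add: dist_norm)

lemma infdist_span_le_norm: "infdist x (span S) \<le> norm x"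
  using infdist_span_le[OF span_zero, of x] by simp

lemma infdist_le_approx:
  assumes "\<And>e. e > 0 \<Longrightarrow> \<exists>s\<in>span S. norm (x - s) \<le> c + e"
  shows "infdist x (span S) \<le> c"
proof (rule field_le_epsilon)
  fix e :: real assume "e > 0"
  then obtain s where "s \<in> span S" "norm (x - s) \<le> c + e" using assms by blast
  then show "infdist x (span S) \<le> c + e" using infdist_span_le by (meson order_trans)
qed

lemma infdist_span_add_le:
  fixes x y :: "'x::real_normed_vector"
  shows "infdist (x + y) (span S) \<le> infdist x (span S) + infdist y (span S)"
proof (rule infdist_le_approx)
  fix e :: real assume "e > 0"
  then obtain s t where "s \<in> span S" "norm (x - s) < infdist x (span S) + e / 2"
    "t \<in> span S" "norm (y - t) < infdist y (span S) + e / 2"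
    using infdist_span_approx[of x S "infdist x (span S) + e / 2"]
      infdist_span_approx[of y S "infdist y (span S) + e / 2"] by auto
  then show "\<exists>u\<in>span S. norm (x + y - u) \<le> infdist x (span S) + infdist y (span S) + e"
    using norm_triangle_ineq[of "x - s" "y - t"]
    by (intro bexI[of _ "s + t"]) (auto simp: span_add algebra_simps)
qed

lemma infdist_span_shift:
  fixes x :: "'x::real_normed_vector"
  assumes "s \<in> span S" shows "infdist (x + s) (span S) = infdist x (span S)"
proof (rule antisym)
  show "infdist (x + s) (span S) \<le> infdist x (span S)"
    using infdist_span_add_le[of x s S] assms by simp
  show "infdist x (span S) \<le> infdist (x + s) (span S)"
    using infdist_span_add_le[of "x + s" "- s" S] assms by (simp add: span_neg)
qed

lemma infdist_span_scale:
  fixes x :: "'x::real_normed_vector"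
  shows "infdist (c *\<^sub>R x) (span S) = \<bar>c\<bar> * infdist x (span S)"
proof -
  have le: "infdist (c *\<^sub>R x) (span S) \<le> \<bar>c\<bar> * infdist x (span S)" for c x
  proof (rule infdist_le_approx)
    fix e :: real assume "e > 0"
    then have "infdist x (span S) < infdist x (span S) + e / (\<bar>c\<bar> + 1)" by simp
    then obtain s where s: "s \<in> span S" "norm (x - s) < infdist x (span S) + e / (\<bar>c\<bar> + 1)"
      using infdist_span_approx by blast
    have "norm (c *\<^sub>R x - c *\<^sub>R s) = \<bar>c\<bar> * norm (x - s)"
      by (metis norm_scaleR scaleR_diff_right)
    also have "\<dots> \<le> \<bar>c\<bar> * (infdist x (span S) + e / (\<bar>c\<bar> + 1))"
      using s(2) by (intro mult_left_mono) auto
    also have "\<dots> \<le> \<bar>c\<bar> * infdist x (span S) + e"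
      using \<open>e > 0\<close> by (simp add: field_simps)
    finally show "\<exists>u\<in>span S. norm (c *\<^sub>R x - u) \<le> \<bar>c\<bar> * infdist x (span S) + e"
      using s(1) span_scale by blast
  qed
  show ?thesis
  proof (cases "c = 0")
    case True then show ?thesis by (simp add: span_zero)
  next
    case False
    have "infdist x (span S) \<le> \<bar>1/c\<bar> * infdist (c *\<^sub>R x) (span S)"
      using le[of "1/c" "c *\<^sub>R x"] False by simp
    then have "\<bar>c\<bar> * infdist x (span S) \<le> infdist (c *\<^sub>R x) (span S)"
      using False by (simp add: field_simps)
    then show ?thesis using le[of c x] by simp
  qed
qed

lemma infdist_span_minus:
  fixes x :: "'x::real_normed_vector"
  shows "infdist (- x) (span S) = infdist x (span S)"
  using infdist_span_scale[of "-1" x S] by simp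

lemma infdist_span_mono:
  assumes "span S \<subseteq> span T" shows "infdist x (span T) \<le> infdist x (span S)"
  by (rule infdist_mono[OF assms]) simp

lemma span_insert_mono: "span S \<subseteq> span T \<Longrightarrow> span (insert x S) \<subseteq> span (insert x T)"
proof -
  assume a: "span S \<subseteq> span T"
  have "insert x S \<subseteq> span (insert x T)"
    using a span_superset[of S] span_mono[of T "insert x T"] span_base[of x "insert x T"] by blast
  then show ?thesis by (simp add: span_minimal)
qed

lemma span_insert_cong: "span S = span T \<Longrightarrow> span (insert x S) = span (insert x T)"
  by (simp add: subset_antisym span_insert_mono)

lemma span_insert_shift:
  assumes "s \<in> span S" "c \<noteq> 0"
  shows "span (insert (c *\<^sub>R x + s) S) = span (insert x S)"
proof
  have sS: "s \<in> span (insert y S)" for y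
    using assms(1) span_mono[of S "insert y S"] by blast
  have "c *\<^sub>R x + s \<in> span (insert x S)"
    by (intro span_add span_scale span_base sS) auto
  moreover have "S \<subseteq> span (insert x S)"
    using span_superset[of "insert x S"] by blast
  ultimately show "span (insert (c *\<^sub>R x + s) S) \<subseteq> span (insert x S)"
    by (simp add: span_minimal)
  have "x = (1/c) *\<^sub>R ((c *\<^sub>R x + s) - s)" using assms(2) by simp
  also have "\<dots> \<in> span (insert (c *\<^sub>R x + s) S)"
    by (intro span_diff span_scale span_base sS) auto
  finally have "x \<in> span (insert (c *\<^sub>R x + s) S)" .
  moreover have "S \<subseteq> span (insert (c *\<^sub>R x + s) S)"
    using span_superset[of "insert (c *\<^sub>R x + s) S"] by blast
  ultimately show "span (insert x S) \<subseteq> span (insert (c *\<^sub>R x + s) S)"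
    by (simp add: span_minimal)
qed

lemma rel_vol_nonneg [simp]: "rel_vol S xs \<ge> 0"
  by (induction xs arbitrary: S) (auto simp: infdist_nonneg)

lemma rel_vol_cong: "span S = span T \<Longrightarrow> rel_vol S xs = rel_vol T xs"
proof (induction xs arbitrary: S T)
  case (Cons x xs)
  show ?case
    using Cons.IH[OF span_insert_cong[OF Cons.prems, of x]] Cons.prems by simp
qed simp

lemma rel_vol_antimono: "span S \<subseteq> span T \<Longrightarrow> rel_vol T xs \<le> rel_vol S xs"
proof (induction xs arbitrary: S T)
  case (Cons x xs)
  then show ?case
    using span_insert_mono[OF Cons.prems, of x]
    by (auto intro!: mult_mono infdist_span_mono infdist_nonneg)
qed simp

lemma rel_vol_append: "rel_vol S (xs @ ys) = rel_vol S xs * rel_vol (set xs \<union> S) ys"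
  by (induction xs arbitrary: S) (auto simp: Un_commute)

lemma rel_vol_snoc: "rel_vol S (xs @ [x]) = rel_vol S xs * infdist x (span (set xs \<union> S))"
  by (simp add: rel_vol_append)

lemma prod_norm_eq_1: "(\<And>x. x \<in> set xs \<Longrightarrow> norm x = 1) \<Longrightarrow> (\<Prod>x\<leftarrow>xs. norm x) = 1"
  by (induction xs) auto

lemma rel_vol_le_prod: "rel_vol S xs \<le> (\<Prod>x\<leftarrow>xs. norm x)"
  by (induction xs arbitrary: S)
    (auto intro!: mult_mono infdist_span_le_norm infdist_nonneg)

lemma vol_eq_rel_vol: "vol k v = rel_vol {} (map v [0..<k])"
proof (induction k)
  case (Suc k)
  then show ?case
    by (simp add: vol_def rel_vol_snoc atLeast0LessThan)
qed (simp add: vol_def)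

text \<open>Modulo the span of \<open>S\<close>, the parallelogram area computed from either side differs by at most a
  factor of two: a vector \<open>b - t a\<close> almost realising the height over \<open>a\<close> also bounds the height of
  \<open>a\<close> over \<open>b\<close>, unless \<open>t a\<close> is so short that \<open>b\<close> itself is comparable with the height.\<close>

lemma infdist_span_swap:
  fixes a b :: "'x::real_normed_vector"
  shows "infdist b (span S) * infdist a (span (insert b S)) \<le>
     2 * (infdist a (span S) * infdist b (span (insert a S)))"
proof (cases "infdist a (span S) = 0")
  case True
  have "infdist a (span (insert b S)) \<le> infdist a (span S)"
    by (rule infdist_span_mono[OF span_mono]) auto
  then have "infdist a (span (insert b S)) = 0"
    using True infdist_nonneg[of a "span (insert b S)"] by simp
  then show ?thesis by (simp add: infdist_nonneg)
next
  case False
  let ?p = "\<lambda>x. infdist x (span S)"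
  have pa: "?p a > 0" using False infdist_nonneg[of a "span S"] by linarith
  have main: "?p b * infdist a (span (insert b S)) \<le> 2 * (?p a * (infdist b (span (insert a S)) + e))"
    if "e > 0" for e
  proof -
    define d where "d = infdist b (span (insert a S)) + e"
    have d: "d > 0" using that infdist_nonneg[of b "span (insert a S)"] unfolding d_def by linarith
    have "infdist b (span (insert a S)) < d" using that unfolding d_def by simp
    then obtain u where u: "u \<in> span (insert a S)" "norm (b - u) < d"
      using infdist_span_approx by blast
    then obtain t where t: "u - t *\<^sub>R a \<in> span S" using span_breakdown_eq by blast
    define s where "s = u - t *\<^sub>R a"
    have s: "s \<in> span S" "norm (b - t *\<^sub>R a - s) < d"
      using t u(2) by (auto simp: s_def)
    have "?p (b - t *\<^sub>R a) \<le> d"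
      using infdist_span_le[OF s(1), of "b - t *\<^sub>R a"] s(2) by linarith
    then have pb: "?p b \<le> \<bar>t\<bar> * ?p a + d"
      using infdist_span_add_le[of "b - t *\<^sub>R a" "t *\<^sub>R a" S] by (simp add: infdist_span_scale)
    have ab: "infdist a (span (insert b S)) \<le> ?p a"
      by (rule infdist_span_mono[OF span_mono]) auto
    show ?thesis
    proof (cases "\<bar>t\<bar> * ?p a \<le> d")
      case True
      then have "?p b \<le> 2 * d" using pb by linarith
      then have "?p b * infdist a (span (insert b S)) \<le> (2 * d) * ?p a"
        using ab d by (intro mult_mono) (auto simp: infdist_nonneg)
      then show ?thesis by (simp add: d_def algebra_simps)
    next
      case False
      then have t0: "\<bar>t\<bar> > 0" using d pa by (cases "t = 0") auto
      have "(1/t) *\<^sub>R (b - s) \<in> span (insert b S)"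
        using s(1) span_mono[of S "insert b S"] span_base[of b "insert b S"]
        by (intro span_scale span_diff) auto
      then have "infdist a (span (insert b S)) \<le> norm (a - (1/t) *\<^sub>R (b - s))"
        by (rule infdist_span_le)
      also have "a - (1/t) *\<^sub>R (b - s) = (-1/t) *\<^sub>R (b - t *\<^sub>R a - s)"
        using t0 by (simp add: algebra_simps)
      also have "norm \<dots> = norm (b - t *\<^sub>R a - s) / \<bar>t\<bar>" by simp
      also have "\<dots> \<le> d / \<bar>t\<bar>" using s(2) by (intro divide_right_mono) auto
      finally have "infdist a (span (insert b S)) \<le> d / \<bar>t\<bar>" .
      moreover have "?p b \<le> 2 * (\<bar>t\<bar> * ?p a)" using pb False by linarith
      ultimately have "?p b * infdist a (span (insert b S)) \<le> (2 * (\<bar>t\<bar> * ?p a)) * (d / \<bar>t\<bar>)"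
        using pa by (intro mult_mono) (auto simp: infdist_nonneg)
      also have "\<dots> = 2 * (?p a * d)" using t0 by simp
      finally show ?thesis by (simp add: d_def)
    qed
  qed
  show ?thesis
  proof (rule field_le_epsilon)
    fix e :: real assume "e > 0"
    then have "?p b * infdist a (span (insert b S)) \<le>
        2 * (?p a * (infdist b (span (insert a S)) + e / (2 * ?p a)))"
      using pa by (intro main) simp
    also have "\<dots> = 2 * (?p a * infdist b (span (insert a S))) + e"
      using pa by (simp only: distrib_left) simp
    finally show "?p b * infdist a (span (insert b S)) \<le> 2 * (?p a * infdist b (span (insert a S))) + e" .
  qed
qed

text \<open>Every exchange of neighbours costs the factor two of the previous lemma.\<close>

lemma rel_vol_rotate:
  "rel_vol S (x # xs) \<le> 2 ^ length xs * rel_vol S (xs @ [x])"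
  "rel_vol S (xs @ [x]) \<le> 2 ^ length xs * rel_vol S (x # xs)"
proof -
  have swap: "rel_vol S (x # u # us) \<le> 2 * rel_vol S (u # x # us)" for S x u us
  proof -
    have "infdist x (span S) * infdist u (span (insert x S)) * rel_vol (insert x (insert u S)) us
        \<le> 2 * (infdist u (span S) * infdist x (span (insert u S))) * rel_vol (insert x (insert u S)) us"
      by (intro mult_right_mono infdist_span_swap) simp
    then show ?thesis by (simp add: insert_commute mult_ac)
  qed
  show "rel_vol S (x # xs) \<le> 2 ^ length xs * rel_vol S (xs @ [x])"
  proof (induction xs arbitrary: S)
    case (Cons u us)
    have "rel_vol S (x # u # us) \<le> 2 * rel_vol S (u # x # us)" by (rule swap)
    also have "rel_vol S (u # x # us) = infdist u (span S) * rel_vol (insert u S) (x # us)" by simp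
    also have "2 * \<dots> \<le> 2 * (infdist u (span S) * (2 ^ length us * rel_vol (insert u S) (us @ [x])))"
      by (intro mult_left_mono Cons.IH) (auto simp: infdist_nonneg)
    finally show ?case by (simp add: mult_ac)
  qed simp
  show "rel_vol S (xs @ [x]) \<le> 2 ^ length xs * rel_vol S (x # xs)"
  proof (induction xs arbitrary: S)
    case (Cons u us)
    have "rel_vol S ((u # us) @ [x]) = infdist u (span S) * rel_vol (insert u S) (us @ [x])" by simp
    also have "\<dots> \<le> infdist u (span S) * (2 ^ length us * rel_vol (insert u S) (x # us))"
      by (intro mult_left_mono Cons.IH) (auto simp: infdist_nonneg)
    also have "\<dots> = 2 ^ length us * rel_vol S (u # x # us)" by simp
    also have "\<dots> \<le> 2 ^ length us * (2 * rel_vol S (x # u # us))"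
      by (intro mult_left_mono swap) auto
    finally show ?case by (simp add: mult_ac)
  qed simp
qed

lemma rel_vol_scale_shift:
  assumes "s \<in> span (set as \<union> S)" "c \<noteq> 0"
  shows "rel_vol S (as @ (c *\<^sub>R v + s) # bs) = \<bar>c\<bar> * rel_vol S (as @ v # bs)"
proof -
  have "infdist (c *\<^sub>R v + s) (span (set as \<union> S)) = \<bar>c\<bar> * infdist v (span (set as \<union> S))"
    using infdist_span_shift[OF assms(1)] infdist_span_scale by metis
  moreover have "rel_vol (insert (c *\<^sub>R v + s) (set as \<union> S)) bs = rel_vol (insert v (set as \<union> S)) bs"
    by (rule rel_vol_cong[OF span_insert_shift[OF assms]])
  ultimately show ?thesis by (simp add: rel_vol_append)
qed

subsection \<open>Volume growth of operators\<close>

lemma span_blinfun_image: "span (blinfun_apply T ` A) = blinfun_apply T ` span A"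
  by (rule linear_span_image) (rule blinfun.bounded_linear_right[THEN bounded_linear.linear])

lemma infdist_blinfun_le:
  fixes T :: "'x::real_normed_vector \<Rightarrow>\<^sub>L 'y::real_normed_vector"
  shows "infdist (blinfun_apply T x) (span (blinfun_apply T ` A)) \<le> norm T * infdist x (span A)"
proof -
  have "norm T * infdist x (span A) + e \<ge> infdist (blinfun_apply T x) (span (blinfun_apply T ` A))"
    if "e > 0" for e
  proof -
    have "infdist x (span A) < infdist x (span A) + e / (norm T + 1)"
      using that by (simp add: add_nonneg_pos)
    then obtain s where s: "s \<in> span A" "norm (x - s) < infdist x (span A) + e / (norm T + 1)"
      using infdist_span_approx by blast
    have "infdist (blinfun_apply T x) (span (blinfun_apply T ` A)) \<le> norm (blinfun_apply T x - blinfun_apply T s)"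
      using s(1) by (intro infdist_span_le) (simp add: span_blinfun_image)
    also have "\<dots> \<le> norm T * norm (x - s)" by (metis blinfun.diff_right norm_blinfun)
    also have "\<dots> \<le> norm T * (infdist x (span A) + e / (norm T + 1))"
      using s(2) by (intro mult_left_mono) auto
    also have "\<dots> = norm T * infdist x (span A) + norm T / (norm T + 1) * e" by (simp add: field_simps)
    also have "\<dots> \<le> norm T * infdist x (span A) + 1 * e"
      using that by (intro add_left_mono mult_right_mono) (auto simp: divide_le_eq_1 add_nonneg_pos)
    finally show ?thesis by simp
  qed
  then show ?thesis by (rule field_le_epsilon)
qed

lemma rel_vol_blinfun_le:
  fixes T :: "'x::real_normed_vector \<Rightarrow>\<^sub>L 'y::real_normed_vector"
  shows "rel_vol (blinfun_apply T ` A) (map (blinfun_apply T) xs) \<le> norm T ^ length xs * rel_vol A xs"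
proof (induction xs arbitrary: A)
  case (Cons x xs)
  have "rel_vol (blinfun_apply T ` A) (map (blinfun_apply T) (x # xs)) \<le>
      (norm T * infdist x (span A)) * (norm T ^ length xs * rel_vol (insert x A) xs)"
    using Cons.IH[of "insert x A"] infdist_blinfun_le[of T x A]
    by (auto intro!: mult_mono simp: infdist_nonneg)
  then show ?case by (simp add: mult_ac)
qed simp

lemma vol_growth_bdd:
  "bdd_above ((\<lambda>v. vol k (\<lambda>i. blinfun_apply T (v i))) ` {v. \<forall>i<k. norm (v i) = 1})"
proof (rule bdd_aboveI2)
  fix v :: "nat \<Rightarrow> 'a" assume v: "v \<in> {v. \<forall>i<k. norm (v i) = 1}"
  have "vol k (\<lambda>i. blinfun_apply T (v i)) = rel_vol (blinfun_apply T ` {}) (map (blinfun_apply T) (map v [0..<k]))"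
    by (simp add: vol_eq_rel_vol comp_def)
  also have "\<dots> \<le> norm T ^ k * rel_vol {} (map v [0..<k])"
    using rel_vol_blinfun_le[of T "{}" "map v [0..<k]"] by simp
  also have "rel_vol {} (map v [0..<k]) \<le> (\<Prod>x\<leftarrow>map v [0..<k]. norm x)" by (rule rel_vol_le_prod)
  also have "(\<Prod>x\<leftarrow>map v [0..<k]. norm x) = 1"
    using v by (intro prod_norm_eq_1) auto
  finally show "vol k (\<lambda>i. blinfun_apply T (v i)) \<le> norm T ^ k" by (simp add: mult_left_mono)
qed

lemma rel_vol_unit_le_vol_growth:
  assumes "\<And>u. u \<in> set us \<Longrightarrow> norm u = 1"
  shows "rel_vol {} (map (blinfun_apply T) us) \<le> vol_growth (length us) T"
proof -
  have "map (blinfun_apply T) us = map (\<lambda>i. blinfun_apply T (us ! i)) [0..<length us]"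
    by (rule nth_equalityI) auto
  then have "rel_vol {} (map (blinfun_apply T) us) = vol (length us) (\<lambda>i. blinfun_apply T (us ! i))"
    by (simp only: vol_eq_rel_vol)
  also have "\<dots> \<le> vol_growth (length us) T"
    unfolding vol_growth_def using assms
    by (intro cSUP_upper vol_growth_bdd) auto
  finally show ?thesis .
qed

lemma unit_tuple_ex:
  assumes "(x0::'x::real_normed_vector) \<noteq> 0"
  shows "{v :: nat \<Rightarrow> 'x. \<forall>i<k. norm (v i) = 1} \<noteq> {}"
proof -
  have "(\<lambda>_. (1 / norm x0) *\<^sub>R x0) \<in> {v :: nat \<Rightarrow> 'x. \<forall>i<k. norm (v i) = 1}"
    using assms by simp
  then show ?thesis by (metis empty_iff)
qed

lemma vol_growth_least:
  fixes T :: "'x::real_normed_vector \<Rightarrow>\<^sub>L 'x"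
  assumes "(x0::'x) \<noteq> 0"
    and "\<And>us. length us = k \<Longrightarrow> (\<And>u. u \<in> set us \<Longrightarrow> norm u = 1) \<Longrightarrow>
      rel_vol {} (map (blinfun_apply T) us) \<le> c"
  shows "vol_growth k T \<le> c"
  unfolding vol_growth_def
proof (rule cSUP_least[OF unit_tuple_ex[OF assms(1)]])
  fix v :: "nat \<Rightarrow> 'x" assume "v \<in> {v. \<forall>i<k. norm (v i) = 1}"
  then have "rel_vol {} (map (blinfun_apply T) (map v [0..<k])) \<le> c"
    by (intro assms(2)) auto
  then show "vol k (\<lambda>i. blinfun_apply T (v i)) \<le> c" by (simp add: vol_eq_rel_vol comp_def)
qed

lemma vol_growth_near_opt:
  fixes T :: "'x::real_normed_vector \<Rightarrow>\<^sub>L 'x"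
  assumes "(x0::'x) \<noteq> 0" "c < vol_growth k T"
  shows "\<exists>us. length us = k \<and> (\<forall>u\<in>set us. norm u = 1) \<and> c < rel_vol {} (map (blinfun_apply T) us)"
proof (rule ccontr)
  assume nex: "\<not> ?thesis"
  have "rel_vol {} (map (blinfun_apply T) us) \<le> c"
    if "length us = k" "\<And>u. u \<in> set us \<Longrightarrow> norm u = 1" for us
  proof -
    have "\<forall>u\<in>set us. norm u = 1" using that(2) by blast
    then show ?thesis using nex that(1) not_less by blast
  qed
  then have "vol_growth k T \<le> c" by (rule vol_growth_least[OF assms(1)])
  with assms(2) show False by simp
qed

lemma vol_growth_nonneg:
  fixes T :: "'x::real_normed_vector \<Rightarrow>\<^sub>L 'x"
  assumes "(x0::'x) \<noteq> 0"
  shows "vol_growth k T \<ge> 0"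
proof -
  let ?us = "replicate k ((1 / norm x0) *\<^sub>R x0)"
  have "0 \<le> rel_vol {} (map (blinfun_apply T) ?us)" by simp
  also have "\<dots> \<le> vol_growth (length ?us) T"
    using assms by (intro rel_vol_unit_le_vol_growth) auto
  finally show ?thesis by simp
qed

text \<open>Subtracting from each vector a nearly closest point of the span of its predecessors and of \<open>A\<close>
  does not change the volume of the images, but makes the volume of the vectors themselves almost the
  product of their norms. Hence \<open>vol_growth\<close>, defined by unit vectors, controls how \<open>T\<close>
  changes every volume.\<close>

lemma rel_vol_blinfun_le_vol_growth:
  fixes T :: "'x::real_normed_vector \<Rightarrow>\<^sub>L 'x"
  shows "rel_vol (blinfun_apply T ` A) (map (blinfun_apply T) xs) \<le> vol_growth (length xs) T * rel_vol A xs"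
proof (cases "rel_vol A xs = 0")
  case True
  then show ?thesis using rel_vol_blinfun_le[of T A xs] by simp
next
  case False
  then have pos: "rel_vol A xs > 0" using rel_vol_nonneg[of A xs] by linarith
  have ex: "rel_vol A xs > 0 \<Longrightarrow> \<exists>us. length us = length xs \<and> (\<forall>u\<in>set us. norm u = 1) \<and>
     rel_vol (blinfun_apply T ` A) (map (blinfun_apply T) xs) \<le>
       t ^ length xs * rel_vol A xs * rel_vol (blinfun_apply T ` A) (map (blinfun_apply T) us)"
    if t: "t > 1" for t :: real
  proof (induction xs arbitrary: A)
    case (Cons x xs)
    have d: "infdist x (span A) > 0" and pos': "rel_vol (insert x A) xs > 0"
      using Cons.prems infdist_nonneg[of x "span A"] rel_vol_nonneg[of "insert x A" xs]
      by (auto simp: zero_less_mult_iff)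
    then have "infdist x (span A) < t * infdist x (span A)" using t by simp
    then obtain s where s: "s \<in> span A" "norm (x - s) < t * infdist x (span A)"
      using infdist_span_approx by blast
    let ?n = "norm (x - s)"
    have n: "?n > 0" using d infdist_span_le[OF s(1), of x] by linarith
    define u where "u = (1 / ?n) *\<^sub>R (x - s)"
    have x: "x = ?n *\<^sub>R u + s" and nu: "norm u = 1" using n by (auto simp: u_def)
    have Ts: "blinfun_apply T s \<in> span (blinfun_apply T ` A)" using s(1) by (simp add: span_blinfun_image)
    have Tx: "blinfun_apply T x = ?n *\<^sub>R blinfun_apply T u + blinfun_apply T s"
      by (subst x) (simp add: blinfun.add_right blinfun.scaleR_right)
    have sp: "span (insert x A) = span (insert u A)"
      by (subst x, rule span_insert_shift[OF s(1)]) (use n in simp)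
    have spT: "span (blinfun_apply T ` insert x A) = span (blinfun_apply T ` insert u A)"
      by (simp only: span_blinfun_image sp)
    have "rel_vol (insert u A) xs > 0" using pos' rel_vol_cong[OF sp] by simp
    then obtain us where us: "length us = length xs" "\<forall>u\<in>set us. norm u = 1"
      "rel_vol (blinfun_apply T ` insert u A) (map (blinfun_apply T) xs) \<le>
       t ^ length xs * rel_vol (insert u A) xs * rel_vol (blinfun_apply T ` insert u A) (map (blinfun_apply T) us)"
      using Cons.IH by blast
    have "rel_vol (blinfun_apply T ` A) (map (blinfun_apply T) (x # xs)) =
        infdist (blinfun_apply T x) (span (blinfun_apply T ` A)) *
          rel_vol (blinfun_apply T ` insert u A) (map (blinfun_apply T) xs)"
      using rel_vol_cong[OF spT] by simp
    also have "infdist (blinfun_apply T x) (span (blinfun_apply T ` A)) =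
        ?n * infdist (blinfun_apply T u) (span (blinfun_apply T ` A))"
      using infdist_span_shift[OF Ts, of "?n *\<^sub>R blinfun_apply T u"] Tx by (simp add: infdist_span_scale)
    also have "?n * infdist (blinfun_apply T u) (span (blinfun_apply T ` A)) *
          rel_vol (blinfun_apply T ` insert u A) (map (blinfun_apply T) xs) \<le>
        (t * infdist x (span A) * infdist (blinfun_apply T u) (span (blinfun_apply T ` A))) *
         (t ^ length xs * rel_vol (insert u A) xs * rel_vol (blinfun_apply T ` insert u A) (map (blinfun_apply T) us))"
      using s(2) us(3) t d by (intro mult_mono mult_nonneg_nonneg) (auto simp: infdist_nonneg)
    also have "\<dots> = t ^ length (x # xs) * rel_vol A (x # xs) * rel_vol (blinfun_apply T ` A) (map (blinfun_apply T) (u # us))"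
      using rel_vol_cong[OF sp, of xs] by simp
    finally show ?case using us nu by (intro exI[of _ "u # us"]) auto
  qed (auto intro!: exI[of _ "[]"])
  have le: "rel_vol (blinfun_apply T ` A) (map (blinfun_apply T) xs) \<le>
      t ^ length xs * (vol_growth (length xs) T * rel_vol A xs)" if t: "t > 1" for t :: real
  proof -
    obtain us where us: "length us = length xs" "\<forall>u\<in>set us. norm u = 1"
     "rel_vol (blinfun_apply T ` A) (map (blinfun_apply T) xs) \<le>
       t ^ length xs * rel_vol A xs * rel_vol (blinfun_apply T ` A) (map (blinfun_apply T) us)"
      using ex[OF t pos] by blast
    have "rel_vol (blinfun_apply T ` A) (map (blinfun_apply T) us) \<le> rel_vol {} (map (blinfun_apply T) us)"
      by (rule rel_vol_antimono[OF span_mono]) simp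
    also have "\<dots> \<le> vol_growth (length xs) T"
      using rel_vol_unit_le_vol_growth[of us T] us by auto
    finally have "t ^ length xs * rel_vol A xs * rel_vol (blinfun_apply T ` A) (map (blinfun_apply T) us)
      \<le> t ^ length xs * rel_vol A xs * vol_growth (length xs) T"
      using t by (intro mult_left_mono) auto
    then show ?thesis using us(3) by (simp add: mult_ac)
  qed
  have "(\<lambda>n. (1 + 1 / real (Suc n)) ^ length xs * (vol_growth (length xs) T * rel_vol A xs))
      \<longlonglongrightarrow> (1 + 0) ^ length xs * (vol_growth (length xs) T * rel_vol A xs)"
    by (intro tendsto_intros LIMSEQ_Suc[OF lim_1_over_n])
  then show ?thesis
    by (rule LIMSEQ_le_const[THEN order_trans])
      (auto intro!: exI[of _ 0] le)
qed

corollary rel_vol_le_vol_growth_prod: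
  fixes T :: "'x::real_normed_vector \<Rightarrow>\<^sub>L 'x"
  assumes "(x0::'x) \<noteq> 0"
  shows "rel_vol {} (map (blinfun_apply T) xs) \<le> vol_growth (length xs) T * (\<Prod>x\<leftarrow>xs. norm x)"
proof -
  have "rel_vol {} (map (blinfun_apply T) xs) \<le> vol_growth (length xs) T * rel_vol {} xs"
    using rel_vol_blinfun_le_vol_growth[of T "{}" xs] by simp
  also have "\<dots> \<le> vol_growth (length xs) T * (\<Prod>x\<leftarrow>xs. norm x)"
    by (intro mult_left_mono rel_vol_le_prod vol_growth_nonneg[OF assms])
  finally show ?thesis .
qed

lemma vol_growth_compose:
  fixes S T :: "'x::real_normed_vector \<Rightarrow>\<^sub>L 'x"
  assumes "(x0::'x) \<noteq> 0"
  shows "vol_growth k (S o\<^sub>L T) \<le> vol_growth k S * vol_growth k T"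
proof (rule vol_growth_least[OF assms])
  fix us :: "'x list" assume us: "length us = k" "\<And>u. u \<in> set us \<Longrightarrow> norm u = 1"
  have "rel_vol {} (map (blinfun_apply (S o\<^sub>L T)) us) =
      rel_vol (blinfun_apply S ` {}) (map (blinfun_apply S) (map (blinfun_apply T) us))"
    by (auto intro!: arg_cong[where f = "rel_vol {}"])
  also have "\<dots> \<le> vol_growth k S * rel_vol {} (map (blinfun_apply T) us)"
    using rel_vol_blinfun_le_vol_growth[of S "{}" "map (blinfun_apply T) us"] us by simp
  also have "\<dots> \<le> vol_growth k S * vol_growth k T"
    using rel_vol_unit_le_vol_growth[of us T] us
    by (intro mult_left_mono vol_growth_nonneg[OF assms]) auto
  finally show "rel_vol {} (map (blinfun_apply (S o\<^sub>L T)) us) \<le> vol_growth k S * vol_growth k T" .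
qed

lemma vol_growth_0:
  fixes T :: "'x::real_normed_vector \<Rightarrow>\<^sub>L 'x"
  shows "vol_growth 0 T = 1"
  by (simp add: vol_growth_def vol_def)

lemma vol_growth_1:
  fixes T :: "'x::real_normed_vector \<Rightarrow>\<^sub>L 'x"
  assumes "(x0::'x) \<noteq> 0"
  shows "vol_growth (Suc 0) T = norm T"
proof (rule antisym)
  show "vol_growth (Suc 0) T \<le> norm T"
  proof (rule vol_growth_least[OF assms])
    fix us :: "'x list" assume us: "length us = Suc 0" "\<And>u. u \<in> set us \<Longrightarrow> norm u = 1"
    then obtain u where "us = [u]" by (cases us) auto
    then show "rel_vol {} (map (blinfun_apply T) us) \<le> norm T"
      using us norm_blinfun[of T u] by simp
  qed
  show "norm T \<le> vol_growth (Suc 0) T"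
  proof (rule norm_blinfun_bound[OF vol_growth_nonneg[OF assms]])
    fix x show "norm (blinfun_apply T x) \<le> vol_growth (Suc 0) T * norm x"
      using rel_vol_le_vol_growth_prod[OF assms, of T "[x]"] by simp
  qed
qed

section \<open>Subspaces on which an operator is large\<close>

lemma span_list_coeffs:
  assumes "y \<in> span (set ws)"
  shows "\<exists>c. y = (\<Sum>j<length ws. c j *\<^sub>R ws ! j)"
  using assms
proof (induction ws arbitrary: y rule: rev_induct)
  case (snoc w ws)
  from snoc.prems obtain t where "y - t *\<^sub>R w \<in> span (set ws)"
    using span_breakdown_eq[of y w "set ws"] by auto
  then obtain c where c: "y - t *\<^sub>R w = (\<Sum>j<length ws. c j *\<^sub>R ws ! j)" using snoc.IH by blast
  let ?c = "c(length ws := t)"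
  have "(\<Sum>j<length (ws @ [w]). ?c j *\<^sub>R (ws @ [w]) ! j) =
      (\<Sum>j<length ws. ?c j *\<^sub>R (ws @ [w]) ! j) + t *\<^sub>R w" by simp
  also have "(\<Sum>j<length ws. ?c j *\<^sub>R (ws @ [w]) ! j) = (\<Sum>j<length ws. c j *\<^sub>R ws ! j)"
    by (rule sum.cong) (auto simp: nth_append)
  finally have "y = (\<Sum>j<length (ws @ [w]). ?c j *\<^sub>R (ws @ [w]) ! j)" using c by (simp add: algebra_simps)
  then show ?case by blast
qed simp

text \<open>The vector \<open>v\<close> is the last one with a nonzero coefficient in \<open>f\<close>. Then the rest \<open>s\<close> lies in the span of
  its predecessors, and replacing \<open>v\<close> by \<open>f\<close> multiplies volumes by \<open>\<bar>c\<bar>\<close> (\<open>rel_vol_scale_shift\<close>).\<close>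

lemma span_list_last_coeff:
  assumes "f \<in> span (set vs)" "f \<noteq> 0"
  shows "\<exists>as v bs c s. vs = as @ v # bs \<and> s \<in> span (set as) \<and> c \<noteq> 0 \<and> f = c *\<^sub>R v + s"
  using assms
proof (induction vs rule: rev_induct)
  case (snoc w ws)
  from snoc.prems(1) obtain t where t: "f - t *\<^sub>R w \<in> span (set ws)"
    using span_breakdown_eq[of f w "set ws"] by auto
  show ?case
  proof (cases "t = 0")
    case True
    then obtain as v bs c s where "ws = as @ v # bs \<and> s \<in> span (set as) \<and> c \<noteq> 0 \<and> f = c *\<^sub>R v + s"
      using snoc t by auto
    then show ?thesis
      by (intro exI[of _ as] exI[of _ v] exI[of _ "bs @ [w]"] exI[of _ c] exI[of _ s]) simp
  next
    case False
    then show ?thesis using t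
      by (intro exI[of _ ws] exI[of _ w] exI[of _ "[]"] exI[of _ t] exI[of _ "f - t *\<^sub>R w"]) simp
  qed
qed simp

lemma rel_vol_pos_independent:
  assumes "rel_vol S xs > 0" "independent S"
  shows "independent (set xs \<union> S) \<and> distinct xs \<and> set xs \<inter> S = {}"
  using assms
proof (induction xs arbitrary: S)
  case (Cons x xs)
  have "infdist x (span S) \<noteq> 0" and pos: "rel_vol (insert x S) xs > 0"
    using Cons.prems(1) infdist_nonneg[of x "span S"] rel_vol_nonneg[of "insert x S" xs]
    by (auto simp: zero_less_mult_iff)
  then have x: "x \<notin> span S" by auto
  then have "independent (insert x S)" using Cons.prems(2) by (simp add: independent_insert)
  from Cons.IH[OF pos this] have "independent (set xs \<union> insert x S)" "distinct xs" "set xs \<inter> insert x S = {}"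
    by auto
  then show ?case using x span_base[of x S] by auto
qed simp

lemma rel_vol_image_pos:
  fixes T :: "'x::real_normed_vector \<Rightarrow>\<^sub>L 'x"
  assumes "rel_vol {} (map (blinfun_apply T) vs) > 0"
  shows "rel_vol {} vs > 0"
proof -
  have "0 < norm T ^ length vs * rel_vol {} vs"
    using rel_vol_blinfun_le[of T "{}" vs] assms by simp
  then show ?thesis using rel_vol_nonneg[of "{}" vs] by (simp add: zero_less_mult_iff)
qed

text \<open>A vector \<open>f\<close> of the span of a nearly optimal tuple can be exchanged for one of the vectors of the
  tuple and moved to the first place, at the cost of a constant. The remaining vectors are then
  transformed by \<open>S\<close> with volume growth at most \<open>vol_growth k S\<close>, so \<open>S\<close> cannot contract
  \<open>T\<^sub>1 f\<close> by more than the quotient of volume growths.\<close>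

lemma near_opt_span_no_contraction:
  fixes S T\<^sub>1 :: "'x::real_normed_vector \<Rightarrow>\<^sub>L 'x"
  assumes "(x0::'x) \<noteq> 0" "length vs = Suc k" "\<And>v. v \<in> set vs \<Longrightarrow> norm v = 1"
    and opt: "vol_growth (Suc k) (S o\<^sub>L T\<^sub>1) \<le> 2 * rel_vol {} (map (blinfun_apply (S o\<^sub>L T\<^sub>1)) vs)"
    and f: "f \<in> span (set vs)"
  shows "norm (blinfun_apply T\<^sub>1 f) * vol_growth (Suc k) (S o\<^sub>L T\<^sub>1) \<le>
    2 * 4 ^ k * vol_growth k S * vol_growth (Suc k) T\<^sub>1 * norm (blinfun_apply S (blinfun_apply T\<^sub>1 f))"
proof (cases "f = 0")
  case False
  let ?T = "S o\<^sub>L T\<^sub>1"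
  obtain as v bs c s where d: "vs = as @ v # bs" "s \<in> span (set as)" "c \<noteq> 0" "f = c *\<^sub>R v + s"
    using span_list_last_coeff[OF f False] by blast
  have len: "length (as @ bs) = k" using d(1) assms(2) by simp
  have Rf: "rel_vol {} (map (blinfun_apply R) (as @ f # bs)) = \<bar>c\<bar> * rel_vol {} (map (blinfun_apply R) vs)"
    for R :: "'x \<Rightarrow>\<^sub>L 'x"
  proof -
    have "blinfun_apply R s \<in> span (set (map (blinfun_apply R) as) \<union> {})"
      using d(2) by (simp add: span_blinfun_image)
    from rel_vol_scale_shift[OF this d(3), of "blinfun_apply R v" "map (blinfun_apply R) bs"]
    show ?thesis by (simp add: d(1,4) blinfun.add_right blinfun.scaleR_right)
  qed
  have move: "rel_vol {} (xs @ x # ys) \<le> 2 ^ k * rel_vol {} (x # xs @ ys)"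
      "rel_vol {} (x # xs @ ys) \<le> 2 ^ k * rel_vol {} (xs @ x # ys)"
    if "length (xs @ ys) = k" for xs ys and x :: 'x
  proof -
    have a: "rel_vol {} (xs @ x # ys) = rel_vol {} (xs @ [x]) * rel_vol (insert x (set xs)) ys"
      by (simp add: rel_vol_append)
    have b: "rel_vol {} (x # xs @ ys) = rel_vol {} (x # xs) * rel_vol (insert x (set xs)) ys"
      by (simp add: rel_vol_append)
    have p: "(2::real) ^ length xs \<le> 2 ^ k" using that by (intro power_increasing) auto
    have "rel_vol {} (xs @ [x]) \<le> 2 ^ k * rel_vol {} (x # xs)"
      using rel_vol_rotate(2)[of "{}" xs x] mult_right_mono[OF p rel_vol_nonneg[of "{}" "x # xs"]] by linarith
    then show "rel_vol {} (xs @ x # ys) \<le> 2 ^ k * rel_vol {} (x # xs @ ys)"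
      unfolding a b mult.assoc[symmetric] by (intro mult_right_mono) auto
    have "rel_vol {} (x # xs) \<le> 2 ^ k * rel_vol {} (xs @ [x])"
      using rel_vol_rotate(1)[of "{}" x xs] mult_right_mono[OF p rel_vol_nonneg[of "{}" "xs @ [x]"]] by linarith
    then show "rel_vol {} (x # xs @ ys) \<le> 2 ^ k * rel_vol {} (xs @ x # ys)"
      unfolding a b mult.assoc[symmetric] by (intro mult_right_mono) auto
  qed
  let ?w = "rel_vol {blinfun_apply T\<^sub>1 f} (map (blinfun_apply T\<^sub>1) (as @ bs))"
  have "\<bar>c\<bar> * vol_growth (Suc k) ?T \<le> 2 * rel_vol {} (map (blinfun_apply ?T) (as @ f # bs))"
    using mult_left_mono[OF opt, of "\<bar>c\<bar>"] unfolding Rf by (simp add: mult_ac)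
  also have "rel_vol {} (map (blinfun_apply ?T) (as @ f # bs)) \<le>
      2 ^ k * rel_vol {} (blinfun_apply ?T f # map (blinfun_apply ?T) as @ map (blinfun_apply ?T) bs)"
    using move(1)[of "map (blinfun_apply ?T) as" "map (blinfun_apply ?T) bs" "blinfun_apply ?T f"] len by simp
  also have "rel_vol {} (blinfun_apply ?T f # map (blinfun_apply ?T) as @ map (blinfun_apply ?T) bs) =
      norm (blinfun_apply ?T f) *
        rel_vol (blinfun_apply S ` {blinfun_apply T\<^sub>1 f}) (map (blinfun_apply S) (map (blinfun_apply T\<^sub>1) (as @ bs)))"
    by (auto intro!: arg_cong2[where f = rel_vol])
  also have "\<dots> \<le> norm (blinfun_apply ?T f) * (vol_growth k S * ?w)"
    using rel_vol_blinfun_le_vol_growth[of S "{blinfun_apply T\<^sub>1 f}" "map (blinfun_apply T\<^sub>1) (as @ bs)"] len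
    by (intro mult_left_mono) auto
  finally have 1: "\<bar>c\<bar> * vol_growth (Suc k) ?T \<le> 2 * (2 ^ k * (norm (blinfun_apply ?T f) * (vol_growth k S * ?w)))"
    by simp
  have "norm (blinfun_apply T\<^sub>1 f) * ?w =
      rel_vol {} (blinfun_apply T\<^sub>1 f # map (blinfun_apply T\<^sub>1) as @ map (blinfun_apply T\<^sub>1) bs)" by simp
  also have "\<dots> \<le> 2 ^ k * rel_vol {} (map (blinfun_apply T\<^sub>1) (as @ f # bs))"
    using move(2)[of "map (blinfun_apply T\<^sub>1) as" "map (blinfun_apply T\<^sub>1) bs" "blinfun_apply T\<^sub>1 f"] len by simp
  also have "\<dots> \<le> 2 ^ k * (\<bar>c\<bar> * vol_growth (Suc k) T\<^sub>1)"
    unfolding Rf using rel_vol_unit_le_vol_growth[of vs T\<^sub>1] assms(2,3) by (intro mult_left_mono) auto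
  finally have 2: "norm (blinfun_apply T\<^sub>1 f) * ?w \<le> 2 ^ k * (\<bar>c\<bar> * vol_growth (Suc k) T\<^sub>1)" .
  have nn: "0 \<le> vol_growth k S" by (rule vol_growth_nonneg[OF assms(1)])
  have "norm (blinfun_apply T\<^sub>1 f) * (\<bar>c\<bar> * vol_growth (Suc k) ?T) \<le>
     norm (blinfun_apply T\<^sub>1 f) * (2 * (2 ^ k * (norm (blinfun_apply ?T f) * (vol_growth k S * ?w))))"
    by (rule mult_left_mono[OF 1]) simp
  also have "\<dots> = 2 * 2 ^ k * norm (blinfun_apply ?T f) * vol_growth k S * (norm (blinfun_apply T\<^sub>1 f) * ?w)"
    by (simp add: mult_ac)
  also have "\<dots> \<le> 2 * 2 ^ k * norm (blinfun_apply ?T f) * vol_growth k S * (2 ^ k * (\<bar>c\<bar> * vol_growth (Suc k) T\<^sub>1))"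
    using nn by (intro mult_left_mono[OF 2]) auto
  also have "\<dots> = \<bar>c\<bar> * (2 * (2 ^ k * 2 ^ k) * vol_growth k S * vol_growth (Suc k) T\<^sub>1 * norm (blinfun_apply ?T f))"
    by (simp add: mult_ac)
  finally have "\<bar>c\<bar> * (norm (blinfun_apply T\<^sub>1 f) * vol_growth (Suc k) ?T) \<le>
      \<bar>c\<bar> * (2 * (2 ^ k * 2 ^ k) * vol_growth k S * vol_growth (Suc k) T\<^sub>1 * norm (blinfun_apply ?T f))"
    by (simp add: mult_ac)
  then have "norm (blinfun_apply T\<^sub>1 f) * vol_growth (Suc k) ?T \<le>
      2 * (2 ^ k * 2 ^ k) * vol_growth k S * vol_growth (Suc k) T\<^sub>1 * norm (blinfun_apply ?T f)"
    by (rule mult_left_le_imp_le) (use d(3) in simp)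
  then show ?thesis by (simp add: power_mult_distrib[symmetric])
qed (simp add: blinfun.zero_right)

text \<open>The height of \<open>T x\<close> over the images of the tuple is a quotient of volumes, and approximating this
  height defines \<open>f\<close>. The coefficients of \<open>f\<close> are bounded because replacing a vector of the tuple by \<open>x\<close> cannot increase the volume by more than a constant factor.\<close>

lemma near_opt_span_approx:
  fixes T :: "'x::real_normed_vector \<Rightarrow>\<^sub>L 'x"
  assumes "(x0::'x) \<noteq> 0" and len: "length vs = k" and unit: "\<And>v. v \<in> set vs \<Longrightarrow> norm v = 1"
    and opt: "vol_growth k T \<le> 2 * rel_vol {} (map (blinfun_apply T) vs)" and pos: "vol_growth k T > 0"
    and "\<eta> > 0"
  shows "\<exists>f\<in>span (set vs). norm f \<le> real k * (2 ^ (k + 2) + 1) * norm x \<and>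
    norm (blinfun_apply T (x - f)) \<le> (2 * vol_growth (Suc k) T / vol_growth k T + \<eta>) * norm x"
proof (cases "x = 0")
  case True
  then show ?thesis by (intro bexI[of _ 0]) (auto simp: span_zero)
next
  case False
  \<comment> \<open>The set \<open>?o j\<close> consists of the images of the vectors other than \<open>vs ! j\<close>.\<close>
  let ?W = "blinfun_apply T ` set vs"
  let ?o = "\<lambda>j. set (map (blinfun_apply T) (take j vs @ drop (Suc j) vs))"
  have vpos: "rel_vol {} (map (blinfun_apply T) vs) > 0" using opt pos by linarith
  have split: "vs = take j vs @ vs ! j # drop (Suc j) vs" if "j < k" for j
    using that len by (simp add: id_take_nth_drop)
  have lo: "length (take j vs @ drop (Suc j) vs) = k - 1" if "j < k" for j
    using that len by simp
  have rot: "rel_vol {} (map (blinfun_apply T) vs) \<le>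
      2 ^ k * (rel_vol {} (map (blinfun_apply T) (take j vs @ drop (Suc j) vs)) * infdist (blinfun_apply T (vs ! j)) (span (?o j)))"
    if j: "j < k" for j
  proof -
    let ?a = "map (blinfun_apply T) (take j vs)" let ?b = "map (blinfun_apply T) (drop (Suc j) vs)"
      let ?x = "blinfun_apply T (vs ! j)"
    have "map (blinfun_apply T) vs = ?a @ ?x # ?b" by (subst split[OF j]) simp
    then have "rel_vol {} (map (blinfun_apply T) vs) = rel_vol {} ?a * rel_vol (set ?a \<union> {}) (?x # ?b)"
      by (simp only: rel_vol_append)
    also have "\<dots> \<le> rel_vol {} ?a * (2 ^ length ?b * rel_vol (set ?a \<union> {}) (?b @ [?x]))"
      by (intro mult_left_mono rel_vol_rotate(1)) simp
    also have "\<dots> = 2 ^ length ?b * rel_vol {} (?a @ ?b @ [?x])"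
      by (simp only: rel_vol_append mult_ac)
    also have "\<dots> \<le> 2 ^ k * rel_vol {} (?a @ ?b @ [?x])"
      using len by (intro mult_right_mono power_increasing) auto
    also have "rel_vol {} (?a @ ?b @ [?x]) = rel_vol {} (?a @ ?b) * infdist ?x (span (?o j))"
      using rel_vol_snoc[of "{}" "?a @ ?b" ?x] by simp
    finally show ?thesis by simp
  qed
  have dpos: "infdist (blinfun_apply T (vs ! j)) (span (?o j)) > 0"
      "rel_vol {} (map (blinfun_apply T) (take j vs @ drop (Suc j) vs)) > 0" if j: "j < k" for j
  proof -
    have "0 < 2 ^ k * (rel_vol {} (map (blinfun_apply T) (take j vs @ drop (Suc j) vs)) *
        infdist (blinfun_apply T (vs ! j)) (span (?o j)))"
      using rot[OF j] vpos by linarith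
    then have "0 < rel_vol {} (map (blinfun_apply T) (take j vs @ drop (Suc j) vs)) *
        infdist (blinfun_apply T (vs ! j)) (span (?o j))" by (simp add: zero_less_mult_iff)
    then show "infdist (blinfun_apply T (vs ! j)) (span (?o j)) > 0"
      "rel_vol {} (map (blinfun_apply T) (take j vs @ drop (Suc j) vs)) > 0"
      using rel_vol_nonneg[of "{}" "map (blinfun_apply T) (take j vs @ drop (Suc j) vs)"]
        infdist_nonneg[of "blinfun_apply T (vs ! j)" "span (?o j)"]
      by (simp_all only: zero_less_mult_iff) linarith+
  qed
  have dx: "infdist (blinfun_apply T x) (span (?o j)) \<le> 2 ^ (k + 1) * infdist (blinfun_apply T (vs ! j)) (span (?o j)) * norm x"
    if j: "j < k" for j
  proof -
    let ?R = "rel_vol {} (map (blinfun_apply T) (take j vs @ drop (Suc j) vs))"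
    have "?R * infdist (blinfun_apply T x) (span (?o j)) = rel_vol {} (map (blinfun_apply T) (take j vs @ drop (Suc j) vs @ [x]))"
      using rel_vol_snoc[of "{}" "map (blinfun_apply T) (take j vs @ drop (Suc j) vs)" "blinfun_apply T x"] by simp
    also have "\<dots> \<le> vol_growth (length (take j vs @ drop (Suc j) vs @ [x])) T *
        (\<Prod>u\<leftarrow>take j vs @ drop (Suc j) vs @ [x]. norm u)"
      by (rule rel_vol_le_vol_growth_prod[OF assms(1)])
    also have "length (take j vs @ drop (Suc j) vs @ [x]) = k" using lo[OF j] j by simp
    also have "(\<Prod>u\<leftarrow>take j vs @ drop (Suc j) vs @ [x]. norm u) =
        (\<Prod>u\<leftarrow>take j vs @ drop (Suc j) vs. norm u) * norm x" by simp
    also have "(\<Prod>u\<leftarrow>take j vs @ drop (Suc j) vs. norm u) = 1"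
      by (rule prod_norm_eq_1) (use unit in \<open>auto dest: in_set_takeD in_set_dropD\<close>)
    also have "vol_growth k T * (1 * norm x) \<le> (2 * rel_vol {} (map (blinfun_apply T) vs)) * norm x"
      using opt by (simp add: mult_right_mono)
    also have "\<dots> \<le> (2 * (2 ^ k * (?R * infdist (blinfun_apply T (vs ! j)) (span (?o j))))) * norm x"
      using rot[OF j] by (intro mult_right_mono mult_left_mono) auto
    also have "\<dots> = ?R * (2 ^ (k + 1) * infdist (blinfun_apply T (vs ! j)) (span (?o j)) * norm x)"
      by (simp add: mult_ac)
    finally show ?thesis using dpos(2)[OF j] by (simp only: mult_le_cancel_left_pos)
  qed
  \<comment> \<open>An approximation error that is small enough for the claim and for the bound of every coefficient.\<close>
  define \<delta> where "\<delta> = Min (insert (\<eta> * norm x) ((\<lambda>j. infdist (blinfun_apply T (vs ! j)) (span (?o j)) * norm x) ` {..<k}))"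
  have d0: "\<delta> > 0" unfolding \<delta>_def using dpos(1) False \<open>\<eta> > 0\<close> by (subst Min_gr_iff) auto
  have d1: "\<delta> \<le> \<eta> * norm x" unfolding \<delta>_def by (rule Min_le) auto
  have d2: "\<delta> \<le> infdist (blinfun_apply T (vs ! j)) (span (?o j)) * norm x" if "j < k" for j
    unfolding \<delta>_def using that by (intro Min_le) auto
  have "infdist (blinfun_apply T x) (span ?W) < infdist (blinfun_apply T x) (span ?W) + \<delta>" using d0 by simp
  then obtain g where g: "g \<in> span ?W" "norm (blinfun_apply T x - g) < infdist (blinfun_apply T x) (span ?W) + \<delta>"
    using infdist_span_approx by blast
  then obtain f where f: "f \<in> span (set vs)" "g = blinfun_apply T f" by (auto simp: span_blinfun_image)
  obtain c where c: "f = (\<Sum>j<k. c j *\<^sub>R vs ! j)" using span_list_coeffs[OF f(1)] len by blast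
  have e: "norm (blinfun_apply T (x - f)) \<le> infdist (blinfun_apply T x) (span ?W) + \<delta>"
    using g(2) f(2) by (simp add: blinfun.diff_right)
  have cb: "\<bar>c j\<bar> \<le> (2 ^ (k + 2) + 1) * norm x" if j: "j < k" for j
  proof -
    let ?d = "infdist (blinfun_apply T (vs ! j)) (span (?o j))"
    have "(\<Sum>i\<in>{..<k} - {j}. c i *\<^sub>R blinfun_apply T (vs ! i)) \<in> span (?o j)"
    proof (rule span_sum)
      fix i assume i: "i \<in> {..<k} - {j}"
      have "vs ! i \<in> set (take j vs @ drop (Suc j) vs)"
      proof (cases "i < j")
        case True
        then have "take j vs ! i = vs ! i" "i < length (take j vs)" using i j len by auto
        then show ?thesis using nth_mem[of i "take j vs"] by simp
      next
        case False
        then have "drop (Suc j) vs ! (i - Suc j) = vs ! i" "i - Suc j < length (drop (Suc j) vs)"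
          using i j len by auto
        then show ?thesis using nth_mem[of "i - Suc j" "drop (Suc j) vs"] by simp
      qed
      then show "c i *\<^sub>R blinfun_apply T (vs ! i) \<in> span (?o j)"
        by (intro span_scale span_base) auto
    qed
    moreover have Tf: "blinfun_apply T f = c j *\<^sub>R blinfun_apply T (vs ! j) + (\<Sum>i\<in>{..<k} - {j}. c i *\<^sub>R blinfun_apply T (vs ! i))"
      using j by (simp add: c blinfun.add_right blinfun.sum_right blinfun.scaleR_right sum.remove)
    ultimately have 1: "infdist (blinfun_apply T f) (span (?o j)) = \<bar>c j\<bar> * ?d"
      using infdist_span_shift[of "\<Sum>i\<in>{..<k} - {j}. c i *\<^sub>R blinfun_apply T (vs ! i)" "?o j" "c j *\<^sub>R blinfun_apply T (vs ! j)"]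
      by (simp add: infdist_span_scale)
    have 2: "infdist (blinfun_apply T f) (span (?o j)) \<le>
        infdist (blinfun_apply T x) (span (?o j)) + infdist (- blinfun_apply T (x - f)) (span (?o j))"
      using infdist_span_add_le[of "blinfun_apply T x" "- blinfun_apply T (x - f)" "?o j"]
      by (simp add: blinfun.diff_right)
    have 3: "infdist (- blinfun_apply T (x - f)) (span (?o j)) \<le> norm (blinfun_apply T (x - f))"
      using infdist_span_le_norm[of "- blinfun_apply T (x - f)" "?o j"] by simp
    have 4: "infdist (blinfun_apply T x) (span ?W) \<le> infdist (blinfun_apply T x) (span (?o j))"
      by (rule infdist_span_mono[OF span_mono]) (auto dest: in_set_takeD in_set_dropD)
    have "\<bar>c j\<bar> * ?d \<le> 2 * infdist (blinfun_apply T x) (span (?o j)) + \<delta>"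
      using 1 2 3 4 e by linarith
    also have "\<dots> \<le> 2 * (2 ^ (k + 1) * ?d * norm x) + ?d * norm x"
      using dx[OF j] d2[OF j] by linarith
    also have "\<dots> = ((2 ^ (k + 2) + 1) * norm x) * ?d" by (simp add: algebra_simps)
    finally show ?thesis using dpos(1)[OF j] by (simp only: mult_le_cancel_right_pos)
  qed
  have "norm f \<le> (\<Sum>j<k. norm (c j *\<^sub>R vs ! j))" unfolding c by (rule norm_sum)
  also have "\<dots> \<le> (\<Sum>j<k. (2 ^ (k + 2) + 1) * norm x)"
  proof (rule sum_mono)
    fix j assume "j \<in> {..<k}"
    then have "j < k" "norm (vs ! j) = 1" using unit len by auto
    then show "norm (c j *\<^sub>R vs ! j) \<le> (2 ^ (k + 2) + 1) * norm x" using cb by simp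
  qed
  also have "\<dots> = real k * (2 ^ (k + 2) + 1) * norm x" by simp
  finally have nf: "norm f \<le> real k * (2 ^ (k + 2) + 1) * norm x" .
  have "rel_vol {} (map (blinfun_apply T) vs) * infdist (blinfun_apply T x) (span ?W) =
      rel_vol {} (map (blinfun_apply T) (vs @ [x]))"
    using rel_vol_snoc[of "{}" "map (blinfun_apply T) vs" "blinfun_apply T x"] by simp
  also have "\<dots> \<le> vol_growth (length (vs @ [x])) T * (\<Prod>u\<leftarrow>vs @ [x]. norm u)"
    by (rule rel_vol_le_vol_growth_prod[OF assms(1)])
  also have "\<dots> = vol_growth (Suc k) T * norm x" using len prod_norm_eq_1[of vs] unit by simp
  finally have "rel_vol {} (map (blinfun_apply T) vs) * infdist (blinfun_apply T x) (span ?W) \<le>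
      vol_growth (Suc k) T * norm x" .
  moreover have "vol_growth k T * infdist (blinfun_apply T x) (span ?W) \<le>
      2 * rel_vol {} (map (blinfun_apply T) vs) * infdist (blinfun_apply T x) (span ?W)"
    using opt by (intro mult_right_mono) (auto simp: infdist_nonneg)
  ultimately have "vol_growth k T * infdist (blinfun_apply T x) (span ?W) \<le> 2 * (vol_growth (Suc k) T * norm x)"
    by linarith
  then have "infdist (blinfun_apply T x) (span ?W) \<le> 2 * vol_growth (Suc k) T / vol_growth k T * norm x"
    using pos by (simp add: field_simps)
  then have "norm (blinfun_apply T (x - f)) \<le> (2 * vol_growth (Suc k) T / vol_growth k T + \<eta>) * norm x"
    using e d1 by (simp add: distrib_right)
  then show ?thesis using nf f(1) by blast
qed

section \<open>Closed subspaces and finite-dimensional perturbations\<close>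

lemma infdist_subspace_pos:
  fixes Y :: "'x::real_normed_vector set"
  assumes "closed (span Y)" "b \<notin> span Y"
  shows "infdist b (span Y) > 0"
  using in_closed_iff_infdist_zero[OF assms(1), of b] assms(2) infdist_nonneg[of b "span Y"]
  by (simp add: less_le)

text \<open>The coefficient of \<open>b\<close> is a Lipschitz function on the larger span, since \<open>b\<close> has positive distance from the
  smaller one. So it converges along every convergent sequence.\<close>

lemma closed_span_insert:
  fixes Y :: "'x::banach set"
  assumes "closed (span Y)"
  shows "closed (span (insert b Y))"
proof (cases "b \<in> span Y")
  case True
  then show ?thesis using assms by (simp add: span_redundant)
next
  case False
  have d: "infdist b (span Y) > 0" by (rule infdist_subspace_pos[OF assms False])
  show ?thesis unfolding closed_sequential_limits
  proof (intro allI impI, elim conjE)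
    fix z l assume z: "\<forall>n. z n \<in> span (insert b Y)" and l: "z \<longlonglongrightarrow> l"
    have "\<forall>n. \<exists>t. z n - t *\<^sub>R b \<in> span Y" using z span_breakdown_eq by blast
    then obtain t where t: "\<And>n. z n - t n *\<^sub>R b \<in> span Y" by metis
    have lip: "\<bar>t n - t m\<bar> * infdist b (span Y) \<le> norm (z n - z m)" for n m
    proof -
      have s: "(z n - t n *\<^sub>R b) - (z m - t m *\<^sub>R b) \<in> span Y" by (intro span_diff t)
      have "z n - z m = (t n - t m) *\<^sub>R b + ((z n - t n *\<^sub>R b) - (z m - t m *\<^sub>R b))"
        by (simp add: algebra_simps)
      then have "infdist (z n - z m) (span Y) =
          infdist ((t n - t m) *\<^sub>R b + ((z n - t n *\<^sub>R b) - (z m - t m *\<^sub>R b))) (span Y)"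
        by (rule arg_cong)
      also have "\<dots> = \<bar>t n - t m\<bar> * infdist b (span Y)"
        unfolding infdist_span_shift[OF s] by (rule infdist_span_scale)
      finally have "infdist (z n - z m) (span Y) = \<bar>t n - t m\<bar> * infdist b (span Y)" .
      then show ?thesis using infdist_span_le_norm[of "z n - z m" Y] by simp
    qed
    have "Cauchy t"
    proof (rule CauchyI)
      fix e :: real assume "e > 0"
      then have "e * infdist b (span Y) > 0" using d by simp
      then obtain M where M: "\<And>m n. m \<ge> M \<Longrightarrow> n \<ge> M \<Longrightarrow> norm (z m - z n) < e * infdist b (span Y)"
        using CauchyD[OF LIMSEQ_imp_Cauchy[OF l]] by metis
      have "norm (t m - t n) < e" if "m \<ge> M" "n \<ge> M" for m n
      proof -
        have "\<bar>t m - t n\<bar> * infdist b (span Y) < e * infdist b (span Y)"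
          using lip[of m n] M[OF that] by linarith
        then show ?thesis using d by simp
      qed
      then show "\<exists>M. \<forall>m\<ge>M. \<forall>n\<ge>M. norm (t m - t n) < e" by blast
    qed
    then obtain t' where "t \<longlonglongrightarrow> t'" using Cauchy_convergent convergent_def by blast
    then have "(\<lambda>n. z n - t n *\<^sub>R b) \<longlonglongrightarrow> l - t' *\<^sub>R b"
      by (intro tendsto_intros l)
    then have "l - t' *\<^sub>R b \<in> span Y"
      using closed_sequentially[OF assms, of "\<lambda>n. z n - t n *\<^sub>R b"] t by blast
    then show "l \<in> span (insert b Y)" using span_breakdown_eq by blast
  qed
qed

lemma closed_span_Un_finite:
  fixes Y :: "'x::banach set"
  assumes "finite B" "closed (span Y)"
  shows "closed (span (B \<union> Y))"
  using assms by (induction B) (auto intro: closed_span_insert)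

lemma closed_span_finite: "finite (B :: 'x::banach set) \<Longrightarrow> closed (span B)"
  using closed_span_Un_finite[of B "{}"] by simp

text \<open>A further basis vector \<open>b\<close> has positive distance from the closed space spanned by \<open>Y\<close> and the earlier ones.
  This bounds its own coefficient, and subtracting the term with \<open>b\<close> then bounds the others.\<close>

lemma coeff_sum_le_infdist:
  fixes Y :: "'x::banach set"
  assumes "finite B" "independent B" "closed (span Y)" "span B \<inter> span Y = {0}"
  shows "\<exists>c>0. \<forall>u. c * (\<Sum>b\<in>B. \<bar>u b\<bar>) \<le> infdist (\<Sum>b\<in>B. u b *\<^sub>R b) (span Y)"
  using assms
proof (induction B)
  case empty
  then show ?case by (intro exI[of _ 1]) (simp add: infdist_nonneg)
next
  case (insert b B)
  have ind: "independent B" and bB: "b \<notin> span B"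
    using insert.prems(1) insert.hyps(2) by (auto simp: independent_insert)
  have "span B \<subseteq> span (insert b B)" by (rule span_mono) auto
  then have "span B \<inter> span Y \<subseteq> {0}" using insert.prems(3) by blast
  then have "span B \<inter> span Y = {0}" using span_zero by blast
  then obtain c where c: "c > 0" "\<And>u. c * (\<Sum>b\<in>B. \<bar>u b\<bar>) \<le> infdist (\<Sum>b\<in>B. u b *\<^sub>R b) (span Y)"
    using insert.IH ind insert.prems(2) by blast
  have bn: "b \<notin> span (B \<union> Y)"
  proof
    assume "b \<in> span (B \<union> Y)"
    then obtain x y where xy: "b = x + y" "x \<in> span B" "y \<in> span Y" by (auto simp: span_Un)
    have "x \<in> span (insert b B)" using xy(2) span_mono[of B "insert b B"] by blast
    then have "b - x \<in> span (insert b B)" using span_base[of b "insert b B"] by (intro span_diff) auto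
    then have "y \<in> span (insert b B) \<inter> span Y" using xy by auto
    then have "y = 0" using insert.prems(3) by blast
    then show False using xy bB by simp
  qed
  let ?d = "infdist b (span (B \<union> Y))"
  have d: "?d > 0"
    by (intro infdist_subspace_pos closed_span_Un_finite bn insert)
  define c' where "c' = 1 / ((1 + norm b / ?d) / c + 1 / ?d)"
  have den: "(1 + norm b / ?d) / c + 1 / ?d > 0" using c d by (intro add_pos_pos divide_pos_pos add_pos_nonneg) auto
  have "c' * (\<Sum>x\<in>insert b B. \<bar>u x\<bar>) \<le> infdist (\<Sum>x\<in>insert b B. u x *\<^sub>R x) (span Y)" for u
  proof -
    let ?s = "\<Sum>x\<in>B. u x *\<^sub>R x" let ?S = "\<Sum>x\<in>B. \<bar>u x\<bar>"
    let ?P = "infdist (\<Sum>x\<in>insert b B. u x *\<^sub>R x) (span Y)"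
    have e: "(\<Sum>x\<in>insert b B. u x *\<^sub>R x) = u b *\<^sub>R b + ?s" using insert.hyps by simp
    have s: "?s \<in> span (B \<union> Y)" by (intro span_sum span_scale span_base) auto
    have "\<bar>u b\<bar> * ?d = infdist (u b *\<^sub>R b + ?s) (span (B \<union> Y))"
      using infdist_span_shift[OF s] by (simp add: infdist_span_scale)
    also have "\<dots> \<le> ?P" unfolding e by (rule infdist_span_mono[OF span_mono]) auto
    finally have 1: "\<bar>u b\<bar> \<le> ?P / ?d" using d by (simp add: field_simps)
    have "c * ?S \<le> infdist ?s (span Y)" by (rule c(2))
    also have "?s = (u b *\<^sub>R b + ?s) + (- u b) *\<^sub>R b" by simp
    also have "infdist \<dots> (span Y) \<le> ?P + \<bar>u b\<bar> * infdist b (span Y)"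
      using infdist_span_add_le[of "u b *\<^sub>R b + ?s" "(- u b) *\<^sub>R b" Y] unfolding e infdist_span_scale by simp
    also have "\<dots> \<le> ?P + \<bar>u b\<bar> * norm b"
      using infdist_span_le_norm[of b Y] by (simp add: mult_left_mono)
    also have "\<dots> \<le> ?P + ?P / ?d * norm b" using mult_right_mono[OF 1, of "norm b"] by simp
    finally have "?S \<le> (?P + ?P / ?d * norm b) / c" using c(1) by (simp add: field_simps)
    then have "\<bar>u b\<bar> + ?S \<le> ?P / ?d + (?P + ?P / ?d * norm b) / c" using 1 by linarith
    also have "\<dots> = ?P * ((1 + norm b / ?d) / c + 1 / ?d)" by (simp add: algebra_simps add_divide_distrib)
    finally have "\<bar>u b\<bar> + ?S \<le> ?P * ((1 + norm b / ?d) / c + 1 / ?d)" .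
    then have "(\<bar>u b\<bar> + ?S) / ((1 + norm b / ?d) / c + 1 / ?d) \<le> ?P"
      using den by (simp only: pos_divide_le_eq)
    then show ?thesis using insert.hyps by (simp add: c'_def)
  qed
  moreover have "c' > 0" using den by (simp add: c'_def)
  ultimately show ?case by blast
qed

lemma span_finite_coeffs:
  assumes "finite B" "x \<in> span B" shows "\<exists>u. x = (\<Sum>b\<in>B. u b *\<^sub>R b)"
  using assms span_finite[of B] by auto

lemma norm_le_infdist_complement:
  fixes Y :: "'x::banach set"
  assumes "finite B" "independent B" "closed (span Y)" "span B \<inter> span Y = {0}"
  shows "\<exists>c>0. \<forall>f\<in>span B. c * norm f \<le> infdist f (span Y)"
proof -
  obtain c where c: "c > 0" "\<And>u. c * (\<Sum>b\<in>B. \<bar>u b\<bar>) \<le> infdist (\<Sum>b\<in>B. u b *\<^sub>R b) (span Y)"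
    using coeff_sum_le_infdist[OF assms] by blast
  define m where "m = 1 + (\<Sum>b\<in>B. norm b)"
  have m: "m > 0" by (simp add: m_def add_pos_nonneg sum_nonneg)
  have mb: "norm b \<le> m" if "b \<in> B" for b
    using assms(1) member_le_sum[of b B norm] that unfolding m_def by simp
  have "c / m * norm f \<le> infdist f (span Y)" if f: "f \<in> span B" for f
  proof -
    obtain u where u: "f = (\<Sum>b\<in>B. u b *\<^sub>R b)" using span_finite_coeffs[OF assms(1) f] by blast
    have "norm f \<le> (\<Sum>b\<in>B. norm (u b *\<^sub>R b))" unfolding u by (rule norm_sum)
    also have "\<dots> \<le> (\<Sum>b\<in>B. \<bar>u b\<bar> * m)" using mb by (intro sum_mono) (auto intro: mult_left_mono)
    also have "\<dots> = (\<Sum>b\<in>B. \<bar>u b\<bar>) * m" by (simp add: sum_distrib_right)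
    finally have "c / m * norm f \<le> c / m * ((\<Sum>b\<in>B. \<bar>u b\<bar>) * m)"
      using m c by (intro mult_left_mono) auto
    also have "\<dots> = c * (\<Sum>b\<in>B. \<bar>u b\<bar>)" using m by simp
    also have "\<dots> \<le> infdist f (span Y)" unfolding u by (rule c(2))
    finally show ?thesis .
  qed
  moreover have "c / m > 0" using c m by simp
  ultimately show ?thesis by blast
qed

text \<open>It suffices to bound the seminorms on a basis, because the norm controls the coefficients.\<close>

lemma finite_dim_uniform_bound:
  fixes W :: "'x::banach set" and p :: "nat \<Rightarrow> 'x \<Rightarrow> real"
  assumes "subspace W" "W \<subseteq> span B" "finite B"
    and add: "\<And>n x y. p n (x + y) \<le> p n x + p n y" and scale: "\<And>n c x. p n (c *\<^sub>R x) = \<bar>c\<bar> * p n x"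
    and bdd: "\<And>x. x \<in> W \<Longrightarrow> \<exists>K. \<forall>n. p n x \<le> K"
  shows "\<exists>K. \<forall>x\<in>W. \<forall>n. p n x \<le> K * norm x"
proof -
  obtain D where D: "D \<subseteq> W" "independent D" "W \<subseteq> span D"
    using maximal_independent_subset[of W] by blast
  have fD: "finite D" using independent_span_bound[OF assms(3) D(2)] D(1) assms(2) by blast
  obtain c where c: "c > 0" "\<And>u. c * (\<Sum>b\<in>D. \<bar>u b\<bar>) \<le> infdist (\<Sum>b\<in>D. u b *\<^sub>R b) (span {})"
    using coeff_sum_le_infdist[OF fD D(2), of "{}"] span_zero[of D] by auto
  have "\<forall>b\<in>D. \<exists>K. \<forall>n. p n b \<le> K" using bdd D(1) by blast
  then obtain K where K: "\<And>b n. b \<in> D \<Longrightarrow> p n b \<le> K b" by metis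
  define m where "m = (\<Sum>b\<in>D. \<bar>K b\<bar>)"
  have m: "p n b \<le> m" if "b \<in> D" for n b
  proof -
    have "\<bar>K b\<bar> \<le> m" unfolding m_def using fD that by (intro member_le_sum) auto
    then show ?thesis using K[OF that, of n] by linarith
  qed
  have m0: "m \<ge> 0" by (simp add: m_def sum_nonneg)
  have p0: "p n 0 = 0" for n using scale[of n 0 0] by simp
  have psum: "p n (\<Sum>b\<in>A. u b *\<^sub>R b) \<le> (\<Sum>b\<in>A. \<bar>u b\<bar> * p n b)" if "finite A" for n A u
    using that
  proof (induction A)
    case (insert a A)
    then show ?case using add[of n "u a *\<^sub>R a" "\<Sum>b\<in>A. u b *\<^sub>R b"] by (simp add: scale)
  qed (simp add: p0)
  have "p n x \<le> m / c * norm x" if x: "x \<in> W" for n x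
  proof -
    have "x \<in> span D" using x D(3) by blast
    then obtain u where u: "x = (\<Sum>b\<in>D. u b *\<^sub>R b)" using span_finite_coeffs[OF fD] by blast
    have "p n x \<le> (\<Sum>b\<in>D. \<bar>u b\<bar> * p n b)" unfolding u by (rule psum[OF fD])
    also have "\<dots> \<le> (\<Sum>b\<in>D. \<bar>u b\<bar> * m)" by (intro sum_mono mult_left_mono m) auto
    also have "\<dots> = m / c * (c * (\<Sum>b\<in>D. \<bar>u b\<bar>))" using c by (simp add: sum_distrib_right[symmetric])
    also have "\<dots> \<le> m / c * norm x"
      using c(2)[of u] c(1) m0 unfolding u by (intro mult_left_mono) auto
    finally show ?thesis .
  qed
  then show ?thesis by blast
qed

section \<open>The slow subspace of a sequence of operators\<close>

text \<open>The spaces \<open>span (B m)\<close> of fast vectors are those of dimension \<open>k\<close> on which \<open>T m\<close> is large. The hypotheses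
  \<open>approx\<close> and \<open>backward\<close> are the two estimates for near-optimal tuples; \<open>e\<close> stands for the errors in the
  ergodic theorems. The gap between \<open>\<mu>\<close> and \<open>\<nu>\<close> has to exceed the sum of all errors that accumulate
  below.\<close>

locale dominated_sequence =
  fixes T :: "nat \<Rightarrow> 'x::banach \<Rightarrow>\<^sub>L 'x" and B :: "nat \<Rightarrow> 'x set" and k :: nat
    and \<mu> \<nu> e C :: real
  assumes T_0: "T 0 = id_blinfun"
    and B_finite: "finite (B n)" and B_indep: "independent (B n)" and B_card: "card (B n) = k"
    and approx: "\<exists>f\<in>span (B m). norm f \<le> C * norm x \<and>
      norm (blinfun_apply (T m) (x - f)) \<le> C * exp (real m * (\<nu> + e)) * norm x"
    and backward: "n \<le> m \<Longrightarrow> f \<in> span (B m) \<Longrightarrow> norm (blinfun_apply (T n) f) \<le>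
      C * exp (- (real m - real n) * \<mu> + 3 * e * real m) * norm (blinfun_apply (T m) f)"
    and step: "norm (blinfun_apply (T (Suc m)) x) \<le> C * exp (e * real m) * norm (blinfun_apply (T m) x)"
    and C_ge_1: "C \<ge> 1" and e_pos: "e > 0" and gap: "9 * e < \<mu> - \<nu>"
begin

definition slow :: "'x set" where
  "slow = {x. \<exists>K. \<forall>n. norm (blinfun_apply (T n) x) \<le> K * exp (real n * (\<nu> + 5 * e))}"

definition pr :: "nat \<Rightarrow> 'x \<Rightarrow> 'x" where
  "pr m x = (SOME f. f \<in> span (B m) \<and> norm f \<le> C * norm x \<and>
      norm (blinfun_apply (T m) (x - f)) \<le> C * exp (real m * (\<nu> + e)) * norm x)"

lemma pr: "pr m x \<in> span (B m)" "norm (pr m x) \<le> C * norm x"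
  "norm (blinfun_apply (T m) (x - pr m x)) \<le> C * exp (real m * (\<nu> + e)) * norm x"
proof -
  have "\<exists>f. f \<in> span (B m) \<and> norm f \<le> C * norm x \<and>
      norm (blinfun_apply (T m) (x - f)) \<le> C * exp (real m * (\<nu> + e)) * norm x"
    using approx[of m x] by blast
  from someI_ex[OF this] show "pr m x \<in> span (B m)" "norm (pr m x) \<le> C * norm x"
    "norm (blinfun_apply (T m) (x - pr m x)) \<le> C * exp (real m * (\<nu> + e)) * norm x"
    unfolding pr_def by blast+
qed

lemma slow_subspace: "subspace slow"
proof (rule subspaceI)
  show "0 \<in> slow" unfolding slow_def by (auto simp: blinfun.zero_right intro!: exI[of _ 0])
  show "x + y \<in> slow" if xy: "x \<in> slow" "y \<in> slow" for x y
  proof -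
    obtain K K' where K: "\<forall>n. norm (blinfun_apply (T n) x) \<le> K * exp (real n * (\<nu> + 5 * e))"
      "\<forall>n. norm (blinfun_apply (T n) y) \<le> K' * exp (real n * (\<nu> + 5 * e))"
      using xy unfolding slow_def by blast
    have "norm (blinfun_apply (T n) (x + y)) \<le> (K + K') * exp (real n * (\<nu> + 5 * e))" for n
      using K(1)[rule_format, of n] K(2)[rule_format, of n]
        norm_triangle_ineq[of "blinfun_apply (T n) x" "blinfun_apply (T n) y"]
      by (simp add: blinfun.add_right distrib_right)
    then show ?thesis unfolding slow_def by blast
  qed
  show "c *\<^sub>R x \<in> slow" if x: "x \<in> slow" for c x
  proof -
    obtain K where K: "\<forall>n. norm (blinfun_apply (T n) x) \<le> K * exp (real n * (\<nu> + 5 * e))"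
      using x unfolding slow_def by blast
    have "norm (blinfun_apply (T n) (c *\<^sub>R x)) \<le> (\<bar>c\<bar> * K) * exp (real n * (\<nu> + 5 * e))" for n
      using mult_left_mono[OF K[rule_format, of n], of "\<bar>c\<bar>"] by (simp add: blinfun.scaleR_right mult_ac)
    then show ?thesis unfolding slow_def by blast
  qed
qed

text \<open>The corrections made below at time \<open>m\<close> have norm at most \<open>C2 * exp (- m g)\<close> times a bound for the remainders.\<close>

definition "g = \<mu> - \<nu> - 5 * e"
definition "C2 = C * (C\<^sup>2 * exp (- (\<nu> + 2 * e)) + C)"

lemma g_pos: "g > 0" using gap e_pos by (simp add: g_def)
lemma C2_nonneg: "C2 \<ge> 0" using C_ge_1 by (simp add: C2_def)

text \<open>Starting at time \<open>N\<close>, the component in the span of \<open>B m\<close> is removed at every time \<open>m \<ge> N\<close>.\<close>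

primrec rest :: "nat \<Rightarrow> 'x \<Rightarrow> nat \<Rightarrow> 'x" where
  "rest N x 0 = x - pr N x"
| "rest N x (Suc j) = rest N x j - pr (N + Suc j) (rest N x j)"

definition corr :: "nat \<Rightarrow> 'x \<Rightarrow> nat \<Rightarrow> 'x" where
  "corr N x j = pr (N + Suc j) (rest N x j)"

lemma rest_eq: "rest N x j = x - pr N x - (\<Sum>i<j. corr N x i)"
  by (induction j) (auto simp: corr_def)

lemma rest_small:
  assumes "norm x \<le> R" "\<And>i. i < j \<Longrightarrow> norm (rest N x i) \<le> R"
  shows "norm (blinfun_apply (T (N + j)) (rest N x j)) \<le> C * exp (real (N + j) * (\<nu> + e)) * R"
proof (cases j)
  case 0
  have "norm (blinfun_apply (T N) (x - pr N x)) \<le> C * exp (real N * (\<nu> + e)) * norm x" by (rule pr)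
  also have "\<dots> \<le> C * exp (real N * (\<nu> + e)) * R" using assms(1) C_ge_1 by (intro mult_left_mono) auto
  finally show ?thesis using 0 by simp
next
  case (Suc i)
  have "norm (blinfun_apply (T (N + j)) (rest N x j)) \<le> C * exp (real (N + j) * (\<nu> + e)) * norm (rest N x i)"
    using pr(3)[of "N + Suc i" "rest N x i"] Suc by simp
  also have "\<dots> \<le> C * exp (real (N + j) * (\<nu> + e)) * R" using assms(2)[of i] Suc C_ge_1 by (intro mult_left_mono) auto
  finally show ?thesis .
qed

text \<open>The correction at time \<open>m\<close> has a small image at time \<open>m\<close>; since vectors of the span of \<open>B m\<close>
  are not contracted before, its images at earlier times are smaller still.\<close>

lemma corr_small:
  assumes R: "norm x \<le> R" "\<And>i. i \<le> j \<Longrightarrow> norm (rest N x i) \<le> R" and n: "n \<le> N + Suc j"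
  shows "norm (blinfun_apply (T n) (corr N x j)) \<le> C2 * R * exp (real n * \<mu> - real (N + Suc j) * g)"
proof -
  let ?m = "N + Suc j"
  have R0: "R \<ge> 0" using R(1) norm_ge_zero order_trans by blast
  have "blinfun_apply (T ?m) (corr N x j) = blinfun_apply (T ?m) (rest N x j) - blinfun_apply (T ?m) (rest N x (Suc j))"
    by (simp add: corr_def blinfun.diff_right[symmetric])
  then have "norm (blinfun_apply (T ?m) (corr N x j)) \<le>
      norm (blinfun_apply (T ?m) (rest N x j)) + norm (blinfun_apply (T ?m) (rest N x (Suc j)))"
    using norm_triangle_ineq4 by simp
  also have "norm (blinfun_apply (T ?m) (rest N x j)) \<le> C * exp (e * real (N + j)) * norm (blinfun_apply (T (N + j)) (rest N x j))"
    using step[of "N + j"] by simp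
  also have "\<dots> \<le> C * exp (e * real (N + j)) * (C * exp (real (N + j) * (\<nu> + e)) * R)"
    using C_ge_1 R by (intro mult_left_mono rest_small) auto
  also have "\<dots> = C\<^sup>2 * exp (- (\<nu> + 2 * e)) * exp (real ?m * (\<nu> + 2 * e)) * R"
    by (simp add: power2_eq_square exp_add[symmetric] mult_ac) (simp add: algebra_simps)
  also have "norm (blinfun_apply (T ?m) (rest N x (Suc j))) \<le> C * exp (real ?m * (\<nu> + e)) * R"
    using rest_small[of x R "Suc j" N] R by simp
  also have "\<dots> \<le> C * exp (real ?m * (\<nu> + 2 * e)) * R"
    using C_ge_1 R0 e_pos by (intro mult_right_mono mult_left_mono) auto
  finally have 1: "norm (blinfun_apply (T ?m) (corr N x j)) \<le>
      (C\<^sup>2 * exp (- (\<nu> + 2 * e)) + C) * exp (real ?m * (\<nu> + 2 * e)) * R"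
    by (simp add: distrib_right)
  have "norm (blinfun_apply (T n) (corr N x j)) \<le>
      C * exp (- (real ?m - real n) * \<mu> + 3 * e * real ?m) * norm (blinfun_apply (T ?m) (corr N x j))"
    by (rule backward[OF n]) (simp add: corr_def pr)
  also have "\<dots> \<le> C * exp (- (real ?m - real n) * \<mu> + 3 * e * real ?m) *
      ((C\<^sup>2 * exp (- (\<nu> + 2 * e)) + C) * exp (real ?m * (\<nu> + 2 * e)) * R)"
    using C_ge_1 by (intro mult_left_mono 1) auto
  also have "\<dots> = C2 * R * (exp (- (real ?m - real n) * \<mu> + 3 * e * real ?m) * exp (real ?m * (\<nu> + 2 * e)))"
    by (simp add: C2_def mult_ac)
  also have "exp (- (real ?m - real n) * \<mu> + 3 * e * real ?m) * exp (real ?m * (\<nu> + 2 * e)) =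
      exp (real n * \<mu> - real ?m * g)"
    by (simp add: exp_add[symmetric] g_def del: of_nat_add of_nat_Suc) (simp add: algebra_simps)
  finally show ?thesis .
qed

lemma geometric_tail:
  "(\<lambda>j. exp (- real (N + Suc j) * g)) sums (exp (- real (Suc N) * g) / (1 - exp (- g)))"
proof -
  have "norm (exp (- g)) < 1" using g_pos by simp
  from sums_mult[OF geometric_sums[OF this], of "exp (- real (Suc N) * g)"]
  show ?thesis
    by (simp add: exp_of_nat_mult[symmetric] exp_add[symmetric] algebra_simps)
qed

text \<open>By geometric decay the corrections have a sum, which is small compared with \<open>x\<close> if the first of them is made
  late. At any time the remaining corrections are small as well, so that the vector left after all of them
  is slow.\<close>

lemma slow_approx:
  "\<exists>N0. \<forall>N\<ge>N0. \<exists>K\<ge>0. \<forall>x. \<exists>y. (\<forall>n. norm (blinfun_apply (T n) y) \<le> K * exp (real n * (\<nu> + 5 * e)) * norm x) \<and>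
     norm (x - pr N x - y) \<le> norm x / 2"
proof -
  define \<delta> where "\<delta> N = C2 * (exp (- real (Suc N) * g) / (1 - exp (- g)))" for N
  have q1: "exp (- g) < 1" using g_pos by simp
  have \<delta>0: "\<delta> N \<ge> 0" for N using C2_nonneg q1 by (simp add: \<delta>_def)
  have "(\<lambda>N. exp (- g) ^ Suc N) \<longlonglongrightarrow> 0"
    by (rule LIMSEQ_Suc[OF LIMSEQ_power_zero]) (use q1 in simp)
  then have "(\<lambda>N. C2 * (exp (- g) ^ Suc N / (1 - exp (- g)))) \<longlonglongrightarrow> C2 * (0 / (1 - exp (- g)))"
    by (intro tendsto_intros) (use q1 in auto)
  moreover have "exp (- g) ^ Suc N = exp (- real (Suc N) * g)" for N
    by (simp add: exp_of_nat_mult[symmetric] del: power_Suc of_nat_Suc)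
  ultimately have "\<delta> \<longlonglongrightarrow> 0" by (simp add: \<delta>_def[abs_def])
  then have "eventually (\<lambda>N. \<delta> N < 1 / (4 * (1 + C))) sequentially"
    using C_ge_1 by (intro order_tendstoD(2)[of \<delta> 0]) auto
  then obtain N0 where N0: "\<And>N. N \<ge> N0 \<Longrightarrow> \<delta> N < 1 / (4 * (1 + C))"
    by (auto simp: eventually_sequentially)
  have "\<exists>K\<ge>0. \<forall>x. \<exists>y. (\<forall>n. norm (blinfun_apply (T n) y) \<le> K * exp (real n * (\<nu> + 5 * e)) * norm x) \<and>
     norm (x - pr N x - y) \<le> norm x / 2" if N: "N \<ge> N0" for N
  proof -
    have \<delta>1: "\<delta> N * (4 * (1 + C)) \<le> 1" using N0[OF N] C_ge_1 by (simp add: field_simps)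
    have "\<delta> N * 4 \<le> \<delta> N * (4 * (1 + C))" using \<delta>0 C_ge_1 by (intro mult_left_mono) auto
    then have \<delta>2: "\<delta> N * 4 \<le> 1" using \<delta>1 by linarith
    \<comment> \<open>Before time \<open>N\<close> there are only finitely many operators, which are bounded by their norms.\<close>
    define M where "M = (\<Sum>n<N. norm (T n) * exp (- (real n * (\<nu> + 5 * e))))"
    define K where "K = (C + C2 * (exp (- real (Suc 0) * g) / (1 - exp (- g)))) * (2 * (1 + C)) + M * (2 * (1 + C) * 2)"
    have M0: "M \<ge> 0" by (auto simp: M_def intro!: sum_nonneg)
    have K1: "K \<ge> (C + C2 * (exp (- real (Suc 0) * g) / (1 - exp (- g)))) * (2 * (1 + C))"
      unfolding K_def using M0 C_ge_1 by simp
    have "(C + C2 * (exp (- real (Suc 0) * g) / (1 - exp (- g)))) * (2 * (1 + C)) \<ge> 0"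
      using C_ge_1 C2_nonneg q1 by (intro mult_nonneg_nonneg add_nonneg_nonneg divide_nonneg_nonneg) auto
    then have K0: "K \<ge> 0" and K2: "K \<ge> M * (2 * (1 + C) * 2)" unfolding K_def using M0 C_ge_1 by auto
    have "\<exists>y. (\<forall>n. norm (blinfun_apply (T n) y) \<le> K * exp (real n * (\<nu> + 5 * e)) * norm x) \<and>
       norm (x - pr N x - y) \<le> norm x / 2" for x
    proof -
      \<comment> \<open>The first remainder is bounded by \<open>R / 2\<close>, and the corrections add up to at most \<open>R / 2\<close>.\<close>
      define R where "R = 2 * (1 + C) * norm x"
      have R0: "R \<ge> 0" and xR: "norm x \<le> R"
        using C_ge_1 mult_right_mono[of 1 "2 * (1 + C)" "norm x"] by (auto simp: R_def)
      have hsm: "norm (corr N x j) \<le> C2 * R * exp (- real (N + Suc j) * g)"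
        if "\<And>i. i \<le> j \<Longrightarrow> norm (rest N x i) \<le> R" for j
        using corr_small[where n=0 and N=N and x=x and R=R and j=j, OF xR that] T_0 by (simp add: algebra_simps)
      have psum: "(\<Sum>i<j. exp (- real (N + Suc i) * g)) \<le> exp (- real (Suc N) * g) / (1 - exp (- g))" for j
        using geometric_tail[of N] sums_iff sum_le_suminf[of "\<lambda>j. exp (- real (N + Suc j) * g)" "{..<j}"]
        by (metis finite_lessThan exp_ge_zero)
      have yR: "norm (rest N x j) \<le> R" for j
      proof (induction j rule: less_induct)
        case (less j)
        have "norm (pr N x) \<le> C * norm x" by (rule pr)
        then have "norm (x - pr N x) \<le> (1 + C) * norm x"
          using norm_triangle_ineq4[of x "pr N x"] by (simp add: distrib_right)
        moreover have "norm (\<Sum>i<j. corr N x i) \<le> (\<Sum>i<j. C2 * R * exp (- real (N + Suc i) * g))"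
          using less by (intro sum_norm_le hsm) auto
        moreover have "\<dots> = C2 * R * (\<Sum>i<j. exp (- real (N + Suc i) * g))" by (simp add: sum_distrib_left)
        moreover have "\<dots> \<le> C2 * R * (exp (- real (Suc N) * g) / (1 - exp (- g)))"
          using C2_nonneg R0 by (intro mult_left_mono psum) auto
        moreover have "\<dots> = \<delta> N * R" by (simp add: \<delta>_def)
        moreover have "\<delta> N * R \<le> R / 2"
          using mult_right_mono[OF \<delta>2 R0] R0 by simp
        moreover have "norm (rest N x j) \<le> norm (x - pr N x) + norm (\<Sum>i<j. corr N x i)"
          unfolding rest_eq by (rule norm_triangle_ineq4)
        moreover have "(1 + C) * norm x = R / 2" by (simp add: R_def)
        ultimately show ?case by linarith
      qed
      have h: "norm (corr N x j) \<le> C2 * R * exp (- real (N + Suc j) * g)" for j by (rule hsm[OF yR])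
      have gs: "summable (\<lambda>j. C2 * R * exp (- real (N + Suc j) * g))"
        using sums_mult[OF geometric_tail[of N], of "C2 * R"] by (simp add: sums_iff)
      have hs: "summable (corr N x)" by (rule summable_comparison_test'[OF gs h])
      define y where "y = x - pr N x - suminf (corr N x)"
      have "norm (x - pr N x - y) = norm (suminf (corr N x))" by (simp add: y_def)
      also have "\<dots> \<le> (\<Sum>j. C2 * R * exp (- real (N + Suc j) * g))"
        by (rule norm_suminf_le[OF h gs])
      also have "\<dots> = \<delta> N * R"
        using sums_mult[OF geometric_tail[of N], of "C2 * R"] by (simp add: sums_iff \<delta>_def)
      also have "\<dots> = (\<delta> N * (4 * (1 + C))) * norm x / 2" by (simp add: R_def)
      also have "\<dots> \<le> 1 * norm x / 2" using \<delta>1 by (intro divide_right_mono mult_right_mono) auto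
      finally have close: "norm (x - pr N x - y) \<le> norm x / 2" by simp
      have yeq: "y = rest N x j - (\<Sum>i. corr N x (i + j))" for j
        unfolding y_def rest_eq using suminf_split_initial_segment[OF hs, of j] by (simp add: algebra_simps)
      have growth: "norm (blinfun_apply (T n) y) \<le> K * exp (real n * (\<nu> + 5 * e)) * norm x" for n
      proof (cases "n \<ge> N")
        case True
        then obtain j where j: "n = N + j" using le_Suc_ex by blast
        have s1: "summable (\<lambda>i. corr N x (i + j))" using hs by (simp add: summable_iff_shift)
        have "blinfun_apply (T n) y = blinfun_apply (T n) (rest N x j) - (\<Sum>i. blinfun_apply (T n) (corr N x (i + j)))"
          using yeq[of j] bounded_linear.suminf[OF blinfun.bounded_linear_right s1, of "T n"]
          by (simp add: blinfun.diff_right)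
        then have "norm (blinfun_apply (T n) y) \<le>
            norm (blinfun_apply (T n) (rest N x j)) + norm (\<Sum>i. blinfun_apply (T n) (corr N x (i + j)))"
          by (simp add: norm_triangle_ineq4)
        also have "norm (blinfun_apply (T n) (rest N x j)) \<le> C * exp (real n * (\<nu> + e)) * R"
          unfolding j by (rule rest_small[OF xR yR])
        also have "C * exp (real n * (\<nu> + e)) * R \<le> C * exp (real n * (\<nu> + 5 * e)) * R"
          using C_ge_1 R0 e_pos by (intro mult_right_mono mult_left_mono exp_mono) auto
        also have "norm (\<Sum>i. blinfun_apply (T n) (corr N x (i + j))) \<le>
            (\<Sum>i. C2 * R * exp (real n * (\<nu> + 5 * e)) * exp (- real (0 + Suc i) * g))"
        proof (rule norm_suminf_le)
          fix i
          have "norm (blinfun_apply (T n) (corr N x (i + j))) \<le> C2 * R * exp (real n * \<mu> - real (N + Suc (i + j)) * g)"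
            by (rule corr_small[OF xR yR]) (simp add: j)
          also have "real n * \<mu> - real (N + Suc (i + j)) * g = real n * (\<nu> + 5 * e) + (- real (0 + Suc i) * g)"
            by (simp add: j g_def algebra_simps)
          finally show "norm (blinfun_apply (T n) (corr N x (i + j))) \<le>
              C2 * R * exp (real n * (\<nu> + 5 * e)) * exp (- real (0 + Suc i) * g)"
            by (simp only: exp_add mult.assoc)
        next
          show "summable (\<lambda>i. C2 * R * exp (real n * (\<nu> + 5 * e)) * exp (- real (0 + Suc i) * g))"
            using sums_mult[OF geometric_tail[of 0], of "C2 * R * exp (real n * (\<nu> + 5 * e))"] by (simp add: sums_iff)
        qed
        also have "\<dots> = C2 * R * exp (real n * (\<nu> + 5 * e)) * (exp (- real (Suc 0) * g) / (1 - exp (- g)))"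
          using sums_mult[OF geometric_tail[of 0], of "C2 * R * exp (real n * (\<nu> + 5 * e))"] by (simp add: sums_iff)
        finally have "norm (blinfun_apply (T n) y) \<le>
            (C + C2 * (exp (- real (Suc 0) * g) / (1 - exp (- g)))) * (2 * (1 + C)) * (exp (real n * (\<nu> + 5 * e)) * norm x)"
          by (simp add: R_def algebra_simps add_divide_distrib)
        also have "\<dots> \<le> K * (exp (real n * (\<nu> + 5 * e)) * norm x)"
          using K1 by (intro mult_right_mono) auto
        finally show ?thesis by (simp add: mult_ac)
      next
        case False
        have "y = x - pr N x - (x - pr N x - y)" by simp
        then have "norm y \<le> norm (rest N x 0) + norm (x - pr N x - y)"
          using norm_triangle_ineq4[of "x - pr N x" "x - pr N x - y"] by simp
        also have "\<dots> \<le> R + R" using yR[of 0] close xR norm_ge_zero[of x] by linarith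
        finally have ny: "norm y \<le> 2 * R" by simp
        have "norm (T n) * exp (- (real n * (\<nu> + 5 * e))) \<le> M"
          unfolding M_def using False by (intro member_le_sum) auto
        then have "norm (T n) * exp (- (real n * (\<nu> + 5 * e))) * exp (real n * (\<nu> + 5 * e)) \<le> M * exp (real n * (\<nu> + 5 * e))"
          by (intro mult_right_mono) auto
        then have nT: "norm (T n) \<le> M * exp (real n * (\<nu> + 5 * e))"
          by (simp add: mult.assoc exp_add[symmetric])
        have "norm (blinfun_apply (T n) y) \<le> norm (T n) * norm y" by (rule norm_blinfun)
        also have "\<dots> \<le> (M * exp (real n * (\<nu> + 5 * e))) * (2 * R)"
          using nT ny M0 by (intro mult_mono) auto
        also have "\<dots> = (M * (2 * (1 + C) * 2)) * (exp (real n * (\<nu> + 5 * e)) * norm x)" by (simp add: R_def)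
        also have "\<dots> \<le> K * (exp (real n * (\<nu> + 5 * e)) * norm x)"
          using K2 by (intro mult_right_mono) auto
        finally show ?thesis by (simp add: mult_ac)
      qed
      show ?thesis using close growth by blast
    qed
    then show ?thesis using K0 by blast
  qed
  then show ?thesis by blast
qed

text \<open>Iterating the previous approximation on the remainder, which is at most half as long.\<close>

lemma slow_decomp:
  "\<exists>N0. \<forall>N\<ge>N0. \<exists>K\<ge>0. \<forall>x. \<exists>f\<in>span (B N). norm f \<le> 2 * C * norm x \<and>
     (\<forall>n. norm (blinfun_apply (T n) (x - f)) \<le> K * exp (real n * (\<nu> + 5 * e)) * norm x)"
proof -
  obtain N0 where N0: "\<And>N. N \<ge> N0 \<Longrightarrow> \<exists>K\<ge>0. \<forall>x. \<exists>y. (\<forall>n. norm (blinfun_apply (T n) y) \<le> K * exp (real n * (\<nu> + 5 * e)) * norm x) \<and>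
     norm (x - pr N x - y) \<le> norm x / 2" using slow_approx by blast
  have "\<exists>K\<ge>0. \<forall>x. \<exists>f\<in>span (B N). norm f \<le> 2 * C * norm x \<and>
     (\<forall>n. norm (blinfun_apply (T n) (x - f)) \<le> K * exp (real n * (\<nu> + 5 * e)) * norm x)" if N: "N \<ge> N0" for N
  proof -
    obtain K Y where K: "K \<ge> 0"
      and Y: "\<And>x n. norm (blinfun_apply (T n) (Y x)) \<le> K * exp (real n * (\<nu> + 5 * e)) * norm x"
      and Yx: "\<And>x. norm (x - pr N x - Y x) \<le> norm x / 2"
      using N0[OF N] by metis
    have "\<exists>f\<in>span (B N). norm f \<le> 2 * C * norm x \<and>
     (\<forall>n. norm (blinfun_apply (T n) (x - f)) \<le> (2 * K) * exp (real n * (\<nu> + 5 * e)) * norm x)" for x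
    proof -
      define X where "X = rec_nat x (\<lambda>_ x. x - pr N x - Y x)"
      have X0: "X 0 = x" and XS: "X (Suc i) = X i - pr N (X i) - Y (X i)" for i by (auto simp: X_def)
      have nX: "norm (X i) \<le> (1/2) ^ i * norm x" for i
      proof (induction i)
        case (Suc i)
        then show ?case using Yx[of "X i"] unfolding XS by simp
      qed (simp add: X0)
      have hsum: "(\<lambda>i. (1/2::real) ^ i * a) sums (2 * a)" for a
        using sums_mult2[OF geometric_sums[of "1/2::real"], of a] by simp
      have fb: "norm (pr N (X i)) \<le> (1/2) ^ i * (C * norm x)" for i
      proof -
        have "norm (pr N (X i)) \<le> C * norm (X i)" by (rule pr)
        also have "\<dots> \<le> C * ((1/2) ^ i * norm x)" using C_ge_1 by (intro mult_left_mono nX) auto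
        finally show ?thesis by (simp add: mult_ac)
      qed
      have fs: "summable (\<lambda>i. pr N (X i))"
        by (rule summable_comparison_test'[OF sums_summable[OF hsum] fb])
      define f where "f = (\<Sum>i. pr N (X i))"
      have "norm f \<le> (\<Sum>i. (1/2) ^ i * (C * norm x))"
        unfolding f_def by (rule norm_suminf_le[OF fb sums_summable[OF hsum]])
      also have "\<dots> = 2 * (C * norm x)" by (rule sums_unique[OF hsum, symmetric])
      finally have nf: "norm f \<le> 2 * C * norm x" by simp
      have flim: "(\<lambda>m. \<Sum>i<m. pr N (X i)) \<longlonglongrightarrow> f" unfolding f_def by (rule summable_LIMSEQ[OF fs])
      moreover have "(\<Sum>i<m. pr N (X i)) \<in> span (B N)" for m by (intro span_sum pr)
      ultimately have fB: "f \<in> span (B N)"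
        by (rule closed_sequentially[OF closed_span_finite[OF B_finite], rotated])
      have Xeq: "x - (\<Sum>i<m. pr N (X i)) - X m = (\<Sum>i<m. Y (X i))" for m
        by (induction m) (auto simp: X0 XS algebra_simps)
      have "(\<lambda>m. (1/2) ^ m * norm x) \<longlonglongrightarrow> 0 * norm x"
        by (intro tendsto_intros LIMSEQ_power_zero) simp
      then have "(\<lambda>m. (1/2) ^ m * norm x) \<longlonglongrightarrow> 0" by simp
      then have Xlim: "X \<longlonglongrightarrow> 0"
        by (rule Lim_null_comparison[rotated]) (use nX in auto)
      have "norm (blinfun_apply (T n) (x - f)) \<le> (2 * K) * exp (real n * (\<nu> + 5 * e)) * norm x" for n
      proof (rule LIMSEQ_le_const2)
        show "(\<lambda>m. norm (blinfun_apply (T n) (x - (\<Sum>i<m. pr N (X i)) - X m))) \<longlonglongrightarrow> norm (blinfun_apply (T n) (x - f))"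
          by (rule tendsto_eq_intros flim Xlim refl)+ simp
        have "norm (blinfun_apply (T n) (x - (\<Sum>i<m. pr N (X i)) - X m)) \<le> (2 * K) * exp (real n * (\<nu> + 5 * e)) * norm x" for m
        proof -
          have "norm (blinfun_apply (T n) (x - (\<Sum>i<m. pr N (X i)) - X m)) \<le> (\<Sum>i<m. norm (blinfun_apply (T n) (Y (X i))))"
            unfolding Xeq blinfun.sum_right by (rule norm_sum)
          also have "\<dots> \<le> (\<Sum>i<m. (1/2) ^ i * (K * exp (real n * (\<nu> + 5 * e)) * norm x))"
          proof (rule sum_mono)
            fix i
            have "norm (blinfun_apply (T n) (Y (X i))) \<le> K * exp (real n * (\<nu> + 5 * e)) * norm (X i)" by (rule Y)
            also have "\<dots> \<le> K * exp (real n * (\<nu> + 5 * e)) * ((1/2) ^ i * norm x)"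
              using K by (intro mult_left_mono nX) auto
            finally show "norm (blinfun_apply (T n) (Y (X i))) \<le> (1/2) ^ i * (K * exp (real n * (\<nu> + 5 * e)) * norm x)"
              by (simp add: mult_ac)
          qed
          also have "\<dots> \<le> (\<Sum>i. (1/2) ^ i * (K * exp (real n * (\<nu> + 5 * e)) * norm x))"
            using K by (intro sum_le_suminf sums_summable[OF hsum]) auto
          also have "\<dots> = 2 * (K * exp (real n * (\<nu> + 5 * e)) * norm x)" by (rule sums_unique[OF hsum, symmetric])
          finally show ?thesis by simp
        qed
        then show "\<exists>M. \<forall>m\<ge>M. norm (blinfun_apply (T n) (x - (\<Sum>i<m. pr N (X i)) - X m)) \<le> (2 * K) * exp (real n * (\<nu> + 5 * e)) * norm x"
          by blast
      qed
      then show ?thesis using fB nf by blast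
    qed
    then show ?thesis using K by (intro exI[of _ "2 * K"]) auto
  qed
  then show ?thesis by blast
qed

text \<open>A priori the constant depends on the vector. By the decomposition it only has to be bounded on the
  finite-dimensional space of slow vectors in \<open>span (B N)\<close>.\<close>

lemma slow_uniform:
  "\<exists>K\<ge>0. \<forall>x\<in>slow. \<forall>n. norm (blinfun_apply (T n) x) \<le> K * exp (real n * (\<nu> + 5 * e)) * norm x"
proof -
  obtain N K where K: "K \<ge> 0" and dec: "\<And>x. \<exists>f\<in>span (B N). norm f \<le> 2 * C * norm x \<and>
     (\<forall>n. norm (blinfun_apply (T n) (x - f)) \<le> K * exp (real n * (\<nu> + 5 * e)) * norm x)"
    using slow_decomp by blast
  have nf: "norm (blinfun_apply (T n) x) * exp (- (real n * (\<nu> + 5 * e))) \<le> c \<longleftrightarrow>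
      norm (blinfun_apply (T n) x) \<le> c * exp (real n * (\<nu> + 5 * e))" for n x c
    unfolding exp_minus by (simp only: divide_inverse[symmetric] pos_divide_le_eq exp_gt_zero)
  have "\<exists>K. \<forall>x\<in>slow \<inter> span (B N). \<forall>n. norm (blinfun_apply (T n) x) * exp (- (real n * (\<nu> + 5 * e))) \<le> K * norm x"
  proof (rule finite_dim_uniform_bound)
    show "subspace (slow \<inter> span (B N))" by (intro subspace_inter slow_subspace subspace_span)
    show "slow \<inter> span (B N) \<subseteq> span (B N)" by blast
    show "finite (B N)" by (rule B_finite)
    show "norm (blinfun_apply (T n) (x + y)) * exp (- (real n * (\<nu> + 5 * e))) \<le>
      norm (blinfun_apply (T n) x) * exp (- (real n * (\<nu> + 5 * e))) + norm (blinfun_apply (T n) y) * exp (- (real n * (\<nu> + 5 * e)))" for n x y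
      unfolding distrib_right[symmetric] blinfun.add_right by (intro mult_right_mono norm_triangle_ineq) auto
    show "norm (blinfun_apply (T n) (c *\<^sub>R x)) * exp (- (real n * (\<nu> + 5 * e))) =
        \<bar>c\<bar> * (norm (blinfun_apply (T n) x) * exp (- (real n * (\<nu> + 5 * e))))" for n c x
      by (simp add: blinfun.scaleR_right)
    show "\<exists>K. \<forall>n. norm (blinfun_apply (T n) x) * exp (- (real n * (\<nu> + 5 * e))) \<le> K" if "x \<in> slow \<inter> span (B N)" for x
      using that unfolding nf slow_def by blast
  qed
  then obtain K' where K': "\<And>x n. x \<in> slow \<Longrightarrow> x \<in> span (B N) \<Longrightarrow> norm (blinfun_apply (T n) x) \<le> K' * norm x * exp (real n * (\<nu> + 5 * e))"
    unfolding nf by blast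
  have "norm (blinfun_apply (T n) x) \<le> (\<bar>K'\<bar> * (2 * C) + K) * exp (real n * (\<nu> + 5 * e)) * norm x" if x: "x \<in> slow" for x n
  proof -
    obtain f where f: "f \<in> span (B N)" "norm f \<le> 2 * C * norm x"
       "\<And>n. norm (blinfun_apply (T n) (x - f)) \<le> K * exp (real n * (\<nu> + 5 * e)) * norm x"
      using dec[of x] by blast
    have "x - f \<in> slow" unfolding slow_def
      using f(3) by (auto intro!: exI[of _ "K * norm x"] simp: mult_ac)
    then have "x - (x - f) \<in> slow" by (rule subspace_diff[OF slow_subspace x])
    then have "f \<in> slow" by simp
    then have "norm (blinfun_apply (T n) f) \<le> K' * norm f * exp (real n * (\<nu> + 5 * e))" using K' f(1) by blast
    also have "\<dots> \<le> \<bar>K'\<bar> * (2 * C * norm x) * exp (real n * (\<nu> + 5 * e))"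
      using f(2) by (intro mult_right_mono mult_mono) auto
    finally have "norm (blinfun_apply (T n) f) \<le> \<bar>K'\<bar> * (2 * C * norm x) * exp (real n * (\<nu> + 5 * e))" .
    moreover have "norm (blinfun_apply (T n) x) \<le> norm (blinfun_apply (T n) f) + norm (blinfun_apply (T n) (x - f))"
      using norm_triangle_ineq[of "blinfun_apply (T n) f" "blinfun_apply (T n) (x - f)"] by (simp add: blinfun.diff_right)
    ultimately show ?thesis using f(3)[of n] by (simp add: algebra_simps)
  qed
  moreover have "\<bar>K'\<bar> * (2 * C) + K \<ge> 0" using K C_ge_1 by simp
  ultimately show ?thesis by blast
qed

lemma closed_slow: "closed slow"
  unfolding closed_sequential_limits
proof (intro allI impI, elim conjE)
  fix x l assume x: "\<forall>i. x i \<in> slow" and l: "x \<longlonglongrightarrow> l"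
  obtain K where K: "\<And>x n. x \<in> slow \<Longrightarrow> norm (blinfun_apply (T n) x) \<le> K * exp (real n * (\<nu> + 5 * e)) * norm x"
    using slow_uniform by blast
  have "norm (blinfun_apply (T n) l) \<le> K * exp (real n * (\<nu> + 5 * e)) * norm l" for n
  proof (rule LIMSEQ_le)
    show "(\<lambda>i. norm (blinfun_apply (T n) (x i))) \<longlonglongrightarrow> norm (blinfun_apply (T n) l)"
      by (intro tendsto_intros l)
    show "(\<lambda>i. K * exp (real n * (\<nu> + 5 * e)) * norm (x i)) \<longlonglongrightarrow> K * exp (real n * (\<nu> + 5 * e)) * norm l"
      by (intro tendsto_intros l)
  qed (use K x in auto)
  then show "l \<in> slow" unfolding slow_def by (auto intro!: exI[of _ "K * norm l"] simp: mult_ac)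
qed

lemma exp_collect: "exp (real n * a) * exp (real n * b) = exp (real n * (a + b))"
  by (simp add: exp_add distrib_left)

lemma exp_decay:
  assumes "a < 0" "d > 0" shows "\<exists>n0. \<forall>n\<ge>n0. c * exp (real n * a) < (d::real)"
proof -
  have "(\<lambda>n. c * exp a ^ n) \<longlonglongrightarrow> c * 0"
    by (intro tendsto_intros LIMSEQ_power_zero) (use assms in simp)
  then have "eventually (\<lambda>n. c * exp a ^ n < d) sequentially"
    using assms(2) by (intro order_tendstoD(2)) auto
  then show ?thesis by (simp add: eventually_sequentially exp_of_nat_mult)
qed

lemma span_B_lower: "f \<in> span (B n) \<Longrightarrow> norm f \<le> C * exp (real n * (- \<mu> + 3 * e)) * norm (blinfun_apply (T n) f)"
  using backward[of 0 n f] T_0 by (simp add: algebra_simps)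

text \<open>A vector of \<open>span (B n)\<close> has expanded too much since time zero to be slow.\<close>

lemma span_B_inter_slow: "\<exists>n0. \<forall>n\<ge>n0. span (B n) \<inter> slow = {0}"
proof -
  obtain K where K: "K \<ge> 0" "\<And>x n. x \<in> slow \<Longrightarrow> norm (blinfun_apply (T n) x) \<le> K * exp (real n * (\<nu> + 5 * e)) * norm x"
    using slow_uniform by blast
  obtain n0 where n0: "\<And>n. n \<ge> n0 \<Longrightarrow> C * K * exp (real n * (- \<mu> + 3 * e + (\<nu> + 5 * e))) < 1"
    using exp_decay[of "- \<mu> + 3 * e + (\<nu> + 5 * e)" 1 "C * K"] gap e_pos by auto
  have "f = 0" if n: "n \<ge> n0" and f: "f \<in> span (B n)" "f \<in> slow" for n f
  proof (rule ccontr)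
    assume "f \<noteq> 0"
    have "norm f \<le> C * exp (real n * (- \<mu> + 3 * e)) * norm (blinfun_apply (T n) f)" by (rule span_B_lower[OF f(1)])
    also have "\<dots> \<le> C * exp (real n * (- \<mu> + 3 * e)) * (K * exp (real n * (\<nu> + 5 * e)) * norm f)"
      using C_ge_1 by (intro mult_left_mono K f) auto
    also have "\<dots> = C * K * exp (real n * (- \<mu> + 3 * e + (\<nu> + 5 * e))) * norm f"
      by (simp only: exp_collect[symmetric] mult_ac)
    also have "\<dots> < 1 * norm f" using n0[OF n] \<open>f \<noteq> 0\<close> by (intro mult_strict_right_mono) auto
    finally show False by simp
  qed
  then show ?thesis using span_zero subspace_0[OF slow_subspace] by blast
qed

lemma slow_complement:
  "\<exists>n0. \<forall>n\<ge>n0. span (B n) \<inter> slow = {0} \<and> (\<forall>x. \<exists>f\<in>span (B n). x - f \<in> slow)"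
proof -
  obtain N0 where N0: "\<And>N. N \<ge> N0 \<Longrightarrow> \<exists>K\<ge>0. \<forall>x. \<exists>f\<in>span (B N). norm f \<le> 2 * C * norm x \<and>
     (\<forall>n. norm (blinfun_apply (T n) (x - f)) \<le> K * exp (real n * (\<nu> + 5 * e)) * norm x)"
    using slow_decomp by blast
  obtain n0 where n0: "\<And>n. n \<ge> n0 \<Longrightarrow> span (B n) \<inter> slow = {0}" using span_B_inter_slow by blast
  have "\<exists>f\<in>span (B n). x - f \<in> slow" if n: "n \<ge> N0" for n x
  proof -
    obtain K f where "f \<in> span (B n)" "\<forall>i. norm (blinfun_apply (T i) (x - f)) \<le> K * exp (real i * (\<nu> + 5 * e)) * norm x"
      using N0[OF n] by blast
    then show ?thesis unfolding slow_def by (auto intro!: bexI[of _ f] exI[of _ "K * norm x"] simp: mult_ac)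
  qed
  then show ?thesis using n0 by (intro exI[of _ "max n0 N0"]) auto
qed

lemma has_codim_slow: "has_codim slow k"
proof -
  obtain n where "span (B n) \<inter> slow = {0}" "\<forall>x. \<exists>f\<in>span (B n). x - f \<in> slow"
    using slow_complement by blast
  moreover have "\<exists>b\<in>span (B n). x - b \<in> slow" for x using calculation by blast
  ultimately show ?thesis unfolding has_codim_def
    using slow_subspace B_finite B_indep B_card by (intro conjI exI[of _ "B n"] allI)
qed

text \<open>At a late time, vectors of \<open>span (B n)\<close> have large images and slow vectors small ones, so that a component along
  \<open>span (B n)\<close> shows in the image unless it is small.\<close>

lemma near_slow:
  assumes "t < \<mu> - 3 * e" "\<eta> > 0"
  shows "\<exists>n0. \<forall>n\<ge>n0. \<forall>x. norm (blinfun_apply (T n) x) \<le> exp (real n * t) * norm x \<longrightarrow> infdist x slow \<le> \<eta> * norm x"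
proof -
  obtain K where K: "K \<ge> 0" "\<And>x n. x \<in> slow \<Longrightarrow> norm (blinfun_apply (T n) x) \<le> K * exp (real n * (\<nu> + 5 * e)) * norm x"
    using slow_uniform by blast
  obtain n1 where n1: "\<And>n x. n \<ge> n1 \<Longrightarrow> \<exists>f\<in>span (B n). x - f \<in> slow" using slow_complement by blast
  obtain n2 where n2: "\<And>n. n \<ge> n2 \<Longrightarrow> C * K * exp (real n * (- \<mu> + 3 * e + (\<nu> + 5 * e))) < min (1/2) (\<eta> / 4)"
    using exp_decay[of "- \<mu> + 3 * e + (\<nu> + 5 * e)" "min (1/2) (\<eta> / 4)" "C * K"] gap e_pos assms(2) by auto
  obtain n3 where n3: "\<And>n. n \<ge> n3 \<Longrightarrow> C * exp (real n * (- \<mu> + 3 * e + t)) < \<eta> / 4"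
    using exp_decay[of "- \<mu> + 3 * e + t" "\<eta> / 4" C] assms by auto
  have "infdist x slow \<le> \<eta> * norm x"
    if n: "n \<ge> max n1 (max n2 n3)" and x: "norm (blinfun_apply (T n) x) \<le> exp (real n * t) * norm x" for n x
  proof -
    let ?\<beta> = "C * K * exp (real n * (- \<mu> + 3 * e + (\<nu> + 5 * e)))"
    let ?\<alpha> = "C * exp (real n * (- \<mu> + 3 * e + t))"
    have b: "?\<beta> < 1/2" "?\<beta> < \<eta> / 4" "?\<alpha> < \<eta> / 4" using n2[of n] n3[of n] n by auto
    obtain f where f: "f \<in> span (B n)" "x - f \<in> slow" using n1 n by (meson max.boundedE)
    have "norm (blinfun_apply (T n) f) \<le> norm (blinfun_apply (T n) x) + norm (blinfun_apply (T n) (x - f))"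
      using norm_triangle_ineq4[of "blinfun_apply (T n) x" "blinfun_apply (T n) (x - f)"] by (simp add: blinfun.diff_right)
    also have "\<dots> \<le> exp (real n * t) * norm x + K * exp (real n * (\<nu> + 5 * e)) * norm (x - f)"
      using x K(2)[OF f(2), of n] by linarith
    also have "\<dots> \<le> exp (real n * t) * norm x + K * exp (real n * (\<nu> + 5 * e)) * (norm x + norm f)"
      using K(1) norm_triangle_ineq4[of x f] by (intro add_left_mono mult_left_mono) auto
    finally have "C * exp (real n * (- \<mu> + 3 * e)) * norm (blinfun_apply (T n) f) \<le> C * exp (real n * (- \<mu> + 3 * e)) *
       (exp (real n * t) * norm x + K * exp (real n * (\<nu> + 5 * e)) * (norm x + norm f))"
      using C_ge_1 by (intro mult_left_mono) auto
    also have "\<dots> = ?\<alpha> * norm x + ?\<beta> * (norm x + norm f)"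
      unfolding exp_collect[of n "- \<mu> + 3 * e", symmetric] by (simp only: distrib_left mult_ac)
    finally have "norm f \<le> ?\<alpha> * norm x + ?\<beta> * norm x + ?\<beta> * norm f"
      using span_B_lower[OF f(1)] by (simp add: distrib_left)
    moreover have "?\<beta> * norm f \<le> 1/2 * norm f" using b by (intro mult_right_mono) auto
    moreover have "?\<beta> * norm x \<le> \<eta> / 4 * norm x" by (rule mult_right_mono[OF less_imp_le[OF b(2)] norm_ge_zero])
    moreover have "?\<alpha> * norm x \<le> \<eta> / 4 * norm x" by (rule mult_right_mono[OF less_imp_le[OF b(3)] norm_ge_zero])
    ultimately have nf: "norm f \<le> \<eta> * norm x" by linarith
    have "infdist x slow \<le> dist x (x - f)" by (rule infdist_le[OF f(2)])
    then show ?thesis using nf by (simp add: dist_norm)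
  qed
  then show ?thesis by blast
qed

end

section \<open>Ergodic theorems\<close>

locale ergodic_map = prob_space M for M :: "'o measure" +
  fixes \<sigma> :: "'o \<Rightarrow> 'o"
  assumes \<sigma>_meas [measurable]: "\<sigma> \<in> measurable M M"
    and \<sigma>_pres: "\<And>A. A \<in> sets M \<Longrightarrow> emeasure M (\<sigma> -` A \<inter> space M) = emeasure M A"
    and \<sigma>_erg: "\<And>A. A \<in> sets M \<Longrightarrow> \<sigma> -` A \<inter> space M = A \<Longrightarrow> prob A = 0 \<or> prob A = 1"
begin

lemma pow_meas [measurable]: "(\<sigma> ^^ n) \<in> measurable M M"
  by (induction n) (auto intro: measurable_compose)

lemma \<sigma>_space: "\<omega> \<in> space M \<Longrightarrow> \<sigma> \<omega> \<in> space M"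
  by (rule measurable_space[OF \<sigma>_meas])

lemma pow_space: "\<omega> \<in> space M \<Longrightarrow> (\<sigma> ^^ n) \<omega> \<in> space M"
  by (rule measurable_space[OF pow_meas])

lemma distr_\<sigma>: "distr M M \<sigma> = M"
  by (rule measure_eqI) (auto simp: emeasure_distr \<sigma>_pres)

lemma distr_pow: "distr M M (\<sigma> ^^ n) = M"
proof (induction n)
  case (Suc n)
  have "distr M M (\<sigma> ^^ Suc n) = distr (distr M M (\<sigma> ^^ n)) M \<sigma>"
    by (simp add: distr_distr)
  then show ?case by (simp only: Suc distr_\<sigma>)
qed (simp add: distr_id id_def)

lemma integrable_pow: "integrable M f \<Longrightarrow> integrable M (\<lambda>\<omega>. f ((\<sigma> ^^ n) \<omega>) :: real)"
  using integrable_distr[OF pow_meas, where f = f] by (simp add: distr_pow)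

lemma integral_pow:
  fixes f :: "'o \<Rightarrow> real"
  assumes "integrable M f" shows "(\<integral>\<omega>. f ((\<sigma> ^^ n) \<omega>) \<partial>M) = (\<integral>\<omega>. f \<omega> \<partial>M)"
  using integral_distr[OF pow_meas, where f = f, of n] assms by (simp add: distr_pow)

lemma AE_pow:
  assumes "AE \<omega> in M. P \<omega>" shows "AE \<omega> in M. \<forall>n. P ((\<sigma> ^^ n) \<omega>)"
proof -
  have "AE \<omega> in M. P ((\<sigma> ^^ n) \<omega>)" for n
  proof (rule AE_distrD[OF pow_meas])
    show "AE \<omega> in distr M M (\<sigma> ^^ n). P \<omega>" unfolding distr_pow by (rule assms)
  qed
  then show ?thesis by (simp add: AE_all_countable)
qed

lemma prob_vimage_pow: "A \<in> sets M \<Longrightarrow> prob ((\<sigma> ^^ n) -` A \<inter> space M) = prob A"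
  using measure_distr[OF pow_meas, where S = A, of n] by (simp add: distr_pow)

text \<open>The preimages of a set containing its own preimage decrease to a strictly invariant set of the
  same probability.\<close>

lemma zero_one_subinvariant:
  assumes E [measurable]: "E \<in> sets M" and sub: "\<sigma> -` E \<inter> space M \<subseteq> E"
  shows "prob E = 0 \<or> prob E = 1"
proof -
  define F where "F n = (\<sigma> ^^ n) -` E \<inter> space M" for n
  have Fm: "F n \<in> sets M" for n unfolding F_def by measurable
  have dec: "F (Suc n) \<subseteq> F n" for n
    using sub pow_space by (auto simp: F_def)
  then have decF: "decseq F" by (rule decseq_SucI)
  have "prob (F n) = prob E" for n unfolding F_def by (rule prob_vimage_pow[OF E])
  moreover have "(\<lambda>n. prob (F n)) \<longlonglongrightarrow> prob (\<Inter>n. F n)"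
    using Fm decF by (intro finite_Lim_measure_decseq) auto
  ultimately have pE: "prob (\<Inter>n. F n) = prob E"
    by (simp add: LIMSEQ_const_iff)
  have "\<sigma> -` (\<Inter>n. F n) \<inter> space M = (\<Inter>n. F (Suc n))"
    by (auto simp: F_def funpow_swap1 \<sigma>_space)
  also have "\<dots> = (\<Inter>n. F n)" using dec by (auto simp: subset_iff)
  finally have "\<sigma> -` (\<Inter>n. F n) \<inter> space M = (\<Inter>n. F n)" .
  moreover have "(\<Inter>n. F n) \<in> sets M" using Fm by auto
  ultimately show ?thesis using \<sigma>_erg pE by metis
qed

definition bsum :: "('o \<Rightarrow> real) \<Rightarrow> nat \<Rightarrow> 'o \<Rightarrow> real" where
  "bsum h n \<omega> = (\<Sum>j<n. h ((\<sigma> ^^ j) \<omega>))"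

text \<open>The maximum of \<open>bsum h i\<close> over \<open>i \<le> n\<close>.\<close>

primrec bmax :: "('o \<Rightarrow> real) \<Rightarrow> nat \<Rightarrow> 'o \<Rightarrow> real" where
  "bmax h 0 \<omega> = 0"
| "bmax h (Suc n) \<omega> = max 0 (h \<omega> + bmax h n (\<sigma> \<omega>))"

lemma bsum_Suc_left: "bsum h (Suc n) \<omega> = h \<omega> + bsum h n (\<sigma> \<omega>)"
  unfolding bsum_def by (subst sum.lessThan_Suc_shift) (simp add: funpow_swap1)

lemma bsum_shift: "bsum h i ((\<sigma> ^^ n) \<omega>) = bsum h (n + i) \<omega> - bsum h n \<omega>"
proof -
  have "bsum h (n + i) \<omega> = bsum h n \<omega> + bsum h i ((\<sigma> ^^ n) \<omega>)"
    by (induction i) (auto simp: bsum_def funpow_add add.commute)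
  then show ?thesis by simp
qed

lemma bmax_nonneg: "bmax h n \<omega> \<ge> 0"
  by (cases n) auto

lemma bmax_mono: "bmax h n \<omega> \<le> bmax h (Suc n) \<omega>"
proof (induction n arbitrary: \<omega>)
  case (Suc n)
  have "h \<omega> + bmax h n (\<sigma> \<omega>) \<le> h \<omega> + bmax h (Suc n) (\<sigma> \<omega>)"
    using Suc.IH[of "\<sigma> \<omega>"] by (rule add_left_mono)
  then have "max 0 (h \<omega> + bmax h n (\<sigma> \<omega>)) \<le> max 0 (h \<omega> + bmax h (Suc n) (\<sigma> \<omega>))"
    by (rule max.mono[OF order_refl])
  then show ?case by (simp only: bmax.simps)
qed simp

lemma bsum_le_bmax: "bsum h n \<omega> \<le> bmax h n \<omega>"
proof (induction n arbitrary: \<omega>)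
  case (Suc n)
  then show ?case using Suc.IH[of "\<sigma> \<omega>"] unfolding bsum_Suc_left bmax.simps by linarith
qed (simp add: bsum_def)

lemma bmax_integrable: "integrable M h \<Longrightarrow> integrable M (bmax h n)"
proof (induction n)
  case (Suc n)
  have "integrable M (\<lambda>\<omega>. bmax h n (\<sigma> \<omega>))"
    using integrable_pow[OF Suc.IH[OF Suc.prems], of 1] by simp
  then have "integrable M (\<lambda>\<omega>. max 0 (h \<omega> + bmax h n (\<sigma> \<omega>)))"
    using Suc.prems by (intro integrable_max) auto
  then show ?case by simp
next
  case 0
  have "bmax h 0 = (\<lambda>\<omega>. 0)" by (simp add: fun_eq_iff)
  then show ?case by simp
qed

text \<open>The maximum \<open>bmax h n\<close> of the first partial sums satisfies
  \<open>bmax h (n + 1) - bmax h n \<circ> \<sigma> = max h (- bmax h n \<circ> \<sigma>)\<close>. The left side has nonnegative integral;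
  if the maxima were unbounded, which is an invariant event, then the right side would tend to \<open>h\<close>,
  whose integral is negative.\<close>

lemma bsum_bounded_above:
  assumes h: "integrable M h" and neg: "(\<integral>\<omega>. h \<omega> \<partial>M) < 0"
  shows "AE \<omega> in M. \<exists>K. \<forall>n. bsum h n \<omega> \<le> K"
proof -
  have hm [measurable]: "h \<in> borel_measurable M" using h by simp
  have bm [measurable]: "bmax h n \<in> borel_measurable M" for n using bmax_integrable[OF h] by simp
  define A where "A = {\<omega> \<in> space M. \<forall>K::nat. \<exists>n. bmax h n \<omega> > real K}"
  have Am: "A \<in> sets M" unfolding A_def by measurable
  have inv: "\<sigma> -` A \<inter> space M = A"
  proof (intro equalityI subsetI)
    fix \<omega> assume w: "\<omega> \<in> \<sigma> -` A \<inter> space M"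
    have "\<exists>n. bmax h n \<omega> > real K" for K
    proof -
      obtain K' :: nat where K': "real K' > real K + \<bar>h \<omega>\<bar>" using reals_Archimedean2 by blast
      obtain n where "bmax h n (\<sigma> \<omega>) > real K'" using w by (auto simp: A_def)
      then have "bmax h (Suc n) \<omega> > real K" using K' by auto
      then show ?thesis by blast
    qed
    then show "\<omega> \<in> A" using w by (auto simp: A_def)
  next
    fix \<omega> assume w: "\<omega> \<in> A"
    have "\<exists>n. bmax h n (\<sigma> \<omega>) > real K" for K
    proof -
      obtain K' :: nat where K': "real K' > real K + \<bar>h \<omega>\<bar>" using reals_Archimedean2 by blast
      obtain n where n: "bmax h n \<omega> > real K'" using w by (auto simp: A_def)
      then have "n \<noteq> 0" by (cases n) auto
      then obtain m where "n = Suc m" by (cases n) auto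
      then have "bmax h m (\<sigma> \<omega>) > real K" using n K' by auto
      then show ?thesis by blast
    qed
    then show "\<omega> \<in> \<sigma> -` A \<inter> space M" using w \<sigma>_space by (auto simp: A_def)
  qed
  have "prob A \<noteq> 1"
  proof
    assume "prob A = 1"
    then have AE: "AE \<omega> in M. \<omega> \<in> A" using Am by (simp add: AE_in_set_eq_1)
    define D where "D n \<omega> = bmax h (Suc n) \<omega> - bmax h n (\<sigma> \<omega>)" for n \<omega>
    have int\<sigma>: "integrable M (\<lambda>\<omega>. bmax h n (\<sigma> \<omega>))" for n
      using integrable_pow[OF bmax_integrable[OF h], of n 1] by simp
    have D0: "(\<integral>\<omega>. D n \<omega> \<partial>M) \<ge> 0" for n
    proof -
      have "(\<integral>\<omega>. D n \<omega> \<partial>M) = (\<integral>\<omega>. bmax h (Suc n) \<omega> \<partial>M) - (\<integral>\<omega>. bmax h n (\<sigma> \<omega>) \<partial>M)"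
        unfolding D_def by (intro Bochner_Integration.integral_diff bmax_integrable h int\<sigma>)
      also have "(\<integral>\<omega>. bmax h n (\<sigma> \<omega>) \<partial>M) = (\<integral>\<omega>. bmax h n \<omega> \<partial>M)"
        using integral_pow[OF bmax_integrable[OF h], of n 1] by simp
      finally show ?thesis
        using integral_mono[OF bmax_integrable[OF h, of n] bmax_integrable[OF h, of "Suc n"] bmax_mono] by simp
    qed
    have Deq: "D n \<omega> = max (- bmax h n (\<sigma> \<omega>)) (h \<omega>)" for n \<omega> by (auto simp: D_def max_def)
    have "(\<lambda>n. \<integral>\<omega>. D n \<omega> \<partial>M) \<longlonglongrightarrow> (\<integral>\<omega>. h \<omega> \<partial>M)"
    proof (rule integral_dominated_convergence[where w = "\<lambda>\<omega>. \<bar>h \<omega>\<bar>"])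
      show "AE \<omega> in M. (\<lambda>n. D n \<omega>) \<longlonglongrightarrow> h \<omega>"
        using AE
      proof eventually_elim
        case (elim \<omega>)
        then have "\<sigma> \<omega> \<in> A" using inv by blast
        obtain K :: nat where K: "real K > \<bar>h \<omega>\<bar>" using reals_Archimedean2 by blast
        obtain n0 where n0: "bmax h n0 (\<sigma> \<omega>) > real K" using \<open>\<sigma> \<omega> \<in> A\<close> by (auto simp: A_def)
        have "D n \<omega> = h \<omega>" if "n \<ge> n0" for n
        proof -
          have "bmax h n0 (\<sigma> \<omega>) \<le> bmax h n (\<sigma> \<omega>)"
            using that by (rule lift_Suc_mono_le[where f = "\<lambda>n. bmax h n (\<sigma> \<omega>)", OF bmax_mono])
          then show ?thesis using n0 K unfolding Deq by auto
        qed
        then show ?case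
          by (intro tendsto_eventually) (auto simp: eventually_sequentially)
      qed
      show "AE \<omega> in M. norm (D n \<omega>) \<le> \<bar>h \<omega>\<bar>" for n
      proof (rule AE_I2)
        fix \<omega>
        show "norm (D n \<omega>) \<le> \<bar>h \<omega>\<bar>"
          using bmax_nonneg[of h n "\<sigma> \<omega>"] unfolding Deq by (auto simp: max_def)
      qed
      show "D n \<in> borel_measurable M" for n
        unfolding D_def by measurable
    qed (use h in auto)
    then have "(\<integral>\<omega>. h \<omega> \<partial>M) \<ge> 0" by (rule LIMSEQ_le_const) (use D0 in auto)
    then show False using neg by simp
  qed
  then have "prob A = 0" using \<sigma>_erg[OF Am inv] by blast
  then have "AE \<omega> in M. \<omega> \<notin> A" using Am by (simp add: prob_eq_0)
  then show ?thesis using AE_space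
  proof eventually_elim
    case (elim \<omega>)
    then obtain K :: nat where K: "\<And>n. bmax h n \<omega> \<le> real K" by (auto simp: A_def not_less)
    have "bsum h n \<omega> \<le> real K" for n using bsum_le_bmax[of h n \<omega>] K[of n] by linarith
    then show ?case by blast
  qed
qed

text \<open>The two bounds follow from the boundedness of the sums of \<open>h\<close> and \<open>- h\<close>, shifted to have negative mean. A
  bound at all times with a constant that depends on the orbit, rather than a limit, is what can be
  transferred to orbit segments with an arbitrary starting time.\<close>

theorem birkhoff:
  assumes h: "integrable M h"
  shows "AE \<omega> in M. \<forall>\<epsilon>>0. \<exists>C\<ge>0. \<forall>n. \<bar>bsum h n \<omega> - real n * (\<integral>\<omega>. h \<omega> \<partial>M)\<bar> \<le> C + \<epsilon> * real n"
proof -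
  have up: "AE \<omega> in M. \<exists>K. \<forall>n. bsum h n \<omega> - real n * (\<integral>\<omega>. h \<omega> \<partial>M) \<le> K + \<epsilon> * real n"
    if h: "integrable M h" and e: "\<epsilon> > 0" for h and \<epsilon> :: real
  proof -
    let ?I = "\<integral>\<omega>. h \<omega> \<partial>M"
    have "(\<integral>\<omega>. h \<omega> - (?I + \<epsilon>) \<partial>M) < 0" using h e by (simp add: prob_space)
    moreover have "integrable M (\<lambda>\<omega>. h \<omega> - (?I + \<epsilon>))" using h by simp
    ultimately have "AE \<omega> in M. \<exists>K. \<forall>n. bsum (\<lambda>\<omega>. h \<omega> - (?I + \<epsilon>)) n \<omega> \<le> K" by (intro bsum_bounded_above)
    then show ?thesis
      by (rule AE_mp) (auto simp: bsum_def sum_subtractf algebra_simps)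
  qed
  have "AE \<omega> in M. \<forall>i::nat. \<exists>K. \<forall>n. \<bar>bsum h n \<omega> - real n * (\<integral>\<omega>. h \<omega> \<partial>M)\<bar> \<le> K + 1 / real (Suc i) * real n"
    unfolding AE_all_countable
  proof
    fix i :: nat
    have pos: "1 / real (Suc i) > 0" by simp
    have "integrable M (\<lambda>\<omega>. - h \<omega>)" using h by simp
    from up[OF h pos] up[OF this pos]
    show "AE \<omega> in M. \<exists>K. \<forall>n. \<bar>bsum h n \<omega> - real n * (\<integral>\<omega>. h \<omega> \<partial>M)\<bar> \<le> K + 1 / real (Suc i) * real n"
    proof eventually_elim
      case (elim \<omega>)
      then obtain K K' where K: "\<And>n. bsum h n \<omega> - real n * (\<integral>\<omega>. h \<omega> \<partial>M) \<le> K + 1 / real (Suc i) * real n"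
        "\<And>n. bsum (\<lambda>\<omega>. - h \<omega>) n \<omega> - real n * (\<integral>\<omega>. - h \<omega> \<partial>M) \<le> K' + 1 / real (Suc i) * real n"
        by blast
      have "\<bar>bsum h n \<omega> - real n * (\<integral>\<omega>. h \<omega> \<partial>M)\<bar> \<le> max K K' + 1 / real (Suc i) * real n" for n
        using K(1)[of n] K(2)[of n] by (simp add: bsum_def sum_negf abs_le_iff max_def split: if_splits)
      then show ?case by blast
    qed
  qed
  then show ?thesis
  proof eventually_elim
    case (elim \<omega>)
    show ?case
    proof (intro allI impI)
      fix \<epsilon> :: real assume "\<epsilon> > 0"
      then obtain i :: nat where i: "1 / real (Suc i) < \<epsilon>" using nat_approx_posE by blast
      obtain K where K: "\<And>n. \<bar>bsum h n \<omega> - real n * (\<integral>\<omega>. h \<omega> \<partial>M)\<bar> \<le> K + 1 / real (Suc i) * real n"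
        using elim by blast
      have "\<bar>bsum h n \<omega> - real n * (\<integral>\<omega>. h \<omega> \<partial>M)\<bar> \<le> \<bar>K\<bar> + \<epsilon> * real n" for n
      proof -
        have "1 / real (Suc i) * real n \<le> \<epsilon> * real n" using i by (intro mult_right_mono) auto
        then show ?thesis using K[of n] by linarith
      qed
      then show "\<exists>C\<ge>0. \<forall>n. \<bar>bsum h n \<omega> - real n * (\<integral>\<omega>. h \<omega> \<partial>M)\<bar> \<le> C + \<epsilon> * real n"
        by (intro exI[of _ "\<bar>K\<bar>"]) auto
    qed
  qed
qed

text \<open>The terms are differences of successive sums.\<close>

corollary tempered:
  assumes h: "integrable M h"
  shows "AE \<omega> in M. \<forall>\<epsilon>>0. \<exists>C\<ge>0. \<forall>n. \<bar>h ((\<sigma> ^^ n) \<omega>)\<bar> \<le> C + \<epsilon> * real n"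
proof -
  have "integrable M (\<lambda>\<omega>. \<bar>h \<omega>\<bar>)" using h by simp
  from birkhoff[OF this] show ?thesis
  proof eventually_elim
    case (elim \<omega>)
    show ?case
    proof (intro allI impI)
      fix \<epsilon> :: real assume "\<epsilon> > 0"
      then have e4: "\<epsilon> / 4 > 0" by simp
      let ?I = "\<integral>\<omega>. \<bar>h \<omega>\<bar> \<partial>M" and ?S = "\<lambda>n. bsum (\<lambda>\<omega>. \<bar>h \<omega>\<bar>) n \<omega>"
      obtain C where C: "C \<ge> 0" "\<And>n. \<bar>?S n - real n * ?I\<bar> \<le> C + \<epsilon> / 4 * real n"
        using elim e4 by blast
      have "\<bar>h ((\<sigma> ^^ n) \<omega>)\<bar> \<le> (2 * C + \<epsilon> + ?I) + \<epsilon> * real n" for n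
      proof -
        have "?S (Suc n) = ?S n + \<bar>h ((\<sigma> ^^ n) \<omega>)\<bar>" by (simp add: bsum_def)
        moreover have "real (Suc n) * ?I = real n * ?I + ?I" by (simp add: distrib_right)
        moreover have "\<epsilon> / 4 * real (Suc n) = \<epsilon> / 4 * real n + \<epsilon> / 4" by (simp add: distrib_left)
        moreover have "\<epsilon> / 4 * real n = \<epsilon> * real n / 4" by simp
        moreover have "\<epsilon> * real n \<ge> 0" using \<open>\<epsilon> > 0\<close> by simp
        ultimately show ?thesis using C(2)[of n] C(2)[of "Suc n"] \<open>\<epsilon> > 0\<close> by linarith
      qed
      moreover have "?I \<ge> 0" by simp
      ultimately show "\<exists>C\<ge>0. \<forall>n. \<bar>h ((\<sigma> ^^ n) \<omega>)\<bar> \<le> C + \<epsilon> * real n"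
        using C(1) \<open>\<epsilon> > 0\<close> by (intro exI[of _ "2 * C + \<epsilon> + ?I"]) auto
    qed
  qed
qed

end

subsection \<open>Subadditive processes\<close>

text \<open>The linear lower bound keeps all means and the limit finite; the general case is reduced to it by truncation.\<close>

locale subadditive_process = ergodic_map M \<sigma> for M :: "'o measure" and \<sigma> +
  fixes f :: "nat \<Rightarrow> 'o \<Rightarrow> real" and b :: real
  assumes f_int: "\<And>n. integrable M (f n)"
    and f_sub: "\<And>n m \<omega>. \<omega> \<in> space M \<Longrightarrow> f (n + m) \<omega> \<le> f n \<omega> + f m ((\<sigma> ^^ n) \<omega>)"
    and f_0: "\<And>\<omega>. \<omega> \<in> space M \<Longrightarrow> f 0 \<omega> = 0"
    and f_lower: "\<And>n \<omega>. \<omega> \<in> space M \<Longrightarrow> - b * real n \<le> f n \<omega>"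
begin

lemma f_meas [measurable]: "f n \<in> borel_measurable M"
  using f_int by simp

definition \<gamma> :: real where "\<gamma> = (INF n\<in>{1..}. (\<integral>\<omega>. f n \<omega> \<partial>M) / real n)"

lemma mean_lower: "n \<ge> 1 \<Longrightarrow> - b \<le> (\<integral>\<omega>. f n \<omega> \<partial>M) / real n"
proof -
  assume n: "n \<ge> 1"
  have "(\<integral>\<omega>. - b * real n \<partial>M) \<le> (\<integral>\<omega>. f n \<omega> \<partial>M)"
    by (intro integral_mono f_int f_lower) auto
  then show ?thesis using n by (simp add: prob_space field_simps)
qed

lemma \<gamma>_le: "n \<ge> 1 \<Longrightarrow> \<gamma> \<le> (\<integral>\<omega>. f n \<omega> \<partial>M) / real n"
  unfolding \<gamma>_def by (intro cINF_lower bdd_belowI2[of _ "- b"] mean_lower) auto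

lemma \<gamma>_approx: "\<gamma> < c \<Longrightarrow> \<exists>n\<ge>1. (\<integral>\<omega>. f n \<omega> \<partial>M) / real n < c"
  unfolding \<gamma>_def by (subst (asm) cINF_less_iff) (auto intro!: bdd_belowI2[of _ "- b"] mean_lower)

text \<open>By subadditivity, multiples of \<open>n\<close> do at least as well as \<open>n\<close>.\<close>

lemma \<gamma>_approx_large:
  assumes "\<gamma> < c" shows "\<exists>n\<ge>N. n \<ge> 1 \<and> (\<integral>\<omega>. f n \<omega> \<partial>M) / real n < c"
proof -
  obtain n where n: "n \<ge> 1" "(\<integral>\<omega>. f n \<omega> \<partial>M) / real n < c" using \<gamma>_approx[OF assms] by blast
  have sub: "(\<integral>\<omega>. f (q * n) \<omega> \<partial>M) \<le> real q * (\<integral>\<omega>. f n \<omega> \<partial>M)" for q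
  proof (induction q)
    case 0
    have "(\<integral>\<omega>. f 0 \<omega> \<partial>M) = (\<integral>\<omega>. 0 \<partial>M)" by (rule Bochner_Integration.integral_cong) (auto simp: f_0)
    then show ?case by simp
  next
    case (Suc q)
    have "(\<integral>\<omega>. f (Suc q * n) \<omega> \<partial>M) \<le> (\<integral>\<omega>. f n \<omega> + f (q * n) ((\<sigma> ^^ n) \<omega>) \<partial>M)"
      using f_sub[of _ n "q * n"] by (intro integral_mono f_int Bochner_Integration.integrable_add integrable_pow) auto
    also have "\<dots> = (\<integral>\<omega>. f n \<omega> \<partial>M) + (\<integral>\<omega>. f (q * n) \<omega> \<partial>M)"
      using integral_pow[OF f_int[of "q * n"], of n]
      by (subst Bochner_Integration.integral_add) (auto intro!: f_int integrable_pow)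
    finally show ?case using Suc.IH by (simp add: distrib_right)
  qed
  let ?q = "Suc N"
  have "(\<integral>\<omega>. f (?q * n) \<omega> \<partial>M) / real (?q * n) \<le> real ?q * (\<integral>\<omega>. f n \<omega> \<partial>M) / real (?q * n)"
    by (intro divide_right_mono sub) simp
  also have "\<dots> = (\<integral>\<omega>. f n \<omega> \<partial>M) / real n" by (simp del: of_nat_Suc mult_Suc)
  also have "\<dots> < c" by (rule n)
  finally have "(\<integral>\<omega>. f (?q * n) \<omega> \<partial>M) / real (?q * n) < c" .
  moreover have "?q * n \<ge> N" "?q * n \<ge> 1" using n(1) mult_le_mono2[of 1 n "Suc N"] by auto
  ultimately show ?thesis by blast
qed

definition p :: "'o \<Rightarrow> real" where "p \<omega> = max 0 (f 1 \<omega>)"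

lemma p_nonneg: "p \<omega> \<ge> 0" by (simp add: p_def)
lemma p_int: "integrable M p"
  unfolding p_def[abs_def] using f_int[of 1] by (intro integrable_max) auto
lemma p_meas [measurable]: "p \<in> borel_measurable M" using p_int by simp

lemma f_le_bsum_p: "\<omega> \<in> space M \<Longrightarrow> f n \<omega> \<le> bsum p n \<omega>"
proof (induction n)
  case (Suc n)
  have "f (n + 1) \<omega> \<le> f n \<omega> + f 1 ((\<sigma> ^^ n) \<omega>)" by (rule f_sub[OF Suc.prems])
  moreover have "f 1 ((\<sigma> ^^ n) \<omega>) \<le> p ((\<sigma> ^^ n) \<omega>)" by (simp add: p_def)
  ultimately show ?case using Suc by (simp add: bsum_def)
qed (simp add: f_0 bsum_def)

text \<open>The sums of \<open>n0\<close> consecutive terms of the process increase by at most \<open>f n0\<close> along the orbit,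
  so the process is dominated by a Birkhoff sum up to boundary terms.\<close>

lemma f_le_block_sum:
  assumes w: "\<omega> \<in> space M"
  shows "real n0 * f (i + n0) \<omega> \<le> bsum (f n0) i \<omega> + real n0 * (bsum p n0 \<omega> + bsum p n0 ((\<sigma> ^^ i) \<omega>))"
proof -
  have bmon: "bsum p s v \<le> bsum p t v" if "s \<le> t" for s t v
    unfolding bsum_def using that by (intro sum_mono2) (auto simp: p_nonneg)
  have \<Phi>: "(\<Sum>s<n0. f (i + s) \<omega>) \<le> (\<Sum>s<n0. f s \<omega>) + bsum (f n0) i \<omega>" for i
  proof (induction i)
    case (Suc i)
    have "(\<Sum>s<n0. f (Suc i + s) \<omega>) + f i \<omega> = (\<Sum>s<Suc n0. f (i + s) \<omega>)"
      by (subst sum.lessThan_Suc_shift) simp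
    also have "\<dots> = (\<Sum>s<n0. f (i + s) \<omega>) + f (i + n0) \<omega>" by simp
    also have "f (i + n0) \<omega> \<le> f i \<omega> + f n0 ((\<sigma> ^^ i) \<omega>)" by (rule f_sub[OF w])
    finally show ?case using Suc by (simp add: bsum_def)
  qed (simp add: bsum_def)
  have "real n0 * f (i + n0) \<omega> = (\<Sum>s<n0. f (i + n0) \<omega>)" by simp
  also have "\<dots> \<le> (\<Sum>s<n0. f (i + s) \<omega> + bsum p n0 ((\<sigma> ^^ i) \<omega>))"
  proof (rule sum_mono)
    fix s assume s: "s \<in> {..<n0}"
    have "f (i + n0) \<omega> \<le> f (i + s) \<omega> + f (n0 - s) ((\<sigma> ^^ (i + s)) \<omega>)"
      using f_sub[OF w, of "i + s" "n0 - s"] s by simp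
    also have "f (n0 - s) ((\<sigma> ^^ (i + s)) \<omega>) \<le> bsum p (n0 - s) ((\<sigma> ^^ (i + s)) \<omega>)"
      by (intro f_le_bsum_p pow_space w)
    also have "\<dots> = bsum p (n0 - s) ((\<sigma> ^^ s) ((\<sigma> ^^ i) \<omega>))" by (subst add.commute) (simp add: funpow_add)
    also have "\<dots> = bsum p n0 ((\<sigma> ^^ i) \<omega>) - bsum p s ((\<sigma> ^^ i) \<omega>)"
      unfolding bsum_shift using s by simp
    also have "\<dots> \<le> bsum p n0 ((\<sigma> ^^ i) \<omega>)" using bmon[of 0 s] by (simp add: bsum_def)
    finally show "f (i + n0) \<omega> \<le> f (i + s) \<omega> + bsum p n0 ((\<sigma> ^^ i) \<omega>)" by simp
  qed
  also have "\<dots> = (\<Sum>s<n0. f (i + s) \<omega>) + real n0 * bsum p n0 ((\<sigma> ^^ i) \<omega>)" by (simp add: sum.distrib)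
  also have "\<dots> \<le> (\<Sum>s<n0. f s \<omega>) + bsum (f n0) i \<omega> + real n0 * bsum p n0 ((\<sigma> ^^ i) \<omega>)" using \<Phi> by simp
  also have "(\<Sum>s<n0. f s \<omega>) \<le> (\<Sum>s<n0. bsum p n0 \<omega>)"
    by (intro sum_mono order_trans[OF f_le_bsum_p[OF w] bmon]) auto
  also have "(\<Sum>s<n0. bsum p n0 \<omega>) = real n0 * bsum p n0 \<omega>" by simp
  finally show ?thesis by (simp add: distrib_left)
qed

text \<open>The process on the orbit segment from time \<open>n\<close> to \<open>n + i\<close> is dominated by a Birkhoff sum over this segment.
  As the difference of two sums from time zero, it has an error of at most \<open>\<epsilon> (n + i)\<close> up to a constant.\<close>

theorem uniform_upper:
  "AE \<omega> in M. \<forall>\<epsilon>>0. \<exists>C. \<forall>n i. f i ((\<sigma> ^^ n) \<omega>) \<le> C + real i * \<gamma> + \<epsilon> * real (n + i)"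
proof -
  have "AE \<omega> in M. \<forall>n0. \<forall>\<epsilon>>0. \<exists>C\<ge>0. \<forall>n. \<bar>bsum (f n0) n \<omega> - real n * (\<integral>\<omega>. f n0 \<omega> \<partial>M)\<bar> \<le> C + \<epsilon> * real n"
    unfolding AE_all_countable by (intro allI birkhoff f_int)
  then show ?thesis using tempered[OF p_int] AE_space
  proof eventually_elim
    case (elim \<omega>)
    note w = elim(3)
    show ?case
    proof (intro allI impI)
      fix \<epsilon> :: real assume e: "\<epsilon> > 0"
      then have "\<gamma> < \<gamma> + \<epsilon> / 4" by simp
      then obtain n0 where n0: "n0 \<ge> 1" "(\<integral>\<omega>. f n0 \<omega> \<partial>M) / real n0 < \<gamma> + \<epsilon> / 4" using \<gamma>_approx by blast
      let ?g = "\<integral>\<omega>. f n0 \<omega> \<partial>M"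
      have "\<epsilon> / 8 > 0" "\<epsilon> / (8 * real n0) > 0" using e n0 by auto
      then obtain C1 C2 where C1: "C1 \<ge> 0" "\<And>n. \<bar>bsum (f n0) n \<omega> - real n * ?g\<bar> \<le> C1 + \<epsilon> / 8 * real n"
        and C2: "C2 \<ge> 0" "\<And>n. \<bar>p ((\<sigma> ^^ n) \<omega>)\<bar> \<le> C2 + \<epsilon> / (8 * real n0) * real n"
        using elim(1,2) by meson
      have bp: "bsum p t ((\<sigma> ^^ u) \<omega>) \<le> real n0 * C2 + \<epsilon> / 8 * real v" if "u + t \<le> v" "t \<le> n0" for t u v
      proof -
        have "bsum p t ((\<sigma> ^^ u) \<omega>) \<le> (\<Sum>l<t. C2 + \<epsilon> / (8 * real n0) * real v)"
          unfolding bsum_def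
        proof (rule sum_mono)
          fix l assume l: "l \<in> {..<t}"
          have "p ((\<sigma> ^^ l) ((\<sigma> ^^ u) \<omega>)) = p ((\<sigma> ^^ (l + u)) \<omega>)" by (simp add: funpow_add)
          also have "\<dots> \<le> C2 + \<epsilon> / (8 * real n0) * real (l + u)" using C2(2)[of "l + u"] by linarith
          also have "\<dots> \<le> C2 + \<epsilon> / (8 * real n0) * real v"
            using l that e by (intro add_left_mono mult_left_mono) auto
          finally show "p ((\<sigma> ^^ l) ((\<sigma> ^^ u) \<omega>)) \<le> C2 + \<epsilon> / (8 * real n0) * real v" .
        qed
        also have "\<dots> = real t * (C2 + \<epsilon> / (8 * real n0) * real v)" by simp
        also have "\<dots> \<le> real n0 * (C2 + \<epsilon> / (8 * real n0) * real v)"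
          using that C2 e by (intro mult_right_mono) auto
        also have "\<dots> = real n0 * C2 + \<epsilon> / 8 * real v" using n0 by (simp add: field_simps)
        finally show ?thesis .
      qed
      define C where "C = 2 * C1 + 2 * real n0 * C2 + real n0 * \<bar>\<gamma>\<bar>"
      have "f i ((\<sigma> ^^ n) \<omega>) \<le> C + real i * \<gamma> + \<epsilon> * real (n + i)" for n i
      proof (cases "i < n0")
        case True
        have "f i ((\<sigma> ^^ n) \<omega>) \<le> bsum p i ((\<sigma> ^^ n) \<omega>)" by (intro f_le_bsum_p pow_space w)
        also have "\<dots> \<le> real n0 * C2 + \<epsilon> / 8 * real (n + i)" using True by (intro bp) auto
        finally have 1: "f i ((\<sigma> ^^ n) \<omega>) \<le> real n0 * C2 + \<epsilon> / 8 * real (n + i)" .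
        have 2: "- (real i * \<gamma>) \<le> real n0 * \<bar>\<gamma>\<bar>"
        proof -
          have "- (real i * \<gamma>) \<le> real i * \<bar>\<gamma>\<bar>" using mult_left_mono[of "-\<gamma>" "\<bar>\<gamma>\<bar>" "real i"] by simp
          also have "\<dots> \<le> real n0 * \<bar>\<gamma>\<bar>" using True by (intro mult_right_mono) auto
          finally show ?thesis .
        qed
        have 3: "\<epsilon> / 8 * real (n + i) \<le> \<epsilon> * real (n + i)" using e by (intro mult_right_mono) auto
        have 4: "real n0 * C2 \<ge> 0" using C2 by simp
        show ?thesis unfolding C_def using 1 2 3 4 C1(1) by linarith
      next
        case False
        define j where "j = i - n0"
        have ij: "i = j + n0" using False by (simp add: j_def)
        have "real n0 * f i ((\<sigma> ^^ n) \<omega>) \<le> bsum (f n0) j ((\<sigma> ^^ n) \<omega>) +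
            real n0 * (bsum p n0 ((\<sigma> ^^ n) \<omega>) + bsum p n0 ((\<sigma> ^^ j) ((\<sigma> ^^ n) \<omega>)))"
          unfolding ij by (rule f_le_block_sum[OF pow_space[OF w]])
        moreover have "bsum p n0 ((\<sigma> ^^ n) \<omega>) \<le> real n0 * C2 + \<epsilon> / 8 * real (n + i)" using ij by (intro bp) auto
        moreover have "bsum p n0 ((\<sigma> ^^ j) ((\<sigma> ^^ n) \<omega>)) \<le> real n0 * C2 + \<epsilon> / 8 * real (n + i)"
          using bp[of "j + n" n0 "n + i"] ij by (simp add: funpow_add)
        ultimately have 1: "real n0 * f i ((\<sigma> ^^ n) \<omega>) \<le> bsum (f n0) j ((\<sigma> ^^ n) \<omega>) +
            real n0 * (2 * (real n0 * C2 + \<epsilon> / 8 * real (n + i)))"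
          using n0(1) by (smt (verit, best) mult_left_mono of_nat_0_le_iff)
        have "\<epsilon> / 8 * real n \<le> \<epsilon> / 8 * real (n + i)" "\<epsilon> / 8 * real (n + j) \<le> \<epsilon> / 8 * real (n + i)"
          using e ij by (auto intro!: mult_left_mono)
        then have 2: "bsum (f n0) j ((\<sigma> ^^ n) \<omega>) \<le> real j * ?g + 2 * C1 + \<epsilon> / 4 * real (n + i)"
          using C1(2)[of n] C1(2)[of "n + j"] unfolding bsum_shift by (simp add: distrib_right abs_le_iff)
        have "?g \<le> real n0 * (\<gamma> + \<epsilon> / 4)" using n0 by (simp add: field_simps)
        then have "real j * ?g \<le> real j * (real n0 * (\<gamma> + \<epsilon> / 4))" by (intro mult_left_mono) auto
        moreover have "2 * C1 + \<epsilon> / 4 * real (n + i) \<le> real n0 * (2 * C1 + \<epsilon> / 4 * real (n + i))"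
          using n0 C1(1) e mult_right_mono[of 1 "real n0" "2 * C1 + \<epsilon> / 4 * real (n + i)"] by simp
        ultimately have "real n0 * f i ((\<sigma> ^^ n) \<omega>) \<le> real n0 * (real j * (\<gamma> + \<epsilon> / 4)) +
            real n0 * (2 * C1 + \<epsilon> / 4 * real (n + i)) + real n0 * (2 * (real n0 * C2 + \<epsilon> / 8 * real (n + i)))"
          using 1 2 by (simp add: mult_ac)
        then have "real n0 * f i ((\<sigma> ^^ n) \<omega>) \<le> real n0 * (real j * (\<gamma> + \<epsilon> / 4) +
            (2 * C1 + \<epsilon> / 4 * real (n + i)) + (2 * (real n0 * C2 + \<epsilon> / 8 * real (n + i))))"
          by (simp only: distrib_left)
        then have 3: "f i ((\<sigma> ^^ n) \<omega>) \<le> real j * (\<gamma> + \<epsilon> / 4) +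
            (2 * C1 + \<epsilon> / 4 * real (n + i)) + (2 * (real n0 * C2 + \<epsilon> / 8 * real (n + i)))"
          by (rule mult_left_le_imp_le) (use n0 in simp)
        have 4: "real j * \<gamma> \<le> real i * \<gamma> + real n0 * \<bar>\<gamma>\<bar>"
        proof -
          have "real n0 * (- \<gamma>) \<le> real n0 * \<bar>\<gamma>\<bar>" by (intro mult_left_mono) auto
          then show ?thesis by (simp add: ij distrib_right)
        qed
        have 5: "real j * (\<epsilon> / 4) \<le> \<epsilon> / 4 * real (n + i)" using e ij by (simp add: mult.commute)
        have "f i ((\<sigma> ^^ n) \<omega>) \<le> C + real i * \<gamma> + (\<epsilon> / 4 + \<epsilon> / 4 + 2 * (\<epsilon> / 8)) * real (n + i)"
          using 3 4 5 unfolding C_def by (simp only: distrib_left distrib_right)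
        also have "(\<epsilon> / 4 + \<epsilon> / 4 + 2 * (\<epsilon> / 8)) * real (n + i) \<le> \<epsilon> * real (n + i)"
          using e by (intro mult_right_mono) auto
        finally show ?thesis by simp
      qed
      then show "\<exists>C. \<forall>n i. f i ((\<sigma> ^^ n) \<omega>) \<le> C + real i * \<gamma> + \<epsilon> * real (n + i)" by blast
    qed
  qed
qed

text \<open>If \<open>f n \<le> n c\<close> for some \<open>n \<le> N\<close> at most points, then an orbit segment can be covered by such
  pieces, except for points in a set \<open>B\<close> of small probability and a final piece of length \<open>N\<close>.\<close>

lemma covering:
  assumes B: "\<And>\<omega>. \<omega> \<in> space M \<Longrightarrow> \<omega> \<notin> B \<Longrightarrow> \<exists>n\<in>{1..N}. f n \<omega> \<le> real n * c"
    and w: "\<omega> \<in> space M"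
  shows "f m \<omega> \<le> real m * c + (\<Sum>u<m. (indicat_real B ((\<sigma> ^^ u) \<omega>) + of_bool (m \<le> u + N)) * (p ((\<sigma> ^^ u) \<omega>) + \<bar>c\<bar>))"
  using w
proof (induction m arbitrary: \<omega> rule: less_induct)
  case (less m)
  note w = less.prems
  define G where "G m \<omega> = (\<Sum>u<m. (indicat_real B ((\<sigma> ^^ u) \<omega>) + of_bool (m \<le> u + N)) * (p ((\<sigma> ^^ u) \<omega>) + \<bar>c\<bar>))" for m \<omega>
  have IH: "f k v \<le> real k * c + G k v" if "k < m" "v \<in> space M" for k v
    using less.IH[OF that] by (simp add: G_def)
  have tnn: "(indicat_real B ((\<sigma> ^^ u) \<omega>) + of_bool (m \<le> u + N)) * (p ((\<sigma> ^^ u) \<omega>) + \<bar>c\<bar>) \<ge> 0" for u m \<omega>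
    using p_nonneg by (intro mult_nonneg_nonneg add_nonneg_nonneg) auto
  have Gshift: "(\<Sum>u<n. (indicat_real B ((\<sigma> ^^ u) \<omega>) + of_bool (n + k \<le> u + N)) * (p ((\<sigma> ^^ u) \<omega>) + \<bar>c\<bar>)) + G k ((\<sigma> ^^ n) \<omega>)
      = G (n + k) \<omega>" for n k
  proof -
    have "G k ((\<sigma> ^^ n) \<omega>) = (\<Sum>u<k. (indicat_real B ((\<sigma> ^^ (u + n)) \<omega>) + of_bool (n + k \<le> (u + n) + N)) * (p ((\<sigma> ^^ (u + n)) \<omega>) + \<bar>c\<bar>))"
      unfolding G_def by (intro sum.cong) (auto simp: funpow_add)
    also have "\<dots> = (\<Sum>u=n..<n+k. (indicat_real B ((\<sigma> ^^ u) \<omega>) + of_bool (n + k \<le> u + N)) * (p ((\<sigma> ^^ u) \<omega>) + \<bar>c\<bar>))"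
      by (rule sum.reindex_bij_witness[of _ "\<lambda>u. u - n" "\<lambda>u. u + n"]) auto
    finally show ?thesis
      unfolding G_def lessThan_atLeast0 by (simp add: sum.atLeastLessThan_concat)
  qed
  have "f m \<omega> \<le> real m * c + G m \<omega>"
  proof (cases "m = 0")
    case True then show ?thesis using w by (simp add: f_0 G_def)
  next
    case m0: False
    show ?thesis
    proof (cases "\<omega> \<in> B")
      case True
      obtain k where k: "m = 1 + k" using m0 by (cases m) auto
      have "f m \<omega> \<le> f 1 \<omega> + f k ((\<sigma> ^^ 1) \<omega>)" unfolding k by (rule f_sub[OF w])
      also have "f k ((\<sigma> ^^ 1) \<omega>) \<le> real k * c + G k ((\<sigma> ^^ 1) \<omega>)" using k by (intro IH pow_space w) simp
      also have "f 1 \<omega> \<le> c + (\<Sum>u<1. (indicat_real B ((\<sigma> ^^ u) \<omega>) + of_bool (1 + k \<le> u + N)) * (p ((\<sigma> ^^ u) \<omega>) + \<bar>c\<bar>))"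
        using True p_nonneg[of \<omega>] unfolding p_def by (auto simp: of_bool_def)
      finally show ?thesis using Gshift[of 1 k] k by (simp add: algebra_simps)
    next
      case False
      then obtain n where n: "n \<ge> 1" "n \<le> N" "f n \<omega> \<le> real n * c" using B[OF w] by auto
      show ?thesis
      proof (cases "n \<le> m")
        case True
        then obtain k where k: "m = n + k" using le_Suc_ex by blast
        have "f m \<omega> \<le> f n \<omega> + f k ((\<sigma> ^^ n) \<omega>)" unfolding k by (rule f_sub[OF w])
        also have "f k ((\<sigma> ^^ n) \<omega>) \<le> real k * c + G k ((\<sigma> ^^ n) \<omega>)" using k n by (intro IH pow_space w) simp
        also have "G k ((\<sigma> ^^ n) \<omega>) \<le> G m \<omega>" using Gshift[of n k] tnn unfolding k by (smt (verit, best) sum_nonneg)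
        finally show ?thesis using n k by (simp add: algebra_simps)
      next
        case False
        have "f m \<omega> \<le> bsum p m \<omega>" by (rule f_le_bsum_p[OF w])
        also have "\<dots> \<le> (\<Sum>u<m. c + (indicat_real B ((\<sigma> ^^ u) \<omega>) + of_bool (m \<le> u + N)) * (p ((\<sigma> ^^ u) \<omega>) + \<bar>c\<bar>))"
          unfolding bsum_def
        proof (rule sum_mono)
          fix u assume "u \<in> {..<m}"
          have "1 * (p ((\<sigma> ^^ u) \<omega>) + \<bar>c\<bar>) \<le> (indicat_real B ((\<sigma> ^^ u) \<omega>) + of_bool (m \<le> u + N)) * (p ((\<sigma> ^^ u) \<omega>) + \<bar>c\<bar>)"
            using False n p_nonneg by (intro mult_right_mono) (auto simp: indicator_def)
          then show "p ((\<sigma> ^^ u) \<omega>) \<le> c + (indicat_real B ((\<sigma> ^^ u) \<omega>) + of_bool (m \<le> u + N)) * (p ((\<sigma> ^^ u) \<omega>) + \<bar>c\<bar>)"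
            by (smt (verit) abs_ge_minus_self)
        qed
        also have "\<dots> = real m * c + G m \<omega>" by (simp add: G_def sum.distrib)
        finally show ?thesis .
      qed
    qed
  qed
  then show ?case by (simp add: G_def)
qed

text \<open>Suppose that almost everywhere the process is infinitely often below \<open>n d\<close>, where \<open>c < d < \<gamma>\<close>. Then nearly
  every orbit segment is covered by pieces on which this happens, so that the means of the process divided by
  time would come down to \<open>d < \<gamma>\<close>. The exceptional event is only subinvariant: passing from \<open>\<sigma> \<omega>\<close> to
  \<open>\<omega>\<close> adds \<open>f 1 \<omega>\<close>, for which the slack \<open>1 / (j + 1)\<close> makes room.\<close>

lemma eventually_lower:
  assumes "c < \<gamma>" shows "AE \<omega> in M. \<exists>n0. \<forall>n\<ge>n0. real n * c \<le> f n \<omega>"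
proof -
  define d where "d = (c + \<gamma>) / 2"
  have d: "c < d" "d < \<gamma>" using assms by (auto simp: d_def)
  define E where "E = {\<omega>\<in>space M. \<exists>j::nat. \<forall>N. \<exists>n\<ge>N. f n \<omega> \<le> real n * (d - 1 / real (Suc j))}"
  have Em: "E \<in> sets M" unfolding E_def by measurable
  have sub: "\<sigma> -` E \<inter> space M \<subseteq> E"
  proof
    fix \<omega> assume "\<omega> \<in> \<sigma> -` E \<inter> space M"
    then have w: "\<omega> \<in> space M" "\<sigma> \<omega> \<in> E" by auto
    then obtain j :: nat where j: "\<And>N. \<exists>n\<ge>N. f n (\<sigma> \<omega>) \<le> real n * (d - 1 / real (Suc j))" by (auto simp: E_def)
    define \<delta> where "\<delta> = 1 / real (Suc j) - 1 / real (Suc (Suc j))"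
    have \<delta>: "\<delta> > 0" unfolding \<delta>_def by (simp add: frac_less2)
    have "\<exists>n\<ge>N. f n \<omega> \<le> real n * (d - 1 / real (Suc (Suc j)))" for N
    proof -
      obtain N' :: nat where N': "real N' > (\<bar>f 1 \<omega>\<bar> + \<bar>d\<bar> + 1) / \<delta>" using reals_Archimedean2 by blast
      obtain n where n: "n \<ge> max N N'" "f n (\<sigma> \<omega>) \<le> real n * (d - 1 / real (Suc j))" using j by blast
      have "real n * \<delta> \<ge> real N' * \<delta>" using n \<delta> by (intro mult_right_mono) auto
      moreover have "real N' * \<delta> > \<bar>f 1 \<omega>\<bar> + \<bar>d\<bar> + 1" using N' \<delta> by (simp add: field_simps)
      ultimately have nd: "real n * \<delta> \<ge> \<bar>f 1 \<omega>\<bar> + \<bar>d\<bar> + 1" by linarith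
      have "f (1 + n) \<omega> \<le> f 1 \<omega> + f n ((\<sigma> ^^ 1) \<omega>)" by (rule f_sub[OF w(1)])
      also have "\<dots> \<le> f 1 \<omega> + real n * (d - 1 / real (Suc j))" using n(2) by simp
      also have "\<dots> = f 1 \<omega> + real n * (d - 1 / real (Suc (Suc j))) - real n * \<delta>" by (simp add: \<delta>_def algebra_simps)
      also have "\<dots> \<le> real n * (d - 1 / real (Suc (Suc j))) - \<bar>d\<bar> - 1" using nd by linarith
      also have "\<dots> \<le> real n * (d - 1 / real (Suc (Suc j))) + (d - 1 / real (Suc (Suc j)))"
      proof -
        have "1 / real (Suc (Suc j)) \<le> 1" by simp
        then show ?thesis by linarith
      qed
      also have "\<dots> = real (1 + n) * (d - 1 / real (Suc (Suc j)))" by (simp only: of_nat_add distrib_right) simp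
      finally show ?thesis using n(1) by (intro exI[of _ "1 + n"]) auto
    qed
    then show "\<omega> \<in> E" using w unfolding E_def by blast
  qed
  have "prob E \<noteq> 1"
  proof
    assume "prob E = 1"
    then have AEE: "AE \<omega> in M. \<omega> \<in> E" using Em by (simp add: AE_in_set_eq_1)
    define B where "B N = {\<omega>\<in>space M. \<forall>n\<in>{1..N}. f n \<omega> > real n * d}" for N
    have Bm [measurable]: "B N \<in> sets M" for N unfolding B_def by measurable
    define w where "w \<omega> = p \<omega> + \<bar>d\<bar>" for \<omega>
    have w_int: "integrable M w" unfolding w_def[abs_def] using p_int by simp
    have w0: "w \<omega> \<ge> 0" for \<omega> using p_nonneg by (simp add: w_def)
    have wm [measurable]: "w \<in> borel_measurable M" using w_int by simp
    have Bw_int: "integrable M (\<lambda>\<omega>. indicat_real (B N) \<omega> * w \<omega>)" for N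
      using integrable_real_mult_indicator[OF Bm w_int, of N] by (simp add: mult.commute)
    have bound: "\<gamma> \<le> d + (\<integral>\<omega>. indicat_real (B N) \<omega> * w \<omega> \<partial>M)" for N
    proof -
      let ?I = "\<integral>\<omega>. indicat_real (B N) \<omega> * w \<omega> \<partial>M" and ?W = "\<integral>\<omega>. w \<omega> \<partial>M"
      have "\<gamma> \<le> d + ?I + real N * ?W / real m" if m: "m \<ge> 1" for m
      proof -
        let ?h = "\<lambda>u \<omega>. (indicat_real (B N) \<omega> + of_bool (m \<le> u + N)) * w \<omega>"
        have h_int: "integrable M (?h u)" for u
          unfolding distrib_right using Bw_int w_int by (intro Bochner_Integration.integrable_add) auto
        have int: "integrable M (\<lambda>\<omega>. real m * d + (\<Sum>u<m. ?h u ((\<sigma> ^^ u) \<omega>)))"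
        proof (rule Bochner_Integration.integrable_add)
          show "integrable M (\<lambda>\<omega>. \<Sum>u<m. ?h u ((\<sigma> ^^ u) \<omega>))"
          proof (rule Bochner_Integration.integrable_sum)
            fix u show "integrable M (\<lambda>\<omega>. ?h u ((\<sigma> ^^ u) \<omega>))" by (rule integrable_pow[OF h_int])
          qed
        qed simp
        have pw: "f m \<omega> \<le> real m * d + (\<Sum>u<m. ?h u ((\<sigma> ^^ u) \<omega>))" if om: "\<omega> \<in> space M" for \<omega>
        proof -
          have "\<exists>n\<in>{1..N}. f n v \<le> real n * d" if "v \<in> space M" "v \<notin> B N" for v
            using that by (auto simp: B_def not_less)
          from covering[OF this om, where m = m] show ?thesis by (simp add: w_def)
        qed
        have "real m * \<gamma> \<le> (\<integral>\<omega>. f m \<omega> \<partial>M)" using \<gamma>_le[OF m] m by (simp add: field_simps)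
        also have "(\<integral>\<omega>. f m \<omega> \<partial>M) \<le> (\<integral>\<omega>. real m * d + (\<Sum>u<m. ?h u ((\<sigma> ^^ u) \<omega>)) \<partial>M)"
          by (rule integral_mono[OF f_int int pw])
        also have "\<dots> = real m * d + (\<Sum>u<m. (\<integral>\<omega>. ?h u ((\<sigma> ^^ u) \<omega>) \<partial>M))"
        proof -
          have "(\<integral>\<omega>. real m * d + (\<Sum>u<m. ?h u ((\<sigma> ^^ u) \<omega>)) \<partial>M) =
              (\<integral>\<omega>. real m * d \<partial>M) + (\<integral>\<omega>. (\<Sum>u<m. ?h u ((\<sigma> ^^ u) \<omega>)) \<partial>M)"
            by (rule Bochner_Integration.integral_add) (simp, rule Bochner_Integration.integrable_sum, rule integrable_pow[OF h_int])
          also have "(\<integral>\<omega>. (\<Sum>u<m. ?h u ((\<sigma> ^^ u) \<omega>)) \<partial>M) = (\<Sum>u<m. (\<integral>\<omega>. ?h u ((\<sigma> ^^ u) \<omega>) \<partial>M))"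
            by (rule Bochner_Integration.integral_sum) (rule integrable_pow[OF h_int])
          finally show ?thesis by (simp add: prob_space)
        qed
        also have "(\<Sum>u<m. (\<integral>\<omega>. ?h u ((\<sigma> ^^ u) \<omega>) \<partial>M)) = (\<Sum>u<m. ?I + of_bool (m \<le> u + N) * ?W)"
        proof (rule sum.cong)
          fix u
          have "(\<integral>\<omega>. ?h u ((\<sigma> ^^ u) \<omega>) \<partial>M) = (\<integral>\<omega>. ?h u \<omega> \<partial>M)" by (rule integral_pow[OF h_int])
          also have "\<dots> = ?I + of_bool (m \<le> u + N) * ?W"
            unfolding distrib_right using Bw_int w_int by (subst Bochner_Integration.integral_add) auto
          finally show "(\<integral>\<omega>. ?h u ((\<sigma> ^^ u) \<omega>) \<partial>M) = ?I + of_bool (m \<le> u + N) * ?W" .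
        qed simp
        also have "\<dots> = real m * ?I + (\<Sum>u<m. of_bool (m \<le> u + N)) * ?W" by (simp add: sum.distrib sum_distrib_right)
        also have "(\<Sum>u<m. of_bool (m \<le> u + N)) \<le> real N"
        proof -
          have "(\<Sum>u<m. of_bool (m \<le> u + N) :: real) = real (card ({..<m} \<inter> {u. m \<le> u + N}))"
            by (simp add: of_bool_def sum.If_cases)
          also have "card ({..<m} \<inter> {u. m \<le> u + N}) \<le> card {m - N..<m}" by (intro card_mono) auto
          also have "\<dots> \<le> N" by simp
          finally show ?thesis by simp
        qed
        finally have "real m * \<gamma> \<le> real m * d + (real m * ?I + real N * ?W)"
          using w0 by (simp add: mult_right_mono)
        then show ?thesis using m by (simp add: field_simps)
      qed
      then have 1: "\<forall>m\<ge>1. \<gamma> \<le> d + ?I + (real N * ?W) / real m" by blast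
      have "(\<lambda>m. d + ?I + (real N * ?W) / real m) \<longlonglongrightarrow> d + ?I + 0"
        by (intro tendsto_intros tendsto_divide_0[OF tendsto_const] filterlim_real_at_infinity_sequentially)
      then show ?thesis using 1 by (intro LIMSEQ_le_const[of _ "d + ?I" \<gamma>]) auto
    qed
    have "(\<lambda>N. \<integral>\<omega>. indicat_real (B N) \<omega> * w \<omega> \<partial>M) \<longlonglongrightarrow> (\<integral>\<omega>. 0 \<partial>M)"
    proof (rule integral_dominated_convergence[where w = w])
      show "AE \<omega> in M. (\<lambda>N. indicat_real (B N) \<omega> * w \<omega>) \<longlonglongrightarrow> 0"
        using AEE
      proof eventually_elim
        case (elim \<omega>)
        then obtain j :: nat where j: "\<And>N. \<exists>n\<ge>N. f n \<omega> \<le> real n * (d - 1 / real (Suc j))" by (auto simp: E_def)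
        obtain n where n: "n \<ge> 1" "f n \<omega> \<le> real n * (d - 1 / real (Suc j))" using j by blast
        have "real n * (d - 1 / real (Suc j)) \<le> real n * d" by (intro mult_left_mono) auto
        then have "f n \<omega> \<le> real n * d" using n(2) by linarith
        then have "indicat_real (B N) \<omega> * w \<omega> = 0" if "N \<ge> n" for N
          using that n(1) by (auto simp: B_def indicator_def not_less intro!: bexI[of _ n])
        then show ?case by (intro tendsto_eventually) (auto simp: eventually_sequentially)
      qed
      show "AE \<omega> in M. norm (indicat_real (B N) \<omega> * w \<omega>) \<le> w \<omega>" for N
        using w0 by (auto simp: indicator_def)
    qed (use w_int in auto)
    then have "(\<lambda>N. d + (\<integral>\<omega>. indicat_real (B N) \<omega> * w \<omega> \<partial>M)) \<longlonglongrightarrow> d + 0"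
      by (intro tendsto_intros) simp
    then have "\<gamma> \<le> d + 0" by (rule LIMSEQ_le_const) (use bound in auto)
    then show False using d by simp
  qed
  then have "prob E = 0" using zero_one_subinvariant[OF Em sub] by blast
  then have "AE \<omega> in M. \<omega> \<notin> E" using Em by (simp add: prob_eq_0)
  then show ?thesis using AE_space
  proof eventually_elim
    case (elim \<omega>)
    obtain j :: nat where j: "1 / real (Suc j) < d - c" using nat_approx_posE[of "d - c"] d by auto
    obtain N where N: "\<And>n. n \<ge> N \<Longrightarrow> f n \<omega> > real n * (d - 1 / real (Suc j))"
    proof -
      have "\<not> (\<forall>N. \<exists>n\<ge>N. f n \<omega> \<le> real n * (d - 1 / real (Suc j)))"
        using elim unfolding E_def by blast
      then show ?thesis using that not_le by blast
    qed
    have "real n * c \<le> f n \<omega>" if "n \<ge> N" for n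
    proof -
      have "real n * c \<le> real n * (d - 1 / real (Suc j))" using j by (intro mult_left_mono) auto
      then show ?thesis using N[OF that] by linarith
    qed
    then show ?case by blast
  qed
qed

theorem kingman: "AE \<omega> in M. (\<lambda>n. f n \<omega> / real n) \<longlonglongrightarrow> \<gamma>"
proof -
  have "AE \<omega> in M. \<forall>j::nat. \<exists>n0. \<forall>n\<ge>n0. real n * (\<gamma> - 1 / real (Suc j)) \<le> f n \<omega>"
    unfolding AE_all_countable by (intro allI eventually_lower) simp
  with uniform_upper show ?thesis
  proof eventually_elim
    case (elim \<omega>)
    show ?case
    proof (rule order_tendstoI)
      fix a assume a: "a < \<gamma>"
      obtain j :: nat where j: "1 / real (Suc j) < \<gamma> - a" using nat_approx_posE[of "\<gamma> - a"] a by auto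
      obtain n0 where n0: "\<And>n. n \<ge> n0 \<Longrightarrow> real n * (\<gamma> - 1 / real (Suc j)) \<le> f n \<omega>" using elim(2) by blast
      have "a < f n \<omega> / real n" if n: "n \<ge> max 1 n0" for n
      proof -
        have "real n * a < real n * (\<gamma> - 1 / real (Suc j))" using j n by (intro mult_strict_left_mono) auto
        also have "\<dots> \<le> f n \<omega>" using n0 n by simp
        finally show ?thesis using n by (simp add: field_simps)
      qed
      then show "\<forall>\<^sub>F n in sequentially. a < f n \<omega> / real n" unfolding eventually_sequentially by blast
    next
      fix a assume a: "\<gamma> < a"
      define \<epsilon> where "\<epsilon> = (a - \<gamma>) / 2"
      have e: "\<epsilon> > 0" using a by (simp add: \<epsilon>_def)
      obtain C where C: "\<And>n i. f i ((\<sigma> ^^ n) \<omega>) \<le> C + real i * \<gamma> + \<epsilon> * real (n + i)" using elim(1) e by blast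
      obtain n0 :: nat where n0: "real n0 > \<bar>C\<bar> / \<epsilon>" using reals_Archimedean2 by blast
      have "f n \<omega> / real n < a" if n: "n \<ge> max 1 n0" for n
      proof -
        have "real n * \<epsilon> \<ge> real n0 * \<epsilon>" using n e by (intro mult_right_mono) auto
        moreover have "real n0 * \<epsilon> > \<bar>C\<bar>" using n0 e by (simp add: field_simps)
        moreover have "f n \<omega> \<le> C + real n * \<gamma> + \<epsilon> * real n" using C[of n 0] by simp
        ultimately have "f n \<omega> < real n * \<epsilon> + real n * \<gamma> + \<epsilon> * real n" by linarith
        also have "\<dots> = real n * a" by (simp add: \<epsilon>_def field_simps)
        finally show ?thesis using n by (simp add: field_simps)
      qed
      then show "\<forall>\<^sub>F n in sequentially. f n \<omega> / real n < a" unfolding eventually_sequentially by blast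
    qed
  qed
qed

end

subsection \<open>Submultiplicative processes\<close>

text \<open>Values \<open>A n = 0\<close>, with logarithm \<open>-\<infinity>\<close>, are allowed. The truncations \<open>max (ln A\<^sub>n) (- K n)\<close> are
  again subadditive, so that the real-valued theorem applies to each of them.\<close>

locale submult_process = ergodic_map M \<sigma> for M :: "'o measure" and \<sigma> +
  fixes A :: "nat \<Rightarrow> 'o \<Rightarrow> real"
  assumes A_meas [measurable]: "\<And>n. A n \<in> borel_measurable M"
    and A_nonneg: "\<And>n \<omega>. \<omega> \<in> space M \<Longrightarrow> A n \<omega> \<ge> 0"
    and A_0: "\<And>\<omega>. \<omega> \<in> space M \<Longrightarrow> A 0 \<omega> = 1"
    and A_sub: "\<And>n m \<omega>. \<omega> \<in> space M \<Longrightarrow> A (n + m) \<omega> \<le> A n \<omega> * A m ((\<sigma> ^^ n) \<omega>)"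
    and A_int: "integrable M (\<lambda>\<omega>. ln (max 1 (A 1 \<omega>)))"
begin

definition trunc :: "nat \<Rightarrow> nat \<Rightarrow> 'o \<Rightarrow> real" where
  "trunc K n \<omega> = ln (max (A n \<omega>) (exp (- real K * real n)))"

lemma max_pos: "max a (exp t) > (0::real)" by (simp add: less_max_iff_disj)

lemma trunc_lower: "- real K * real n \<le> trunc K n \<omega>"
proof -
  have "exp (- real K * real n) \<le> max (A n \<omega>) (exp (- real K * real n))" by simp
  then show ?thesis unfolding trunc_def using max_pos by (simp add: ln_ge_iff)
qed

lemma trunc_sub:
  assumes w: "\<omega> \<in> space M"
  shows "trunc K (n + m) \<omega> \<le> trunc K n \<omega> + trunc K m ((\<sigma> ^^ n) \<omega>)"
proof -
  let ?a = "max (A n \<omega>) (exp (- real K * real n))" and ?b = "max (A m ((\<sigma> ^^ n) \<omega>)) (exp (- real K * real m))"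
  have "A (n + m) \<omega> \<le> A n \<omega> * A m ((\<sigma> ^^ n) \<omega>)" by (rule A_sub[OF w])
  also have "\<dots> \<le> ?a * ?b" using A_nonneg[OF w] A_nonneg[OF pow_space[OF w]] by (intro mult_mono) (auto simp: le_max_iff_disj)
  finally have 1: "A (n + m) \<omega> \<le> ?a * ?b" .
  have "exp (- real K * real (n + m)) = exp (- real K * real n) * exp (- real K * real m)"
    by (simp add: exp_add[symmetric] algebra_simps)
  also have "\<dots> \<le> ?a * ?b" by (intro mult_mono) (auto simp: le_max_iff_disj)
  finally have 2: "exp (- real K * real (n + m)) \<le> ?a * ?b" .
  have "ln (max (A (n + m) \<omega>) (exp (- real K * real (n + m)))) \<le> ln (?a * ?b)"
    using 1 2 max_pos by (subst ln_le_cancel_iff) auto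
  also have "\<dots> = ln ?a + ln ?b" using max_pos by (intro ln_mult_pos) auto
  finally show ?thesis by (simp add: trunc_def)
qed

lemma trunc_meas [measurable]: "trunc K n \<in> borel_measurable M"
  unfolding trunc_def[abs_def] by measurable

lemma trunc_0: "\<omega> \<in> space M \<Longrightarrow> trunc K 0 \<omega> = 0"
  by (simp add: trunc_def A_0)

lemma trunc_upper: "\<omega> \<in> space M \<Longrightarrow> trunc K n \<omega> \<le> bsum (\<lambda>\<omega>. ln (max 1 (A 1 \<omega>))) n \<omega>"
proof (induction n)
  case (Suc n)
  have "trunc K (n + 1) \<omega> \<le> trunc K n \<omega> + trunc K 1 ((\<sigma> ^^ n) \<omega>)" by (rule trunc_sub[OF Suc.prems])
  moreover have "trunc K 1 ((\<sigma> ^^ n) \<omega>) \<le> ln (max 1 (A 1 ((\<sigma> ^^ n) \<omega>)))"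
  proof -
    have "exp (- real K * real 1) \<le> 1" by simp
    then have "max (A 1 ((\<sigma> ^^ n) \<omega>)) (exp (- real K * real 1)) \<le> max 1 (A 1 ((\<sigma> ^^ n) \<omega>))" by linarith
    then show ?thesis unfolding trunc_def by (subst ln_le_cancel_iff) (auto simp: less_max_iff_disj)
  qed
  ultimately show ?case using Suc by (simp add: bsum_def)
qed (simp add: trunc_0 bsum_def)

lemma trunc_int: "integrable M (trunc K n)"
proof (rule Bochner_Integration.integrable_bound)
  let ?h = "\<lambda>\<omega>. bsum (\<lambda>\<omega>. ln (max 1 (A 1 \<omega>))) n \<omega> + real K * real n"
  show "integrable M ?h"
  proof (rule Bochner_Integration.integrable_add)
    show "integrable M (\<lambda>\<omega>. bsum (\<lambda>\<omega>. ln (max 1 (A 1 \<omega>))) n \<omega>)" unfolding bsum_def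
    proof (rule Bochner_Integration.integrable_sum)
      fix i show "integrable M (\<lambda>\<omega>. ln (max 1 (A 1 ((\<sigma> ^^ i) \<omega>))))" by (rule integrable_pow[OF A_int])
    qed
  qed simp
  show "trunc K n \<in> borel_measurable M" by (rule trunc_meas)
  show "AE \<omega> in M. norm (trunc K n \<omega>) \<le> norm (?h \<omega>)"
  proof (rule AE_I2)
    fix \<omega> assume "\<omega> \<in> space M"
    then have "trunc K n \<omega> \<le> bsum (\<lambda>\<omega>. ln (max 1 (A 1 \<omega>))) n \<omega>" by (rule trunc_upper)
    moreover have "bsum (\<lambda>\<omega>. ln (max 1 (A 1 \<omega>))) n \<omega> \<ge> 0"
      unfolding bsum_def by (intro sum_nonneg) auto
    moreover have "real K * real n \<ge> 0" by simp
    ultimately show "norm (trunc K n \<omega>) \<le> norm (?h \<omega>)" using trunc_lower[of K n \<omega>]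
      unfolding real_norm_def by linarith
  qed
qed

lemma trunc_process: "subadditive_process M \<sigma> (trunc K) (real K)"
  by (intro subadditive_process.intro subadditive_process_axioms.intro ergodic_map_axioms
      trunc_int trunc_sub trunc_0 trunc_lower)

definition \<gamma>K :: "nat \<Rightarrow> real" where "\<gamma>K K = subadditive_process.\<gamma> M (trunc K)"
definition rate :: ereal where "rate = (INF K. ereal (\<gamma>K K))"

lemma \<gamma>K_le: "n \<ge> 1 \<Longrightarrow> \<gamma>K K \<le> (\<integral>\<omega>. trunc K n \<omega> \<partial>M) / real n"
  unfolding \<gamma>K_def by (rule subadditive_process.\<gamma>_le[OF trunc_process])

lemma rate_le: "n \<ge> 1 \<Longrightarrow> rate \<le> ereal ((\<integral>\<omega>. trunc K n \<omega> \<partial>M) / real n)"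
  unfolding rate_def by (rule INF_lower2[of K]) (use \<gamma>K_le in auto)

lemma rate_less_top: "rate < \<infinity>"
  unfolding rate_def by (rule le_less_trans[OF INF_lower[of 0]]) auto

lemma rate_approx:
  assumes "rate < ereal c"
  shows "\<exists>K. \<forall>N. \<exists>n\<ge>N. n \<ge> 1 \<and> (\<integral>\<omega>. trunc K n \<omega> \<partial>M) / real n < c"
proof -
  obtain K where "\<gamma>K K < c" using assms unfolding rate_def by (auto simp: INF_less_iff)
  then show ?thesis
    using subadditive_process.\<gamma>_approx_large[OF trunc_process, of K c] unfolding \<gamma>K_def by blast
qed

lemma A_le_trunc: "A n \<omega> \<le> exp (trunc K n \<omega>)"
  unfolding trunc_def using max_pos by simp

lemma uniform_upper:
  assumes "rate \<le> ereal c"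
  shows "AE \<omega> in M. \<forall>\<epsilon>>0. \<exists>C>0. \<forall>n i. A i ((\<sigma> ^^ n) \<omega>) \<le> C * exp (real i * c + \<epsilon> * real (n + i))"
proof -
  have "AE \<omega> in M. \<forall>K. \<forall>\<epsilon>>0. \<exists>C. \<forall>n i. trunc K i ((\<sigma> ^^ n) \<omega>) \<le> C + real i * \<gamma>K K + \<epsilon> * real (n + i)"
    unfolding AE_all_countable \<gamma>K_def by (intro allI subadditive_process.uniform_upper[OF trunc_process])
  then show ?thesis
  proof eventually_elim
    case (elim \<omega>)
    show ?case
    proof (intro allI impI)
      fix \<epsilon> :: real assume e: "\<epsilon> > 0"
      then have "rate < ereal (c + \<epsilon> / 2)" using assms by (meson ereal_less_le le_less_trans less_add_same_cancel1 less_ereal.simps(1) half_gt_zero)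
      then obtain K where K: "\<gamma>K K < c + \<epsilon> / 2" unfolding rate_def by (auto simp: INF_less_iff)
      have "\<epsilon> / 2 > 0" using e by simp
      then obtain C where C: "\<And>n i. trunc K i ((\<sigma> ^^ n) \<omega>) \<le> C + real i * \<gamma>K K + \<epsilon> / 2 * real (n + i)" using elim by blast
      have "A i ((\<sigma> ^^ n) \<omega>) \<le> exp C * exp (real i * c + \<epsilon> * real (n + i))" for n i
      proof -
        have "real i * \<gamma>K K \<le> real i * (c + \<epsilon> / 2)" using K by (intro mult_left_mono) auto
        moreover have "real i * (\<epsilon> / 2) \<le> \<epsilon> / 2 * real (n + i)" using e by (simp add: mult.commute)
        ultimately have "trunc K i ((\<sigma> ^^ n) \<omega>) \<le> C + (real i * c + \<epsilon> * real (n + i))"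
          using C[of i n] by (simp only: distrib_left)
        then have "exp (trunc K i ((\<sigma> ^^ n) \<omega>)) \<le> exp C * exp (real i * c + \<epsilon> * real (n + i))"
          by (simp only: exp_add[symmetric] exp_le_cancel_iff)
        then show ?thesis using A_le_trunc[of i "(\<sigma> ^^ n) \<omega>" K] by linarith
      qed
      then show "\<exists>C>0. \<forall>n i. A i ((\<sigma> ^^ n) \<omega>) \<le> C * exp (real i * c + \<epsilon> * real (n + i))"
        by (intro exI[of _ "exp C"]) auto
    qed
  qed
qed

lemma log_rate_le_trunc: "log_rate (\<lambda>n. A n \<omega>) n \<le> ereal (trunc K n \<omega> / real n)"
proof (cases "A n \<omega> \<le> 0")
  case True
  then show ?thesis
    by (cases "n = 0") (auto simp: log_rate_def ext_ln_def zero_ereal_def[symmetric])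
next
  case False
  then have "ln (A n \<omega>) \<le> trunc K n \<omega>" unfolding trunc_def using max_pos by (subst ln_le_cancel_iff) auto
  then show ?thesis using False by (simp add: log_rate_def ext_ln_def divide_right_mono)
qed

theorem log_rate_tendsto: "AE \<omega> in M. log_rate (\<lambda>n. A n \<omega>) \<longlonglongrightarrow> rate"
proof -
  have "AE \<omega> in M. \<forall>K. (\<lambda>n. trunc K n \<omega> / real n) \<longlonglongrightarrow> \<gamma>K K"
    unfolding AE_all_countable \<gamma>K_def by (intro allI subadditive_process.kingman[OF trunc_process])
  then show ?thesis
  proof eventually_elim
    case (elim \<omega>)
    show ?case
    proof (rule order_tendstoI)
      fix a assume "rate < a"
      then obtain K where K: "ereal (\<gamma>K K) < a" unfolding rate_def by (auto simp: INF_less_iff)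
      have "(\<lambda>n. ereal (trunc K n \<omega> / real n)) \<longlonglongrightarrow> ereal (\<gamma>K K)" using elim by simp
      from order_tendstoD(2)[OF this K]
      show "\<forall>\<^sub>F n in sequentially. log_rate (\<lambda>n. A n \<omega>) n < a"
        by eventually_elim (rule le_less_trans[OF log_rate_le_trunc])
    next
      fix a assume a: "a < rate"
      then obtain b where b: "a < ereal b" "ereal b < rate"
        using ereal_dense2 by blast
      obtain K :: nat where K: "- real K < b" using reals_Archimedean2[of "-b"] by (auto simp: minus_less_iff)
      have "ereal b < ereal (\<gamma>K K)" using b(2) unfolding rate_def by (rule less_le_trans[OF _ INF_lower]) simp
      then have "\<forall>\<^sub>F n in sequentially. b < trunc K n \<omega> / real n"
        using elim by (intro order_tendstoD(1)[of _ "\<gamma>K K"]) auto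
      then show "\<forall>\<^sub>F n in sequentially. a < log_rate (\<lambda>n. A n \<omega>) n"
        using eventually_ge_at_top[of 1]
      proof eventually_elim
        case (elim n)
        have nb: "real n * b < trunc K n \<omega>" using elim by (simp add: field_simps)
        have "- real K * real n \<le> real n * b" using mult_right_mono[OF less_imp_le[OF K], of "real n"] by (simp add: mult.commute)
        then have "trunc K n \<omega> > - real K * real n" using nb by linarith
        then have "max (A n \<omega>) (exp (- real K * real n)) \<noteq> exp (- real K * real n)"
          unfolding trunc_def by (auto simp: ln_exp)
        then have A: "A n \<omega> > exp (- real K * real n)" by (auto simp: max_def split: if_splits)
        then have "trunc K n \<omega> = ln (A n \<omega>)" by (simp add: trunc_def max_def)
        moreover have "A n \<omega> > 0" using A exp_gt_zero less_trans by blast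
        ultimately have "log_rate (\<lambda>n. A n \<omega>) n = ereal (trunc K n \<omega> / real n)"
          by (simp add: log_rate_def ext_ln_def)
        then show ?case using b(1) elim by (metis ereal_less_eq(3) less_imp_le order_less_le_trans)
      qed
    qed
  qed
qed

end

section \<open>Measurability\<close>

lemma countable_dense_subset:
  fixes S Q :: "'a::metric_space set"
  assumes Q: "countable Q" "\<And>x e. e > 0 \<Longrightarrow> \<exists>q\<in>Q. dist q x < e"
  shows "\<exists>D. countable D \<and> D \<subseteq> S \<and> (\<forall>x\<in>S. \<forall>e>0. \<exists>d\<in>D. dist d x < e)"
proof -
  define pick where "pick = (\<lambda>(q, n::nat). SOME y. y \<in> S \<and> dist q y < 1 / real (Suc n))"
  define I where "I = {(q, n). q \<in> Q \<and> (\<exists>y. y \<in> S \<and> dist q y < 1 / real (Suc n))}"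
  have pick: "pick (q, n) \<in> S" "dist q (pick (q, n)) < 1 / real (Suc n)" if "(q, n) \<in> I" for q n
  proof -
    have "\<exists>y. y \<in> S \<and> dist q y < 1 / real (Suc n)" using that by (simp add: I_def)
    from someI_ex[OF this] show "pick (q, n) \<in> S" "dist q (pick (q, n)) < 1 / real (Suc n)"
      by (simp_all add: pick_def)
  qed
  have "countable I" by (rule countable_subset[of _ "Q \<times> UNIV"]) (use Q in \<open>auto simp: I_def\<close>)
  moreover have "\<exists>d\<in>pick ` I. dist d x < e" if x: "x \<in> S" "e > 0" for x e
  proof -
    obtain n :: nat where n: "1 / real (Suc n) < e / 2" using nat_approx_posE[of "e/2"] x by auto
    obtain q where q: "q \<in> Q" "dist q x < 1 / real (Suc n)" using Q(2)[of "1 / real (Suc n)" x] by auto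
    then have qi: "(q, n) \<in> I" using x by (auto simp: I_def)
    have "dist (pick (q, n)) x \<le> dist q (pick (q, n)) + dist q x" by (rule dist_triangle3)
    then have "dist (pick (q, n)) x < e" using pick(2)[OF qi] q(2) n by linarith
    then show ?thesis using qi by blast
  qed
  ultimately show ?thesis using pick(1) by (intro exI[of _ "pick ` I"]) auto
qed

lemma countable_dense_subset_second_countable:
  fixes S :: "'a::{metric_space, second_countable_topology} set"
  shows "\<exists>D. countable D \<and> D \<subseteq> S \<and> (\<forall>x\<in>S. \<forall>e>0. \<exists>d\<in>D. dist d x < e)"
proof -
  obtain Q :: "'a set" where Q: "countable Q" "\<And>X. open X \<Longrightarrow> X \<noteq> {} \<Longrightarrow> \<exists>d\<in>Q. d \<in> X"
    by (erule countable_dense_setE)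
  have "\<exists>q\<in>Q. dist q x < e" if "e > 0" for x e
    using Q(2)[of "ball x e"] that by (auto simp: dist_commute)
  with Q(1) show ?thesis by (rule countable_dense_subset)
qed

lemma borel_measurable_family_apply:
  fixes F :: "'o \<Rightarrow> 'x::{real_normed_vector, second_countable_topology} \<Rightarrow>\<^sub>L 'y::{real_normed_vector, second_countable_topology}"
  assumes F: "\<And>x. (\<lambda>\<omega>. blinfun_apply (F \<omega>) x) \<in> borel_measurable M" and y: "y \<in> borel_measurable M"
  shows "(\<lambda>\<omega>. blinfun_apply (F \<omega>) (y \<omega>)) \<in> borel_measurable M"
proof -
  obtain s where s: "\<And>i. simple_function M (s i)" "\<And>\<omega>. \<omega> \<in> space M \<Longrightarrow> (\<lambda>i. s i \<omega>) \<longlonglongrightarrow> y \<omega>"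
    using borel_measurable_implies_sequence_metric[OF y, of 0] by blast
  have "(\<lambda>\<omega>. blinfun_apply (F \<omega>) (s i \<omega>)) \<in> borel_measurable M" for i
  proof (rule measurable_compose_countable'[where I = "s i ` space M" and f = "\<lambda>x \<omega>. blinfun_apply (F \<omega>) x"])
    show "(\<lambda>\<omega>. blinfun_apply (F \<omega>) x) \<in> borel_measurable M" for x by (rule F)
    show "s i \<in> measurable M (count_space (s i ` space M))"
      using s(1)[of i] unfolding simple_function_def
      by (subst measurable_count_space_eq2) auto
    show "countable (s i ` space M)"
      using s(1)[of i] unfolding simple_function_def by (intro countable_finite) auto
  qed
  then show ?thesis
  proof (rule borel_measurable_LIMSEQ_metric)
    fix \<omega> assume "\<omega> \<in> space M"
    then show "(\<lambda>i. blinfun_apply (F \<omega>) (s i \<omega>)) \<longlonglongrightarrow> blinfun_apply (F \<omega>) (y \<omega>)"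
      by (intro tendsto_intros s(2))
  qed
qed

text \<open>Rational coefficients suffice, so that the distance to the span of finitely many measurable vectors is a
  countable infimum, taken one vector at a time.\<close>

lemma infdist_span_insert_less_iff:
  fixes u w :: "'x::real_normed_vector"
  shows "infdist u (span (insert w S)) < r \<longleftrightarrow> (\<exists>q\<in>\<rat>. infdist (u - q *\<^sub>R w) (span S) < r)"
proof
  assume "infdist u (span (insert w S)) < r"
  then obtain s where s: "s \<in> span (insert w S)" "norm (u - s) < r" using infdist_span_approx by blast
  then obtain t where t: "s - t *\<^sub>R w \<in> span S" using span_breakdown_eq by blast
  have pos: "(r - norm (u - s)) / (norm w + 1) > 0" using s(2) by (simp add: add_nonneg_pos)
  have "t < t + (r - norm (u - s)) / (norm w + 1)" using pos by simp
  then obtain q where q: "q \<in> \<rat>" "t < q" "q < t + (r - norm (u - s)) / (norm w + 1)"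
    using Rats_dense_in_real by blast
  have "\<bar>q - t\<bar> * norm w \<le> \<bar>q - t\<bar> * (norm w + 1)" by (intro mult_left_mono) auto
  also have "\<dots> < (r - norm (u - s)) / (norm w + 1) * (norm w + 1)"
    using q by (intro mult_strict_right_mono) (auto simp: add_nonneg_pos)
  also have "\<dots> = r - norm (u - s)" by (simp add: add_nonneg_eq_0_iff)
  finally have qt: "\<bar>q - t\<bar> * norm w < r - norm (u - s)" .
  have "infdist (u - q *\<^sub>R w) (span S) \<le> norm (u - q *\<^sub>R w - (s - t *\<^sub>R w))" by (rule infdist_span_le[OF t])
  also have "u - q *\<^sub>R w - (s - t *\<^sub>R w) = (u - s) - (q - t) *\<^sub>R w" by (simp add: algebra_simps)
  also have "norm \<dots> \<le> norm (u - s) + \<bar>q - t\<bar> * norm w"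
    using norm_triangle_ineq4[of "u - s" "(q - t) *\<^sub>R w"] by simp
  also have "\<dots> < r" using qt by simp
  finally show "\<exists>q\<in>\<rat>. infdist (u - q *\<^sub>R w) (span S) < r" using q(1) by blast
next
  assume "\<exists>q\<in>\<rat>. infdist (u - q *\<^sub>R w) (span S) < r"
  then obtain q where "infdist (u - q *\<^sub>R w) (span S) < r" by blast
  then obtain s where s: "s \<in> span S" "norm (u - q *\<^sub>R w - s) < r" using infdist_span_approx by blast
  have "q *\<^sub>R w + s \<in> span (insert w S)"
    using s(1) span_mono[of S "insert w S"] span_base[of w "insert w S"] by (intro span_add span_scale) auto
  from infdist_span_le[OF this, of u] s(2) show "infdist u (span (insert w S)) < r"
    by (simp add: diff_diff_eq)
qed

lemma borel_measurable_infdist_span: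
  fixes w :: "nat \<Rightarrow> 'o \<Rightarrow> 'x::{real_normed_vector, second_countable_topology}"
  assumes w: "\<And>l. w l \<in> borel_measurable M" and u: "u \<in> borel_measurable M"
  shows "(\<lambda>\<omega>. infdist (u \<omega>) (span ((\<lambda>l. w l \<omega>) ` {..<j}))) \<in> borel_measurable M"
  using u
proof (induction j arbitrary: u)
  case 0
  then show ?case by simp
next
  case (Suc j)
  note [measurable] = Suc.prems w
  show ?case unfolding borel_measurable_iff_less
  proof
    fix a
    have [measurable]: "(\<lambda>\<omega>. infdist (u \<omega> - q *\<^sub>R w j \<omega>) (span ((\<lambda>l. w l \<omega>) ` {..<j}))) \<in> borel_measurable M" for q
      by (rule Suc.IH) measurable
    have "{\<omega> \<in> space M. infdist (u \<omega>) (span ((\<lambda>l. w l \<omega>) ` {..<Suc j})) < a} =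
       (\<Union>q\<in>\<rat>. {\<omega> \<in> space M. infdist (u \<omega> - q *\<^sub>R w j \<omega>) (span ((\<lambda>l. w l \<omega>) ` {..<j})) < a})"
      by (auto simp: lessThan_Suc infdist_span_insert_less_iff)
    also have "\<dots> \<in> sets M" by (intro sets.countable_UN' countable_rat image_subsetI) measurable
    finally show "{\<omega> \<in> space M. infdist (u \<omega>) (span ((\<lambda>l. w l \<omega>) ` {..<Suc j})) < a} \<in> sets M" .
  qed
qed

lemma borel_measurable_vol:
  fixes w :: "nat \<Rightarrow> 'o \<Rightarrow> 'x::{real_normed_vector, second_countable_topology}"
  assumes "\<And>l. w l \<in> borel_measurable M"
  shows "(\<lambda>\<omega>. vol k (\<lambda>l. w l \<omega>)) \<in> borel_measurable M"
  unfolding vol_def by (intro borel_measurable_prod borel_measurable_infdist_span assms)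

subsection \<open>Lower semicontinuity of volumes\<close>

lemma vol_Suc: "vol (Suc k) v = vol k v * infdist (v k) (span (v ` {..<k}))"
  by (simp add: vol_def)

lemma vol_nonneg: "vol k v \<ge> 0"
  by (simp add: vol_eq_rel_vol)

text \<open>The last coefficient is bounded because its vector has positive height over the others; the remaining ones
  follow by induction.\<close>

lemma vol_pos_coeffs:
  fixes v :: "nat \<Rightarrow> 'x::real_normed_vector"
  assumes "vol k v > 0"
  shows "\<exists>c>0. \<forall>a. c * (\<Sum>l<k. \<bar>a l\<bar>) \<le> norm (\<Sum>l<k. a l *\<^sub>R v l)"
  using assms
proof (induction k)
  case 0
  then show ?case by (intro exI[of _ 1]) simp
next
  case (Suc k)
  have d: "infdist (v k) (span (v ` {..<k})) > 0" and "vol k v > 0"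
    using Suc.prems vol_nonneg[of k v] infdist_nonneg[of "v k" "span (v ` {..<k})"]
    unfolding vol_Suc by (auto simp: zero_less_mult_iff)
  let ?d = "infdist (v k) (span (v ` {..<k}))"
  obtain c where c: "c > 0" "\<And>a. c * (\<Sum>l<k. \<bar>a l\<bar>) \<le> norm (\<Sum>l<k. a l *\<^sub>R v l)"
    using Suc.IH \<open>vol k v > 0\<close> by blast
  define m where "m = (1 + norm (v k) / ?d) / c + 1 / ?d"
  have m: "m > 0" using c d unfolding m_def by (intro add_pos_pos divide_pos_pos add_pos_nonneg) auto
  have "(1 / m) * (\<Sum>l<Suc k. \<bar>a l\<bar>) \<le> norm (\<Sum>l<Suc k. a l *\<^sub>R v l)" for a
  proof -
    let ?s = "\<Sum>l<k. a l *\<^sub>R v l" and ?P = "norm (\<Sum>l<Suc k. a l *\<^sub>R v l)"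
    have e: "(\<Sum>l<Suc k. a l *\<^sub>R v l) = a k *\<^sub>R v k + ?s" by simp
    have "?s \<in> span (v ` {..<k})" by (intro span_sum span_scale span_base) auto
    then have "\<bar>a k\<bar> * ?d = infdist (a k *\<^sub>R v k + ?s) (span (v ` {..<k}))"
      using infdist_span_shift by (simp add: infdist_span_scale infdist_span_shift)
    also have "\<dots> \<le> ?P" unfolding e by (rule infdist_span_le_norm)
    finally have 1: "\<bar>a k\<bar> \<le> ?P / ?d" using d by (simp add: field_simps)
    have "c * (\<Sum>l<k. \<bar>a l\<bar>) \<le> norm ?s" by (rule c)
    also have "\<dots> \<le> ?P + \<bar>a k\<bar> * norm (v k)"
      using norm_triangle_ineq4[of "a k *\<^sub>R v k + ?s" "a k *\<^sub>R v k"] unfolding e by simp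
    also have "\<dots> \<le> ?P + ?P / ?d * norm (v k)" using mult_right_mono[OF 1, of "norm (v k)"] by simp
    finally have "(\<Sum>l<k. \<bar>a l\<bar>) \<le> (?P + ?P / ?d * norm (v k)) / c" using c(1) by (simp add: field_simps)
    then have "(\<Sum>l<Suc k. \<bar>a l\<bar>) \<le> ?P / ?d + (?P + ?P / ?d * norm (v k)) / c" using 1 by simp
    also have "\<dots> = ?P * m" unfolding m_def by (simp add: algebra_simps add_divide_distrib)
    finally show ?thesis using m by (simp add: field_simps)
  qed
  then show ?case using m by (intro exI[of _ "1 / m"]) auto
qed

text \<open>By the previous lemma, a uniformly small change of the vectors changes every linear combination by at most the
  fraction \<open>1 - t\<close> of its norm.\<close>

lemma vol_perturb:
  fixes v :: "nat \<Rightarrow> 'x::real_normed_vector"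
  assumes "vol k v > 0" "t < 1"
  shows "\<exists>\<delta>>0. \<forall>v'. (\<forall>l<k. norm (v' l - v l) \<le> \<delta>) \<longrightarrow> (\<forall>j<k. t * infdist (v j) (span (v ` {..<j})) \<le> infdist (v' j) (span (v' ` {..<j})))"
proof -
  obtain c where c: "c > 0" "\<And>a. c * (\<Sum>l<k. \<bar>a l\<bar>) \<le> norm (\<Sum>l<k. a l *\<^sub>R v l)"
    using vol_pos_coeffs[OF assms(1)] by blast
  define \<delta> where "\<delta> = c * (1 - t)"
  have \<delta>: "\<delta> > 0" using c assms(2) by (simp add: \<delta>_def)
  have "t * infdist (v j) (span (v ` {..<j})) \<le> infdist (v' j) (span (v' ` {..<j}))"
    if v': "\<forall>l<k. norm (v' l - v l) \<le> \<delta>" and j: "j < k" for v' j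
  proof (cases "t \<le> 0")
    case True
    then have "t * infdist (v j) (span (v ` {..<j})) \<le> 0" by (simp add: infdist_nonneg mult_nonpos_nonneg)
    then show ?thesis using infdist_nonneg[of "v' j"] order_trans by blast
  next
    case False
    show ?thesis
    proof (rule field_le_epsilon)
      fix e :: real assume "e > 0"
      then have "infdist (v' j) (span (v' ` {..<j})) < infdist (v' j) (span (v' ` {..<j})) + e" by simp
      then obtain s where s: "s \<in> span (v' ` {..<j})" "norm (v' j - s) < infdist (v' j) (span (v' ` {..<j})) + e"
        using infdist_span_approx by blast
      have "set (map v' [0..<j]) = v' ` {..<j}" by auto
      then obtain a0 where a0: "s = (\<Sum>l<j. a0 l *\<^sub>R map v' [0..<j] ! l)"
        using span_list_coeffs[of s "map v' [0..<j]"] s(1) by auto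
      then have s_eq: "s = (\<Sum>l<j. a0 l *\<^sub>R v' l)" by simp
      define a where "a l = (if l < j then - a0 l else if l = j then 1 else 0)" for l
      have sum_eq: "(\<Sum>l<k. a l *\<^sub>R z l) = z j - (\<Sum>l<j. a0 l *\<^sub>R z l)" for z :: "nat \<Rightarrow> 'x"
      proof -
        have "(\<Sum>l<k. a l *\<^sub>R z l) = (\<Sum>l<Suc j. a l *\<^sub>R z l)"
          using j by (intro sum.mono_neutral_right) (auto simp: a_def)
        then show ?thesis by (simp add: a_def sum_negf)
      qed
      let ?A = "\<Sum>l<k. \<bar>a l\<bar>"
      have "norm ((\<Sum>l<k. a l *\<^sub>R v' l) - (\<Sum>l<k. a l *\<^sub>R v l)) = norm (\<Sum>l<k. a l *\<^sub>R (v' l - v l))"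
        by (simp add: sum_subtractf scaleR_diff_right)
      also have "\<dots> \<le> (\<Sum>l<k. \<bar>a l\<bar> * \<delta>)"
        using v' by (intro sum_norm_le) (auto intro!: mult_left_mono)
      also have "\<dots> = (1 - t) * (c * ?A)" by (simp add: \<delta>_def sum_distrib_left mult_ac)
      also have "\<dots> \<le> (1 - t) * norm (\<Sum>l<k. a l *\<^sub>R v l)" using assms(2) by (intro mult_left_mono c) auto
      finally have "norm ((\<Sum>l<k. a l *\<^sub>R v' l) - (\<Sum>l<k. a l *\<^sub>R v l)) \<le> (1 - t) * norm (\<Sum>l<k. a l *\<^sub>R v l)" .
      moreover have "norm (\<Sum>l<k. a l *\<^sub>R v l) - norm (\<Sum>l<k. a l *\<^sub>R v' l) \<le> norm ((\<Sum>l<k. a l *\<^sub>R v' l) - (\<Sum>l<k. a l *\<^sub>R v l))"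
        by (metis norm_minus_commute norm_triangle_ineq2)
      ultimately have 1: "t * norm (\<Sum>l<k. a l *\<^sub>R v l) \<le> norm (\<Sum>l<k. a l *\<^sub>R v' l)" by (simp add: left_diff_distrib)
      have "(\<Sum>l<j. a0 l *\<^sub>R v l) \<in> span (v ` {..<j})" by (intro span_sum span_scale span_base) auto
      then have "infdist (v j) (span (v ` {..<j})) \<le> norm (\<Sum>l<k. a l *\<^sub>R v l)"
        unfolding sum_eq by (rule infdist_span_le)
      then have "t * infdist (v j) (span (v ` {..<j})) \<le> t * norm (\<Sum>l<k. a l *\<^sub>R v l)"
        using False by (intro mult_left_mono) auto
      then show "t * infdist (v j) (span (v ` {..<j})) \<le> infdist (v' j) (span (v' ` {..<j})) + e"
        using 1 s(2) unfolding sum_eq[of v'] s_eq by linarith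
    qed
  qed
  then show ?thesis using \<delta> by blast
qed

lemma vol_lower_semicontinuous:
  fixes v :: "nat \<Rightarrow> 'x::real_normed_vector"
  assumes "c < vol k v" "0 \<le> c"
  shows "\<exists>\<delta>>0. \<forall>v'. (\<forall>l<k. norm (v' l - v l) \<le> \<delta>) \<longrightarrow> c < vol k v'"
proof -
  have pos: "vol k v > 0" using assms by linarith
  have "(\<lambda>n. (1 - 1 / real (Suc n)) ^ k * vol k v) \<longlonglongrightarrow> (1 - 0) ^ k * vol k v"
    by (intro tendsto_intros LIMSEQ_Suc[OF lim_1_over_n])
  then have "eventually (\<lambda>n. c < (1 - 1 / real (Suc n)) ^ k * vol k v) sequentially"
    using assms(1) by (intro order_tendstoD(1)) auto
  then obtain n where n: "c < (1 - 1 / real (Suc n)) ^ k * vol k v" using eventually_happens sequentially_bot by blast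
  define t where "t = 1 - 1 / real (Suc n)"
  have t: "0 \<le> t" "t < 1" "c < t ^ k * vol k v" using n by (auto simp: t_def)
  obtain \<delta> where \<delta>: "\<delta> > 0" "\<And>v' j. (\<forall>l<k. norm (v' l - v l) \<le> \<delta>) \<Longrightarrow> j < k \<Longrightarrow>
      t * infdist (v j) (span (v ` {..<j})) \<le> infdist (v' j) (span (v' ` {..<j}))"
    using vol_perturb[OF pos t(2)] by blast
  have "c < vol k v'" if v': "\<forall>l<k. norm (v' l - v l) \<le> \<delta>" for v'
  proof -
    have "t ^ k * vol k v = (\<Prod>j<k. t * infdist (v j) (span (v ` {..<j})))"
      by (simp add: vol_def prod.distrib)
    also have "\<dots> \<le> vol k v'" unfolding vol_def
      using t \<delta>(2)[OF v'] by (intro prod_mono) (auto simp: infdist_nonneg)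
    finally show ?thesis using t(3) by linarith
  qed
  then show ?thesis using \<delta>(1) by blast
qed

text \<open>Volumes are only lower semicontinuous, but this is enough to restrict the supremum to a countable dense set of
  unit vectors.\<close>

lemma borel_measurable_vol_growth:
  fixes T :: "'o \<Rightarrow> 'x::{real_normed_vector, second_countable_topology} \<Rightarrow>\<^sub>L 'x"
  assumes x0: "(x0::'x) \<noteq> 0" and T: "\<And>x. (\<lambda>\<omega>. blinfun_apply (T \<omega>) x) \<in> borel_measurable M"
  shows "(\<lambda>\<omega>. vol_growth k (T \<omega>)) \<in> borel_measurable M"
  unfolding borel_measurable_iff_greater
proof
  fix c
  show "{\<omega> \<in> space M. c < vol_growth k (T \<omega>)} \<in> sets M"
  proof (cases "c < 0")
    case True
    then have "{\<omega> \<in> space M. c < vol_growth k (T \<omega>)} = space M"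
      using vol_growth_nonneg[OF x0] by (auto intro: less_le_trans)
    then show ?thesis by simp
  next
    case False
    obtain D where D: "countable D" "D \<subseteq> sphere (0::'x) 1" "\<And>x e. x \<in> sphere 0 1 \<Longrightarrow> e > 0 \<Longrightarrow> \<exists>d\<in>D. dist d x < e"
      using countable_dense_subset_second_countable[of "sphere (0::'x) 1"] by blast
    define I where "I = {us \<in> lists D. length us = k}"
    have "{\<omega> \<in> space M. c < vol_growth k (T \<omega>)} =
      (\<Union>us\<in>I. {\<omega> \<in> space M. c < vol k (\<lambda>l. blinfun_apply (T \<omega>) (us ! l))})"
    proof (intro equalityI subsetI)
      fix \<omega> assume "\<omega> \<in> {\<omega> \<in> space M. c < vol_growth k (T \<omega>)}"
      then have w: "\<omega> \<in> space M" "c < vol_growth k (T \<omega>)" by auto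
      obtain vs where vs: "length vs = k" "\<forall>u\<in>set vs. norm u = 1" "c < rel_vol {} (map (blinfun_apply (T \<omega>)) vs)"
        using vol_growth_near_opt[OF x0 w(2)] by blast
      have "map (\<lambda>i. blinfun_apply (T \<omega>) (vs ! i)) [0..<k] = map (blinfun_apply (T \<omega>)) vs"
        using vs(1) by (intro nth_equalityI) auto
      then have "c < vol k (\<lambda>i. blinfun_apply (T \<omega>) (vs ! i))"
        unfolding vol_eq_rel_vol using vs(3) by simp
      then obtain \<delta> where \<delta>: "\<delta> > 0" "\<And>v'. (\<forall>l<k. norm (v' l - blinfun_apply (T \<omega>) (vs ! l)) \<le> \<delta>) \<Longrightarrow> c < vol k v'"
        using vol_lower_semicontinuous[of c k] False by force
      have "\<exists>d\<in>D. norm (blinfun_apply (T \<omega>) d - blinfun_apply (T \<omega>) (vs ! l)) \<le> \<delta>" if "l < k" for l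
      proof -
        have "vs ! l \<in> sphere 0 1" using vs that by simp
        moreover have "\<delta> / (norm (T \<omega>) + 1) > 0" using \<delta>(1) by (simp add: add_nonneg_pos)
        ultimately obtain d where d: "d \<in> D" "dist d (vs ! l) < \<delta> / (norm (T \<omega>) + 1)" using D(3) by blast
        have "norm (blinfun_apply (T \<omega>) d - blinfun_apply (T \<omega>) (vs ! l)) \<le> norm (T \<omega>) * norm (d - vs ! l)"
          by (metis blinfun.diff_right norm_blinfun)
        also have "\<dots> \<le> (norm (T \<omega>) + 1) * (\<delta> / (norm (T \<omega>) + 1))"
          using d(2) by (intro mult_mono) (auto simp: dist_norm)
        also have "\<dots> = \<delta>" by (simp add: add_nonneg_eq_0_iff)
        finally show ?thesis using d(1) by blast
      qed
      then obtain d where d: "\<And>l. l < k \<Longrightarrow> d l \<in> D" "\<And>l. l < k \<Longrightarrow> norm (blinfun_apply (T \<omega>) (d l) - blinfun_apply (T \<omega>) (vs ! l)) \<le> \<delta>"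
        by metis
      have "map d [0..<k] \<in> I" using d(1) by (auto simp: I_def in_lists_conv_set)
      moreover have "c < vol k (\<lambda>l. blinfun_apply (T \<omega>) (map d [0..<k] ! l))"
        using d(2) by (intro \<delta>(2)) auto
      ultimately show "\<omega> \<in> (\<Union>us\<in>I. {\<omega> \<in> space M. c < vol k (\<lambda>l. blinfun_apply (T \<omega>) (us ! l))})"
        using w(1) by blast
    next
      fix \<omega> assume "\<omega> \<in> (\<Union>us\<in>I. {\<omega> \<in> space M. c < vol k (\<lambda>l. blinfun_apply (T \<omega>) (us ! l))})"
      then obtain us where us: "us \<in> I" "\<omega> \<in> space M" "c < vol k (\<lambda>l. blinfun_apply (T \<omega>) (us ! l))" by blast
      have "vol k (\<lambda>l. blinfun_apply (T \<omega>) (us ! l)) \<le> vol_growth k (T \<omega>)"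
        unfolding vol_growth_def using us(1) D(2)
        by (intro cSUP_upper vol_growth_bdd) (auto simp: I_def in_lists_conv_set subset_iff)
      then show "\<omega> \<in> {\<omega> \<in> space M. c < vol_growth k (T \<omega>)}" using us by simp
    qed
    also have "\<dots> \<in> sets M"
    proof (intro sets.countable_UN' image_subsetI)
      show "countable I" unfolding I_def by (rule countable_subset[OF _ countable_lists[OF D(1)]]) auto
      fix us
      have [measurable]: "(\<lambda>\<omega>. vol k (\<lambda>l. blinfun_apply (T \<omega>) (us ! l))) \<in> borel_measurable M"
        by (intro borel_measurable_vol T)
      show "{\<omega> \<in> space M. c < vol k (\<lambda>l. blinfun_apply (T \<omega>) (us ! l))} \<in> sets M" by measurable
    qed
    finally show ?thesis .
  qed
qed

section \<open>The measure of noncompactness\<close>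

definition covered :: "('x::real_normed_vector \<Rightarrow>\<^sub>L 'x) \<Rightarrow> real \<Rightarrow> bool" where
  "covered A r \<longleftrightarrow> r > 0 \<and> (\<exists>C. finite C \<and> blinfun_apply A ` cball 0 1 \<subseteq> (\<Union>c\<in>C. ball c r))"

lemma ball_noncompactness_eq: "ball_noncompactness A = Inf {r. covered A r}"
  by (simp add: ball_noncompactness_def covered_def)

lemma covered_norm: "norm A < r \<Longrightarrow> covered A r"
proof -
  assume r: "norm A < r"
  have "norm (blinfun_apply A x) < r" if "norm x \<le> 1" for x
  proof -
    have "norm (blinfun_apply A x) \<le> norm A * norm x" by (rule norm_blinfun)
    also have "\<dots> \<le> norm A * 1" using that by (intro mult_left_mono) auto
    finally show ?thesis using r by simp
  qed
  moreover have "r > 0" using r norm_ge_zero[of A] by linarith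
  ultimately show ?thesis unfolding covered_def by (auto intro!: exI[of _ "{0}"])
qed

lemma covered_bdd: "bdd_below {r. covered A r}"
  by (rule bdd_belowI[of _ 0]) (auto simp: covered_def)

lemma ball_noncompactness_le: "covered A r \<Longrightarrow> ball_noncompactness A \<le> r"
  unfolding ball_noncompactness_eq by (intro cInf_lower covered_bdd) auto

lemma covered_ne: "{r. covered A r} \<noteq> {}"
  using covered_norm[of A "norm A + 1"] by auto

lemma ball_noncompactness_nonneg: "ball_noncompactness A \<ge> 0"
  unfolding ball_noncompactness_eq by (rule cInf_greatest[OF covered_ne]) (auto simp: covered_def)

lemma ball_noncompactness_less_iff: "ball_noncompactness A < r \<longleftrightarrow> (\<exists>s<r. covered A s)"
  unfolding ball_noncompactness_eq by (subst cInf_less_iff[OF covered_ne covered_bdd]) auto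

lemma ball_noncompactness_le_norm: "ball_noncompactness A \<le> norm A"
proof (rule field_le_epsilon)
  fix e :: real assume "e > 0"
  then show "ball_noncompactness A \<le> norm A + e" by (intro ball_noncompactness_le covered_norm) simp
qed

lemma covered_image_ball:
  assumes "covered A s" "r > 0"
  shows "\<exists>D. finite D \<and> blinfun_apply A ` ball c r \<subseteq> (\<Union>d\<in>D. ball d (r * s))"
proof -
  obtain C where C: "finite C" "blinfun_apply A ` cball 0 1 \<subseteq> (\<Union>c\<in>C. ball c s)"
    using assms(1) by (auto simp: covered_def)
  have "blinfun_apply A x \<in> (\<Union>d\<in>(\<lambda>d. blinfun_apply A c + r *\<^sub>R d) ` C. ball d (r * s))" if x: "x \<in> ball c r" for x
  proof -
    have "(1 / r) *\<^sub>R (x - c) \<in> cball 0 1" using x assms(2) by (simp add: dist_norm norm_minus_commute)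
    then have "blinfun_apply A ((1 / r) *\<^sub>R (x - c)) \<in> (\<Union>c\<in>C. ball c s)" using C(2) by blast
    then obtain d where d: "d \<in> C" "dist d (blinfun_apply A ((1 / r) *\<^sub>R (x - c))) < s" by auto
    have "blinfun_apply A c + r *\<^sub>R d - blinfun_apply A x = r *\<^sub>R (d - blinfun_apply A ((1 / r) *\<^sub>R (x - c)))"
      using assms(2) by (simp add: blinfun.scaleR_right blinfun.diff_right algebra_simps)
    then have "dist (blinfun_apply A c + r *\<^sub>R d) (blinfun_apply A x) = r * dist d (blinfun_apply A ((1 / r) *\<^sub>R (x - c)))"
      using assms(2) by (simp add: dist_norm)
    also have "\<dots> < r * s" using d(2) assms(2) by simp
    finally show ?thesis using d(1) by auto
  qed
  then show ?thesis using C(1) by (intro exI[of _ "(\<lambda>d. blinfun_apply A c + r *\<^sub>R d) ` C"]) blast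
qed

lemma covered_compose:
  assumes "covered A r" "covered A' s"
  shows "covered (A' o\<^sub>L A) (r * s)"
proof -
  obtain C where C: "r > 0" "finite C" "blinfun_apply A ` cball 0 1 \<subseteq> (\<Union>c\<in>C. ball c r)"
    using assms(1) by (auto simp: covered_def)
  have "\<forall>c. \<exists>D. finite D \<and> blinfun_apply A' ` ball c r \<subseteq> (\<Union>d\<in>D. ball d (r * s))"
    using covered_image_ball[OF assms(2) C(1)] by blast
  then obtain D where D: "\<And>c. finite (D c)" "\<And>c. blinfun_apply A' ` ball c r \<subseteq> (\<Union>d\<in>D c. ball d (r * s))"
    by metis
  have "blinfun_apply (A' o\<^sub>L A) ` cball 0 1 \<subseteq> (\<Union>d\<in>(\<Union>c\<in>C. D c). ball d (r * s))"
  proof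
    fix y assume "y \<in> blinfun_apply (A' o\<^sub>L A) ` cball 0 1"
    then obtain x where x: "x \<in> cball 0 1" "y = blinfun_apply A' (blinfun_apply A x)" by auto
    then obtain c where c: "c \<in> C" "blinfun_apply A x \<in> ball c r" using C(3) by blast
    then have "y \<in> (\<Union>d\<in>D c. ball d (r * s))" using D(2)[of c] x(2) by blast
    then show "y \<in> (\<Union>d\<in>(\<Union>c\<in>C. D c). ball d (r * s))" using c(1) by blast
  qed
  moreover have "r * s > 0" using C(1) assms(2) by (simp add: covered_def)
  moreover have "finite (\<Union>c\<in>C. D c)" using C D by blast
  ultimately show ?thesis unfolding covered_def by blast
qed

lemma ball_noncompactness_compose:
  "ball_noncompactness (A' o\<^sub>L A) \<le> ball_noncompactness A' * ball_noncompactness A"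
proof -
  have "ball_noncompactness (A' o\<^sub>L A) \<le> (ball_noncompactness A + e) * (ball_noncompactness A' + e)" if e: "e > 0" for e
  proof -
    obtain r s where rs: "r < ball_noncompactness A + e" "covered A r" "s < ball_noncompactness A' + e" "covered A' s"
      using ball_noncompactness_less_iff[of A "ball_noncompactness A + e"]
        ball_noncompactness_less_iff[of A' "ball_noncompactness A' + e"] e by auto
    have "ball_noncompactness (A' o\<^sub>L A) \<le> r * s" by (intro ball_noncompactness_le covered_compose rs)
    also have "\<dots> \<le> (ball_noncompactness A + e) * (ball_noncompactness A' + e)"
      using rs by (intro mult_mono) (auto simp: covered_def)
    finally show ?thesis .
  qed
  note le = this
  have "(\<lambda>n. (ball_noncompactness A + 1 / real (Suc n)) * (ball_noncompactness A' + 1 / real (Suc n)))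
      \<longlonglongrightarrow> (ball_noncompactness A + 0) * (ball_noncompactness A' + 0)"
    by (intro tendsto_intros LIMSEQ_Suc[OF lim_1_over_n])
  then have "ball_noncompactness (A' o\<^sub>L A) \<le> (ball_noncompactness A + 0) * (ball_noncompactness A' + 0)"
    by (rule LIMSEQ_le_const) (use le in auto)
  then show ?thesis by (simp add: mult.commute)
qed

text \<open>Centres can be moved into a countable dense set at the cost of a slightly larger radius, and whether the balls
  cover the image needs to be tested only on a dense set of vectors.\<close>

lemma borel_measurable_ball_noncompactness:
  fixes T :: "'o \<Rightarrow> 'x::{real_normed_vector, second_countable_topology} \<Rightarrow>\<^sub>L 'x"
  assumes T: "\<And>x. (\<lambda>\<omega>. blinfun_apply (T \<omega>) x) \<in> borel_measurable M"
  shows "(\<lambda>\<omega>. ball_noncompactness (T \<omega>)) \<in> borel_measurable M"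
  unfolding borel_measurable_iff_less
proof
  fix r
  obtain E where E: "countable E" "\<And>x::'x. \<And>e. e > 0 \<Longrightarrow> \<exists>d\<in>E. dist d x < e"
    using countable_dense_subset_second_countable[of "UNIV :: 'x set"] by blast
  obtain D where D: "countable D" "D \<subseteq> cball (0::'x) 1" "\<And>x e. x \<in> cball 0 1 \<Longrightarrow> e > 0 \<Longrightarrow> \<exists>d\<in>D. dist d x < e"
    using countable_dense_subset_second_countable[of "cball (0::'x) 1"] by blast
  note [measurable] = T
  have "{\<omega> \<in> space M. ball_noncompactness (T \<omega>) < r} =
      (\<Union>q\<in>{q\<in>\<rat>. 0 < q \<and> q < r}. \<Union>C\<in>{C. finite C \<and> C \<subseteq> E}. {\<omega> \<in> space M. \<forall>x\<in>D. \<exists>c\<in>C. dist c (blinfun_apply (T \<omega>) x) < q})"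
  proof (intro equalityI subsetI)
    fix \<omega> assume "\<omega> \<in> {\<omega> \<in> space M. ball_noncompactness (T \<omega>) < r}"
    then obtain s where s: "\<omega> \<in> space M" "s < r" "covered (T \<omega>) s" using ball_noncompactness_less_iff by blast
    obtain q where q: "q \<in> \<rat>" "s < q" "q < r" using Rats_dense_in_real[OF s(2)] by blast
    obtain C where C: "s > 0" "finite C" "blinfun_apply (T \<omega>) ` cball 0 1 \<subseteq> (\<Union>c\<in>C. ball c s)"
      using s(3) by (auto simp: covered_def)
    have "\<forall>c. \<exists>d\<in>E. dist d c < q - s" using E(2) q by auto
    then obtain h where h: "\<And>c. h c \<in> E" "\<And>c. dist (h c) c < q - s" by metis
    have "\<exists>c\<in>h ` C. dist c (blinfun_apply (T \<omega>) x) < q" if x: "x \<in> D" for x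
    proof -
      have "blinfun_apply (T \<omega>) x \<in> (\<Union>c\<in>C. ball c s)" using C(3) D(2) x by blast
      then obtain c where c: "c \<in> C" "dist c (blinfun_apply (T \<omega>) x) < s" by auto
      have "dist (h c) (blinfun_apply (T \<omega>) x) \<le> dist (h c) c + dist c (blinfun_apply (T \<omega>) x)" by (rule dist_triangle)
      then have "dist (h c) (blinfun_apply (T \<omega>) x) < q" using c(2) h(2)[of c] by linarith
      then show ?thesis using c(1) by blast
    qed
    moreover have "q \<in> {q\<in>\<rat>. 0 < q \<and> q < r}" using q C(1) by auto
    moreover have "h ` C \<in> {C. finite C \<and> C \<subseteq> E}" using h(1) C(2) by auto
    ultimately show "\<omega> \<in> (\<Union>q\<in>{q\<in>\<rat>. 0 < q \<and> q < r}. \<Union>C\<in>{C. finite C \<and> C \<subseteq> E}. {\<omega> \<in> space M. \<forall>x\<in>D. \<exists>c\<in>C. dist c (blinfun_apply (T \<omega>) x) < q})"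
      using s(1) by blast
  next
    fix \<omega> assume "\<omega> \<in> (\<Union>q\<in>{q\<in>\<rat>. 0 < q \<and> q < r}. \<Union>C\<in>{C. finite C \<and> C \<subseteq> E}. {\<omega> \<in> space M. \<forall>x\<in>D. \<exists>c\<in>C. dist c (blinfun_apply (T \<omega>) x) < q})"
    then obtain q C where q: "0 < q" "q < r" "finite C" "\<omega> \<in> space M" "\<And>x. x \<in> D \<Longrightarrow> \<exists>c\<in>C. dist c (blinfun_apply (T \<omega>) x) < q"
      by blast
    define s where "s = (q + r) / 2"
    have s: "q < s" "s < r" using q by (auto simp: s_def)
    have "blinfun_apply (T \<omega>) x \<in> (\<Union>c\<in>C. ball c s)" if x: "x \<in> cball 0 1" for x
    proof -
      have "(s - q) / (norm (T \<omega>) + 1) > 0" using s by (simp add: add_nonneg_pos)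
      then obtain d where d: "d \<in> D" "dist d x < (s - q) / (norm (T \<omega>) + 1)" using D(3)[OF x] by blast
      obtain c where c: "c \<in> C" "dist c (blinfun_apply (T \<omega>) d) < q" using q(5)[OF d(1)] by blast
      have "dist (blinfun_apply (T \<omega>) d) (blinfun_apply (T \<omega>) x) \<le> norm (T \<omega>) * norm (d - x)"
        unfolding dist_norm by (metis blinfun.diff_right norm_blinfun)
      also have "\<dots> \<le> (norm (T \<omega>) + 1) * ((s - q) / (norm (T \<omega>) + 1))"
        using d(2) by (intro mult_mono) (auto simp: dist_norm)
      also have "\<dots> = s - q" by (simp add: add_nonneg_eq_0_iff)
      finally have "dist c (blinfun_apply (T \<omega>) x) < s"
        using c(2) dist_triangle[of c "blinfun_apply (T \<omega>) x" "blinfun_apply (T \<omega>) d"] by linarith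
      then show ?thesis using c(1) by auto
    qed
    then have "covered (T \<omega>) s" using q s unfolding covered_def by (intro conjI exI[of _ C]) auto
    then show "\<omega> \<in> {\<omega> \<in> space M. ball_noncompactness (T \<omega>) < r}" using ball_noncompactness_less_iff s(2) q(4) by blast
  qed
  also have "\<dots> \<in> sets M"
  proof (intro sets.countable_UN' image_subsetI)
    show "countable {q \<in> \<rat>. 0 < q \<and> q < r}" by (rule countable_subset[OF _ countable_rat]) auto
    show "countable {C. finite C \<and> C \<subseteq> E}" by (rule countable_Collect_finite_subset[OF E(1)])
    fix q and C :: "'x set" assume "C \<in> {C. finite C \<and> C \<subseteq> E}"
    then have C: "countable C" by (auto intro: countable_finite)
    have "{\<omega> \<in> space M. \<forall>x\<in>D. \<exists>c\<in>C. dist c (blinfun_apply (T \<omega>) x) < q} \<in> sets M"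
      using D(1) C by measurable
    then show "{\<omega> \<in> space M. \<forall>x\<in>D. \<exists>c\<in>C. dist c (blinfun_apply (T \<omega>) x) < q} \<in> sets M" .
  qed
  finally show "{\<omega> \<in> space M. ball_noncompactness (T \<omega>) < r} \<in> sets M" .
qed

text \<open>If the image of the unit ball is covered by \<open>N\<close> balls of radius \<open>r\<close>, then among the images of
  unit vectors all but \<open>N\<close> are within \<open>2 r\<close> of an earlier one. In the induction, \<open>C'\<close> consists of the balls
  that have been met before.\<close>

lemma rel_vol_le_of_cover:
  fixes ws :: "'x::real_normed_vector list"
  assumes "finite C" "\<And>w. w \<in> set ws \<Longrightarrow> w \<in> (\<Union>c\<in>C \<union> C'. ball c r)" "\<And>c. c \<in> C' \<Longrightarrow> S \<inter> ball c r \<noteq> {}"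
    and "\<And>w. w \<in> set ws \<Longrightarrow> norm w \<le> b" and b: "2 * r \<le> b" "r > 0"
  shows "rel_vol S ws * (2 * r) ^ card C \<le> b ^ card C * (2 * r) ^ length ws"
  using assms(1-4)
proof (induction ws arbitrary: S C C')
  case Nil
  have "(2 * r) ^ card C \<le> b ^ card C" by (rule power_mono) (use b in auto)
  then show ?case by simp
next
  case (Cons w ws)
  show ?case
  proof (cases "\<exists>c\<in>C'. w \<in> ball c r")
    case True
    then obtain c where c: "c \<in> C'" "w \<in> ball c r" by blast
    then obtain y where y: "y \<in> S" "y \<in> ball c r" using Cons.prems(3) by blast
    have "infdist w (span S) \<le> norm (w - y)" by (rule infdist_span_le[OF span_base[OF y(1)]])
    also have "\<dots> \<le> 2 * r" using c(2) y(2) dist_triangle3[of w y c] by (simp add: dist_norm[symmetric])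
    finally have d: "infdist w (span S) \<le> 2 * r" .
    have "rel_vol (insert w S) ws * (2 * r) ^ card C \<le> b ^ card C * (2 * r) ^ length ws"
      by (rule Cons.IH[of C C']) (use Cons.prems in auto)
    then have "infdist w (span S) * (rel_vol (insert w S) ws * (2 * r) ^ card C) \<le> (2 * r) * (b ^ card C * (2 * r) ^ length ws)"
      by (rule mult_mono[OF d]) (use b in auto)
    then show ?thesis by (simp add: mult_ac)
  next
    case False
    then obtain c where c: "c \<in> C" "w \<in> ball c r" using Cons.prems(2)[of w] by auto
    have d: "infdist w (span S) \<le> b" using infdist_span_le_norm[of w S] Cons.prems(4)[of w] by simp
    have "rel_vol (insert w S) ws * (2 * r) ^ card (C - {c}) \<le> b ^ card (C - {c}) * (2 * r) ^ length ws"
    proof (rule Cons.IH)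
      show "finite (C - {c})" using Cons.prems(1) by simp
      show "v \<in> (\<Union>c\<in>C - {c} \<union> insert c C'. ball c r)" if "v \<in> set ws" for v
        using Cons.prems(2)[of v] that by auto
      show "insert w S \<inter> ball c' r \<noteq> {}" if "c' \<in> insert c C'" for c'
        using that c(2) Cons.prems(3) by blast
      show "norm v \<le> b" if "v \<in> set ws" for v using Cons.prems(4) that by simp
    qed
    then have "infdist w (span S) * (rel_vol (insert w S) ws * (2 * r) ^ card (C - {c})) \<le>
        b * (b ^ card (C - {c}) * (2 * r) ^ length ws)"
      by (rule mult_mono[OF d]) (use b in auto)
    then have "infdist w (span S) * (rel_vol (insert w S) ws * (2 * r) ^ card (C - {c})) * (2 * r) \<le>
        b * (b ^ card (C - {c}) * (2 * r) ^ length ws) * (2 * r)"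
      by (rule mult_right_mono) (use b in simp)
    moreover define n where "n = card (C - {c})"
    moreover have "card C = Suc n" unfolding n_def using c(1) Cons.prems(1) by (rule card.remove[rotated])
    ultimately show ?thesis by (simp add: mult_ac)
  qed
qed

lemma vol_growth_le_of_covered:
  fixes A :: "'x::real_normed_vector \<Rightarrow>\<^sub>L 'x"
  assumes x0: "(x0::'x) \<noteq> 0" and A: "covered A r"
  shows "\<exists>N. \<forall>j. vol_growth j A \<le> (max (norm A) (2 * r) / (2 * r)) ^ N * (2 * r) ^ j"
proof -
  obtain C where C: "r > 0" "finite C" "blinfun_apply A ` cball 0 1 \<subseteq> (\<Union>c\<in>C. ball c r)"
    using A by (auto simp: covered_def)
  let ?b = "max (norm A) (2 * r)"
  have "vol_growth j A \<le> (?b / (2 * r)) ^ card C * (2 * r) ^ j" for j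
  proof (rule vol_growth_least[OF x0])
    fix us :: "'x list" assume us: "length us = j" "\<And>u. u \<in> set us \<Longrightarrow> norm u = 1"
    have "rel_vol {} (map (blinfun_apply A) us) * (2 * r) ^ card C \<le> ?b ^ card C * (2 * r) ^ length (map (blinfun_apply A) us)"
    proof (rule rel_vol_le_of_cover[where C' = "{}"])
      show "w \<in> (\<Union>c\<in>C \<union> {}. ball c r)" if w: "w \<in> set (map (blinfun_apply A) us)" for w
      proof -
        obtain u where u: "u \<in> set us" "w = blinfun_apply A u" using w by auto
        then have "u \<in> cball 0 1" using us(2) by simp
        then have "w \<in> (\<Union>c\<in>C. ball c r)" using C(3) u(2) by blast
        then show ?thesis by simp
      qed
      show "norm w \<le> ?b" if w: "w \<in> set (map (blinfun_apply A) us)" for w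
      proof -
        obtain u where u: "u \<in> set us" "w = blinfun_apply A u" using w by auto
        then have "norm w \<le> norm A" using us(2)[of u] norm_blinfun[of A u] by simp
        then show ?thesis by simp
      qed
    qed (use C in auto)
    then show "rel_vol {} (map (blinfun_apply A) us) \<le> (?b / (2 * r)) ^ card C * (2 * r) ^ j"
      using C(1) us(1) by (simp add: power_divide field_simps)
  qed
  then show ?thesis by blast
qed

section \<open>Subspaces of finite codimension\<close>

lemma complement_projection:
  fixes Y :: "'x::real_vector set"
  assumes Y: "subspace Y" and int: "span B \<inter> Y = {0}" and sum: "\<And>x. \<exists>b\<in>span B. x - b \<in> Y"
  shows "\<exists>p. linear p \<and> (\<forall>x. p x \<in> span B \<and> x - p x \<in> Y) \<and> (\<forall>x. x \<in> Y \<longrightarrow> p x = 0)"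
proof -
  obtain p where p: "\<And>x. p x \<in> span B" "\<And>x. x - p x \<in> Y" using sum by metis
  have uniq: "b = p x" if "b \<in> span B" "x - b \<in> Y" for b x
  proof -
    have "b - p x \<in> span B" by (intro span_diff that p)
    moreover have "(x - p x) - (x - b) \<in> Y" by (rule subspace_diff[OF Y p(2) that(2)])
    then have "b - p x \<in> Y" by simp
    ultimately have "b - p x = 0" using int by blast
    then show ?thesis by simp
  qed
  have "linear p"
  proof (rule linearI)
    fix x y :: 'x and c :: real
    have "(x - p x) + (y - p y) \<in> Y" by (rule subspace_add[OF Y p(2) p(2)])
    then have "x + y - (p x + p y) \<in> Y" by (simp add: algebra_simps)
    then show "p (x + y) = p x + p y" using uniq[of "p x + p y" "x + y"] p(1) span_add by metis
    have "c *\<^sub>R (x - p x) \<in> Y" by (rule subspace_scale[OF Y p(2)])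
    then have "c *\<^sub>R x - c *\<^sub>R p x \<in> Y" by (simp add: algebra_simps)
    then show "p (c *\<^sub>R x) = c *\<^sub>R p x" using uniq[of "c *\<^sub>R p x" "c *\<^sub>R x"] p(1) span_scale by metis
  qed
  moreover have "p x = 0" if "x \<in> Y" for x using uniq[of 0 x] that span_zero[of B] by simp
  ultimately show ?thesis using p by blast
qed

lemma has_codimE:
  assumes "has_codim Y k"
  obtains B p where "subspace Y" "finite B" "independent B" "card B = k" "span B \<inter> Y = {0}"
    "linear p" "\<And>x. p x \<in> span B" "\<And>x. x - p x \<in> Y" "\<And>x. x \<in> Y \<Longrightarrow> p x = 0"
proof -
  obtain B where B: "subspace Y" "finite B" "independent B" "card B = k" "span B \<inter> Y = {0}" "\<forall>x. \<exists>b\<in>span B. x - b \<in> Y"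
    using assms unfolding has_codim_def by blast
  obtain p where "linear p" "\<forall>x. p x \<in> span B \<and> x - p x \<in> Y" "\<forall>x. x \<in> Y \<longrightarrow> p x = 0"
    using complement_projection[OF B(1,5)] B(6) by blast
  then show thesis using that B by blast
qed

lemma projection_independent:
  fixes p :: "'x::real_vector \<Rightarrow> 'x"
  assumes p: "linear p" "\<And>x. x - p x \<in> Y" and B: "independent B" "span B \<inter> Y = {0}"
  shows "independent (p ` B)" "inj_on p (span B)"
proof -
  show inj: "inj_on p (span B)"
  proof (rule inj_onI)
    fix x y assume xy: "x \<in> span B" "y \<in> span B" "p x = p y"
    have "x - y - p (x - y) \<in> Y" by (rule p(2))
    then have "x - y \<in> Y" using xy(3) by (simp add: linear_diff[OF p(1)])
    moreover have "x - y \<in> span B" by (intro span_diff xy)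
    ultimately have "x - y \<in> {0}" using B(2) by blast
    then show "x = y" by simp
  qed
  show "independent (p ` B)" by (rule linear_independent_injective_image[OF p(1) B(1) inj])
qed

lemma has_codim_antimono:
  assumes "has_codim Y k" "has_codim Y' k'" "Y \<subseteq> Y'"
  shows "k' \<le> k"
proof -
  obtain B p where B: "finite B" "card B = k" and p: "linear p" "\<And>x. p x \<in> span B" "\<And>x. x - p x \<in> Y"
    by (rule has_codimE[OF assms(1)]) (rule that)
  obtain B' where B': "finite B'" "independent B'" "card B' = k'" "span B' \<inter> Y' = {0}"
    using assms(2) unfolding has_codim_def by blast
  have pY': "x - p x \<in> Y'" for x using p(3) assms(3) by blast
  note ind = projection_independent[OF p(1) pY' B'(2,4)]
  have "card (p ` B') \<le> card B"
    using independent_span_bound[OF B(1) ind(1)] p(2) by blast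
  moreover have "card (p ` B') = card B'"
    by (rule card_image[OF inj_on_subset[OF ind(2) span_superset]])
  ultimately show ?thesis using B B' by simp
qed

lemma has_codim_complement:
  assumes "has_codim Y' k" "finite B" "independent B" "card B = k" "span B \<inter> Y' = {0}"
  shows "\<exists>b\<in>span B. x - b \<in> Y'"
proof -
  obtain B' p where B': "finite B'" "card B' = k" "subspace Y'"
    and p: "linear p" "\<And>x. p x \<in> span B'" "\<And>x. x - p x \<in> Y'"
    by (rule has_codimE[OF assms(1)]) (rule that)
  note ind = projection_independent[OF p(1) p(3) assms(3,5)]
  have c: "card (p ` B) = k"
    using card_image[OF inj_on_subset[OF ind(2) span_superset]] assms(4) by simp
  have "p x \<in> span (p ` B)"
  proof (rule ccontr)
    assume n: "p x \<notin> span (p ` B)"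
    then have "independent (insert (p x) (p ` B))" using ind(1) by (simp add: independent_insert)
    moreover have "insert (p x) (p ` B) \<subseteq> span B'" using p(2) by blast
    ultimately have "card (insert (p x) (p ` B)) \<le> card B'"
      using independent_span_bound[OF B'(1)] by blast
    moreover have "p x \<notin> p ` B" by (rule contra_subsetD[OF span_superset n])
    ultimately show False using c B'(2) assms(2) by simp
  qed
  then obtain b where b: "b \<in> span B" "p x = p b"
    unfolding linear_span_image[OF p(1), of B] by blast
  have "x - b - p (x - b) \<in> Y'" by (rule p(3))
  then have "x - b \<in> Y'" using b(2) by (simp add: linear_diff[OF p(1)])
  then show ?thesis using b(1) by blast
qed

text \<open>The space \<open>span B\<close> meets \<open>Y'\<close> trivially, hence by equality of codimensions is a complement of \<open>Y'\<close>. The component of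
  \<open>y\<close> in \<open>span B\<close> is close to \<open>Y\<close>, because the other component is, and this forces it to be small.\<close>

lemma infdist_gap_reverse:
  fixes Y Y' :: "'x::banach set"
  assumes "has_codim Y' k" "subspace Y" "finite B" "independent B" "card B = k"
    and c: "\<And>f. f \<in> span B \<Longrightarrow> c * norm f \<le> infdist f Y"
    and gap: "\<And>y. y \<in> Y' \<Longrightarrow> infdist y Y \<le> \<eta> * norm y" and \<eta>: "0 \<le> \<eta>" "\<eta> < c" and y: "y \<in> Y"
  shows "infdist y Y' \<le> \<eta> / (c - \<eta>) * norm y"
proof -
  have sY: "span Y = Y" using assms(2) by simp
  have Y': "subspace Y'" using assms(1) by (simp add: has_codim_def)
  have "f = 0" if "f \<in> span B" "f \<in> Y'" for f
  proof (rule ccontr)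
    assume "f \<noteq> 0"
    then have "\<eta> * norm f < c * norm f" using \<eta> by simp
    then show False using c[OF that(1)] gap[OF that(2)] by linarith
  qed
  then have "span B \<inter> Y' = {0}" using span_zero subspace_0[OF Y'] by blast
  then obtain f where f: "f \<in> span B" "y - f \<in> Y'"
    using has_codim_complement[OF assms(1,3,4,5)] by blast
  have "f = - (y - f) + y" by simp
  then have "infdist f Y = infdist (- (y - f)) Y"
    using infdist_span_shift[of y Y "- (y - f)"] y unfolding sY by metis
  also have "\<dots> = infdist (y - f) Y" using infdist_span_minus[of "y - f" Y] unfolding sY .
  also have "\<dots> \<le> \<eta> * norm (y - f)" by (rule gap[OF f(2)])
  also have "\<dots> \<le> \<eta> * (norm y + norm f)" using \<eta> by (intro mult_left_mono norm_triangle_ineq4)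
  finally have "c * norm f \<le> \<eta> * (norm y + norm f)" using c[OF f(1)] by linarith
  then have "norm f \<le> \<eta> / (c - \<eta>) * norm y" using \<eta> by (simp add: field_simps)
  moreover have "infdist y Y' \<le> dist y (y - f)" by (rule infdist_le[OF f(2)])
  ultimately show ?thesis by (simp add: dist_norm)
qed

text \<open>Normalising a nearly closest point at most doubles its distance.\<close>

lemma infdist_sphere_le:
  fixes Y :: "'x::real_normed_vector set"
  assumes "subspace Y" "Y \<noteq> {0}" "norm x = 1"
  shows "infdist x (Y \<inter> sphere 0 1) \<le> 2 * infdist x Y"
proof (rule field_le_epsilon)
  fix e :: real assume "e > 0"
  have sY: "span Y = Y" using assms(1) by simp
  have "infdist x Y < infdist x Y + e / 2" using \<open>e > 0\<close> by simp
  then obtain y where y: "y \<in> Y" "norm (x - y) < infdist x Y + e / 2"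
    using infdist_span_approx[of x Y] unfolding sY by blast
  show "infdist x (Y \<inter> sphere 0 1) \<le> 2 * infdist x Y + e"
  proof (cases "y = 0")
    case True
    obtain z where z: "z \<in> Y \<inter> sphere 0 1" using subspace_sphere_empty_iff[OF assms(1)] assms(2) by blast
    have "infdist x (Y \<inter> sphere 0 1) \<le> dist x z" by (rule infdist_le[OF z])
    also have "\<dots> \<le> 2" using norm_triangle_ineq4[of x z] z assms(3) by (simp add: dist_norm)
    also have "\<dots> \<le> 2 * infdist x Y + e" using y(2) True assms(3) by simp
    finally show ?thesis .
  next
    case False
    let ?z = "(1 / norm y) *\<^sub>R y"
    have z: "?z \<in> Y \<inter> sphere 0 1" using False y(1) assms(1) by (simp add: subspace_scale)
    have "norm (y - ?z) = \<bar>norm y - 1\<bar>"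
    proof -
      have "y - ?z = (1 - 1 / norm y) *\<^sub>R y" by (simp add: algebra_simps)
      then have "norm (y - ?z) = \<bar>1 - 1 / norm y\<bar> * norm y" by (metis norm_scaleR)
      also have "\<dots> = \<bar>(1 - 1 / norm y) * norm y\<bar>" by (simp add: abs_mult)
      also have "(1 - 1 / norm y) * norm y = norm y - 1" using False by (simp add: field_simps)
      finally show ?thesis .
    qed
    also have "\<dots> \<le> norm (x - y)" using assms(3) norm_triangle_ineq3[of y x] by (simp add: norm_minus_commute)
    finally have "norm (x - ?z) \<le> 2 * norm (x - y)"
      using norm_triangle_ineq[of "x - y" "y - ?z"] by simp
    moreover have "infdist x (Y \<inter> sphere 0 1) \<le> norm (x - ?z)" using infdist_le[OF z, of x] by (simp add: dist_norm)
    ultimately show ?thesis using y(2) by linarith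
  qed
qed

lemma cograss_dist_le:
  fixes Y Y' :: "'x::real_normed_vector set"
  assumes Y: "subspace Y" "Y \<noteq> {0}" "subspace Y'" "Y' \<noteq> {0}"
    and 1: "\<And>y. y \<in> Y \<Longrightarrow> infdist y Y' \<le> \<eta> * norm y" and 2: "\<And>y. y \<in> Y' \<Longrightarrow> infdist y Y \<le> \<eta> * norm y"
    and "\<eta> \<ge> 0"
  shows "cograss_dist Y Y' \<le> 2 * \<eta>"
proof -
  have bd: "bounded (W \<inter> sphere (0::'x) 1)" for W
    by (rule bounded_subset[OF bounded_cball[of 0 1]]) auto
  have half: "infdist x (Y2 \<inter> sphere 0 1) \<le> 2 * \<eta>"
    if "x \<in> Y1 \<inter> sphere 0 1" "subspace Y2" "Y2 \<noteq> {0}" "\<And>y. y \<in> Y1 \<Longrightarrow> infdist y Y2 \<le> \<eta> * norm y" for x Y1 Y2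
    using infdist_sphere_le[OF that(2,3), of x] that(1) that(4)[of x] by simp
  show ?thesis unfolding cograss_dist_def
    using half[of _ Y Y'] half[of _ Y' Y] assms subspace_sphere_empty_iff[OF Y(1)] subspace_sphere_empty_iff[OF Y(3)]
    by (subst hausdorff_dist_le_iff[OF _ _ bd bd]) auto
qed

subsection \<open>Separability of the Grassmannian\<close>

text \<open>The functionals \<open>\<phi> i\<close> are the coordinates with respect to \<open>b\<close> of a projection along \<open>Y\<close>.\<close>

definition defining_functionals :: "nat \<Rightarrow> 'x::banach set \<Rightarrow> (nat \<Rightarrow> 'x \<Rightarrow>\<^sub>L real) \<Rightarrow> (nat \<Rightarrow> 'x) \<Rightarrow> bool" where
  "defining_functionals k Y \<phi> b \<longleftrightarrow>
     (\<forall>x. x - (\<Sum>i<k. blinfun_apply (\<phi> i) x *\<^sub>R b i) \<in> Y) \<and> (\<forall>y\<in>Y. \<forall>i<k. blinfun_apply (\<phi> i) y = 0)"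

lemma defining_functionals_ex:
  fixes Y :: "'x::banach set"
  assumes "Y \<in> cograss k"
  shows "\<exists>\<phi> b. defining_functionals k Y \<phi> b"
proof -
  have cl: "closed Y" and cod: "has_codim Y k" using assms by (auto simp: cograss_def)
  obtain B p where B: "subspace Y" "finite B" "independent B" "card B = k" "span B \<inter> Y = {0}"
    and p: "linear p" "\<And>x. p x \<in> span B" "\<And>x. x - p x \<in> Y" "\<And>x. x \<in> Y \<Longrightarrow> p x = 0"
    by (rule has_codimE[OF cod]) (rule that)
  have sY: "span Y = Y" using B(1) by simp
  obtain c where c: "c > 0" "\<And>u. c * (\<Sum>b\<in>B. \<bar>u b\<bar>) \<le> infdist (\<Sum>b\<in>B. u b *\<^sub>R b) Y"
    using coeff_sum_le_infdist[OF B(2,3), of Y] cl B(5) unfolding sY by auto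
  define r where "r x b = representation B (p x) b" for x b
  have rsum: "(\<Sum>b\<in>B. r x b *\<^sub>R b) = p x" for x
    unfolding r_def using B p by (intro real_vector.sum_representation_eq) auto
  have blin: "bounded_linear (\<lambda>x. r x b)" if b: "b \<in> B" for b
  proof (rule bounded_linear_intro[where K = "1 / c"])
    show "r (x + y) b = r x b + r y b" for x y
      unfolding r_def linear_add[OF p(1)] using real_vector.representation_add[OF B(3) p(2) p(2)] by metis
    show "r (a *\<^sub>R x) b = a *\<^sub>R r x b" for a x
      unfolding r_def linear_scale[OF p(1)] using real_vector.representation_scale[OF B(3) p(2)] by simp
    fix x
    have "\<bar>r x b\<bar> \<le> (\<Sum>b\<in>B. \<bar>r x b\<bar>)" using b B(2) by (intro member_le_sum) auto
    then have "c * \<bar>r x b\<bar> \<le> c * (\<Sum>b\<in>B. \<bar>r x b\<bar>)" using c(1) by (intro mult_left_mono) auto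
    also have "\<dots> \<le> infdist (\<Sum>b\<in>B. r x b *\<^sub>R b) Y" by (rule c(2))
    also have "\<dots> = infdist (p x) Y" by (simp add: rsum)
    also have "\<dots> = infdist (p x + (x - p x)) Y"
      using infdist_span_shift[of "x - p x" Y "p x"] p(3) unfolding sY by metis
    also have "\<dots> \<le> norm x" using infdist_span_le_norm[of x Y] unfolding sY by simp
    finally show "norm (r x b) \<le> norm x * (1 / c)" using c(1) by (simp add: field_simps)
  qed
  obtain h where h: "bij_betw h {..<k} B" using ex_bij_betw_nat_finite[OF B(2)] B(4) by (auto simp: lessThan_atLeast0)
  have hB: "h i \<in> B" if "i < k" for i using h that by (auto simp: bij_betw_def)
  define \<phi> where "\<phi> i = Blinfun (\<lambda>x. r x (h i))" for i
  have \<phi>: "blinfun_apply (\<phi> i) x = r x (h i)" if "i < k" for i x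
    unfolding \<phi>_def by (rule bounded_linear_Blinfun_apply[THEN fun_cong, OF blin[OF hB[OF that]]])
  have "(\<Sum>i<k. blinfun_apply (\<phi> i) x *\<^sub>R h i) = p x" for x
  proof -
    have "(\<Sum>i<k. blinfun_apply (\<phi> i) x *\<^sub>R h i) = (\<Sum>i<k. r x (h i) *\<^sub>R h i)" by (intro sum.cong) (auto simp: \<phi>)
    also have "\<dots> = (\<Sum>b\<in>B. r x b *\<^sub>R b)" by (rule sum.reindex_bij_betw[OF h])
    finally show ?thesis by (simp add: rsum)
  qed
  moreover have "blinfun_apply (\<phi> i) y = 0" if "y \<in> Y" "i < k" for y i
    using \<phi>[OF that(2)] p(4)[OF that(1)] by (simp add: r_def real_vector.representation_zero)
  ultimately have "defining_functionals k Y \<phi> h" using p(3) by (simp add: defining_functionals_def)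
  then show ?thesis by blast
qed

text \<open>Subspaces with nearly the same defining functionals are close to each other. Functionals from a dense set need not
  define a subspace of codimension \<open>k\<close> with a controlled projection; therefore one picks, for every list of such
  functionals and every precision, one subspace that has defining functionals near the list, provided that there is one.\<close>

lemma cograss_separable:
  assumes sep: "separable_space (euclidean :: ('x::banach \<Rightarrow>\<^sub>L real) topology)"
  shows "\<exists>\<Y>. countable \<Y> \<and> \<Y> \<subseteq> cograss k \<and> (\<forall>Y\<in>cograss k. \<forall>r>0. \<exists>Y'\<in>\<Y>. cograss_dist (Y::'x set) Y' < r)"
proof (cases "{0::'x} \<in> cograss k")
  case True
  then have all: "cograss k = {{0::'x}}" using has_codim_zero_eq by (auto simp: cograss_def)
  have "cograss_dist {0} ({0} :: 'x set) = 0"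
    by (simp add: cograss_dist_def hausdorff_dist_def bot_ennreal)
  then show ?thesis unfolding all by (intro exI[of _ "{{0}}"]) auto
next
  case False
  obtain \<Psi> :: "('x \<Rightarrow>\<^sub>L real) set" where \<Psi>: "countable \<Psi>" "closure \<Psi> = UNIV"
    using sep unfolding separable_space_def by (auto simp: euclidean_closure_of)
  have dense: "\<exists>\<psi>\<in>\<Psi>. dist \<psi> \<phi> < e" if "e > 0" for \<phi> e
    using closure_approachable[of \<phi> \<Psi>] \<Psi>(2) that by auto
  define good where "good = (\<lambda>(\<psi>s :: ('x \<Rightarrow>\<^sub>L real) list, n::nat) (Y :: 'x set). Y \<in> cograss k \<and> (\<exists>\<phi> b. defining_functionals k Y \<phi> b \<and>
      (\<forall>i<k. dist (\<psi>s ! i) (\<phi> i) < 1 / real (Suc n))))"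
  define I where "I = {q \<in> lists \<Psi> \<times> UNIV. \<exists>Y. good q Y}"
  define pick where "pick q = (SOME Y. good q Y)" for q
  have pick: "good q (pick q)" if "q \<in> I" for q
    unfolding pick_def using that by (auto simp: I_def intro: someI_ex)
  have "countable I" unfolding I_def by (rule countable_subset[of _ "lists \<Psi> \<times> UNIV"]) (use \<Psi> in auto)
  moreover have "pick ` I \<subseteq> cograss k" using pick by (auto simp: good_def)
  moreover have "\<exists>Y'\<in>pick ` I. cograss_dist Y Y' < r" if Y: "Y \<in> cograss k" and r: "r > 0" for Y r
  proof -
    obtain \<phi> b where \<phi>: "defining_functionals k Y \<phi> b" using defining_functionals_ex[OF Y] by blast
    have cl: "closed Y" and cod: "has_codim Y k" using Y by (auto simp: cograss_def)
    obtain B where B: "subspace Y" "finite B" "independent B" "card B = k" "span B \<inter> Y = {0}"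
      using cod unfolding has_codim_def by blast
    have sY: "span Y = Y" using B(1) by simp
    obtain c where c: "c > 0" "\<And>f. f \<in> span B \<Longrightarrow> c * norm f \<le> infdist f Y"
      using norm_le_infdist_complement[OF B(2,3), of Y] cl B(5) unfolding sY by auto
    define m where "m = 1 + (\<Sum>i<k. norm (b i))"
    have m: "m > 0" by (simp add: m_def add_pos_nonneg sum_nonneg)
    define \<eta>0 where "\<eta>0 = min (c / 2) (min (r / 4) (r * c / 8))"
    have \<eta>0: "\<eta>0 > 0" using c r by (simp add: \<eta>0_def)
    obtain n :: nat where n: "1 / real (Suc n) < \<eta>0 / (2 * m)" using nat_approx_posE[of "\<eta>0 / (2 * m)"] \<eta>0 m by auto
    have "\<forall>i. \<exists>\<psi>\<in>\<Psi>. dist \<psi> (\<phi> i) < 1 / real (Suc n)" using dense by simp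
    then obtain \<psi> where \<psi>: "\<And>i. \<psi> i \<in> \<Psi>" "\<And>i. dist (\<psi> i) (\<phi> i) < 1 / real (Suc n)" by metis
    define q where "q = (map \<psi> [0..<k], n)"
    have "good q Y" using Y \<phi> \<psi>(2) by (auto simp: good_def q_def)
    then have qI: "q \<in> I" using \<psi>(1) by (auto simp: I_def q_def in_lists_conv_set)
    define Y' where "Y' = pick q"
    obtain \<phi>' b' where Y': "Y' \<in> cograss k" "defining_functionals k Y' \<phi>' b'"
      "\<And>i. i < k \<Longrightarrow> dist (\<psi> i) (\<phi>' i) < 1 / real (Suc n)"
      using pick[OF qI] by (auto simp: good_def q_def Y'_def)
    have cod': "has_codim Y' k" using Y' by (auto simp: cograss_def)
    have sub': "subspace Y'" using cod' by (simp add: has_codim_def)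
    define \<eta> where "\<eta> = 2 / real (Suc n) * m"
    have \<eta>: "0 \<le> \<eta>" "\<eta> < \<eta>0" using n m by (auto simp: \<eta>_def field_simps)
    have gap: "infdist y Y \<le> \<eta> * norm y" if y: "y \<in> Y'" for y
    proof -
      have "\<bar>blinfun_apply (\<phi> i) y\<bar> \<le> 2 / real (Suc n) * norm y" if i: "i < k" for i
      proof -
        have "blinfun_apply (\<phi>' i) y = 0" using Y'(2) y i by (auto simp: defining_functionals_def)
        then have "\<bar>blinfun_apply (\<phi> i) y\<bar> = norm (blinfun_apply (\<phi> i - \<phi>' i) y)" by (simp add: blinfun.diff_left)
        also have "\<dots> \<le> norm (\<phi> i - \<phi>' i) * norm y" by (rule norm_blinfun)
        also have "norm (\<phi> i - \<phi>' i) \<le> dist (\<psi> i) (\<phi> i) + dist (\<psi> i) (\<phi>' i)"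
          unfolding dist_norm[symmetric] by (rule dist_triangle3)
        also have "\<dots> \<le> 2 / real (Suc n)" using \<psi>(2)[of i] Y'(3)[OF i] by (simp add: add_divide_distrib[symmetric])
        finally show ?thesis by (simp add: mult_right_mono)
      qed
      then have "\<bar>blinfun_apply (\<phi> i) y\<bar> * norm (b i) \<le> 2 / real (Suc n) * norm y * norm (b i)" if "i < k" for i
        using that by (intro mult_right_mono) auto
      then have "norm (\<Sum>i<k. blinfun_apply (\<phi> i) y *\<^sub>R b i) \<le> (\<Sum>i<k. 2 / real (Suc n) * norm y * norm (b i))"
        by (intro sum_norm_le) simp
      also have "\<dots> = 2 / real (Suc n) * norm y * (\<Sum>i<k. norm (b i))" by (simp add: sum_distrib_left)
      also have "\<dots> \<le> 2 / real (Suc n) * norm y * m" by (intro mult_left_mono) (auto simp: m_def)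
      finally have 1: "norm (\<Sum>i<k. blinfun_apply (\<phi> i) y *\<^sub>R b i) \<le> \<eta> * norm y" by (simp add: \<eta>_def mult_ac)
      have "y - (\<Sum>i<k. blinfun_apply (\<phi> i) y *\<^sub>R b i) \<in> Y" using \<phi> by (auto simp: defining_functionals_def)
      from infdist_le[OF this, of y] 1 show ?thesis by (simp add: dist_norm)
    qed
    have \<eta>c: "\<eta> < c" using \<eta>(2) c(1) by (simp add: \<eta>0_def)
    have gap': "infdist y Y' \<le> \<eta> / (c - \<eta>) * norm y" if "y \<in> Y" for y
      by (rule infdist_gap_reverse[OF cod' B(1-4) c(2) gap \<eta>(1) \<eta>c that])
    define \<zeta> where "\<zeta> = max \<eta> (\<eta> / (c - \<eta>))"
    have "cograss_dist Y Y' \<le> 2 * \<zeta>"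
    proof (rule cograss_dist_le)
      show "Y \<noteq> {0}" "Y' \<noteq> {0}" using False Y Y'(1) by auto
      show "infdist y Y' \<le> \<zeta> * norm y" if "y \<in> Y" for y
        using gap'[OF that] mult_right_mono[of "\<eta> / (c - \<eta>)" \<zeta> "norm y"] by (simp add: \<zeta>_def)
      show "infdist y Y \<le> \<zeta> * norm y" if "y \<in> Y'" for y
        using gap[OF that] mult_right_mono[of \<eta> \<zeta> "norm y"] by (simp add: \<zeta>_def)
    qed (use B(1) sub' \<eta>(1) in \<open>auto simp: \<zeta>_def\<close>)
    also have "2 * \<zeta> < r"
    proof -
      have "\<eta> < r / 4" "\<eta> < r * c / 8" "\<eta> < c / 2" using \<eta>(2) by (auto simp: \<eta>0_def)
      moreover have "\<eta> / (c - \<eta>) \<le> \<eta> / (c / 2)" using \<eta> calculation(3) c(1) by (intro divide_left_mono) auto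
      moreover have "\<eta> / (c / 2) < r / 2"
      proof -
        have "r * c / 8 < r * c / 4" using r c(1) by simp
        then have "\<eta> < r * c / 4" using calculation(2) by linarith
        then show ?thesis using c(1) by (simp add: field_simps)
      qed
      ultimately show ?thesis using r by (auto simp: \<zeta>_def)
    qed
    finally show ?thesis using qI Y'_def by blast
  qed
  ultimately show ?thesis by (intro exI[of _ "pick ` I"]) auto
qed

subsection \<open>Measurability of families of subspaces\<close>

text \<open>By separability, open sets are countable unions of balls.\<close>

lemma measurable_cograss:
  fixes V :: "'o \<Rightarrow> 'x::banach set"
  assumes sep: "separable_space (euclidean :: ('x \<Rightarrow>\<^sub>L real) topology)"
    and V: "\<And>\<omega>. \<omega> \<in> space M \<Longrightarrow> V \<omega> \<in> cograss k"
    and dist: "\<And>Y. Y \<in> cograss k \<Longrightarrow> (\<lambda>\<omega>. cograss_dist Y (V \<omega>)) \<in> borel_measurable M"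
  shows "V \<in> measurable M (cograss_borel k)"
proof -
  interpret Metric_space "cograss k :: 'x set set" cograss_dist by (rule Metric_space_cograss)
  obtain \<Y> where \<Y>: "countable \<Y>" "\<Y> \<subseteq> cograss k" "\<And>Y r. Y \<in> cograss k \<Longrightarrow> r > 0 \<Longrightarrow> \<exists>Y'\<in>\<Y>. cograss_dist (Y::'x set) Y' < r"
    using cograss_separable[OF sep, of k] by blast
  show ?thesis unfolding cograss_borel_def
  proof (rule measurable_measure_of)
    show "{U. openin mtopology U} \<subseteq> Pow (cograss k)"
      using openin_subset[of mtopology] by auto
    show "V \<in> space M \<rightarrow> cograss k" using V by auto
    fix U assume "U \<in> {U. openin mtopology U}"
    then have U: "openin mtopology U" by simp
    define J where "J = {(Y, q). Y \<in> \<Y> \<and> q \<in> \<rat> \<and> mball Y q \<subseteq> U}"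
    have "V -` U \<inter> space M = (\<Union>(Y, q)\<in>J. {\<omega>\<in>space M. cograss_dist Y (V \<omega>) < q})"
    proof (intro equalityI subsetI)
      fix \<omega> assume w: "\<omega> \<in> V -` U \<inter> space M"
      then obtain r where r: "r > 0" "mball (V \<omega>) r \<subseteq> U" using U by (auto simp: openin_mtopology)
      obtain Y where Y: "Y \<in> \<Y>" "cograss_dist (V \<omega>) Y < r / 2" using \<Y>(3)[of "V \<omega>" "r / 2"] V r w by auto
      obtain q where q: "q \<in> \<rat>" "cograss_dist (V \<omega>) Y < q" "q < r / 2" using Rats_dense_in_real[OF Y(2)] by blast
      have "mball Y q \<subseteq> mball (V \<omega>) r"
      proof
        fix Z assume Z: "Z \<in> mball Y q"
        then have "Z \<in> cograss k" "cograss_dist Y Z < q" by (auto simp: in_mball)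
        then have "cograss_dist (V \<omega>) Z \<le> cograss_dist (V \<omega>) Y + cograss_dist Y Z"
          using V w \<Y>(2) Y(1) by (intro triangle) auto
        then show "Z \<in> mball (V \<omega>) r" using q \<open>cograss_dist Y Z < q\<close> \<open>Z \<in> cograss k\<close> V w by (auto simp: in_mball)
      qed
      then have "(Y, q) \<in> J" using Y q r by (auto simp: J_def)
      moreover have "cograss_dist Y (V \<omega>) < q" using q(2) by (simp add: commute)
      ultimately show "\<omega> \<in> (\<Union>(Y, q)\<in>J. {\<omega>\<in>space M. cograss_dist Y (V \<omega>) < q})" using w by blast
    next
      fix \<omega> assume "\<omega> \<in> (\<Union>(Y, q)\<in>J. {\<omega>\<in>space M. cograss_dist Y (V \<omega>) < q})"
      then obtain Y q where Yq: "(Y, q) \<in> J" "\<omega> \<in> space M" "cograss_dist Y (V \<omega>) < q" by blast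
      then have "V \<omega> \<in> mball Y q" using V \<Y>(2) by (auto simp: in_mball J_def)
      then show "\<omega> \<in> V -` U \<inter> space M" using Yq by (auto simp: J_def)
    qed
    also have "\<dots> \<in> sets M"
    proof (intro sets.countable_UN' image_subsetI)
      show "countable J" unfolding J_def
        by (rule countable_subset[of _ "\<Y> \<times> \<rat>"]) (use \<Y>(1) countable_rat in auto)
      fix x assume "x \<in> J"
      then obtain Y q where x: "x = (Y, q)" "Y \<in> \<Y>" by (auto simp: J_def)
      have [measurable]: "(\<lambda>\<omega>. cograss_dist Y (V \<omega>)) \<in> borel_measurable M" using dist x(2) \<Y>(2) by blast
      show "(case x of (Y, q) \<Rightarrow> {\<omega> \<in> space M. cograss_dist Y (V \<omega>) < q}) \<in> sets M"
        unfolding x(1) prod.case by measurable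
    qed
    finally show "V -` U \<inter> space M \<in> sets M" .
  qed
qed

lemma hausdorff_dist_dense:
  fixes A A' B :: "'a::metric_space set"
  assumes sub: "A' \<subseteq> A" and dense: "\<And>x e. x \<in> A \<Longrightarrow> e > 0 \<Longrightarrow> \<exists>d\<in>A'. dist d x < e"
  shows "hausdorff_dist A B = hausdorff_dist A' B"
proof -
  have "(SUP x\<in>A. INF y\<in>B. ennreal (dist x y)) = (SUP x\<in>A'. INF y\<in>B. ennreal (dist x y))"
  proof (rule antisym)
    show "(SUP x\<in>A'. INF y\<in>B. ennreal (dist x y)) \<le> (SUP x\<in>A. INF y\<in>B. ennreal (dist x y))"
      by (rule SUP_subset_mono[OF sub]) simp
    show "(SUP x\<in>A. INF y\<in>B. ennreal (dist x y)) \<le> (SUP x\<in>A'. INF y\<in>B. ennreal (dist x y))"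
    proof (rule SUP_least)
      fix x assume x: "x \<in> A"
      show "(INF y\<in>B. ennreal (dist x y)) \<le> (SUP x\<in>A'. INF y\<in>B. ennreal (dist x y))"
      proof (cases "B = {}")
        case True
        obtain d where "d \<in> A'" using dense[OF x, of 1] by auto
        then show ?thesis using True by (auto intro: SUP_upper2)
      next
        case False
        show ?thesis unfolding INF_dist_eq_infdist[OF False]
        proof (rule ennreal_le_epsilon)
          fix e :: real assume e: "e > 0"
          obtain d where d: "d \<in> A'" "dist d x < e" using dense[OF x e] by blast
          have "infdist x B \<le> infdist d B + e" using infdist_triangle[of x B d] d(2) by (simp add: dist_commute)
          then have "ennreal (infdist x B) \<le> ennreal (infdist d B) + ennreal e"
            using e by (simp flip: ennreal_plus add: infdist_nonneg ennreal_leI)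
          also have "\<dots> \<le> (SUP x\<in>A'. ennreal (infdist x B)) + ennreal e"
            using d(1) by (intro add_right_mono SUP_upper)
          finally show "ennreal (infdist x B) \<le> (SUP x\<in>A'. ennreal (infdist x B)) + ennreal e" .
        qed
      qed
    qed
  qed
  moreover have "(INF x\<in>A. ennreal (dist x y)) = (INF x\<in>A'. ennreal (dist x y))" for y
  proof (rule antisym)
    show "(INF x\<in>A. ennreal (dist x y)) \<le> (INF x\<in>A'. ennreal (dist x y))"
      by (rule INF_superset_mono[OF sub]) simp
    show "(INF x\<in>A'. ennreal (dist x y)) \<le> (INF x\<in>A. ennreal (dist x y))"
    proof (rule INF_greatest, rule ennreal_le_epsilon)
      fix x and e :: real assume x: "x \<in> A" and e: "e > 0"
      obtain d where d: "d \<in> A'" "dist d x < e" using dense[OF x e] by blast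
      have "(INF x\<in>A'. ennreal (dist x y)) \<le> ennreal (dist d y)" by (rule INF_lower[OF d(1)])
      also have "\<dots> \<le> ennreal (dist x y + e)"
        using d(2) dist_triangle[of d y x] by (intro ennreal_leI) simp
      also have "\<dots> = ennreal (dist x y) + ennreal e" using e by simp
      finally show "(INF x\<in>A'. ennreal (dist x y)) \<le> ennreal (dist x y) + ennreal e" .
    qed
  qed
  ultimately show ?thesis by (simp add: hausdorff_dist_def)
qed

text \<open>A countable dense subset of \<open>S\<close> is dense in every relatively open part of \<open>S\<close>, so that the suprema and infima can be
  taken over fixed countable sets.\<close>

lemma borel_measurable_hausdorff_dist:
  fixes W :: "'o \<Rightarrow> 'x::{metric_space, second_countable_topology} set"
  assumes op: "\<And>\<omega>. \<omega> \<in> space M \<Longrightarrow> open (W \<omega>)" and meas: "\<And>x. {\<omega>\<in>space M. x \<in> W \<omega>} \<in> sets M"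
  shows "(\<lambda>\<omega>. hausdorff_dist A (W \<omega> \<inter> S)) \<in> borel_measurable M"
proof -
  obtain D where D: "countable D" "D \<subseteq> S" "\<And>x e. x \<in> S \<Longrightarrow> e > 0 \<Longrightarrow> \<exists>d\<in>D. dist d x < e"
    using countable_dense_subset_second_countable[of S] by blast
  obtain E where E: "countable E" "E \<subseteq> A" "\<And>x e. x \<in> A \<Longrightarrow> e > 0 \<Longrightarrow> \<exists>d\<in>E. dist d x < e"
    using countable_dense_subset_second_countable[of A] by blast
  have eq: "hausdorff_dist A (W \<omega> \<inter> S) = enn2real
     (max (SUP x\<in>E. INF y\<in>D. if y \<in> W \<omega> then ennreal (dist x y) else \<top>)
       (SUP y\<in>D. if y \<in> W \<omega> then (INF x\<in>E. ennreal (dist x y)) else 0))" if w: "\<omega> \<in> space M" for \<omega>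
  proof -
    have dW: "\<exists>d\<in>W \<omega> \<inter> D. dist d x < e" if x: "x \<in> W \<omega> \<inter> S" and e: "e > 0" for x e
    proof -
      obtain r where r: "r > 0" "ball x r \<subseteq> W \<omega>" using op[OF w] x by (auto simp: open_contains_ball)
      obtain d where d: "d \<in> D" "dist d x < min r e" using D(3)[of x "min r e"] x r e by auto
      then have "d \<in> ball x r" by (simp add: dist_commute)
      then show ?thesis using r d by auto
    qed
    have "hausdorff_dist A (W \<omega> \<inter> S) = hausdorff_dist E (W \<omega> \<inter> S)"
      by (rule hausdorff_dist_dense[OF E(2,3)])
    also have "\<dots> = hausdorff_dist (W \<omega> \<inter> S) E" by (rule hausdorff_dist_commute)
    also have "\<dots> = hausdorff_dist (W \<omega> \<inter> D) E"
      by (rule hausdorff_dist_dense) (use D(2) dW in auto)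
    also have "\<dots> = hausdorff_dist E (W \<omega> \<inter> D)" by (rule hausdorff_dist_commute)
    finally have 1: "hausdorff_dist A (W \<omega> \<inter> S) = hausdorff_dist E (W \<omega> \<inter> D)" .
    have 2: "(INF y\<in>W \<omega> \<inter> D. g y) = (INF y\<in>D. if y \<in> W \<omega> then g y else \<top>)" for g :: "'x \<Rightarrow> ennreal"
    proof (rule antisym)
      show "(INF y\<in>W \<omega> \<inter> D. g y) \<le> (INF y\<in>D. if y \<in> W \<omega> then g y else \<top>)"
        by (rule INF_greatest) (auto intro: INF_lower)
      show "(INF y\<in>D. if y \<in> W \<omega> then g y else \<top>) \<le> (INF y\<in>W \<omega> \<inter> D. g y)"
        proof (rule INF_greatest)
        fix y assume y: "y \<in> W \<omega> \<inter> D"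
        then show "(INF y\<in>D. if y \<in> W \<omega> then g y else \<top>) \<le> g y"
          by (intro INF_lower2[of y]) auto
      qed
    qed
    have 3: "(SUP y\<in>W \<omega> \<inter> D. g y) = (SUP y\<in>D. if y \<in> W \<omega> then g y else 0)" for g :: "'x \<Rightarrow> ennreal"
    proof (rule antisym)
      show "(SUP y\<in>D. if y \<in> W \<omega> then g y else 0) \<le> (SUP y\<in>W \<omega> \<inter> D. g y)"
        by (rule SUP_least) (auto intro: SUP_upper)
      show "(SUP y\<in>W \<omega> \<inter> D. g y) \<le> (SUP y\<in>D. if y \<in> W \<omega> then g y else 0)"
      proof (rule SUP_least)
        fix y assume y: "y \<in> W \<omega> \<inter> D"
        then show "g y \<le> (SUP y\<in>D. if y \<in> W \<omega> then g y else 0)"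
          by (intro SUP_upper2[of y]) auto
      qed
    qed
    show ?thesis by (subst 1) (simp only: hausdorff_dist_def 2 3)
  qed
  note [measurable] = meas
  have [measurable]: "Measurable.pred M (\<lambda>\<omega>. x \<in> W \<omega>)" for x using meas by (simp add: pred_def)
  have "(\<lambda>\<omega>. enn2real
     (max (SUP x\<in>E. INF y\<in>D. if y \<in> W \<omega> then ennreal (dist x y) else \<top>)
       (SUP y\<in>D. if y \<in> W \<omega> then (INF x\<in>E. ennreal (dist x y)) else 0))) \<in> borel_measurable M"
    by (intro borel_measurable_enn2real borel_measurable_max borel_measurable_SUP borel_measurable_INF D(1) E(1)) measurable
  then show ?thesis by (subst measurable_cong[OF eq]) auto
qed

text \<open>This expresses the distance from a family of subspaces by distances from open sets, to which the previous lemma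
  applies.\<close>

lemma cograss_dist_limit:
  fixes V Y :: "'x::real_normed_vector set" and W :: "nat \<Rightarrow> 'x set"
  assumes V: "subspace V" "V \<noteq> {0}" and Y: "Y \<inter> sphere 0 1 \<noteq> {}"
    and sub: "\<And>n. n \<ge> n0 \<Longrightarrow> V \<inter> sphere 0 1 \<subseteq> W n"
    and near: "\<And>\<eta>. \<eta> > 0 \<Longrightarrow> \<exists>n1. \<forall>n\<ge>n1. \<forall>x\<in>W n. infdist x V \<le> \<eta> * norm x"
  shows "(\<lambda>n. hausdorff_dist (Y \<inter> sphere 0 1) (W n \<inter> sphere 0 1)) \<longlonglongrightarrow> cograss_dist Y V"
proof (rule LIMSEQ_I)
  fix r :: real assume r: "r > 0"
  let ?S = "sphere (0::'x) 1"
  have bd: "bounded (Z \<inter> ?S)" for Z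
    by (rule bounded_subset[OF bounded_cball[of 0 1]]) auto
  have Vne: "V \<inter> ?S \<noteq> {}" using subspace_sphere_empty_iff[OF V(1)] V(2) by blast
  have "r / 4 > 0" using r by simp
  then obtain n1 where n1: "\<And>n x. n \<ge> n1 \<Longrightarrow> x \<in> W n \<Longrightarrow> infdist x V \<le> r / 4 * norm x" using near by blast
  have "norm (hausdorff_dist (Y \<inter> ?S) (W n \<inter> ?S) - cograss_dist Y V) < r" if n: "n \<ge> max n0 n1" for n
  proof -
    have s: "V \<inter> ?S \<subseteq> W n \<inter> ?S" using sub n by auto
    then have Wne: "W n \<inter> ?S \<noteq> {}" using Vne by blast
    have "hausdorff_dist (W n \<inter> ?S) (V \<inter> ?S) \<le> r / 2"
    proof (subst hausdorff_dist_le_iff[OF Wne Vne bd bd], use r in simp, intro conjI ballI)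
      fix x assume x: "x \<in> W n \<inter> ?S"
      have "infdist x (V \<inter> ?S) \<le> 2 * infdist x V" using x by (intro infdist_sphere_le V) auto
      also have "\<dots> \<le> 2 * (r / 4 * norm x)" using n1[of n x] x n by (intro mult_left_mono) auto
      finally show "infdist x (V \<inter> ?S) \<le> r / 2" using x by simp
    next
      fix y assume "y \<in> V \<inter> ?S"
      then have "infdist y (W n \<inter> ?S) = 0" using s by (intro infdist_zero) auto
      then show "infdist y (W n \<inter> ?S) \<le> r / 2" using r by simp
    qed
    moreover have "hausdorff_dist (Y \<inter> ?S) (V \<inter> ?S) \<le> hausdorff_dist (Y \<inter> ?S) (W n \<inter> ?S) + hausdorff_dist (W n \<inter> ?S) (V \<inter> ?S)"
      by (rule hausdorff_dist_triangle[OF Y Wne Vne bd bd bd])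
    moreover have "hausdorff_dist (Y \<inter> ?S) (W n \<inter> ?S) \<le> hausdorff_dist (Y \<inter> ?S) (V \<inter> ?S) + hausdorff_dist (V \<inter> ?S) (W n \<inter> ?S)"
      by (rule hausdorff_dist_triangle[OF Y Vne Wne bd bd bd])
    ultimately show ?thesis using r
      unfolding cograss_dist_def hausdorff_dist_commute[of "V \<inter> ?S" "W n \<inter> ?S"] by (simp add: abs_less_iff)
  qed
  then show "\<exists>no. \<forall>n\<ge>no. norm (hausdorff_dist (Y \<inter> ?S) (W n \<inter> ?S) - cograss_dist Y V) < r" by blast
qed

section \<open>From volume growth to a slow subspace\<close>

text \<open>The spaces are spanned by tuples that are optimal up to the factor two. In the estimate of \<open>approx\<close> the quotient of the
  volume growths for \<open>j + 2\<close> and \<open>j + 1\<close> vectors occurs, and in that of \<open>backward\<close> the quotient for \<open>j + 1\<close>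
  and \<open>j\<close> vectors.\<close>

lemma dominated_sequence_ex:
  fixes T :: "nat \<Rightarrow> 'x::banach \<Rightarrow>\<^sub>L 'x" and S :: "nat \<Rightarrow> nat \<Rightarrow> 'x \<Rightarrow>\<^sub>L 'x"
  assumes x0: "(x0::'x) \<noteq> 0" and T0: "T 0 = id_blinfun" and TS: "\<And>n i. T (n + i) = S n i o\<^sub>L T n"
    and upj: "\<exists>c>0. \<forall>n i. vol_growth j (S n i) \<le> c * exp (real i * a + e * real (n + i))"
    and upk: "\<exists>c>0. \<forall>n. vol_growth (Suc j) (T n) \<le> c * exp (real n * b + e * real n)"
    and lowk: "\<exists>c>0. \<forall>n. exp (real n * b - e * real n) \<le> c * vol_growth (Suc j) (T n)"
    and upk1: "\<exists>c>0. \<forall>n. vol_growth (Suc (Suc j)) (T n) \<le> c * exp (real n * (b + \<nu>))"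
    and norm1: "\<exists>c>0. \<forall>n. norm (S n 1) \<le> c * exp (e * real n)"
    and e: "e > 0" "9 * e < (b - a) - \<nu>"
  shows "\<exists>B C. dominated_sequence T B (Suc j) (b - a) \<nu> e C"
proof -
  obtain c1 where c1: "c1 > 0" "\<And>n i. vol_growth j (S n i) \<le> c1 * exp (real i * a + e * real (n + i))" using upj by blast
  obtain c2 where c2: "c2 > 0" "\<And>n. vol_growth (Suc j) (T n) \<le> c2 * exp (real n * b + e * real n)" using upk by blast
  obtain c3 where c3: "c3 > 0" "\<And>n. exp (real n * b - e * real n) \<le> c3 * vol_growth (Suc j) (T n)" using lowk by blast
  obtain c4 where c4: "c4 > 0" "\<And>n. vol_growth (Suc (Suc j)) (T n) \<le> c4 * exp (real n * (b + \<nu>))" using upk1 by blast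
  obtain c5 where c5: "c5 > 0" "\<And>n. norm (S n 1) \<le> c5 * exp (e * real n)" using norm1 by blast
  have Dpos: "vol_growth (Suc j) (T n) > 0" for n
  proof -
    have "0 < c3 * vol_growth (Suc j) (T n)" using c3(2)[of n] exp_gt_zero less_le_trans by blast
    then show ?thesis using c3(1) by (simp add: zero_less_mult_iff)
  qed
  have "\<exists>vs. length vs = Suc j \<and> (\<forall>u\<in>set vs. norm u = 1) \<and>
      vol_growth (Suc j) (T n) / 2 < rel_vol {} (map (blinfun_apply (T n)) vs)" for n
    by (rule vol_growth_near_opt[OF x0]) (use Dpos in simp)
  then obtain vs where vs: "\<And>n. length (vs n) = Suc j" "\<And>n u. u \<in> set (vs n) \<Longrightarrow> norm u = 1"
      "\<And>n. vol_growth (Suc j) (T n) / 2 < rel_vol {} (map (blinfun_apply (T n)) (vs n))" by metis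
  have opt: "vol_growth (Suc j) (T n) \<le> 2 * rel_vol {} (map (blinfun_apply (T n)) (vs n))" for n
    using vs(3)[of n] by linarith
  define C where "C = real (Suc j) * (2 ^ (Suc j + 2) + 1) + (2 * c4 * c3 + 1) + 2 * 4 ^ j * c1 * c2 * c3 + c5 + 1"
  have t1: "real (Suc j) * (2 ^ (Suc j + 2) + 1) \<ge> 0" by simp
  have t2: "2 * c4 * c3 + 1 \<ge> 0" "2 * 4 ^ j * c1 * c2 * c3 \<ge> 0" using c1 c2 c3 c4 by auto
  have C: "real (Suc j) * (2 ^ (Suc j + 2) + 1) \<le> C" "2 * c4 * c3 + 1 \<le> C" "2 * 4 ^ j * c1 * c2 * c3 \<le> C" "c5 \<le> C" "C \<ge> 1"
    using t1 t2 c5 unfolding C_def by linarith+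
  have inv: "1 \<le> c3 * exp (- (real n * b - e * real n)) * vol_growth (Suc j) (T n)" for n
  proof -
    have "exp (real n * b - e * real n) * exp (- (real n * b - e * real n)) \<le> c3 * vol_growth (Suc j) (T n) * exp (- (real n * b - e * real n))"
      by (rule mult_right_mono[OF c3(2)]) simp
    then show ?thesis by (simp add: exp_add[symmetric] mult_ac)
  qed
  have ind: "independent (set (vs n))" "distinct (vs n)" for n
  proof -
    have "rel_vol {} (map (blinfun_apply (T n)) (vs n)) > 0" using vs(3)[of n] Dpos[of n] by linarith
    from rel_vol_pos_independent[OF rel_vol_image_pos[OF this]]
    show "independent (set (vs n))" "distinct (vs n)" by (auto simp: independent_empty)
  qed
  have "dominated_sequence T (\<lambda>n. set (vs n)) (Suc j) (b - a) \<nu> e C"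
  proof
    show "T 0 = id_blinfun" by (rule T0)
    show "finite (set (vs n))" for n by simp
    show "independent (set (vs n))" for n by (rule ind)
    show "card (set (vs n)) = Suc j" for n using ind(2)[of n] vs(1)[of n] by (simp add: distinct_card)
    show "C \<ge> 1" "e > 0" "9 * e < b - a - \<nu>" using C e by auto
    show "\<exists>f\<in>span (set (vs m)). norm f \<le> C * norm x \<and>
        norm (blinfun_apply (T m) (x - f)) \<le> C * exp (real m * (\<nu> + e)) * norm x" for m x
    proof -
      obtain f where f: "f \<in> span (set (vs m))" "norm f \<le> real (Suc j) * (2 ^ (Suc j + 2) + 1) * norm x"
        "norm (blinfun_apply (T m) (x - f)) \<le> (2 * vol_growth (Suc (Suc j)) (T m) / vol_growth (Suc j) (T m) + exp (real m * (\<nu> + e))) * norm x"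
        using near_opt_span_approx[OF x0 vs(1)[of m] vs(2)[of _ m] opt[of m] Dpos[of m] exp_gt_zero[of "real m * (\<nu> + e)"], of x] by blast
      have "vol_growth (Suc (Suc j)) (T m) \<le> c4 * exp (real m * (b + \<nu>))" by (rule c4)
      also have "\<dots> \<le> c4 * exp (real m * (b + \<nu>)) * (c3 * exp (- (real m * b - e * real m)) * vol_growth (Suc j) (T m))"
        using mult_left_mono[OF inv[of m], of "c4 * exp (real m * (b + \<nu>))"] c4(1) by simp
      also have "\<dots> = c4 * c3 * (exp (real m * (b + \<nu>)) * exp (- (real m * b - e * real m))) * vol_growth (Suc j) (T m)"
        by (simp add: mult_ac)
      also have "exp (real m * (b + \<nu>)) * exp (- (real m * b - e * real m)) = exp (real m * (\<nu> + e))"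
        by (simp add: exp_add[symmetric] algebra_simps)
      finally have "vol_growth (Suc (Suc j)) (T m) / vol_growth (Suc j) (T m) \<le> c4 * c3 * exp (real m * (\<nu> + e))"
        using Dpos[of m] by (simp add: pos_divide_le_eq)
      then have "2 * vol_growth (Suc (Suc j)) (T m) / vol_growth (Suc j) (T m) + exp (real m * (\<nu> + e)) \<le>
          (2 * c4 * c3 + 1) * exp (real m * (\<nu> + e))" by (simp add: distrib_right)
      also have "\<dots> \<le> C * exp (real m * (\<nu> + e))" using C(2) by (intro mult_right_mono) auto
      finally have "(2 * vol_growth (Suc (Suc j)) (T m) / vol_growth (Suc j) (T m) + exp (real m * (\<nu> + e))) * norm x \<le>
          C * exp (real m * (\<nu> + e)) * norm x" by (intro mult_right_mono) auto
      moreover have "real (Suc j) * (2 ^ (Suc j + 2) + 1) * norm x \<le> C * norm x" using C(1) by (intro mult_right_mono) auto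
      ultimately show ?thesis using f by (intro bexI[of _ f]) auto
    qed
    show "norm (blinfun_apply (T n) f) \<le> C * exp (- (real m - real n) * (b - a) + 3 * e * real m) * norm (blinfun_apply (T m) f)"
      if nm: "n \<le> m" and f: "f \<in> span (set (vs m))" for n m f
    proof -
      let ?i = "m - n"
      have Tm: "T m = S n ?i o\<^sub>L T n" using TS[of n ?i] nm by simp
      have "norm (blinfun_apply (T n) f) * vol_growth (Suc j) (S n ?i o\<^sub>L T n) \<le>
          2 * 4 ^ j * vol_growth j (S n ?i) * vol_growth (Suc j) (T n) * norm (blinfun_apply (S n ?i) (blinfun_apply (T n) f))"
        by (rule near_opt_span_no_contraction[OF x0 vs(1)[of m] vs(2) _ f]) (use opt[of m] Tm in auto)
      then have 1: "norm (blinfun_apply (T n) f) * vol_growth (Suc j) (T m) \<le>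
          2 * 4 ^ j * (vol_growth j (S n ?i) * vol_growth (Suc j) (T n)) * norm (blinfun_apply (T m) f)"
        by (simp add: Tm mult_ac)
      have "vol_growth j (S n ?i) * vol_growth (Suc j) (T n) \<le>
          (c1 * exp (real ?i * a + e * real (n + ?i))) * (c2 * exp (real n * b + e * real n))"
        using c1 c2 by (intro mult_mono vol_growth_nonneg[OF x0]) auto
      then have "2 * 4 ^ j * (vol_growth j (S n ?i) * vol_growth (Suc j) (T n)) * norm (blinfun_apply (T m) f) \<le>
        2 * 4 ^ j * ((c1 * exp (real ?i * a + e * real (n + ?i))) * (c2 * exp (real n * b + e * real n))) * norm (blinfun_apply (T m) f)"
        by (intro mult_right_mono mult_left_mono) auto
      with 1 have 2: "norm (blinfun_apply (T n) f) * vol_growth (Suc j) (T m) \<le>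
         2 * 4 ^ j * ((c1 * exp (real ?i * a + e * real (n + ?i))) * (c2 * exp (real n * b + e * real n))) * norm (blinfun_apply (T m) f)"
        by linarith
      have "norm (blinfun_apply (T n) f) \<le> norm (blinfun_apply (T n) f) * (c3 * exp (- (real m * b - e * real m)) * vol_growth (Suc j) (T m))"
        using mult_left_mono[OF inv[of m], of "norm (blinfun_apply (T n) f)"] by simp
      also have "\<dots> = (c3 * exp (- (real m * b - e * real m))) * (norm (blinfun_apply (T n) f) * vol_growth (Suc j) (T m))"
        by (simp add: mult_ac)
      also have "\<dots> \<le> (c3 * exp (- (real m * b - e * real m))) *
         (2 * 4 ^ j * ((c1 * exp (real ?i * a + e * real (n + ?i))) * (c2 * exp (real n * b + e * real n))) * norm (blinfun_apply (T m) f))"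
        using c3(1) by (intro mult_left_mono 2) auto
      also have "\<dots> = (2 * 4 ^ j * c1 * c2 * c3) * (exp (- (real m * b - e * real m)) * exp (real ?i * a + e * real (n + ?i)) * exp (real n * b + e * real n))
          * norm (blinfun_apply (T m) f)" by (simp add: mult_ac)
      also have "exp (- (real m * b - e * real m)) * exp (real ?i * a + e * real (n + ?i)) * exp (real n * b + e * real n) =
          exp (- (real m * b - e * real m) + (real ?i * a + e * real (n + ?i)) + (real n * b + e * real n))"
        by (simp only: exp_add)
      also have "- (real m * b - e * real m) + (real ?i * a + e * real (n + ?i)) + (real n * b + e * real n) =
          - (real m - real n) * (b - a) + (2 * e * real m + e * real n)"
        using nm by (simp add: of_nat_diff algebra_simps)
      also have "(2 * 4 ^ j * c1 * c2 * c3) * exp (- (real m - real n) * (b - a) + (2 * e * real m + e * real n)) * norm (blinfun_apply (T m) f) \<le>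
          C * exp (- (real m - real n) * (b - a) + 3 * e * real m) * norm (blinfun_apply (T m) f)"
      proof (intro mult_right_mono mult_mono C(3))
        have "e * real n \<le> e * real m" using nm e by simp
        then show "exp (- (real m - real n) * (b - a) + (2 * e * real m + e * real n)) \<le> exp (- (real m - real n) * (b - a) + 3 * e * real m)"
          by simp
      qed (use C(5) in auto)
      finally show ?thesis .
    qed
    show "norm (blinfun_apply (T (Suc m)) x) \<le> C * exp (e * real m) * norm (blinfun_apply (T m) x)" for m x
    proof -
      have "norm (blinfun_apply (T (Suc m)) x) = norm (blinfun_apply (S m 1) (blinfun_apply (T m) x))"
        using TS[of m 1] by simp
      also have "\<dots> \<le> norm (S m 1) * norm (blinfun_apply (T m) x)" by (rule norm_blinfun)
      also have "\<dots> \<le> c5 * exp (e * real m) * norm (blinfun_apply (T m) x)" by (intro mult_right_mono c5) auto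
      also have "\<dots> \<le> C * exp (e * real m) * norm (blinfun_apply (T m) x)" using C(4) by (intro mult_right_mono) auto
      finally show ?thesis .
    qed
  qed
  then show ?thesis by blast
qed

subsection \<open>Logarithmic growth rates\<close>

lemma log_rate_le_iff:
  assumes "n \<ge> 1" shows "log_rate a n \<le> ereal c \<longleftrightarrow> a n \<le> exp (real n * c)"
proof (cases "a n \<le> 0")
  case True
  then have "a n \<le> exp (real n * c)" using exp_ge_zero order_trans by blast
  then show ?thesis using True assms by (simp add: log_rate_def ext_ln_def)
next
  case False
  then have "log_rate a n \<le> ereal c \<longleftrightarrow> ln (a n) \<le> real n * c"
    using assms by (simp add: log_rate_def ext_ln_def field_simps)
  also have "\<dots> \<longleftrightarrow> a n \<le> exp (real n * c)" using False by (metis exp_le_cancel_iff exp_ln not_le)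
  finally show ?thesis .
qed

lemma log_rate_less_iff:
  assumes "n \<ge> 1" shows "ereal c < log_rate a n \<longleftrightarrow> exp (real n * c) < a n"
  using log_rate_le_iff[OF assms, of a c] by (metis not_le)

lemma limsup_log_rate_le:
  assumes "eventually (\<lambda>n. a n \<le> K * exp (real n * c)) sequentially"
  shows "limsup (log_rate a) \<le> ereal c"
proof -
  obtain m where m: "\<And>n. n \<ge> m \<Longrightarrow> a n \<le> K * exp (real n * c)"
    using assms by (auto simp: eventually_sequentially)
  have "limsup (log_rate a) \<le> ereal (c + d)" if d: "d > 0" for d
  proof (rule Limsup_bounded)
    obtain n0 :: nat where n0: "real n0 > ln (max 1 K) / d" using reals_Archimedean2 by blast
    have "log_rate a n \<le> ereal (c + d)" if n: "n \<ge> max 1 (max n0 m)" for n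
    proof -
      have "ln (max 1 K) \<le> real n0 * d" using n0 d by (simp add: field_simps)
      also have "\<dots> \<le> real n * d" using n d by (intro mult_right_mono) auto
      finally have "max 1 K \<le> exp (real n * d)" by (metis exp_le_cancel_iff exp_ln less_max_iff_disj zero_less_one)
      then have "K \<le> exp (real n * d)" by simp
      then have "K * exp (real n * c) \<le> exp (real n * d) * exp (real n * c)" by (intro mult_right_mono) auto
      also have "\<dots> = exp (real n * (c + d))" by (simp add: exp_add[symmetric] algebra_simps)
      finally have "a n \<le> exp (real n * (c + d))" using m[of n] n by simp
      then show ?thesis using n by (subst log_rate_le_iff) auto
    qed
    then show "\<forall>\<^sub>F n in sequentially. log_rate a n \<le> ereal (c + d)" unfolding eventually_sequentially by blast
  qed
  then have "limsup (log_rate a) \<le> ereal c + ereal d" if "d > 0" for d using that by simp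
  then show ?thesis by (rule ereal_le_epsilon2)
qed

lemma ereal_between: "(x::ereal) < ereal y \<Longrightarrow> \<exists>z. x < ereal z \<and> z < y"
  using ereal_dense2[of x "ereal y"] by auto

text \<open>A slow subspace does not depend on the rate used to define it: a vector outside grows faster than
  any rate below \<open>\<mu>\<close>, so it is outside all of them.\<close>

lemma slow_dichotomy:
  fixes T :: "nat \<Rightarrow> 'x::banach \<Rightarrow>\<^sub>L 'x" and \<mu>' :: ereal and \<mu> :: real
  assumes dom: "\<And>\<nu> e. \<mu>' < ereal \<nu> \<Longrightarrow> e > 0 \<Longrightarrow> 9 * e < \<mu> - \<nu> \<Longrightarrow> \<exists>B C. dominated_sequence T B k \<mu> \<nu> e C"
    and gap: "\<mu>' < ereal \<mu>"
  defines "V \<equiv> {x. limsup (log_rate (\<lambda>n. norm (blinfun_apply (T n) x))) \<le> \<mu>'}"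
  shows "V \<in> cograss k"
    and "\<And>x. x \<notin> V \<Longrightarrow> ereal \<mu> \<le> liminf (log_rate (\<lambda>n. norm (blinfun_apply (T n) x)))"
    and "\<And>t. \<mu>' < ereal t \<Longrightarrow> t < \<mu> \<Longrightarrow> \<exists>n0. \<forall>n\<ge>n0. \<forall>x\<in>V. x \<noteq> 0 \<longrightarrow> norm (blinfun_apply (T n) x) < exp (real n * t) * norm x"
    and "\<And>t \<eta>. t < \<mu> \<Longrightarrow> \<eta> > 0 \<Longrightarrow> \<exists>n0. \<forall>n\<ge>n0. \<forall>x. norm (blinfun_apply (T n) x) \<le> exp (real n * t) * norm x \<longrightarrow> infdist x V \<le> \<eta> * norm x"
proof -
  let ?r = "\<lambda>x. log_rate (\<lambda>n. norm (blinfun_apply (T n) x))"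
  define slow where "slow \<nu> e = dominated_sequence.slow T \<nu> e" for \<nu> e
  define valid where "valid \<nu> e \<longleftrightarrow> \<mu>' < ereal \<nu> \<and> e > 0 \<and> 9 * e < \<mu> - \<nu>" for \<nu> e
  have ex: "\<exists>B C. dominated_sequence T B k \<mu> \<nu> e C" if "valid \<nu> e" for \<nu> e
    using dom that by (auto simp: valid_def)
  have s1: "limsup (?r x) \<le> ereal (\<nu> + 5 * e)" if v: "valid \<nu> e" and x: "x \<in> slow \<nu> e" for \<nu> e x
  proof -
    obtain B C where d: "dominated_sequence T B k \<mu> \<nu> e C" using ex[OF v] by blast
    obtain K where "\<forall>n. norm (blinfun_apply (T n) x) \<le> K * exp (real n * (\<nu> + 5 * e))"
      using x unfolding slow_def dominated_sequence.slow_def[OF d] by blast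
    then show ?thesis by (intro limsup_log_rate_le[where K = K]) auto
  qed
  have s2: "ereal t \<le> liminf (?r x)" "eventually (\<lambda>n. ereal t < ?r x n) sequentially"
    if v: "valid \<nu> e" and x: "x \<notin> slow \<nu> e" and t: "t < \<mu> - 3 * e" for \<nu> e x t
  proof -
    obtain B C where d: "dominated_sequence T B k \<mu> \<nu> e C" using ex[OF v] by blast
    note cl = dominated_sequence.closed_slow[OF d] and sp = dominated_sequence.slow_subspace[OF d]
    have x0: "x \<noteq> 0" using x subspace_0[OF sp] by (auto simp: slow_def)
    have "infdist x (slow \<nu> e) \<noteq> 0"
      using in_closed_iff_infdist_zero[OF cl, of x] x subspace_0[OF sp] by (auto simp: slow_def)
    then have pos: "infdist x (slow \<nu> e) > 0" using infdist_nonneg[of x "slow \<nu> e"] by linarith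
    define t' where "t' = (t + (\<mu> - 3 * e)) / 2"
    have t': "t < t'" "t' < \<mu> - 3 * e" using t by (auto simp: t'_def)
    have "infdist x (slow \<nu> e) / (2 * norm x) > 0" using pos x0 by simp
    from dominated_sequence.near_slow[OF d t'(2) this] obtain n0 where n0:
      "\<And>n. n \<ge> n0 \<Longrightarrow> norm (blinfun_apply (T n) x) \<le> exp (real n * t') * norm x \<Longrightarrow>
         infdist x (slow \<nu> e) \<le> infdist x (slow \<nu> e) / (2 * norm x) * norm x" unfolding slow_def by blast
    have n1: "exp (real n * t') * norm x < norm (blinfun_apply (T n) x)" if "n \<ge> n0" for n
      using n0[OF that] pos x0 by (cases "norm (blinfun_apply (T n) x) \<le> exp (real n * t') * norm x") auto
    obtain n2 :: nat where n2: "real n2 > - ln (norm x) / (t' - t)" using reals_Archimedean2 by blast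
    have "ereal t < ?r x n" if n: "n \<ge> max 1 (max n0 n2)" for n
    proof -
      have "- ln (norm x) \<le> real n2 * (t' - t)" using n2 t' by (simp add: field_simps)
      also have "\<dots> \<le> real n * (t' - t)" using n t' by (intro mult_right_mono) auto
      finally have "exp (real n * t) \<le> exp (real n * t' + ln (norm x))" by (simp add: algebra_simps)
      also have "\<dots> = exp (real n * t') * norm x" using x0 by (simp add: exp_add)
      also have "\<dots> < norm (blinfun_apply (T n) x)" using n by (intro n1) auto
      finally show ?thesis using n by (subst log_rate_less_iff) auto
    qed
    then show ev: "eventually (\<lambda>n. ereal t < ?r x n) sequentially" unfolding eventually_sequentially by blast
    then show "ereal t \<le> liminf (?r x)" by (intro Liminf_bounded) (auto elim: eventually_mono)
  qed
  have valid_ex: "\<exists>\<nu> e. valid \<nu> e \<and> \<nu> + 5 * e < c \<and> t < \<mu> - 3 * e" if c: "\<mu>' < ereal c" and t: "t < \<mu>" for c t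
  proof -
    have "\<mu>' < ereal (min c \<mu>)" using c gap by (simp add: min_def)
    then obtain \<nu> where \<nu>: "\<mu>' < ereal \<nu>" "\<nu> < min c \<mu>" using ereal_between by blast
    obtain w where w: "w \<le> c" "w \<le> \<mu>" "\<nu> < w" using \<nu>(2) by (meson min.cobounded1 min.cobounded2)
    define e where "e = min ((w - \<nu>) / 10) ((\<mu> - t) / 4)"
    have e1: "e > 0" using w t by (auto simp: e_def)
    have "e \<le> (w - \<nu>) / 10" unfolding e_def by (rule min.cobounded1)
    then have e2: "10 * e \<le> w - \<nu>" by (simp add: field_simps)
    have "e \<le> (\<mu> - t) / 4" unfolding e_def by (rule min.cobounded2)
    then have e3: "4 * e \<le> \<mu> - t" by (simp add: field_simps)
    have "9 * e < \<mu> - \<nu>" using e1 e2 w by linarith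
    moreover have "\<nu> + 5 * e < c" using e1 e2 w by linarith
    moreover have "t < \<mu> - 3 * e" using e1 e3 by linarith
    moreover note e1
    ultimately have "valid \<nu> e \<and> \<nu> + 5 * e < c \<and> t < \<mu> - 3 * e" using \<nu>(1) unfolding valid_def by blast
    then show ?thesis by blast
  qed
  have dich: "x \<in> V" if x: "\<not> ereal \<mu> \<le> liminf (?r x)" for x
  proof -
    obtain t where t: "liminf (?r x) < ereal t" "t < \<mu>" using x ereal_between[of "liminf (?r x)" \<mu>] unfolding not_le by blast
    have "limsup (?r x) \<le> ereal c" if c: "\<mu>' < ereal c" for c
    proof -
      obtain \<nu> e where ve: "valid \<nu> e" "\<nu> + 5 * e < c" "t < \<mu> - 3 * e" using valid_ex[OF c t(2)] by blast
      have "x \<in> slow \<nu> e" using s2(1)[OF ve(1) _ ve(3), of x] t(1) by (auto simp: not_le[symmetric])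
      then have "limsup (?r x) \<le> ereal (\<nu> + 5 * e)" by (rule s1[OF ve(1)])
      also have "\<dots> \<le> ereal c" using ve(2) by simp
      finally show ?thesis .
    qed
    then have "limsup (?r x) \<le> \<mu>'" by (metis ereal_dense2 not_le)
    then show ?thesis by (simp add: V_def)
  qed
  have Veq: "V = slow \<nu> e" if v: "valid \<nu> e" for \<nu> e
  proof (intro equalityI subsetI)
    fix x assume "x \<in> slow \<nu> e"
    then have "limsup (?r x) \<le> ereal (\<nu> + 5 * e)" by (rule s1[OF v])
    also have "\<dots> < ereal \<mu>" using v by (simp add: valid_def)
    finally have "limsup (?r x) < ereal \<mu>" .
    moreover have "liminf (?r x) \<le> limsup (?r x)" by (rule Liminf_le_Limsup) simp
    ultimately show "x \<in> V" by (intro dich) (auto simp: not_le)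
  next
    fix x assume x: "x \<in> V"
    show "x \<in> slow \<nu> e"
    proof (rule ccontr)
      assume "x \<notin> slow \<nu> e"
      then have "ereal \<nu> \<le> liminf (?r x)" using v by (intro s2(1)[OF v]) (auto simp: valid_def)
      also have "\<dots> \<le> limsup (?r x)" by (rule Liminf_le_Limsup) simp
      also have "\<dots> \<le> \<mu>'" using x by (simp add: V_def)
      finally show False using v by (auto simp: valid_def not_le[symmetric])
    qed
  qed
  obtain \<nu>0 e0 where v0: "valid \<nu>0 e0" using valid_ex[OF gap, of "\<mu> - 1"] by auto
  obtain B0 C0 where d0: "dominated_sequence T B0 k \<mu> \<nu>0 e0 C0" using ex[OF v0] by blast
  show "V \<in> cograss k"
    using Veq[OF v0] dominated_sequence.closed_slow[OF d0] dominated_sequence.has_codim_slow[OF d0]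
    by (simp add: cograss_def slow_def)
  show "\<And>x. x \<notin> V \<Longrightarrow> ereal \<mu> \<le> liminf (?r x)" using dich by blast
  show "\<exists>n0. \<forall>n\<ge>n0. \<forall>x\<in>V. x \<noteq> 0 \<longrightarrow> norm (blinfun_apply (T n) x) < exp (real n * t) * norm x"
    if t: "\<mu>' < ereal t" "t < \<mu>" for t
  proof -
    obtain \<nu> e where ve: "valid \<nu> e" "\<nu> + 5 * e < t" using valid_ex[OF t(1), of "\<mu> - 1"] by auto
    obtain B C where d: "dominated_sequence T B k \<mu> \<nu> e C" using ex[OF ve(1)] by blast
    obtain K where K: "\<And>x n. x \<in> V \<Longrightarrow> norm (blinfun_apply (T n) x) \<le> K * exp (real n * (\<nu> + 5 * e)) * norm x"
      using dominated_sequence.slow_uniform[OF d] unfolding Veq[OF ve(1)] slow_def by blast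
    obtain n0 where n0: "\<And>n. n \<ge> n0 \<Longrightarrow> K * exp (real n * (\<nu> + 5 * e - t)) < 1"
      using dominated_sequence.exp_decay[OF d, of "\<nu> + 5 * e - t" 1 K] ve(2) by auto
    have "norm (blinfun_apply (T n) x) < exp (real n * t) * norm x" if n: "n \<ge> n0" and x: "x \<in> V" "x \<noteq> 0" for n x
    proof -
      have "norm (blinfun_apply (T n) x) \<le> K * exp (real n * (\<nu> + 5 * e)) * norm x" by (rule K[OF x(1)])
      also have "exp (real n * (\<nu> + 5 * e)) = exp (real n * (\<nu> + 5 * e - t)) * exp (real n * t)"
        by (simp add: exp_add[symmetric] algebra_simps)
      also have "K * (exp (real n * (\<nu> + 5 * e - t)) * exp (real n * t)) * norm x =
          (K * exp (real n * (\<nu> + 5 * e - t))) * (exp (real n * t) * norm x)" by simp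
      also have "\<dots> < 1 * (exp (real n * t) * norm x)" using n0[OF n] x(2) by (intro mult_strict_right_mono) auto
      finally show ?thesis by simp
    qed
    then show ?thesis by blast
  qed
  show "\<exists>n0. \<forall>n\<ge>n0. \<forall>x. norm (blinfun_apply (T n) x) \<le> exp (real n * t) * norm x \<longrightarrow> infdist x V \<le> \<eta> * norm x"
    if t: "t < \<mu>" "\<eta> > 0" for t \<eta>
  proof -
    obtain \<nu> e where ve: "valid \<nu> e" "t < \<mu> - 3 * e" using valid_ex[OF gap t(1)] by auto
    obtain B C where d: "dominated_sequence T B k \<mu> \<nu> e C" using ex[OF ve(1)] by blast
    show ?thesis using dominated_sequence.near_slow[OF d ve(2) t(2)] unfolding Veq[OF ve(1)] slow_def .
  qed
qed

section \<open>Volume growth along the cocycle\<close>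

lemma cocycle_add: "cocycle \<sigma> L (n + i) \<omega> = cocycle \<sigma> L i ((\<sigma> ^^ n) \<omega>) o\<^sub>L cocycle \<sigma> L n \<omega>"
proof (induction i)
  case 0
  show ?case by (rule blinfun_eqI) simp
next
  case (Suc i)
  have "(\<sigma> ^^ (n + i)) \<omega> = (\<sigma> ^^ i) ((\<sigma> ^^ n) \<omega>)" by (subst add.commute) (simp add: funpow_add)
  then show ?case using Suc by (intro blinfun_eqI) simp
qed

lemma blinfun_compose_id [simp]: "id_blinfun o\<^sub>L A = A" "A o\<^sub>L id_blinfun = A"
  by (rule blinfun_eqI, simp)+

lemma tendsto_log_rate_cong:
  assumes "\<And>n. n \<ge> 1 \<Longrightarrow> a n = b n"
  shows "(log_rate a \<longlonglongrightarrow> l) \<longleftrightarrow> (log_rate b \<longlonglongrightarrow> l)"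
  by (rule tendsto_cong) (use assms in \<open>auto simp: eventually_sequentially log_rate_def intro!: exI[of _ 1]\<close>)

locale nontrivial_ergodic_rds = ergodic_rds M \<sigma> L
  for M :: "'o measure" and \<sigma> :: "'o \<Rightarrow> 'o"
    and L :: "'o \<Rightarrow> 'x::{banach,second_countable_topology} \<Rightarrow>\<^sub>L 'x" +
  fixes x0 :: 'x
  assumes x0: "x0 \<noteq> 0"
begin

sublocale ergodic_map M \<sigma>
  by unfold_locales (use base_measurable base_preserving ergodic in auto)

lemma cocycle_measurable [measurable]: "(\<lambda>\<omega>. blinfun_apply (cocycle \<sigma> L n \<omega>) x) \<in> borel_measurable M"
proof (induction n)
  case (Suc n)
  have "(\<lambda>\<omega>. blinfun_apply (L ((\<sigma> ^^ n) \<omega>)) x) \<in> borel_measurable M" for x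
    by (rule measurable_compose[OF pow_meas strongly_measurable])
  from borel_measurable_family_apply[OF this Suc] show ?case by simp
qed simp

lemma norm_L_measurable [measurable]: "(\<lambda>\<omega>. norm (L \<omega>)) \<in> borel_measurable M"
  using borel_measurable_vol_growth[OF x0 strongly_measurable, of "Suc 0"] by (simp add: vol_growth_1[OF x0])

lemma log_norm_abs_int: "integrable M (\<lambda>\<omega>. \<bar>ln (norm (L \<omega>))\<bar>)"
  using log_norm_integrable by simp

lemma cocycle_1: "cocycle \<sigma> L 1 \<omega> = L \<omega>"
  by (simp add: blinfun_eqI)

text \<open>In finite dimension the volume growth of the identity vanishes for large \<open>k\<close>, and so does its measure of
  noncompactness. The processes are set to one at time zero in order to be submultiplicative with the usual
  initial value; rates are not affected.\<close>

definition volA :: "nat \<Rightarrow> nat \<Rightarrow> 'o \<Rightarrow> real" where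
  "volA k n \<omega> = (if n = 0 then 1 else vol_growth k (cocycle \<sigma> L n \<omega>))"

definition noncA :: "nat \<Rightarrow> 'o \<Rightarrow> real" where
  "noncA n \<omega> = (if n = 0 then 1 else ball_noncompactness (cocycle \<sigma> L n \<omega>))"

lemma ln_max_integrable:
  assumes [measurable]: "F \<in> borel_measurable M" and le: "\<And>\<omega>. F \<omega> \<le> norm (L \<omega>) ^ k"
  shows "integrable M (\<lambda>\<omega>. ln (max 1 (F \<omega>)))"
proof (rule Bochner_Integration.integrable_bound)
  show "integrable M (\<lambda>\<omega>. real k * \<bar>ln (norm (L \<omega>))\<bar>)" using log_norm_abs_int by simp
  show "AE \<omega> in M. norm (ln (max 1 (F \<omega>))) \<le> norm (real k * \<bar>ln (norm (L \<omega>))\<bar>)"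
  proof (rule AE_I2)
    fix \<omega>
    have "norm (L \<omega>) ^ k \<le> exp (real k * \<bar>ln (norm (L \<omega>))\<bar>)"
    proof (cases "L \<omega> = 0")
      case True
      then show ?thesis by (cases k) auto
    next
      case False
      have "norm (L \<omega>) = exp (ln (norm (L \<omega>)))" using False by simp
      also have "\<dots> \<le> exp \<bar>ln (norm (L \<omega>))\<bar>" by simp
      finally have "norm (L \<omega>) ^ k \<le> exp \<bar>ln (norm (L \<omega>))\<bar> ^ k" by (intro power_mono) auto
      then show ?thesis by (simp add: exp_of_nat_mult)
    qed
    then have "max 1 (F \<omega>) \<le> exp (real k * \<bar>ln (norm (L \<omega>))\<bar>)" using le[of \<omega>] by simp
    then have "ln (max 1 (F \<omega>)) \<le> real k * \<bar>ln (norm (L \<omega>))\<bar>"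
      by (metis ln_le_cancel_iff exp_gt_zero ln_exp less_max_iff_disj zero_less_one)
    moreover have "0 \<le> ln (max 1 (F \<omega>))" by simp
    ultimately show "norm (ln (max 1 (F \<omega>))) \<le> norm (real k * \<bar>ln (norm (L \<omega>))\<bar>)" by simp
  qed
qed measurable

lemma vol_growth_le_norm_power:
  fixes A :: "'x \<Rightarrow>\<^sub>L 'x" shows "vol_growth k A \<le> norm A ^ k"
proof (rule vol_growth_least[OF x0])
  fix us :: "'x list" assume us: "length us = k" "\<And>u. u \<in> set us \<Longrightarrow> norm u = 1"
  have "rel_vol {} (map (blinfun_apply A) us) \<le> norm A ^ length us * rel_vol {} us"
    using rel_vol_blinfun_le[of A "{}" us] by simp
  also have "\<dots> \<le> norm A ^ length us * (\<Prod>u\<leftarrow>us. norm u)"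
    by (intro mult_left_mono rel_vol_le_prod) auto
  also have "(\<Prod>u\<leftarrow>us. norm u) = 1" using us by (intro prod_norm_eq_1) auto
  finally show "rel_vol {} (map (blinfun_apply A) us) \<le> norm A ^ k" using us by simp
qed

lemma vol_growth_id_le: "vol_growth k (id_blinfun :: 'x \<Rightarrow>\<^sub>L 'x) \<le> 1"
proof -
  have "norm (id_blinfun :: 'x \<Rightarrow>\<^sub>L 'x) \<le> 1" by (rule norm_blinfun_bound) auto
  then have "norm (id_blinfun :: 'x \<Rightarrow>\<^sub>L 'x) ^ k \<le> 1" by (intro power_le_one) auto
  then show ?thesis using vol_growth_le_norm_power[of k id_blinfun] by linarith
qed

lemma vol_process: "submult_process M \<sigma> (volA k)"
proof (intro submult_process.intro submult_process_axioms.intro ergodic_map_axioms)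
  show meas: "volA k n \<in> borel_measurable M" for n
    unfolding volA_def[abs_def] using borel_measurable_vol_growth[OF x0 cocycle_measurable, of k n]
    by (cases "n = 0") auto
  show "volA k n \<omega> \<ge> 0" for n \<omega> by (simp add: volA_def vol_growth_nonneg[OF x0])
  show "volA k 0 \<omega> = 1" for \<omega> by (simp add: volA_def)
  show "volA k (n + m) \<omega> \<le> volA k n \<omega> * volA k m ((\<sigma> ^^ n) \<omega>)" for n m \<omega>
    using vol_growth_compose[OF x0, of k "cocycle \<sigma> L m ((\<sigma> ^^ n) \<omega>)" "cocycle \<sigma> L n \<omega>"]
    by (auto simp: volA_def cocycle_add mult.commute)
  have "volA k 1 \<omega> \<le> norm (L \<omega>) ^ k" for \<omega>
    using vol_growth_le_norm_power[of k "L \<omega>"] by (simp add: volA_def cocycle_1[unfolded One_nat_def])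
  then show "integrable M (\<lambda>\<omega>. ln (max 1 (volA k 1 \<omega>)))" by (rule ln_max_integrable[OF meas])
qed

lemma nonc_process: "submult_process M \<sigma> noncA"
proof (intro submult_process.intro submult_process_axioms.intro ergodic_map_axioms)
  show meas: "noncA n \<in> borel_measurable M" for n
    unfolding noncA_def[abs_def] using borel_measurable_ball_noncompactness[OF cocycle_measurable, of n]
    by (cases "n = 0") auto
  show "noncA n \<omega> \<ge> 0" for n \<omega> by (simp add: noncA_def ball_noncompactness_nonneg)
  show "noncA 0 \<omega> = 1" for \<omega> by (simp add: noncA_def)
  show "noncA (n + m) \<omega> \<le> noncA n \<omega> * noncA m ((\<sigma> ^^ n) \<omega>)" for n m \<omega>
    using ball_noncompactness_compose[of "cocycle \<sigma> L m ((\<sigma> ^^ n) \<omega>)" "cocycle \<sigma> L n \<omega>"]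
    by (auto simp: noncA_def cocycle_add mult.commute)
  have "noncA 1 \<omega> \<le> norm (L \<omega>) ^ 1" for \<omega>
    using ball_noncompactness_le_norm[of "L \<omega>"] by (simp add: noncA_def cocycle_1[unfolded One_nat_def])
  then show "integrable M (\<lambda>\<omega>. ln (max 1 (noncA 1 \<omega>)))" by (rule ln_max_integrable[OF meas])
qed

abbreviation "\<Delta> k \<equiv> vol_exponent M \<sigma> L k"
abbreviation "\<kappa> \<equiv> compactness_exponent M \<sigma> L"

lemma log_rate_volA_iff:
  "(log_rate (\<lambda>n. volA k n \<omega>) \<longlonglongrightarrow> l) \<longleftrightarrow> (log_rate (\<lambda>n. vol_growth k (cocycle \<sigma> L n \<omega>)) \<longlonglongrightarrow> l)"
  by (rule tendsto_log_rate_cong) (simp add: volA_def)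

lemma \<Delta>_eq: "\<Delta> k = submult_process.rate M (volA k)"
proof (cases "k = 0")
  case True
  have "AE \<omega> in M. submult_process.rate M (volA k) = 0"
    using submult_process.log_rate_tendsto[OF vol_process[of k]]
  proof eventually_elim
    case (elim \<omega>)
    have "log_rate (\<lambda>n. volA k n \<omega>) = (\<lambda>n. 0)"
      using True by (auto simp: log_rate_def ext_ln_def volA_def vol_growth_0 fun_eq_iff zero_ereal_def)
    with elim show ?case using LIMSEQ_unique tendsto_const by metis
  qed
  then show ?thesis using True by (simp add: vol_exponent_def)
next
  case False
  have "AE \<omega> in M. log_rate (\<lambda>n. vol_growth k (cocycle \<sigma> L n \<omega>)) \<longlonglongrightarrow> submult_process.rate M (volA k)"
    using submult_process.log_rate_tendsto[OF vol_process[of k]] by (simp add: log_rate_volA_iff)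
  then show ?thesis using False as_growth_rate_eqI by (simp add: vol_exponent_def)
qed

lemma \<kappa>_eq: "\<kappa> = submult_process.rate M noncA"
proof -
  have "(log_rate (\<lambda>n. noncA n \<omega>) \<longlonglongrightarrow> l) \<longleftrightarrow> (log_rate (\<lambda>n. ball_noncompactness (cocycle \<sigma> L n \<omega>)) \<longlonglongrightarrow> l)" for \<omega> l
    by (rule tendsto_log_rate_cong) (simp add: noncA_def)
  then have "AE \<omega> in M. log_rate (\<lambda>n. ball_noncompactness (cocycle \<sigma> L n \<omega>)) \<longlonglongrightarrow> submult_process.rate M noncA"
    using submult_process.log_rate_tendsto[OF nonc_process] by simp
  then show ?thesis by (simp add: compactness_exponent_def as_growth_rate_eqI)
qed

lemma top_eq: "top_exponent M \<sigma> L = \<Delta> 1"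
  by (simp add: top_exponent_def vol_exponent_def vol_growth_1[OF x0])

lemma \<Delta>_0: "\<Delta> 0 = 0" by (simp add: vol_exponent_def)

lemma \<Delta>_less_top: "\<Delta> k < \<infinity>"
  unfolding \<Delta>_eq by (rule submult_process.rate_less_top[OF vol_process])

lemma \<Delta>_limit: "AE \<omega> in M. log_rate (\<lambda>n. vol_growth k (cocycle \<sigma> L n \<omega>)) \<longlonglongrightarrow> \<Delta> k"
  using submult_process.log_rate_tendsto[OF vol_process[of k]] unfolding \<Delta>_eq by (simp add: log_rate_volA_iff)

lemma \<Delta>_upper:
  assumes "\<Delta> k \<le> ereal c"
  shows "AE \<omega> in M. \<forall>\<epsilon>>0. \<exists>C>0. \<forall>n i. vol_growth k (cocycle \<sigma> L i ((\<sigma> ^^ n) \<omega>)) \<le> C * exp (real i * c + \<epsilon> * real (n + i))"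
proof -
  have "AE \<omega> in M. \<forall>\<epsilon>>0. \<exists>C>0. \<forall>n i. volA k i ((\<sigma> ^^ n) \<omega>) \<le> C * exp (real i * c + \<epsilon> * real (n + i))"
    using submult_process.uniform_upper[OF vol_process[of k], of c] assms unfolding \<Delta>_eq[symmetric] by blast
  then show ?thesis
proof eventually_elim
  case (elim \<omega>)
  have le: "vol_growth k (cocycle \<sigma> L i v) \<le> volA k i v" for i v
    using vol_growth_id_le[of k] by (simp add: volA_def)
  show ?case
  proof (intro allI impI)
    fix \<epsilon> :: real assume "\<epsilon> > 0"
    then obtain C where "C > 0" "\<And>n i. volA k i ((\<sigma> ^^ n) \<omega>) \<le> C * exp (real i * c + \<epsilon> * real (n + i))" using elim by blast
    then show "\<exists>C>0. \<forall>n i. vol_growth k (cocycle \<sigma> L i ((\<sigma> ^^ n) \<omega>)) \<le> C * exp (real i * c + \<epsilon> * real (n + i))"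
      using le order_trans by blast
  qed
qed
qed

lemma norm_tempered: "AE \<omega> in M. \<forall>\<epsilon>>0. \<exists>C>0. \<forall>n. norm (L ((\<sigma> ^^ n) \<omega>)) \<le> C * exp (\<epsilon> * real n)"
proof -
  have "integrable M (\<lambda>\<omega>. ln (max 1 (norm (L \<omega>))))" by (rule ln_max_integrable[of _ 1]) auto
  from tempered[OF this] show ?thesis
  proof eventually_elim
    case (elim \<omega>)
    show ?case
    proof (intro allI impI)
      fix \<epsilon> :: real assume "\<epsilon> > 0"
      then obtain C where C: "\<And>n. \<bar>ln (max 1 (norm (L ((\<sigma> ^^ n) \<omega>))))\<bar> \<le> C + \<epsilon> * real n" using elim by blast
      have "norm (L ((\<sigma> ^^ n) \<omega>)) \<le> exp C * exp (\<epsilon> * real n)" for n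
      proof -
        have "norm (L ((\<sigma> ^^ n) \<omega>)) \<le> max 1 (norm (L ((\<sigma> ^^ n) \<omega>)))" by simp
        also have "\<dots> = exp (ln (max 1 (norm (L ((\<sigma> ^^ n) \<omega>)))))" by (simp add: less_max_iff_disj)
        also have "\<dots> \<le> exp (C + \<epsilon> * real n)" using C[of n] by (subst exp_le_cancel_iff) linarith
        finally show ?thesis by (simp add: exp_add)
      qed
      then show "\<exists>C>0. \<forall>n. norm (L ((\<sigma> ^^ n) \<omega>)) \<le> C * exp (\<epsilon> * real n)"
        by (intro exI[of _ "exp C"]) auto
    qed
  qed
qed

text \<open>For a fixed time \<open>n\<close>, covering the image of the unit ball by balls of radius about its measure of
  noncompactness bounds \<open>(1/j) log D\<^sub>j\<close> asymptotically by the logarithm of four times that radius. The factor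
  disappears after division by \<open>n\<close>.\<close>

lemma \<Delta>_eventually_le:
  assumes "\<kappa> < ereal c"
  shows "\<exists>j0. \<forall>j\<ge>j0. \<Delta> j \<le> ereal (real j * c)"
proof -
  interpret N: submult_process M \<sigma> noncA by (rule nonc_process)
  obtain c' where c': "\<kappa> < ereal c'" "c' < c" using ereal_between[OF assms] by blast
  obtain K where K: "\<And>N. \<exists>n\<ge>N. n \<ge> 1 \<and> (\<integral>\<omega>. N.trunc K n \<omega> \<partial>M) / real n < c'"
    using N.rate_approx[of c'] c'(1) unfolding \<kappa>_eq by blast
  obtain N0 :: nat where N0: "real N0 > ln 4 / (c - c')" using reals_Archimedean2 by blast
  obtain n where n: "n \<ge> N0" "n \<ge> 1" "(\<integral>\<omega>. N.trunc K n \<omega> \<partial>M) / real n < c'" using K by blast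
  have n4: "ln 4 < real n * (c - c')"
  proof -
    have "ln 4 < real N0 * (c - c')" using N0 c'(2) by (simp add: field_simps)
    also have "\<dots> \<le> real n * (c - c')" using n(1) c'(2) by (intro mult_right_mono) auto
    finally show ?thesis .
  qed
  let ?T = "\<lambda>\<omega>. cocycle \<sigma> L n \<omega>"
  define g where "g = N.trunc K n"
  have g_int: "integrable M g" unfolding g_def by (rule N.trunc_int)
  define w where "w \<omega> = ln 4 + g \<omega>" for \<omega>
  have w_int: "integrable M w" unfolding w_def[abs_def] using g_int by simp
  have Iw: "(\<integral>\<omega>. w \<omega> \<partial>M) < real n * c"
  proof -
    have "(\<integral>\<omega>. w \<omega> \<partial>M) = ln 4 + (\<integral>\<omega>. g \<omega> \<partial>M)" unfolding w_def[abs_def] using g_int by (simp add: prob_space)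
    moreover have "(\<integral>\<omega>. g \<omega> \<partial>M) < real n * c'" using n(2,3) by (simp add: g_def field_simps)
    ultimately show ?thesis using n4 by (simp add: algebra_simps)
  qed
  \<comment> \<open>The truncation level grows with \<open>j\<close>, so that \<open>t j / j\<close> is bounded below uniformly in \<open>j\<close>.\<close>
  define t where "t j = submult_process.trunc (volA j) (K * j) n" for j
  have t_int: "integrable M (t j)" for j unfolding t_def by (rule submult_process.trunc_int[OF vol_process])
  have t_eq: "t j \<omega> = ln (max (vol_growth j (?T \<omega>)) (exp (- real (K * j) * real n)))" for j \<omega>
    unfolding t_def submult_process.trunc_def[OF vol_process] volA_def using n(2) by simp
  define v where "v j \<omega> = max (t j \<omega> / real j) (w \<omega>)" for j \<omega>
  have wK: "w \<omega> \<ge> - real K * real n" for \<omega>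
    using N.trunc_lower[of K n \<omega>] unfolding w_def g_def using ln_ge_zero[of 4] by linarith
  define h where "h \<omega> = \<bar>t 1 \<omega>\<bar> + real K * real n + \<bar>w \<omega>\<bar>" for \<omega>
  have h_int: "integrable M h" unfolding h_def[abs_def]
    using t_int[of 1] w_int by (intro Bochner_Integration.integrable_add) auto
  have t_upper: "t j \<omega> / real j \<le> t 1 \<omega>" if j: "j \<ge> 1" for j \<omega>
  proof -
    let ?m = "max (vol_growth 1 (?T \<omega>)) (exp (- real (K * 1) * real n))"
    have m: "?m > 0" by (simp add: less_max_iff_disj)
    have "vol_growth j (?T \<omega>) \<le> norm (?T \<omega>) ^ j" by (rule vol_growth_le_norm_power)
    also have "\<dots> \<le> ?m ^ j" by (intro power_mono) (auto simp: vol_growth_1[OF x0])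
    finally have 1: "vol_growth j (?T \<omega>) \<le> ?m ^ j" .
    have "exp (- real (K * j) * real n) = exp (- real (K * 1) * real n) ^ j"
      by (simp add: exp_of_nat_mult[symmetric])
    also have "\<dots> \<le> ?m ^ j" by (intro power_mono) auto
    finally have 2: "exp (- real (K * j) * real n) \<le> ?m ^ j" .
    have "t j \<omega> \<le> ln (?m ^ j)" unfolding t_eq using 1 2 m by (subst ln_le_cancel_iff) (auto simp: less_max_iff_disj)
    also have "\<dots> = real j * t 1 \<omega>" unfolding t_eq using m by (simp add: ln_realpow)
    finally show ?thesis using j by (simp add: field_simps)
  qed
  have "(\<lambda>j. \<integral>\<omega>. v j \<omega> \<partial>M) \<longlonglongrightarrow> (\<integral>\<omega>. w \<omega> \<partial>M)"
  proof (rule integral_dominated_convergence[OF _ _ h_int])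
    show "w \<in> borel_measurable M" using w_int by simp
    show "v j \<in> borel_measurable M" for j unfolding v_def[abs_def] using t_int[of j] w_int by simp
    show "AE \<omega> in M. norm (v j \<omega>) \<le> h \<omega>" for j
    proof (rule AE_I2)
      fix \<omega>
      show "norm (v j \<omega>) \<le> h \<omega>"
      proof (cases "j = 0")
        case True
        have "v j \<omega> = max 0 (w \<omega>)" using True by (simp add: v_def)
        moreover have "0 \<le> real K * real n" by simp
        ultimately show ?thesis unfolding h_def real_norm_def by linarith
      next
        case False
        then have "t j \<omega> / real j \<le> t 1 \<omega>" by (intro t_upper) simp
        moreover have "0 \<le> real K * real n" by simp
        ultimately show ?thesis using wK[of \<omega>] unfolding v_def h_def real_norm_def by linarith
      qed
    qed
    show "AE \<omega> in M. (\<lambda>j. v j \<omega>) \<longlonglongrightarrow> w \<omega>"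
    proof (rule AE_I2)
      fix \<omega>
      have "ball_noncompactness (?T \<omega>) \<le> exp (g \<omega>)"
        using N.A_le_trunc[of n \<omega> K] n(2) by (simp add: noncA_def g_def)
      then have "ball_noncompactness (?T \<omega>) < 2 * exp (g \<omega>)" using exp_gt_zero[of "g \<omega>"] by linarith
      then obtain s where s: "s < 2 * exp (g \<omega>)" "covered (?T \<omega>) s" using ball_noncompactness_less_iff by blast
      then have s0: "s > 0" by (simp add: covered_def)
      obtain N where N: "\<And>j. vol_growth j (?T \<omega>) \<le> (max (norm (?T \<omega>)) (2 * s) / (2 * s)) ^ N * (2 * s) ^ j"
        using vol_growth_le_of_covered[OF x0 s(2)] by blast
      define Q where "Q = max 1 ((max (norm (?T \<omega>)) (2 * s) / (2 * s)) ^ N)"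
      have Q: "Q \<ge> 1" by (simp add: Q_def)
      have "t j \<omega> / real j \<le> ln Q / real j + w \<omega>" if j: "j \<ge> 1" for j
      proof -
        have ew: "exp (w \<omega>) = 4 * exp (g \<omega>)" by (simp add: w_def exp_add)
        have "vol_growth j (?T \<omega>) \<le> (max (norm (?T \<omega>)) (2 * s) / (2 * s)) ^ N * (2 * s) ^ j" by (rule N)
        also have "\<dots> \<le> Q * exp (w \<omega>) ^ j"
          using s s0 by (intro mult_mono power_mono) (auto simp: Q_def ew)
        finally have 1: "vol_growth j (?T \<omega>) \<le> Q * exp (w \<omega>) ^ j" .
        have "exp (- real (K * j) * real n) = exp (- real K * real n) ^ j" by (simp add: exp_of_nat_mult[symmetric] mult_ac)
        also have "\<dots> \<le> exp (w \<omega>) ^ j" using wK[of \<omega>] by (intro power_mono) auto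
        also have "\<dots> \<le> Q * exp (w \<omega>) ^ j" using mult_right_mono[OF Q, of "exp (w \<omega>) ^ j"] by simp
        finally have 2: "exp (- real (K * j) * real n) \<le> Q * exp (w \<omega>) ^ j" .
        have "t j \<omega> \<le> ln (Q * exp (w \<omega>) ^ j)" unfolding t_eq using 1 2 Q by (subst ln_le_cancel_iff) (auto simp: less_max_iff_disj)
        also have "\<dots> = ln Q + real j * w \<omega>" using Q by (simp add: ln_mult ln_realpow)
        finally show ?thesis using j by (simp add: field_simps)
      qed
      then have ub: "v j \<omega> \<le> ln Q / real j + w \<omega>" if "j \<ge> 1" for j
        using that Q unfolding v_def by simp
      have "(\<lambda>j. ln Q / real j + w \<omega>) \<longlonglongrightarrow> 0 + w \<omega>"
        by (intro tendsto_intros tendsto_divide_0[OF tendsto_const] filterlim_real_at_infinity_sequentially)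
      then have lim: "(\<lambda>j. ln Q / real j + w \<omega>) \<longlonglongrightarrow> w \<omega>" by simp
      show "(\<lambda>j. v j \<omega>) \<longlonglongrightarrow> w \<omega>"
      proof (rule tendsto_sandwich[OF _ _ tendsto_const lim])
        show "\<forall>\<^sub>F j in sequentially. w \<omega> \<le> v j \<omega>" by (simp add: v_def)
        show "\<forall>\<^sub>F j in sequentially. v j \<omega> \<le> ln Q / real j + w \<omega>"
          unfolding eventually_sequentially using ub by blast
      qed
    qed
  qed
  then have "eventually (\<lambda>j. (\<integral>\<omega>. v j \<omega> \<partial>M) < real n * c) sequentially" by (rule order_tendstoD(2)[OF _ Iw])
  then obtain j0 where j0: "\<And>j. j \<ge> j0 \<Longrightarrow> (\<integral>\<omega>. v j \<omega> \<partial>M) < real n * c" by (auto simp: eventually_sequentially)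
  have "\<Delta> j \<le> ereal (real j * c)" if j: "j \<ge> max 1 j0" for j
  proof -
    have v_int: "integrable M (v j)" unfolding v_def[abs_def] using t_int[of j] w_int by (intro integrable_max) auto
    have "(\<integral>\<omega>. t j \<omega> / real j \<partial>M) \<le> (\<integral>\<omega>. v j \<omega> \<partial>M)"
      by (intro integral_mono v_int) (use t_int[of j] in \<open>auto simp: v_def\<close>)
    also have "\<dots> < real n * c" using j by (intro j0) auto
    finally have "(\<integral>\<omega>. t j \<omega> \<partial>M) / real n \<le> real j * c" using j n(2) by (simp add: field_simps)
    moreover have "\<Delta> j \<le> ereal ((\<integral>\<omega>. t j \<omega> \<partial>M) / real n)"
      unfolding \<Delta>_eq t_def by (rule submult_process.rate_le[OF vol_process n(2)])
    ultimately show ?thesis using order_trans by fastforce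
  qed
  then show ?thesis by blast
qed

end

section \<open>The slow subspaces of a system\<close>

lemma limsup_log_rate_shift:
  assumes "limsup (log_rate a) \<le> c"
  shows "limsup (log_rate (\<lambda>n. a (Suc n))) \<le> c"
proof -
  have "limsup (log_rate (\<lambda>n. a (Suc n))) \<le> ereal d" if d: "c < ereal d" for d
  proof -
    obtain d1 where d1: "c < ereal d1" "d1 < d" using ereal_between[OF d] by blast
    have "limsup (log_rate a) < ereal d1" using assms d1(1) by (rule le_less_trans)
    from Limsup_lessD[OF this] obtain m where m: "\<And>n. n \<ge> m \<Longrightarrow> log_rate a n < ereal d1"
      by (auto simp: eventually_sequentially)
    have "a (Suc n) \<le> exp d1 * exp (real n * d1)" if n: "n \<ge> m" for n
    proof -
      have "a (Suc n) \<le> exp (real (Suc n) * d1)" using less_imp_le[OF m[of "Suc n"]] n log_rate_le_iff[of "Suc n" a d1] by simp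
      then show ?thesis by (simp add: exp_add[symmetric] algebra_simps)
    qed
    then have "limsup (log_rate (\<lambda>n. a (Suc n))) \<le> ereal d1"
      by (intro limsup_log_rate_le[where K = "exp d1"]) (auto simp: eventually_sequentially)
    also have "\<dots> \<le> ereal d" using d1(2) by simp
    finally show ?thesis .
  qed
  then show ?thesis by (metis ereal_dense2 not_le)
qed

context nontrivial_ergodic_rds
begin

abbreviation "\<mu> k \<equiv> lyapunov_exponent M \<sigma> L k"

definition slow_space :: "nat \<Rightarrow> 'o \<Rightarrow> 'x set" where
  "slow_space k \<omega> = {x. limsup (log_rate (\<lambda>n. norm (blinfun_apply (cocycle \<sigma> L n \<omega>) x))) \<le> \<mu> (Suc k)}"

definition dominated_at :: "nat \<Rightarrow> 'o \<Rightarrow> bool" where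
  "dominated_at k \<omega> \<longleftrightarrow> (\<forall>\<nu> e. \<mu> (Suc k) < ereal \<nu> \<longrightarrow> e > 0 \<longrightarrow> 9 * e < real_of_ereal (\<mu> k) - \<nu> \<longrightarrow>
     (\<exists>B C. dominated_sequence (\<lambda>n. cocycle \<sigma> L n \<omega>) B k (real_of_ereal (\<mu> k)) \<nu> e C))"

definition gap :: "nat \<Rightarrow> bool" where "gap k \<longleftrightarrow> k \<ge> 1 \<and> \<mu> (Suc k) < \<mu> k"

lemma gapE:
  assumes "gap k"
  obtains j a b where "k = Suc j" "\<Delta> j = ereal a" "\<Delta> (Suc j) = ereal b" "\<mu> k = ereal (b - a)"
    "\<mu> (Suc k) = \<Delta> (Suc (Suc j)) - ereal b" "\<Delta> (Suc (Suc j)) < ereal (b + (b - a))"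
proof -
  obtain j where j: "k = Suc j" using assms unfolding gap_def by (cases k) auto
  have \<mu>k: "\<mu> k = (if \<Delta> j = -\<infinity> then -\<infinity> else \<Delta> (Suc j) - \<Delta> j)" by (simp add: j lyapunov_exponent_def)
  have g: "\<mu> (Suc k) < \<mu> k" using assms by (simp add: gap_def)
  then have "\<Delta> j \<noteq> -\<infinity>" using \<mu>k by auto
  then obtain a where a: "\<Delta> j = ereal a" using \<Delta>_less_top[of j] by (cases "\<Delta> j") auto
  have "\<Delta> (Suc j) \<noteq> -\<infinity>" using g \<mu>k a by auto
  then obtain b where b: "\<Delta> (Suc j) = ereal b" using \<Delta>_less_top[of "Suc j"] by (cases "\<Delta> (Suc j)") auto
  have 1: "\<mu> k = ereal (b - a)" using \<mu>k a b by simp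
  have 2: "\<mu> (Suc k) = \<Delta> (Suc (Suc j)) - ereal b" using b by (simp add: j lyapunov_exponent_def)
  have "\<Delta> (Suc (Suc j)) < ereal (b + (b - a))"
    using g \<Delta>_less_top[of "Suc (Suc j)"] unfolding 1 2 by (cases "\<Delta> (Suc (Suc j))") auto
  then show thesis using that j a b 1 2 by blast
qed

lemma vol_growth_lower:
  assumes lim: "log_rate (\<lambda>n. vol_growth k (cocycle \<sigma> L n \<omega>)) \<longlonglongrightarrow> ereal b" and e: "e > 0"
  shows "\<exists>c>0. \<forall>n. exp (real n * b - e * real n) \<le> c * vol_growth k (cocycle \<sigma> L n \<omega>)"
proof -
  let ?D = "\<lambda>n. vol_growth k (cocycle \<sigma> L n \<omega>)"
  have "ereal (b - e) < ereal b" using e by simp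
  from order_tendstoD(1)[OF lim this] obtain n0 where n0: "\<And>n. n \<ge> n0 \<Longrightarrow> ereal (b - e) < log_rate ?D n"
    by (auto simp: eventually_sequentially)
  define N where "N = max 1 n0"
  have big: "exp (real n * (b - e)) < ?D n" if "n \<ge> N" for n
    using n0[of n] that log_rate_less_iff[of n "b - e" ?D] by (simp add: N_def)
  have pos: "?D n > 0" for n
  proof (cases "n \<ge> N")
    case True
    then show ?thesis using big[of n] exp_gt_zero less_trans by blast
  next
    case False
    then obtain i where i: "N = n + i" using le_Suc_ex[of n N] by auto
    have "0 < ?D N" using big[of N] exp_gt_zero less_trans by blast
    also have "?D N \<le> vol_growth k (cocycle \<sigma> L i ((\<sigma> ^^ n) \<omega>)) * ?D n"
      unfolding i cocycle_add by (rule vol_growth_compose[OF x0])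
    finally show ?thesis using vol_growth_nonneg[OF x0, of k] by (simp add: zero_less_mult_iff not_less[symmetric])
  qed
  define c where "c = 1 + (\<Sum>n<N. exp (real n * b - e * real n) / ?D n)"
  have s0: "(\<Sum>n<N. exp (real n * b - e * real n) / ?D n) \<ge> 0"
    using pos by (intro sum_nonneg divide_nonneg_nonneg) (auto intro: less_imp_le)
  have "exp (real n * b - e * real n) \<le> c * ?D n" for n
  proof (cases "n \<ge> N")
    case True
    have "exp (real n * b - e * real n) = exp (real n * (b - e))" by (simp add: algebra_simps)
    also have "\<dots> \<le> 1 * ?D n" using big[OF True] by simp
    also have "\<dots> \<le> c * ?D n" using s0 pos[of n] by (intro mult_right_mono) (auto simp: c_def)
    finally show ?thesis .
  next
    case False
    have "exp (real n * b - e * real n) / ?D n \<le> (\<Sum>n<N. exp (real n * b - e * real n) / ?D n)"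
      using False pos by (intro member_le_sum) (auto intro: less_imp_le)
    then have "exp (real n * b - e * real n) / ?D n \<le> c" by (simp add: c_def)
    then show ?thesis using pos[of n] by (simp add: pos_divide_le_eq)
  qed
  moreover have "c > 0" using s0 by (simp add: c_def)
  ultimately show ?thesis by blast
qed

lemma AE_dominated_at:
  assumes "gap k"
  shows "AE \<omega> in M. dominated_at k \<omega>"
proof -
  obtain j a b where k: "k = Suc j" and a: "\<Delta> j = ereal a" and b: "\<Delta> (Suc j) = ereal b"
    and \<mu>k: "\<mu> k = ereal (b - a)" and \<mu>k1: "\<mu> (Suc k) = \<Delta> (Suc (Suc j)) - ereal b"
    and lt: "\<Delta> (Suc (Suc j)) < ereal (b + (b - a))"
    using gapE[OF assms] by metis
  have "AE \<omega> in M. \<forall>q\<in>{q\<in>\<rat>. \<Delta> (Suc (Suc j)) \<le> ereal q}. \<forall>\<epsilon>>0. \<exists>C>0. \<forall>n i.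
      vol_growth (Suc (Suc j)) (cocycle \<sigma> L i ((\<sigma> ^^ n) \<omega>)) \<le> C * exp (real i * q + \<epsilon> * real (n + i))"
    by (rule AE_ball_countable'[OF \<Delta>_upper]) (auto intro: countable_subset[OF _ countable_rat])
  moreover have "AE \<omega> in M. \<forall>\<epsilon>>0. \<exists>C>0. \<forall>n i. vol_growth j (cocycle \<sigma> L i ((\<sigma> ^^ n) \<omega>)) \<le> C * exp (real i * a + \<epsilon> * real (n + i))"
    by (rule \<Delta>_upper) (simp add: a)
  moreover have "AE \<omega> in M. \<forall>\<epsilon>>0. \<exists>C>0. \<forall>n i. vol_growth (Suc j) (cocycle \<sigma> L i ((\<sigma> ^^ n) \<omega>)) \<le> C * exp (real i * b + \<epsilon> * real (n + i))"
    by (rule \<Delta>_upper) (simp add: b)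
  moreover have "AE \<omega> in M. log_rate (\<lambda>n. vol_growth (Suc j) (cocycle \<sigma> L n \<omega>)) \<longlonglongrightarrow> ereal b"
    using \<Delta>_limit[of "Suc j"] by (simp add: b)
  ultimately show ?thesis using norm_tempered
  proof eventually_elim
    case (elim \<omega>)
    show ?case unfolding dominated_at_def
    proof (intro allI impI)
      fix \<nu> e assume \<nu>: "\<mu> (Suc k) < ereal \<nu>" and e: "e > 0" and ge: "9 * e < real_of_ereal (\<mu> k) - \<nu>"
      have "\<Delta> (Suc (Suc j)) < ereal (b + \<nu>)"
        using \<nu> unfolding \<mu>k1 by (cases "\<Delta> (Suc (Suc j))") auto
      then obtain z where z: "\<Delta> (Suc (Suc j)) < ereal z" "z < b + \<nu>" using ereal_between by blast
      obtain q where q: "q \<in> \<rat>" "z < q" "q < b + \<nu>" using Rats_dense_in_real[OF z(2)] by blast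
      have "\<Delta> (Suc (Suc j)) \<le> ereal q" using z(1) q(2) by (meson ereal_less_eq(3) less_imp_le order_trans)
      then have qm: "q \<in> {q\<in>\<rat>. \<Delta> (Suc (Suc j)) \<le> ereal q}" using q(1) by simp
      have "b + \<nu> - q > 0" using q(3) by simp
      with elim(1) qm obtain C4 where C4: "C4 > 0" "\<And>n i. vol_growth (Suc (Suc j)) (cocycle \<sigma> L i ((\<sigma> ^^ n) \<omega>)) \<le> C4 * exp (real i * q + (b + \<nu> - q) * real (n + i))"
        by blast
      have upk1: "\<exists>c>0. \<forall>n. vol_growth (Suc (Suc j)) (cocycle \<sigma> L n \<omega>) \<le> c * exp (real n * (b + \<nu>))"
      proof (intro exI[of _ C4] conjI allI C4(1))
        fix n
        have "real n * q + (b + \<nu> - q) * real (0 + n) = real n * (b + \<nu>)" by (simp add: algebra_simps)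
        then show "vol_growth (Suc (Suc j)) (cocycle \<sigma> L n \<omega>) \<le> C4 * exp (real n * (b + \<nu>))"
          using C4(2)[of n 0] by simp
      qed
      have upj: "\<exists>c>0. \<forall>n i. vol_growth j (cocycle \<sigma> L i ((\<sigma> ^^ n) \<omega>)) \<le> c * exp (real i * a + e * real (n + i))"
        using elim(2) e by blast
      obtain C2 where C2: "C2 > 0" "\<And>n i. vol_growth (Suc j) (cocycle \<sigma> L i ((\<sigma> ^^ n) \<omega>)) \<le> C2 * exp (real i * b + e * real (n + i))"
        using elim(3) e by blast
      have upk: "\<exists>c>0. \<forall>n. vol_growth (Suc j) (cocycle \<sigma> L n \<omega>) \<le> c * exp (real n * b + e * real n)"
      proof (intro exI[of _ C2] conjI allI C2(1))
        fix n show "vol_growth (Suc j) (cocycle \<sigma> L n \<omega>) \<le> C2 * exp (real n * b + e * real n)"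
          using C2(2)[of n 0] by simp
      qed
      have lowk: "\<exists>c>0. \<forall>n. exp (real n * b - e * real n) \<le> c * vol_growth (Suc j) (cocycle \<sigma> L n \<omega>)"
        by (rule vol_growth_lower[OF elim(4) e])
      have norm1: "\<exists>c>0. \<forall>n. norm (cocycle \<sigma> L 1 ((\<sigma> ^^ n) \<omega>)) \<le> c * exp (e * real n)"
        using elim(5) e unfolding cocycle_1 by blast
      have "9 * e < (b - a) - \<nu>" using ge by (simp add: \<mu>k)
      from dominated_sequence_ex[where T = "\<lambda>n. cocycle \<sigma> L n \<omega>" and S = "\<lambda>n i. cocycle \<sigma> L i ((\<sigma> ^^ n) \<omega>)",
          OF x0 _ cocycle_add upj upk lowk upk1 norm1 e this]
      show "\<exists>B C. dominated_sequence (\<lambda>n. cocycle \<sigma> L n \<omega>) B k (real_of_ereal (\<mu> k)) \<nu> e C"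
        by (simp add: k \<mu>k[unfolded k])
    qed
  qed
qed

lemma slow_space_at:
  assumes g: "gap k" and d: "dominated_at k \<omega>"
  shows "slow_space k \<omega> \<in> cograss k"
    and "x \<notin> slow_space k \<omega> \<Longrightarrow> \<mu> k \<le> liminf (log_rate (\<lambda>n. norm (blinfun_apply (cocycle \<sigma> L n \<omega>) x)))"
    and "\<mu> (Suc k) < ereal t \<Longrightarrow> ereal t < \<mu> k \<Longrightarrow> \<exists>n0. \<forall>n\<ge>n0. \<forall>x\<in>slow_space k \<omega>. x \<noteq> 0 \<longrightarrow>
      norm (blinfun_apply (cocycle \<sigma> L n \<omega>) x) < exp (real n * t) * norm x"
    and "ereal t < \<mu> k \<Longrightarrow> \<eta> > 0 \<Longrightarrow> \<exists>n0. \<forall>n\<ge>n0. \<forall>x. norm (blinfun_apply (cocycle \<sigma> L n \<omega>) x) \<le> exp (real n * t) * norm x \<longrightarrow>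
      infdist x (slow_space k \<omega>) \<le> \<eta> * norm x"
proof -
  obtain m where m: "\<mu> k = ereal m" using gapE[OF g] by metis
  have lt: "\<mu> (Suc k) < ereal m" using g m by (simp add: gap_def)
  have dom: "\<exists>B C. dominated_sequence (\<lambda>n. cocycle \<sigma> L n \<omega>) B k m \<nu> e C"
    if "\<mu> (Suc k) < ereal \<nu>" "e > 0" "9 * e < m - \<nu>" for \<nu> e
    using d that unfolding dominated_at_def m by simp
  note sd = slow_dichotomy[of "\<mu> (Suc k)" m "\<lambda>n. cocycle \<sigma> L n \<omega>" k, OF dom lt, folded slow_space_def]
  show "slow_space k \<omega> \<in> cograss k" by (rule sd(1))
  show "x \<notin> slow_space k \<omega> \<Longrightarrow> \<mu> k \<le> liminf (log_rate (\<lambda>n. norm (blinfun_apply (cocycle \<sigma> L n \<omega>) x)))"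
    using sd(2) unfolding m by blast
  show "\<mu> (Suc k) < ereal t \<Longrightarrow> ereal t < \<mu> k \<Longrightarrow> \<exists>n0. \<forall>n\<ge>n0. \<forall>x\<in>slow_space k \<omega>. x \<noteq> 0 \<longrightarrow>
      norm (blinfun_apply (cocycle \<sigma> L n \<omega>) x) < exp (real n * t) * norm x"
    using sd(3) unfolding m by simp
  show "ereal t < \<mu> k \<Longrightarrow> \<eta> > 0 \<Longrightarrow> \<exists>n0. \<forall>n\<ge>n0. \<forall>x. norm (blinfun_apply (cocycle \<sigma> L n \<omega>) x) \<le> exp (real n * t) * norm x \<longrightarrow>
      infdist x (slow_space k \<omega>) \<le> \<eta> * norm x"
    using sd(4) unfolding m by simp
qed

lemma slow_space_equivariant:
  "blinfun_apply (L \<omega>) ` slow_space k \<omega> \<subseteq> slow_space k (\<sigma> \<omega>)"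
proof
  fix y assume "y \<in> blinfun_apply (L \<omega>) ` slow_space k \<omega>"
  then obtain x where x: "y = blinfun_apply (L \<omega>) x" "x \<in> slow_space k \<omega>" by blast
  have "blinfun_apply (cocycle \<sigma> L n (\<sigma> \<omega>)) y = blinfun_apply (cocycle \<sigma> L (Suc n) \<omega>) x" for n
    using cocycle_add[of \<sigma> L 1 n \<omega>] by (simp add: x(1) cocycle_1[unfolded One_nat_def] del: cocycle.simps(2))
  then show "y \<in> slow_space k (\<sigma> \<omega>)"
    using limsup_log_rate_shift[of "\<lambda>n. norm (blinfun_apply (cocycle \<sigma> L n \<omega>) x)"] x(2)
    by (simp add: slow_space_def del: cocycle.simps)
qed

text \<open>At late times the unit vectors that grow at most at an intermediate rate form a set close to the
  unit sphere of the slow subspace. These sets are open and depend measurably on \<open>\<omega>\<close>.\<close>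

lemma slow_space_measurable:
  assumes sep: "separable_space (euclidean :: ('x \<Rightarrow>\<^sub>L real) topology)"
    and g: "gap k" and G: "G \<in> sets M" and d: "\<And>\<omega>. \<omega> \<in> G \<Longrightarrow> dominated_at k \<omega>"
  shows "slow_space k \<in> measurable (restrict_space M G) (cograss_borel k)"
proof (rule measurable_cograss[OF sep])
  let ?M = "restrict_space M G"
  have sp: "space ?M = G" using sets.sets_into_space[OF G] by (simp add: space_restrict_space Int_absorb2)
  show V: "slow_space k \<omega> \<in> cograss k" if "\<omega> \<in> space ?M" for \<omega>
    using that slow_space_at(1)[OF g d] unfolding sp by blast
  fix Y :: "'x set" assume Y: "Y \<in> cograss k"
  have sub: "subspace Z" if "Z \<in> cograss k" for Z :: "'x set" using that by (simp add: cograss_def has_codim_def)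
  show "(\<lambda>\<omega>. cograss_dist Y (slow_space k \<omega>)) \<in> borel_measurable ?M"
  proof (cases "{0::'x} \<in> cograss k")
    case True
    then have "Z = {0}" if "Z \<in> cograss k" for Z :: "'x set"
      using has_codim_zero_eq[of k Z] that by (simp add: cograss_def)
    note triv = this
    have "cograss_dist Y (slow_space k \<omega>) = cograss_dist {0} {0::'x}" if "\<omega> \<in> space ?M" for \<omega>
      unfolding triv[OF V[OF that]] triv[OF Y] ..
    then show ?thesis by (subst measurable_cong[where g = "\<lambda>_. cograss_dist {0} {0::'x}"]) auto
  next
    case False
    obtain m where m: "\<mu> k = ereal m" using gapE[OF g] by metis
    have "\<mu> (Suc k) < ereal m" using g m by (simp add: gap_def)
    then obtain t where t: "\<mu> (Suc k) < ereal t" "ereal t < \<mu> k" using ereal_between m by force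
    define W where "W n \<omega> = {x. norm (blinfun_apply (cocycle \<sigma> L n \<omega>) x) < exp (real n * t) * norm x}" for n \<omega>
    show ?thesis
    proof (rule borel_measurable_LIMSEQ_metric)
      show "(\<lambda>\<omega>. hausdorff_dist (Y \<inter> sphere 0 1) (W n \<omega> \<inter> sphere 0 1)) \<in> borel_measurable ?M" for n
      proof (rule borel_measurable_hausdorff_dist)
        show "open (W n \<omega>)" for \<omega> unfolding W_def by (intro open_Collect_less continuous_intros)
        fix x
        have "(\<lambda>\<omega>. norm (blinfun_apply (cocycle \<sigma> L n \<omega>) x)) \<in> borel_measurable ?M"
          by (intro measurable_restrict_space1) measurable
        note [measurable] = this
        show "{\<omega> \<in> space ?M. x \<in> W n \<omega>} \<in> sets ?M" unfolding W_def mem_Collect_eq by measurable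
      qed
      fix \<omega> assume w: "\<omega> \<in> space ?M"
      then have dw: "dominated_at k \<omega>" using d sp by simp
      obtain n0 where n0: "\<And>n x. n \<ge> n0 \<Longrightarrow> x \<in> slow_space k \<omega> \<Longrightarrow> x \<noteq> 0 \<Longrightarrow>
          norm (blinfun_apply (cocycle \<sigma> L n \<omega>) x) < exp (real n * t) * norm x"
        using slow_space_at(3)[OF g dw t] by blast
      show "(\<lambda>n. hausdorff_dist (Y \<inter> sphere 0 1) (W n \<omega> \<inter> sphere 0 1)) \<longlonglongrightarrow> cograss_dist Y (slow_space k \<omega>)"
      proof (rule cograss_dist_limit)
        show "subspace (slow_space k \<omega>)" by (rule sub[OF V[OF w]])
        show "slow_space k \<omega> \<noteq> {0}" using V[OF w] False by metis
        have "Y \<noteq> {0}" using Y False by metis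
        then show "Y \<inter> sphere 0 1 \<noteq> {}" using subspace_sphere_empty_iff[OF sub[OF Y]] by simp
        show "slow_space k \<omega> \<inter> sphere 0 1 \<subseteq> W n \<omega>" if n: "n \<ge> n0" for n
        proof
          fix x assume x: "x \<in> slow_space k \<omega> \<inter> sphere 0 1"
          then have "x \<noteq> 0" by auto
          then show "x \<in> W n \<omega>" using n0[OF n, of x] x by (simp add: W_def)
        qed
        show "\<exists>n1. \<forall>n\<ge>n1. \<forall>x\<in>W n \<omega>. infdist x (slow_space k \<omega>) \<le> \<eta> * norm x" if "\<eta> > 0" for \<eta>
          using slow_space_at(4)[OF g dw t(2) that] unfolding W_def by (auto intro: less_imp_le)
      qed
    qed
  qed
qed

lemma AE_top_growth:
  "AE \<omega> in M. \<forall>x. limsup (log_rate (\<lambda>n. norm (blinfun_apply (cocycle \<sigma> L n \<omega>) x))) \<le> \<mu> 1"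
proof -
  have \<mu>1: "\<mu> 1 = \<Delta> 1" by (simp add: lyapunov_exponent_def \<Delta>_0)
  have "AE \<omega> in M. \<forall>q\<in>{q\<in>\<rat>. \<Delta> 1 \<le> ereal q}. \<forall>\<epsilon>>0. \<exists>C>0. \<forall>n i.
      vol_growth 1 (cocycle \<sigma> L i ((\<sigma> ^^ n) \<omega>)) \<le> C * exp (real i * q + \<epsilon> * real (n + i))"
    by (rule AE_ball_countable'[OF \<Delta>_upper]) (auto intro: countable_subset[OF _ countable_rat])
  then show ?thesis
  proof eventually_elim
    case (elim \<omega>)
    show ?case
    proof
      fix x
      have "limsup (log_rate (\<lambda>n. norm (blinfun_apply (cocycle \<sigma> L n \<omega>) x))) \<le> ereal c" if c: "\<Delta> 1 < ereal c" for c
      proof -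
        obtain z where z: "\<Delta> 1 < ereal z" "z < c" using ereal_between[OF c] by blast
        obtain q where q: "q \<in> \<rat>" "z < q" "q < c" using Rats_dense_in_real[OF z(2)] by blast
        have "\<Delta> 1 \<le> ereal q" using z(1) q(2) by (meson ereal_less_eq(3) less_imp_le order_trans)
        moreover have "c - q > 0" using q(3) by simp
        ultimately obtain C where C: "\<And>n i. vol_growth 1 (cocycle \<sigma> L i ((\<sigma> ^^ n) \<omega>)) \<le> C * exp (real i * q + (c - q) * real (n + i))"
          using elim q(1) by blast
        have "norm (blinfun_apply (cocycle \<sigma> L n \<omega>) x) \<le> (C * norm x) * exp (real n * c)" for n
        proof -
          have "norm (blinfun_apply (cocycle \<sigma> L n \<omega>) x) \<le> norm (cocycle \<sigma> L n \<omega>) * norm x" by (rule norm_blinfun)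
          also have "norm (cocycle \<sigma> L n \<omega>) \<le> C * exp (real n * q + (c - q) * real n)"
            using C[of n 0] vol_growth_1[OF x0] by simp
          also have "real n * q + (c - q) * real n = real n * c" by (simp add: algebra_simps)
          finally show ?thesis by (simp add: mult_right_mono mult_ac)
        qed
        then show ?thesis by (intro limsup_log_rate_le[where K = "C * norm x"]) auto
      qed
      then show "limsup (log_rate (\<lambda>n. norm (blinfun_apply (cocycle \<sigma> L n \<omega>) x))) \<le> \<mu> 1"
        unfolding \<mu>1 by (metis ereal_dense2 not_le)
    qed
  qed
qed

end

section \<open>The exceptional exponents\<close>

context nontrivial_ergodic_rds
begin

text \<open>Otherwise \<open>\<Delta> j\<close> would grow at least linearly with slope \<open>c\<close>, while its growth is known to be bounded with any slope
  above \<open>\<kappa>\<close>.\<close>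

lemma exponent_below:
  assumes "\<kappa> < ereal c" shows "\<exists>j\<ge>j0. \<mu> j < ereal c"
proof (rule ccontr)
  assume "\<not> ?thesis"
  then have ge: "\<mu> j \<ge> ereal c" if "j \<ge> j0" for j using that by (auto simp: not_less)
  let ?s = "j0"
  have step: "\<Delta> (Suc i) \<ge> \<Delta> i + ereal c \<and> \<Delta> i \<noteq> -\<infinity>" if "i \<ge> ?s" for i
  proof -
    have "\<mu> (Suc i) \<ge> ereal c" using ge[of "Suc i"] that by simp
    then show ?thesis using \<Delta>_less_top[of i] \<Delta>_less_top[of "Suc i"]
      unfolding lyapunov_exponent_def
      by (cases "\<Delta> i"; cases "\<Delta> (Suc i)") (auto split: if_splits)
  qed
  obtain d where d: "\<Delta> ?s = ereal d" using step[of ?s] \<Delta>_less_top[of ?s] by (cases "\<Delta> ?s") auto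
  have lin: "\<Delta> (?s + i) \<ge> ereal (d + real i * c)" for i
  proof (induction i)
    case (Suc i)
    have "ereal (d + real (Suc i) * c) = ereal (d + real i * c) + ereal c" by (simp add: algebra_simps)
    also have "\<dots> \<le> \<Delta> (?s + i) + ereal c" by (intro add_right_mono Suc.IH)
    also have "\<dots> \<le> \<Delta> (?s + Suc i)" using step[of "?s + i"] by simp
    finally show ?case .
  qed (simp add: d)
  obtain c' where c': "\<kappa> < ereal c'" "c' < c" using ereal_between[OF assms] by blast
  obtain j1 where j1: "\<And>j. j \<ge> j1 \<Longrightarrow> \<Delta> j \<le> ereal (real j * c')" using \<Delta>_eventually_le[OF c'(1)] by blast
  obtain N :: nat where N: "real N > (real ?s * c' - d) / (c - c')" using reals_Archimedean2 by blast
  define i where "i = max N j1"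
  have "ereal (d + real i * c) \<le> ereal (real (?s + i) * c')"
    by (rule order_trans[OF lin[of i] j1]) (simp add: i_def)
  then have "real i * (c - c') \<le> real ?s * c' - d" by (simp add: algebra_simps)
  moreover have "real i * (c - c') \<ge> real N * (c - c')" using c'(2) by (intro mult_right_mono) (auto simp: i_def)
  moreover have "real N * (c - c') > real ?s * c' - d" using N c'(2) by (simp add: field_simps)
  ultimately show False by linarith
qed

definition gaps :: "nat set" where "gaps = {k. gap k \<and> \<kappa> < \<mu> k}"

text \<open>Without a gap the exponents do not decrease, but later ones come down to any level above \<open>\<kappa>\<close>.\<close>

lemma next_gap:
  assumes "j \<ge> 1" "\<kappa> < \<mu> j"
  shows "\<exists>k\<in>gaps. j \<le> k \<and> (\<forall>i. j \<le> i \<and> i < k \<longrightarrow> i \<notin> gaps) \<and> (\<forall>i. j \<le> i \<and> i \<le> k \<longrightarrow> \<mu> j \<le> \<mu> i)"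
proof -
  have mono: "\<mu> j \<le> \<mu> (j + i)" if "\<forall>l. j \<le> l \<and> l < j + i \<longrightarrow> l \<notin> gaps" for i
    using that
  proof (induction i)
    case (Suc i)
    then have IH: "\<mu> j \<le> \<mu> (j + i)" by auto
    have "j + i \<notin> gaps" using Suc.prems by simp
    moreover have "\<kappa> < \<mu> (j + i)" using assms(2) IH by (rule less_le_trans)
    ultimately have "\<mu> (j + i) \<le> \<mu> (Suc (j + i))" using assms(1) by (auto simp: gaps_def gap_def not_less)
    then show ?case using IH by simp
  qed simp
  have "\<exists>k. k \<in> gaps \<and> j \<le> k"
  proof (rule ccontr)
    assume n: "\<not> ?thesis"
    obtain c where c: "\<kappa> < ereal c" "ereal c < \<mu> j" using ereal_dense2[OF assms(2)] by blast
    obtain l where l: "l \<ge> j" "\<mu> l < ereal c" using exponent_below[OF c(1)] by blast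
    have "\<mu> j \<le> \<mu> (j + (l - j))" using n by (intro mono) auto
    then show False using l c(2) by auto
  qed
  then obtain k where k: "k \<in> gaps" "j \<le> k" "\<And>i. i \<in> gaps \<and> j \<le> i \<Longrightarrow> k \<le> i"
    using LeastI_ex[of "\<lambda>k. k \<in> gaps \<and> j \<le> k"] Least_le[of "\<lambda>k. k \<in> gaps \<and> j \<le> k"] by blast
  have "\<mu> j \<le> \<mu> i" if i: "j \<le> i" "i \<le> k" for i
  proof -
    have "\<mu> j \<le> \<mu> (j + (i - j))"
    proof (rule mono, intro allI impI notI)
      fix l assume l: "j \<le> l \<and> l < j + (i - j)" "l \<in> gaps"
      then have "k \<le> l" using k(3) by blast
      then show False using l i by simp
    qed
    then show ?thesis using i by simp
  qed
  then show ?thesis using k by (intro bexI[of _ k]) (auto simp: not_le[symmetric])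
qed

definition good_at :: "'o \<Rightarrow> bool" where
  "good_at \<omega> \<longleftrightarrow> (\<forall>k. gap k \<longrightarrow> dominated_at k \<omega>) \<and>
     (\<forall>x. limsup (log_rate (\<lambda>i. norm (blinfun_apply (cocycle \<sigma> L i \<omega>) x))) \<le> \<mu> 1)"

text \<open>Imposing the properties along the whole forward orbit makes the set forward invariant.\<close>

definition good :: "'o set" where
  "good = {\<omega>\<in>space M. \<forall>n. good_at ((\<sigma> ^^ n) \<omega>)}"

lemma good_null: "space M - good \<in> null_sets M"
proof -
  have "AE \<omega> in M. \<forall>k. gap k \<longrightarrow> dominated_at k \<omega>"
    unfolding AE_all_countable using AE_dominated_at by auto
  then have "AE \<omega> in M. good_at \<omega>"
    using AE_top_growth unfolding good_at_def by eventually_elim simp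
  from AE_pow[OF this] obtain N where N: "N \<in> null_sets M" "{\<omega>\<in>space M. \<not> (\<forall>n. good_at ((\<sigma> ^^ n) \<omega>))} \<subseteq> N"
    unfolding eventually_ae_filter by blast
  moreover have "space M - good = {\<omega>\<in>space M. \<not> (\<forall>n. good_at ((\<sigma> ^^ n) \<omega>))}" by (auto simp: good_def)
  ultimately show ?thesis using complete2 by metis
qed

lemma good_sets: "good \<in> sets M"
proof -
  have "space M - (space M - good) \<in> sets M" using good_null by (intro sets.compl_sets null_setsD2)
  moreover have "space M - (space M - good) = good" by (auto simp: good_def)
  ultimately show ?thesis by simp
qed

lemma AE_good: "AE \<omega> in M. \<omega> \<in> good"
  using AE_not_in[OF good_null] AE_space by eventually_elim simp

lemma good_step: "\<omega> \<in> good \<Longrightarrow> \<sigma> \<omega> \<in> good"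
proof -
  assume w: "\<omega> \<in> good"
  have "good_at ((\<sigma> ^^ n) (\<sigma> \<omega>))" for n
  proof -
    have "good_at ((\<sigma> ^^ Suc n) \<omega>)" using w unfolding good_def by blast
    then show ?thesis by (simp add: funpow_swap1)
  qed
  then show ?thesis using w \<sigma>_space by (simp add: good_def)
qed

lemma good_good_at: "\<omega> \<in> good \<Longrightarrow> good_at \<omega>"
  unfolding good_def by (metis (mono_tags, lifting) funpow_0 mem_Collect_eq)

lemma good_dominated: "\<omega> \<in> good \<Longrightarrow> gap k \<Longrightarrow> dominated_at k \<omega>"
  using good_good_at unfolding good_at_def by blast

lemma good_top: "\<omega> \<in> good \<Longrightarrow> limsup (log_rate (\<lambda>i. norm (blinfun_apply (cocycle \<sigma> L i \<omega>) x))) \<le> \<mu> 1"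
  using good_good_at unfolding good_at_def by blast

lemma good_nonempty: "\<exists>\<omega>. \<omega> \<in> good"
proof (rule ccontr)
  assume "\<not> ?thesis"
  then have "space M \<in> null_sets M" using good_null by simp
  then have "emeasure M (space M) = 0" by (rule null_setsD1)
  then show False using emeasure_space_1 by simp
qed

text \<open>The exponents do not decrease between the gaps. If they increased, then the vectors of the slow subspace at
  \<open>k\<close> would grow too slowly to lie outside the slow subspace at \<open>k'\<close>, so that a space of codimension \<open>k\<close> would
  be contained in one of larger codimension.\<close>

lemma consecutive_gaps:
  assumes k: "k = 0 \<or> gap k" and k': "k' \<in> gaps" and lt: "k < k'"
    and between: "\<And>i. k < i \<Longrightarrow> i < k' \<Longrightarrow> i \<notin> gaps"
  shows "\<mu> (Suc k) = \<mu> k'"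
proof -
  have g': "gap k'" using k' by (simp add: gaps_def)
  obtain \<omega> where w: "\<omega> \<in> good" using good_nonempty by blast
  note d' = good_dominated[OF w g']
  have "\<not> \<mu> (Suc k) < \<mu> k'"
  proof
    assume less: "\<mu> (Suc k) < \<mu> k'"
    have sub: "slow_space k \<omega> \<subseteq> slow_space k' \<omega>"
    proof
      fix x assume "x \<in> slow_space k \<omega>"
      then have l: "limsup (log_rate (\<lambda>n. norm (blinfun_apply (cocycle \<sigma> L n \<omega>) x))) < \<mu> k'"
        using less by (auto simp: slow_space_def)
      have "liminf (log_rate (\<lambda>n. norm (blinfun_apply (cocycle \<sigma> L n \<omega>) x))) \<le>
          limsup (log_rate (\<lambda>n. norm (blinfun_apply (cocycle \<sigma> L n \<omega>) x)))"
        by (rule Liminf_le_Limsup) simp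
      then show "x \<in> slow_space k' \<omega>" using slow_space_at(2)[OF g' d', of x] l by fastforce
    qed
    have cod': "has_codim (slow_space k' \<omega>) k'" using slow_space_at(1)[OF g' d'] by (simp add: cograss_def)
    have "has_codim (slow_space k \<omega>) k"
    proof (cases "k = 0")
      case True
      have "slow_space 0 \<omega> = UNIV" using good_top[OF w] by (auto simp: slow_space_def)
      then show ?thesis using True by (auto simp: has_codim_def independent_empty intro!: exI[of _ "{}"])
    next
      case False
      then have "gap k" using k by simp
      then show ?thesis using slow_space_at(1)[OF _ good_dominated[OF w]] by (simp add: cograss_def)
    qed
    from has_codim_antimono[OF this cod' sub] lt show False by simp
  qed
  then have ge: "\<mu> k' \<le> \<mu> (Suc k)" by simp
  moreover have "\<kappa> < \<mu> k'" using k' by (simp add: gaps_def)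
  ultimately have "\<kappa> < \<mu> (Suc k)" by (rule less_le_trans[rotated])
  then obtain l where l: "l \<in> gaps" "Suc k \<le> l" "\<forall>i. Suc k \<le> i \<and> i < l \<longrightarrow> i \<notin> gaps"
    "\<forall>i. Suc k \<le> i \<and> i \<le> l \<longrightarrow> \<mu> (Suc k) \<le> \<mu> i"
    using next_gap[of "Suc k"] by auto
  have "l = k'" using l between[of l] k' lt by (metis Suc_le_eq linorder_neqE_nat)
  then show ?thesis using l(2,4) ge by (auto intro: antisym)
qed

text \<open>The initial value is no gap: it belongs to the whole space, of codimension zero. The value at \<open>i\<close> is meaningful only if
  \<open>has_gap i\<close> holds.\<close>

fun nth_gap :: "nat \<Rightarrow> nat" where
  "nth_gap 0 = 0"
| "nth_gap (Suc i) = (LEAST k. k \<in> gaps \<and> nth_gap i < k)"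

fun has_gap :: "nat \<Rightarrow> bool" where
  "has_gap 0 = True"
| "has_gap (Suc i) \<longleftrightarrow> has_gap i \<and> (\<exists>k\<in>gaps. nth_gap i < k)"

lemma nth_gap_Suc:
  assumes "has_gap (Suc i)"
  shows "nth_gap (Suc i) \<in> gaps" "nth_gap i < nth_gap (Suc i)"
    "\<And>l. nth_gap i < l \<Longrightarrow> l < nth_gap (Suc i) \<Longrightarrow> l \<notin> gaps"
proof -
  have "\<exists>k. k \<in> gaps \<and> nth_gap i < k" using assms by auto
  from LeastI_ex[OF this] show "nth_gap (Suc i) \<in> gaps" "nth_gap i < nth_gap (Suc i)" by auto
  show "\<And>l. nth_gap i < l \<Longrightarrow> l < nth_gap (Suc i) \<Longrightarrow> l \<notin> gaps"
    using not_less_Least[of _ "\<lambda>k. k \<in> gaps \<and> nth_gap i < k"] by auto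
qed

lemma has_gap_le: "has_gap n \<Longrightarrow> i \<le> n \<Longrightarrow> has_gap i"
proof (induction n)
  case (Suc n)
  then show ?case by (cases "i = Suc n") auto
qed simp

lemma nth_gap_gap: "has_gap i \<Longrightarrow> nth_gap i = 0 \<or> gap (nth_gap i)"
proof (cases i)
  case (Suc j)
  assume "has_gap i"
  then show ?thesis using nth_gap_Suc(1)[of j] Suc by (auto simp: gaps_def simp del: nth_gap.simps)
qed simp

lemma nth_gap_exponent:
  assumes "has_gap (Suc i)" shows "\<mu> (Suc (nth_gap i)) = \<mu> (nth_gap (Suc i))"
proof (rule consecutive_gaps)
  show "nth_gap i = 0 \<or> gap (nth_gap i)" using assms by (intro nth_gap_gap) simp
qed (use nth_gap_Suc[OF assms] in blast)+

lemma nth_gap_ge: "has_gap i \<Longrightarrow> i \<le> nth_gap i"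
proof (induction i)
  case (Suc i)
  have "has_gap i" using Suc.prems by simp
  then show ?case using Suc.IH nth_gap_Suc(2)[OF Suc.prems] by linarith
qed simp

definition expo :: "nat \<Rightarrow> ereal" where "expo i = \<mu> (nth_gap i)"

lemma expo_gt: "has_gap (Suc i) \<Longrightarrow> \<kappa> < expo (Suc i)"
  using nth_gap_Suc(1)[of i] by (simp add: expo_def gaps_def del: nth_gap.simps)

lemma expo_decreasing:
  assumes "has_gap (Suc (Suc i))" shows "expo (Suc (Suc i)) < expo (Suc i)"
proof -
  have h: "has_gap (Suc i)" using assms by simp
  have "gap (nth_gap (Suc i))" using nth_gap_Suc(1)[OF h] by (simp add: gaps_def del: nth_gap.simps)
  then show ?thesis unfolding expo_def nth_gap_exponent[OF assms, symmetric] by (simp add: gap_def del: nth_gap.simps)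
qed

text \<open>No exponent is below that of the next gap after it. So the small exponents provided by \<open>exponent_below\<close> force
  small exponents at the gaps.\<close>

lemma expo_tendsto:
  assumes all: "\<And>i. has_gap i" shows "expo \<longlonglongrightarrow> \<kappa>"
proof (rule order_tendstoI)
  fix a assume a: "a < \<kappa>"
  have "a < expo n" if "n \<ge> 1" for n
    using expo_gt[of "n - 1"] all[of n] that a by (cases n) (auto simp del: has_gap.simps)
  then show "\<forall>\<^sub>F n in sequentially. a < expo n" unfolding eventually_sequentially by blast
next
  fix a assume "\<kappa> < a"
  then obtain c where c: "\<kappa> < ereal c" "ereal c < a" using ereal_dense2 by blast
  obtain j where j: "j \<ge> 1" "\<mu> j < ereal c" using exponent_below[OF c(1)] by blast
  have "\<exists>i. j \<le> nth_gap i" using nth_gap_ge[OF all, of j] by blast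
  then obtain i where i: "j \<le> nth_gap i" "\<And>l. l < i \<Longrightarrow> \<not> j \<le> nth_gap l"
    using LeastI_ex[of "\<lambda>i. j \<le> nth_gap i"] not_less_Least[of _ "\<lambda>i. j \<le> nth_gap i"] by blast
  have "i \<noteq> 0" using i(1) j(1) by (cases i) auto
  then obtain l where l: "i = Suc l" by (cases i) auto
  have jl: "Suc (nth_gap l) \<le> j" using i(2)[of l] l by simp
  have h: "has_gap (Suc l)" by (rule all)
  have e: "\<mu> (Suc (nth_gap l)) = expo i" unfolding expo_def l by (rule nth_gap_exponent[OF h])
  have "\<kappa> < \<mu> (Suc (nth_gap l))" unfolding e l by (rule expo_gt[OF h])
  then obtain k where k: "k \<in> gaps" "Suc (nth_gap l) \<le> k"
     "\<forall>i. Suc (nth_gap l) \<le> i \<and> i < k \<longrightarrow> i \<notin> gaps" "\<forall>i. Suc (nth_gap l) \<le> i \<and> i \<le> k \<longrightarrow> \<mu> (Suc (nth_gap l)) \<le> \<mu> i"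
    using next_gap[of "Suc (nth_gap l)"] by auto
  have "k = nth_gap i" using k nth_gap_Suc[OF h] unfolding l by (metis Suc_le_eq linorder_neqE_nat)
  then have "expo i \<le> \<mu> j" using k(4) jl i(1) e by metis
  then have ei: "expo i < a" using j(2) c(2) by (meson le_less_trans less_trans)
  have "expo n < a" if "n \<ge> i" for n
    using that
  proof (induction n rule: dec_induct)
    case (step n)
    then obtain q where q: "n = Suc q" using l by (cases n) auto
    have "expo (Suc n) < expo n" unfolding q by (rule expo_decreasing[OF all])
    then show ?case using step.IH by (rule less_trans)
  qed (rule ei)
  then show "\<forall>\<^sub>F n in sequentially. expo n < a" unfolding eventually_sequentially by blast
qed

lemma last_gap:
  assumes "has_gap n" "\<not> has_gap (Suc n)" shows "\<mu> (Suc (nth_gap n)) \<le> \<kappa>"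
proof (rule ccontr)
  assume "\<not> ?thesis"
  then have "\<kappa> < \<mu> (Suc (nth_gap n))" by (simp only: not_le)
  from next_gap[OF _ this] obtain k where "k \<in> gaps" "Suc (nth_gap n) \<le> k" by auto
  then show False using assms by (auto simp: Suc_le_eq)
qed

end

section \<open>The filtration\<close>

context nontrivial_ergodic_rds
begin

text \<open>Off the forward invariant set \<open>good\<close> the subspace \<open>{0}\<close> makes the filtration equivariant at every point.\<close>

definition filtration :: "nat \<Rightarrow> 'o \<Rightarrow> 'x set" where
  "filtration l \<omega> = (if l \<le> 1 then UNIV else if \<omega> \<in> good then slow_space (nth_gap (l - 1)) \<omega> else {0})"

lemma filtration_1: "filtration (Suc 0) \<omega> = UNIV"
  by (simp add: filtration_def)

lemma filtration_good: "\<omega> \<in> good \<Longrightarrow> filtration (Suc (Suc i)) \<omega> = slow_space (nth_gap (Suc i)) \<omega>"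
  by (simp add: filtration_def del: nth_gap.simps)

lemma filtration_bad: "\<omega> \<notin> good \<Longrightarrow> filtration (Suc (Suc i)) \<omega> = {0}"
  by (simp add: filtration_def)

lemma gap_nth_gap: "has_gap (Suc i) \<Longrightarrow> gap (nth_gap (Suc i))"
  using nth_gap_Suc(1)[of i] by (simp add: gaps_def del: nth_gap.simps)

lemma filtration_cograss:
  assumes "\<omega> \<in> good" "has_gap i" shows "filtration (Suc i) \<omega> \<in> cograss (nth_gap i)"
proof (cases i)
  case 0
  then show ?thesis
    by (auto simp: filtration_1 cograss_def has_codim_def independent_empty intro!: exI[of _ "{}"])
next
  case (Suc j)
  then show ?thesis
    using slow_space_at(1)[OF gap_nth_gap good_dominated[OF assms(1) gap_nth_gap]] assms(2) filtration_good[OF assms(1)]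
    by (metis)
qed

lemma filtration_closed_subspace:
  assumes "has_gap i" shows "subspace (filtration (Suc i) \<omega>)" "closed (filtration (Suc i) \<omega>)"
proof -
  have "subspace (filtration (Suc i) \<omega>) \<and> closed (filtration (Suc i) \<omega>)"
  proof (cases "\<omega> \<in> good")
    case True
    then show ?thesis using filtration_cograss[OF True assms] by (simp add: cograss_def has_codim_def)
  next
    case False
    then show ?thesis by (cases i) (auto simp: filtration_1 filtration_bad)
  qed
  then show "subspace (filtration (Suc i) \<omega>)" "closed (filtration (Suc i) \<omega>)" by auto
qed

lemma filtration_decreasing:
  assumes "has_gap (Suc i)" shows "filtration (Suc (Suc i)) \<omega> \<subseteq> filtration (Suc i) \<omega>"
proof (cases i)
  case 0 then show ?thesis by (simp add: filtration_1)
next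
  case (Suc j)
  show ?thesis
  proof (cases "\<omega> \<in> good")
    case True
    have "\<mu> (Suc (nth_gap (Suc i))) \<le> \<mu> (nth_gap (Suc i))"
      using gap_nth_gap[OF assms] by (simp add: gap_def less_imp_le del: nth_gap.simps)
    also have "\<dots> = \<mu> (Suc (nth_gap i))" by (rule nth_gap_exponent[OF assms, symmetric])
    finally show ?thesis unfolding Suc filtration_good[OF True]
      by (auto simp: slow_space_def simp del: nth_gap.simps)
  qed (simp add: Suc filtration_bad)
qed

lemma filtration_equivariant:
  assumes "has_gap i" shows "blinfun_apply (L \<omega>) ` filtration (Suc i) \<omega> \<subseteq> filtration (Suc i) (\<sigma> \<omega>)"
proof (cases i)
  case 0 then show ?thesis by (simp add: filtration_1)
next
  case (Suc j)
  show ?thesis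
  proof (cases "\<omega> \<in> good")
    case True
    show ?thesis unfolding Suc filtration_good[OF True] filtration_good[OF good_step[OF True]]
      by (rule slow_space_equivariant)
  next
    case False
    have "0 \<in> filtration (Suc i) (\<sigma> \<omega>)" by (rule subspace_0[OF filtration_closed_subspace(1)[OF assms]])
    then show ?thesis using False by (simp add: Suc filtration_bad blinfun.zero_right)
  qed
qed

lemma filtration_measurable:
  assumes sep: "separable_space (euclidean :: ('x \<Rightarrow>\<^sub>L real) topology)" and "has_gap i"
  shows "measurable_subspaces M (nth_gap i) (filtration (Suc i))"
proof (cases i)
  case 0
  have "(UNIV :: 'x set) \<in> cograss 0"
    by (auto simp: cograss_def has_codim_def independent_empty intro!: exI[of _ "{}"])
  then have "UNIV \<in> space (cograss_borel 0 :: 'x set measure)"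
    by (simp add: cograss_borel_def space_measure_of_conv)
  then have "(\<lambda>\<omega>. UNIV) \<in> measurable (restrict_space M (space M - {})) (cograss_borel 0 :: 'x set measure)"
    by (rule measurable_const)
  moreover have "filtration (Suc 0) = (\<lambda>\<omega>. UNIV)" by (simp add: fun_eq_iff filtration_1)
  ultimately have "filtration (Suc 0) \<in> measurable (restrict_space M (space M - {})) (cograss_borel 0)"
    by (simp only:)
  moreover have "{} \<in> null_sets M" by (rule null_sets.empty_sets)
  ultimately have "measurable_subspaces M 0 (filtration (Suc 0))"
    unfolding measurable_subspaces_def by (rule bexI)
  then show ?thesis unfolding 0 nth_gap.simps(1) .
next
  case (Suc j)
  have g: "gap (nth_gap (Suc j))" using gap_nth_gap assms(2) Suc by simp
  have sp: "space M - (space M - good) = good" by (auto simp: good_def)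
  have "slow_space (nth_gap (Suc j)) \<in> measurable (restrict_space M good) (cograss_borel (nth_gap (Suc j)))"
    by (rule slow_space_measurable[OF sep g good_sets good_dominated[OF _ g]])
  moreover have "filtration (Suc (Suc j)) \<omega> = slow_space (nth_gap (Suc j)) \<omega>"
    if "\<omega> \<in> space (restrict_space M good)" for \<omega>
    using that by (intro filtration_good) (simp add: space_restrict_space)
  ultimately have "filtration (Suc (Suc j)) \<in> measurable (restrict_space M good) (cograss_borel (nth_gap (Suc j)))"
    using measurable_cong[of "restrict_space M good" "filtration (Suc (Suc j))" "slow_space (nth_gap (Suc j))"] by blast
  then show ?thesis unfolding measurable_subspaces_def Suc
    by (intro bexI[OF _ good_null]) (simp add: sp del: nth_gap.simps)
qed

lemma filtration_growth_upper:
  assumes "\<omega> \<in> good" "v \<in> filtration (Suc i) \<omega>"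
  shows "limsup (log_rate (\<lambda>n. norm (blinfun_apply (cocycle \<sigma> L n \<omega>) v))) \<le> \<mu> (Suc (nth_gap i))"
proof (cases i)
  case 0 then show ?thesis using good_top[OF assms(1)] by simp
next
  case (Suc j)
  then show ?thesis using assms(2) unfolding Suc filtration_good[OF assms(1)] slow_space_def by blast
qed

lemma filtration_growth:
  assumes w: "\<omega> \<in> good" and h: "has_gap (Suc i)" and v: "v \<in> filtration (Suc i) \<omega> - filtration (Suc (Suc i)) \<omega>"
  shows "log_rate (\<lambda>n. norm (blinfun_apply (cocycle \<sigma> L n \<omega>) v)) \<longlonglongrightarrow> expo (Suc i)"
proof -
  let ?r = "log_rate (\<lambda>n. norm (blinfun_apply (cocycle \<sigma> L n \<omega>) v))"
  have up: "limsup ?r \<le> expo (Suc i)"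
    using filtration_growth_upper[OF w, of v i] v unfolding expo_def nth_gap_exponent[OF h] by blast
  have "v \<notin> slow_space (nth_gap (Suc i)) \<omega>" using v filtration_good[OF w] by blast
  then have low: "expo (Suc i) \<le> liminf ?r"
    unfolding expo_def by (rule slow_space_at(2)[OF gap_nth_gap[OF h] good_dominated[OF w gap_nth_gap[OF h]]])
  have "liminf ?r \<le> limsup ?r" by (rule Liminf_le_Limsup) simp
  then have "liminf ?r = expo (Suc i)" "limsup ?r = expo (Suc i)" using up low by auto
  then show ?thesis by (simp add: tendsto_iff_Liminf_eq_Limsup)
qed

definition count :: enat where
  "count = (if \<forall>i. has_gap i then \<infinity> else enat (LEAST n. \<not> has_gap (Suc n)))"

lemma has_gap_iff: "has_gap i \<longleftrightarrow> enat i \<le> count"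
proof (cases "\<forall>i. has_gap i")
  case True
  then show ?thesis by (simp add: count_def)
next
  case False
  let ?n = "LEAST n. \<not> has_gap (Suc n)"
  obtain q where q: "\<not> has_gap q" using False by blast
  then have "\<exists>n. \<not> has_gap (Suc n)" by (cases q) auto
  then have n: "\<not> has_gap (Suc ?n)" by (rule LeastI_ex)
  have "has_gap ?n"
  proof (cases "?n")
    case (Suc p)
    then show ?thesis using not_less_Least[of p "\<lambda>n. \<not> has_gap (Suc n)"] by simp
  qed simp
  then have "has_gap i \<longleftrightarrow> i \<le> ?n"
    using n has_gap_le[of i "Suc ?n"] has_gap_le[of "Suc ?n" i] has_gap_le[of ?n i] by (meson has_gap_le not_less_eq_eq)
  then show ?thesis using False by (auto simp: count_def)
qed

lemma has_gap_pred:
  assumes "l \<ge> 1" "enat l \<le> count"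
  obtains j where "l = Suc j" "has_gap (Suc j)" "has_gap j"
proof -
  obtain j where "l = Suc j" using assms(1) not0_implies_Suc[of l] by auto
  then show thesis using that[of j] assms(2) has_gap_iff[of "Suc j"] by simp
qed

lemma has_gap_pred':
  assumes "l \<ge> 1" "enat l \<le> count + 1"
  obtains j where "l = Suc j" "has_gap j"
proof -
  obtain j where j: "l = Suc j" using assms(1) not0_implies_Suc[of l] by auto
  have "enat j \<le> count" using assms(2) unfolding j by (cases count) (auto simp: one_enat_def)
  then show thesis using that[of j] j has_gap_iff by simp
qed

definition multiplicity :: "nat \<Rightarrow> nat" where
  "multiplicity i = nth_gap i - nth_gap (i - 1)"

lemma sum_multiplicity: "has_gap q \<Longrightarrow> (\<Sum>i=1..<Suc q. multiplicity i) = nth_gap q"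
proof (induction q)
  case (Suc q)
  have "nth_gap q < nth_gap (Suc q)" by (rule nth_gap_Suc(2)[OF Suc.prems])
  moreover have "has_gap q" using Suc.prems by simp
  ultimately show ?case using Suc.IH by (simp add: multiplicity_def del: nth_gap.simps(2))
qed simp

definition slowest :: "'o \<Rightarrow> 'x set" where
  "slowest \<omega> = (case count of enat n \<Rightarrow> filtration (Suc n) \<omega> | \<infinity> \<Rightarrow> (\<Inter>i\<in>{1..}. filtration i \<omega>))"

lemma has_gap_count: "count = enat n \<Longrightarrow> has_gap n \<and> \<not> has_gap (Suc n)" "count = \<infinity> \<Longrightarrow> has_gap i"
  using has_gap_iff[of n] has_gap_iff[of "Suc n"] has_gap_iff[of i] by auto

lemma exponents_ok:
  assumes qc: "\<kappa> < top_exponent M \<sigma> L"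
  shows "1 \<le> count"
    and "expo 1 = top_exponent M \<sigma> L \<and>
      (\<forall>i\<ge>1. enat i \<le> count \<longrightarrow> exceptional_exponent M \<sigma> L (expo i)) \<and>
      (\<forall>i\<ge>1. enat (Suc i) \<le> count \<longrightarrow> expo i > expo (Suc i)) \<and>
      (count = \<infinity> \<longrightarrow> expo \<longlonglongrightarrow> \<kappa>)"
    and "\<forall>i\<ge>1. enat i \<le> count \<longrightarrow> multiplicity i > 0"
proof -
  have \<mu>1: "\<mu> 1 = top_exponent M \<sigma> L" by (simp add: top_eq lyapunov_exponent_def \<Delta>_0)
  have "\<exists>k\<in>gaps. 1 \<le> k" using next_gap[of 1] qc unfolding \<mu>1 by blast
  then have g1: "has_gap (Suc 0)" by (auto simp: Suc_le_eq)
  then show "1 \<le> count" by (simp add: has_gap_iff one_enat_def del: has_gap.simps)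
  show "\<forall>i\<ge>1. enat i \<le> count \<longrightarrow> multiplicity i > 0"
  proof (intro allI impI)
    fix i :: nat assume "i \<ge> 1" "enat i \<le> count"
    then obtain j where j: "i = Suc j" "has_gap (Suc j)" by (rule has_gap_pred)
    show "multiplicity i > 0" using nth_gap_Suc(2)[OF j(2)] by (simp add: multiplicity_def j(1) del: nth_gap.simps)
  qed
  show "expo 1 = top_exponent M \<sigma> L \<and>
      (\<forall>i\<ge>1. enat i \<le> count \<longrightarrow> exceptional_exponent M \<sigma> L (expo i)) \<and>
      (\<forall>i\<ge>1. enat (Suc i) \<le> count \<longrightarrow> expo i > expo (Suc i)) \<and>
      (count = \<infinity> \<longrightarrow> expo \<longlonglongrightarrow> \<kappa>)"
  proof (intro conjI allI impI)
    show "expo 1 = top_exponent M \<sigma> L"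
      using nth_gap_exponent[OF g1] \<mu>1 by (simp add: expo_def del: nth_gap.simps(2))
  next
    fix i :: nat assume "i \<ge> 1" "enat i \<le> count"
    then obtain j where j: "i = Suc j" "has_gap (Suc j)" by (rule has_gap_pred)
    have "nth_gap (Suc j) \<ge> 1" using gap_nth_gap[OF j(2)] unfolding gap_def by blast
    then show "exceptional_exponent M \<sigma> L (expo i)"
      using expo_gt[OF j(2)] unfolding exceptional_exponent_def expo_def j by blast
  next
    fix i :: nat assume i: "i \<ge> 1" and "enat (Suc i) \<le> count"
    then have "has_gap (Suc i)" by (simp only: has_gap_iff)
    moreover obtain j where "i = Suc j" using i not0_implies_Suc[of i] by auto
    ultimately show "expo i > expo (Suc i)" using expo_decreasing by blast
  next
    assume "count = \<infinity>"
    then show "expo \<longlonglongrightarrow> \<kappa>" by (intro expo_tendsto has_gap_count)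
  qed
qed

lemma filtration_ok:
  assumes "i \<ge> 1" "enat i \<le> count"
  shows "subspace (filtration i \<omega>) \<and> closed (filtration i \<omega>) \<and> filtration (Suc i) \<omega> \<subseteq> filtration i \<omega> \<and>
      blinfun_apply (L \<omega>) ` filtration i \<omega> \<subseteq> filtration i (\<sigma> \<omega>)"
proof -
  obtain j where j: "i = Suc j" "has_gap (Suc j)" "has_gap j" using has_gap_pred[OF assms] by blast
  show ?thesis unfolding j(1)
    using filtration_closed_subspace[OF j(3)] filtration_decreasing[OF j(2)] filtration_equivariant[OF j(3)] by blast
qed

lemma slowest_ok:
  "subspace (slowest \<omega>) \<and> closed (slowest \<omega>) \<and> blinfun_apply (L \<omega>) ` slowest \<omega> \<subseteq> slowest (\<sigma> \<omega>)"
proof (cases count)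
  case (enat n)
  then show ?thesis unfolding slowest_def
    using filtration_closed_subspace filtration_equivariant has_gap_count(1)[OF enat] by simp
next
  case infinity
  have ok: "subspace (filtration i \<omega>)" "closed (filtration i \<omega>)"
    "blinfun_apply (L \<omega>) ` filtration i \<omega> \<subseteq> filtration i (\<sigma> \<omega>)" if "i \<ge> 1" for i
    using filtration_ok[OF that, of \<omega>] infinity by auto
  have "subspace (\<Inter>i\<in>{1..}. filtration i \<omega>)"
    by (rule subspace_Inter) (use ok(1) in blast)
  moreover have "closed (\<Inter>i\<in>{1..}. filtration i \<omega>)"
    by (intro closed_INT ballI ok(2)) simp
  moreover have "blinfun_apply (L \<omega>) ` (\<Inter>i\<in>{1..}. filtration i \<omega>) \<subseteq> (\<Inter>i\<in>{1..}. filtration i (\<sigma> \<omega>))"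
    using ok(3) by (intro image_subsetI INT_I) blast
  ultimately show ?thesis unfolding slowest_def infinity by simp
qed

lemma slowest_eq:
  "count = enat n \<Longrightarrow> filtration (Suc n) \<omega> = slowest \<omega>"
  "count = \<infinity> \<Longrightarrow> slowest \<omega> = (\<Inter>i\<in>{1..}. filtration i \<omega>)"
  by (simp_all add: slowest_def)

lemma slowest_growth:
  assumes w: "\<omega> \<in> good" and v: "v \<in> slowest \<omega>"
  shows "limsup (log_rate (\<lambda>n. norm (blinfun_apply (cocycle \<sigma> L n \<omega>) v))) \<le> \<kappa>"
proof (cases count)
  case (enat n)
  have "v \<in> filtration (Suc n) \<omega>" using v by (simp add: slowest_eq(1)[OF enat])
  then show ?thesis
    using filtration_growth_upper[OF w] last_gap has_gap_count(1)[OF enat] order_trans by blast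
next
  case infinity
  note all = has_gap_count(2)[OF infinity]
  have "limsup (log_rate (\<lambda>n. norm (blinfun_apply (cocycle \<sigma> L n \<omega>) v))) \<le> expo (Suc i)" for i
  proof -
    have "v \<in> filtration (Suc i) \<omega>" using v unfolding slowest_eq(2)[OF infinity] by auto
    then show ?thesis
      using filtration_growth_upper[OF w] unfolding expo_def nth_gap_exponent[OF all, symmetric] by blast
  qed
  moreover have "(\<lambda>i. expo (Suc i)) \<longlonglongrightarrow> \<kappa>" by (rule LIMSEQ_Suc[OF expo_tendsto[OF all]])
  ultimately show ?thesis by (intro LIMSEQ_le_const) auto
qed

lemma filtration_measurable_ok:
  assumes sep: "separable_space (euclidean :: ('x \<Rightarrow>\<^sub>L real) topology)"
    and "l \<ge> 1" "enat l \<le> count + 1"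
  shows "measurable_subspaces M (\<Sum>i=1..<l. multiplicity i) (filtration l)"
proof -
  obtain j where j: "l = Suc j" "has_gap j" using has_gap_pred'[OF assms(2,3)] by blast
  show ?thesis using filtration_measurable[OF sep j(2)] unfolding j(1) sum_multiplicity[OF j(2)] .
qed

lemma AE_filtration:
  "AE \<omega> in M.
    (\<forall>l\<ge>1. enat l \<le> count + 1 \<longrightarrow> has_codim (filtration l \<omega>) (\<Sum>i=1..<l. multiplicity i)) \<and>
    (\<forall>l\<ge>1. enat l \<le> count \<longrightarrow>
       (\<forall>v \<in> filtration l \<omega> - filtration (Suc l) \<omega>.
          log_rate (\<lambda>n. norm (blinfun_apply (cocycle \<sigma> L n \<omega>) v)) \<longlonglongrightarrow> expo l)) \<and>
    (\<forall>v \<in> slowest \<omega>. limsup (log_rate (\<lambda>n. norm (blinfun_apply (cocycle \<sigma> L n \<omega>) v))) \<le> \<kappa>)"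
  using AE_good
proof eventually_elim
  case (elim \<omega>)
  show ?case
  proof (intro conjI allI impI ballI)
    fix l :: nat assume "l \<ge> 1" "enat l \<le> count + 1"
    then obtain j where j: "l = Suc j" "has_gap j" by (rule has_gap_pred')
    show "has_codim (filtration l \<omega>) (\<Sum>i=1..<l. multiplicity i)"
      using filtration_cograss[OF elim j(2)] unfolding j(1) sum_multiplicity[OF j(2)] by (simp add: cograss_def)
  next
    fix l :: nat and v assume "l \<ge> 1" "enat l \<le> count" and v: "v \<in> filtration l \<omega> - filtration (Suc l) \<omega>"
    then obtain j where j: "l = Suc j" "has_gap (Suc j)" using has_gap_pred by blast
    show "log_rate (\<lambda>n. norm (blinfun_apply (cocycle \<sigma> L n \<omega>) v)) \<longlonglongrightarrow> expo l"
      using filtration_growth[OF elim j(2)] v unfolding j(1) by blast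
  qed (rule slowest_growth[OF elim])
qed

end

theorem theorem16:
  fixes M :: "'o measure" and \<sigma> :: "'o \<Rightarrow> 'o"
    and L :: "'o \<Rightarrow> 'x::{banach,second_countable_topology} \<Rightarrow>\<^sub>L 'x"
  assumes "ergodic_rds M \<sigma> L"
    and "separable_space (euclidean :: ('x \<Rightarrow>\<^sub>L real) topology)"
    and "compactness_exponent M \<sigma> L < top_exponent M \<sigma> L"
  shows "\<exists>(r::enat) (lam :: nat \<Rightarrow> ereal) (m :: nat \<Rightarrow> nat)
            (V :: nat \<Rightarrow> 'o \<Rightarrow> 'x set) (Vinf :: 'o \<Rightarrow> 'x set).
     1 \<le> r \<and>
     (lam 1 = top_exponent M \<sigma> L \<and>
      (\<forall>i\<ge>1. enat i \<le> r \<longrightarrow> exceptional_exponent M \<sigma> L (lam i)) \<and>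
      (\<forall>i\<ge>1. enat (Suc i) \<le> r \<longrightarrow> lam i > lam (Suc i)) \<and>
      (r = \<infinity> \<longrightarrow> lam \<longlonglongrightarrow> compactness_exponent M \<sigma> L)) \<and>
     (\<forall>i\<ge>1. enat i \<le> r \<longrightarrow> m i > 0) \<and>
     ((\<forall>\<omega>\<in>space M.
         V 1 \<omega> = UNIV \<and>
         (\<forall>i\<ge>1. enat i \<le> r \<longrightarrow>
            subspace (V i \<omega>) \<and> closed (V i \<omega>) \<and> V (Suc i) \<omega> \<subseteq> V i \<omega> \<and>
            blinfun_apply (L \<omega>) ` V i \<omega> \<subseteq> V i (\<sigma> \<omega>)) \<and>
         (subspace (Vinf \<omega>) \<and> closed (Vinf \<omega>) \<and>
          blinfun_apply (L \<omega>) ` Vinf \<omega> \<subseteq> Vinf (\<sigma> \<omega>)) \<and>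
         (\<forall>n. r = enat n \<longrightarrow> V (Suc n) \<omega> = Vinf \<omega>) \<and>
         (r = \<infinity> \<longrightarrow> Vinf \<omega> = (\<Inter>i\<in>{1..}. V i \<omega>))) \<and>
      (\<forall>l\<ge>1. enat l \<le> r + 1 \<longrightarrow> measurable_subspaces M (\<Sum>i=1..<l. m i) (V l))) \<and>
     (AE \<omega> in M.
        (\<forall>l\<ge>1. enat l \<le> r + 1 \<longrightarrow> has_codim (V l \<omega>) (\<Sum>i=1..<l. m i)) \<and>
        (\<forall>l\<ge>1. enat l \<le> r \<longrightarrow>
           (\<forall>v \<in> V l \<omega> - V (Suc l) \<omega>.
              log_rate (\<lambda>n. norm (blinfun_apply (cocycle \<sigma> L n \<omega>) v)) \<longlonglongrightarrow> lam l)) \<and>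
        (\<forall>v \<in> Vinf \<omega>.
           limsup (log_rate (\<lambda>n. norm (blinfun_apply (cocycle \<sigma> L n \<omega>) v)))
             \<le> compactness_exponent M \<sigma> L))"
proof -
  interpret ergodic_rds M \<sigma> L by (rule assms(1))
  \<comment> \<open>On the trivial space all operators vanish, and then their norms have no finite logarithm.\<close>
  have "\<exists>x::'x. x \<noteq> 0"
  proof (rule ccontr)
    assume "\<nexists>x::'x. x \<noteq> 0"
    then have "L \<omega> = 0" for \<omega> by (intro blinfun_eqI) metis
    then have "AE \<omega> in M. False" using log_norm_finite by simp
    then have "space M \<in> null_sets M" by (simp add: AE_iff_null)
    then have "emeasure M (space M) = 0" by (rule null_setsD1)
    then show False using emeasure_space_1 by simp
  qed
  then obtain x0 :: 'x where "x0 \<noteq> 0" by blast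
  then interpret nontrivial_ergodic_rds M \<sigma> L x0 by unfold_locales
  have spaces: "\<forall>\<omega>\<in>space M.
         filtration 1 \<omega> = UNIV \<and>
         (\<forall>i\<ge>1. enat i \<le> count \<longrightarrow>
            subspace (filtration i \<omega>) \<and> closed (filtration i \<omega>) \<and> filtration (Suc i) \<omega> \<subseteq> filtration i \<omega> \<and>
            blinfun_apply (L \<omega>) ` filtration i \<omega> \<subseteq> filtration i (\<sigma> \<omega>)) \<and>
         (subspace (slowest \<omega>) \<and> closed (slowest \<omega>) \<and>
          blinfun_apply (L \<omega>) ` slowest \<omega> \<subseteq> slowest (\<sigma> \<omega>)) \<and>
         (\<forall>n. count = enat n \<longrightarrow> filtration (Suc n) \<omega> = slowest \<omega>) \<and>
         (count = \<infinity> \<longrightarrow> slowest \<omega> = (\<Inter>i\<in>{1..}. filtration i \<omega>))"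
    by (intro ballI conjI allI impI)
      (use filtration_1 filtration_ok slowest_ok slowest_eq in \<open>auto simp del: nth_gap.simps\<close>)
  have meas: "\<forall>l\<ge>1. enat l \<le> count + 1 \<longrightarrow> measurable_subspaces M (\<Sum>i=1..<l. multiplicity i) (filtration l)"
    using filtration_measurable_ok[OF assms(2)] by blast
  note exponents = exponents_ok[OF assms(3)]
  show ?thesis
    by (rule exI[of _ count], rule exI[of _ expo], rule exI[of _ multiplicity],
        rule exI[of _ filtration], rule exI[of _ slowest])
      (rule conjI[OF exponents(1) conjI[OF exponents(2) conjI[OF exponents(3)
        conjI[OF conjI[OF spaces meas] AE_filtration]]]])
qed

end
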